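(* For a semantics $\sigma\in\{\mathtt{co},\mathtt{st},\mathtt{pr},\mathtt{sst}\}$, let $\mathsf{CF\text{-}SA}^{\sigma}$ be the following decision problem. Input: an argumentation framework $\Lambda=\langle A,R\rangle$, an argument $g\in A$, a $\sigma$-labelling $\mathcal{L}$ of $\Lambda$, and an argument $g'\in A$. Question: is $g'$ accepted in every counterfactual in $\mathcal{CF}^{\sigma}(g,\mathcal{L})$, i.e. does $\mathcal{L}'(g')=\mathbf{in}$ hold for every $\mathcal{L}'\in\mathcal{CF}^{\sigma}(g,\mathcal{L})$? Then $\mathsf{CF\text{-}SA}^{\sigma}$ is: (1) $coNP$-hard and in $\Theta_2^p$ for $\sigma\in\{\mathtt{co},\mathtt{st}\}$; and (2) $\Pi_2^p$-hard and in $\Theta_3^p$ for $\sigma\in\{\mathtt{pr},\mathtt{sst}\}$.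
   Context: An argumentation framework (AF) is a pair $\Lambda=\langle A,R\rangle$ with $A$ a (finite) set of arguments and $R\subseteq A\times A$ a set of attacks. For $S\subseteq A$ let $\mathit{Def}(S)=\{a\in A\mid \exists b\in S,\ (b,a)\in R\}$ and $\mathit{Acc}(S)=\{a\in A\mid \forall (b,a)\in R,\ b\in \mathit{Def}(S)\}$. $S$ is conflict-free iff $S\cap \mathit{Def}(S)=\emptyset$, and admissible iff it is conflict-free and $S\subseteq \mathit{Acc}(S)$. A set $S\subseteq A$ is an extension called: complete ($\mathtt{co}$) iff it is admissible and $S=\mathit{Acc}(S)$; preferred ($\mathtt{pr}$) iff it is a $\subseteq$-maximal complete extension; stable ($\mathtt{st}$) iff it is a preferred extension with $S\cup \mathit{Def}(S)=A$; semi-stable ($\mathtt{sst}$) iff it is a preferred extension such that $S\cup \mathit{Def}(S)$ is $\subseteq$-maximal (among preferred extensions). A labelling is a total function $\mathcal{L}:A\to\{\mathbf{in},\mathbf{out},\mathbf{und}\}$. The labelling corresponding to an extension $E$ assigns $\mathbf{in}$ to the elements of $E$, $\mathbf{out}$ to the elements of $\mathit{Def}(E)$, and $\mathbf{und}$ to all other arguments. A $\sigma$-labelling of $\Lambda$ is the labelling corresponding to a $\sigma$-extension of $\Lambda$; $\sigma(\Lambda)$ denotes the set of $\sigma$-labellings of $\Lambda$. The distance between labellings is $\delta(\mathcal{L},\mathcal{L}')=|\{a\in A\mid \mathcal{L}(a)\neq\mathcal{L}'(a)\}|$. Counterfactuals: for $g\in A$ and $\mathcal{L}\in\sigma(\Lambda)$,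 a labelling $\mathcal{L}'\in\sigma(\Lambda)$ is a counterfactual of $\mathcal{L}$ w.r.t. $g$ if (i) $\mathcal{L}(g)\neq\mathcal{L}'(g)$, and (ii) there is no $\mathcal{L}''\in\sigma(\Lambda)$ with $\mathcal{L}(g)\neq\mathcal{L}''(g)$ and $\delta(\mathcal{L},\mathcal{L}'')<\delta(\mathcal{L},\mathcal{L}')$. $\mathcal{CF}^{\sigma}(g,\mathcal{L})$ denotes the set of all of them. Complexity: $\Sigma_1^p=NP$, $\Sigma_2^p=NP^{NP}$, $\Pi_2^p=co\Sigma_2^p$; $\Theta_h^p$ is the class of problems decidable in polynomial time by a deterministic Turing machine performing $O(\log n)$ calls to an oracle in $\Sigma_{h-1}^p$. *)

theory Defs
  imports "HOL-Computational_Algebra.Polynomial" "HOL-Library.Landau_Symbols"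
begin

section \<open>Argumentation frameworks\<close>

record 'a af =
  args :: "'a set"
  attacks :: "('a \<times> 'a) set"

definition is_af :: "'a af \<Rightarrow> bool" where
  "is_af F \<longleftrightarrow> finite (args F) \<and> attacks F \<subseteq> args F \<times> args F"

definition Def :: "'a af \<Rightarrow> 'a set \<Rightarrow> 'a set" where
  "Def F S = {a \<in> args F. \<exists>b\<in>S. (b, a) \<in> attacks F}"

definition Acc :: "'a af \<Rightarrow> 'a set \<Rightarrow> 'a set" where
  "Acc F S = {a \<in> args F. \<forall>b. (b, a) \<in> attacks F \<longrightarrow> b \<in> Def F S}"

definition conflict_free :: "'a af \<Rightarrow> 'a set \<Rightarrow> bool" where
  "conflict_free F S \<longleftrightarrow> S \<inter> Def F S = {}"

definition admissible :: "'a af \<Rightarrow> 'a set \<Rightarrow> bool" where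
  "admissible F S \<longleftrightarrow> S \<subseteq> args F \<and> conflict_free F S \<and> S \<subseteq> Acc F S"

definition complete_ext :: "'a af \<Rightarrow> 'a set \<Rightarrow> bool" where
  "complete_ext F S \<longleftrightarrow> admissible F S \<and> S = Acc F S"

definition preferred_ext :: "'a af \<Rightarrow> 'a set \<Rightarrow> bool" where
  "preferred_ext F S \<longleftrightarrow> complete_ext F S \<and> \<not> (\<exists>T. complete_ext F T \<and> S \<subset> T)"

definition stable_ext :: "'a af \<Rightarrow> 'a set \<Rightarrow> bool" where
  "stable_ext F S \<longleftrightarrow> preferred_ext F S \<and> S \<union> Def F S = args F"

definition semi_stable_ext :: "'a af \<Rightarrow> 'a set \<Rightarrow> bool" where
  "semi_stable_ext F S \<longleftrightarrow> preferred_ext F S \<and>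
     \<not> (\<exists>T. preferred_ext F T \<and> S \<union> Def F S \<subset> T \<union> Def F T)"

datatype sem = Co | St | Pr | Sst

fun extension :: "sem \<Rightarrow> 'a af \<Rightarrow> 'a set \<Rightarrow> bool" where
  "extension Co = complete_ext"
| "extension St = stable_ext"
| "extension Pr = preferred_ext"
| "extension Sst = semi_stable_ext"

datatype label = In | Out | Und

text \<open>
  Labellings are total functions on the ambient type. An extension \<open>S\<close> and \<open>Def F S\<close> are subsets
  of \<open>args F\<close>, so the labelling of an extension takes the value \<open>Und\<close> off \<open>args F\<close>; it is thus
  determined by its restriction to \<open>args F\<close>.
\<close>

definition labelling_of :: "'a af \<Rightarrow> 'a set \<Rightarrow> 'a \<Rightarrow> label" where
  "labelling_of F S = (\<lambda>a. if a \<in> S then In else if a \<in> Def F S then Out else Und)"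

definition labellings :: "sem \<Rightarrow> 'a af \<Rightarrow> ('a \<Rightarrow> label) set" where
  "labellings s F = {labelling_of F S | S. extension s F S}"

definition label_dist :: "'a af \<Rightarrow> ('a \<Rightarrow> label) \<Rightarrow> ('a \<Rightarrow> label) \<Rightarrow> nat" where
  "label_dist F L L' = card {a \<in> args F. L a \<noteq> L' a}"

definition counterfactuals :: "sem \<Rightarrow> 'a af \<Rightarrow> 'a \<Rightarrow> ('a \<Rightarrow> label) \<Rightarrow> ('a \<Rightarrow> label) set" where
  "counterfactuals s F g L = {L' \<in> labellings s F. L g \<noteq> L' g \<and>
     \<not> (\<exists>L''\<in>labellings s F. L g \<noteq> L'' g \<and> label_dist F L L'' < label_dist F L L')}"


section \<open>Oracle Turing machines\<close>

type_synonym word = "bool list"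

text \<open>
  Nondeterministic multi-tape oracle machines with two-way infinite tapes. States and tape symbols
  are initial segments of the naturals; symbol 0 is the blank, 1 and 2 are the bits. Tape 0
  initially holds the input; tape 1 is the query tape and, for machines computing functions, the
  output tape. The successor states, symbols to be written and head moves for a state and the list
  of scanned symbols are given by \<open>trans\<close>.
\<close>

datatype dir = Left | Stay | Right

record otm =
  num_tapes :: nat
  num_symbols :: nat
  num_states :: nat
  trans :: "nat \<Rightarrow> nat list \<Rightarrow> (nat \<times> (nat \<times> dir) list) set"
  start_state :: nat
  accept_state :: nat
  query_state :: nat
  yes_state :: nat
  no_state :: nat

definition wf_otm :: "otm \<Rightarrow> bool" where
  "wf_otm M \<longleftrightarrow> 2 \<le> num_tapes M \<and> 3 \<le> num_symbols M \<and>
     {start_state M, accept_state M, query_state M, yes_state M, no_state M} \<subseteq> {..<num_states M} \<and>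
     (\<forall>q < num_states M. \<forall>rs. length rs = num_tapes M \<and> set rs \<subseteq> {..<num_symbols M} \<longrightarrow>
        (\<forall>(q', acts) \<in> trans M q rs. q' < num_states M \<and> length acts = num_tapes M \<and>
           fst ` set acts \<subseteq> {..<num_symbols M}))"

definition deterministic :: "otm \<Rightarrow> bool" where
  "deterministic M \<longleftrightarrow> (\<forall>q rs. \<forall>a\<in>trans M q rs. \<forall>b\<in>trans M q rs. a = b)"

text \<open>A tape is its content together with the position of the head.\<close>

type_synonym tape = "(int \<Rightarrow> nat) \<times> int"
type_synonym config = "nat \<times> tape list"

definition bit_symbol :: "bool \<Rightarrow> nat" where
  "bit_symbol b = (if b then 2 else 1)"

definition blank_tape :: tape where
  "blank_tape = ((\<lambda>_. 0), 0)"

definition input_tape :: "word \<Rightarrow> tape" where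
  "input_tape w = ((\<lambda>i. if 0 \<le> i \<and> i < int (length w) then bit_symbol (w ! nat i) else 0), 0)"

definition init_config :: "otm \<Rightarrow> word \<Rightarrow> config" where
  "init_config M w = (start_state M, input_tape w # replicate (num_tapes M - 1) blank_tape)"

text \<open>The word on a tape starts in cell 0 and extends up to the first cell not holding a bit.\<close>

definition holds_word :: "tape \<Rightarrow> word \<Rightarrow> bool" where
  "holds_word t w \<longleftrightarrow> (\<forall>i < length w. fst t (int i) = bit_symbol (w ! i)) \<and>
     fst t (int (length w)) \<notin> range bit_symbol"

definition scan :: "tape \<Rightarrow> nat" where
  "scan t = fst t (snd t)"

fun offset :: "dir \<Rightarrow> int" where
  "offset Left = - 1"
| "offset Stay = 0"
| "offset Right = 1"

definition act :: "tape \<Rightarrow> nat \<times> dir \<Rightarrow> tape" where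
  "act t a = ((fst t)(snd t := fst a), snd t + offset (snd a))"

inductive step :: "otm \<Rightarrow> word set \<Rightarrow> config \<Rightarrow> config \<Rightarrow> bool" for M B where
  move: "q \<noteq> query_state M \<Longrightarrow> (q', acts) \<in> trans M q (map scan ts) \<Longrightarrow>
    step M B (q, ts) (q', map2 act ts acts)"
| query_yes: "holds_word (ts ! 1) w \<Longrightarrow> w \<in> B \<Longrightarrow>
    step M B (query_state M, ts) (yes_state M, ts)"
| query_no: "holds_word (ts ! 1) w \<Longrightarrow> w \<notin> B \<Longrightarrow>
    step M B (query_state M, ts) (no_state M, ts)"

text \<open>
  \<open>run M B c n k c'\<close>: with oracle \<open>B\<close>, some computation of \<open>M\<close> leads from \<open>c\<close> to \<open>c'\<close> in \<open>n\<close> steps,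
  \<open>k\<close> of which are oracle calls.
\<close>

inductive run :: "otm \<Rightarrow> word set \<Rightarrow> config \<Rightarrow> nat \<Rightarrow> nat \<Rightarrow> config \<Rightarrow> bool" for M B where
  run_refl: "run M B c 0 0 c"
| run_step: "run M B c n k c' \<Longrightarrow> step M B c' c'' \<Longrightarrow>
    run M B c (Suc n) (if fst c' = query_state M then Suc k else k) c''"

definition accepts :: "otm \<Rightarrow> word set \<Rightarrow> word \<Rightarrow> bool" where
  "accepts M B w \<longleftrightarrow> (\<exists>n k c. run M B (init_config M w) n k c \<and> fst c = accept_state M)"

definition poly_time :: "otm \<Rightarrow> word set \<Rightarrow> bool" where
  "poly_time M B \<longleftrightarrow> (\<exists>p :: nat poly. \<forall>w n k c.
     run M B (init_config M w) n k c \<longrightarrow> n \<le> poly p (length w))"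

definition log_queries :: "otm \<Rightarrow> word set \<Rightarrow> bool" where
  "log_queries M B \<longleftrightarrow> (\<exists>f :: nat \<Rightarrow> real. f \<in> O(\<lambda>n. ln (real n)) \<and>
     (\<forall>w n k c. run M B (init_config M w) n k c \<longrightarrow> real k \<le> f (length w)))"


section \<open>Complexity classes\<close>

definition NP_oracle :: "word set \<Rightarrow> word set set" where
  "NP_oracle B = {X. \<exists>M. wf_otm M \<and> poly_time M B \<and> X = {w. accepts M B w}}"

text \<open>Machines without an oracle are represented by machines with the empty oracle.\<close>

definition NP :: "word set set" where
  "NP = NP_oracle {}"

definition Sigma2p :: "word set set" where
  "Sigma2p = (\<Union>B\<in>NP. NP_oracle B)"

definition coNP :: "word set set" where
  "coNP = {X. - X \<in> NP}"

definition Pi2p :: "word set set" where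
  "Pi2p = {X. - X \<in> Sigma2p}"

definition log_query_class :: "word set set \<Rightarrow> word set set" where
  "log_query_class C = {X. \<exists>B\<in>C. \<exists>M. wf_otm M \<and> deterministic M \<and> poly_time M B \<and>
     log_queries M B \<and> X = {w. accepts M B w}}"

definition Theta2p :: "word set set" where
  "Theta2p = log_query_class NP"

definition Theta3p :: "word set set" where
  "Theta3p = log_query_class Sigma2p"

definition poly_time_computable :: "(word \<Rightarrow> word) \<Rightarrow> bool" where
  "poly_time_computable f \<longleftrightarrow> (\<exists>M. wf_otm M \<and> deterministic M \<and> poly_time M {} \<and>
     (\<forall>w. \<exists>n k c. run M {} (init_config M w) n k c \<and> \<not> (\<exists>c'. step M {} c c') \<and>
        holds_word (snd c ! 1) (f w)))"

text \<open>
  A decision problem is given by the set \<open>I\<close> of words encoding a legal input and the set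
  \<open>Y\<close> of words encoding a yes-instance. Hardness is with respect to polynomial-time many-one
  reductions, which have to produce legal inputs.
\<close>

definition hard_for :: "word set set \<Rightarrow> word set \<Rightarrow> word set \<Rightarrow> bool" where
  "hard_for C I Y \<longleftrightarrow> (\<forall>X\<in>C. \<exists>f. poly_time_computable f \<and>
     (\<forall>w. f w \<in> I \<and> (w \<in> X \<longleftrightarrow> f w \<in> Y)))"


section \<open>Skeptical acceptance over counterfactuals\<close>

text \<open>
  Inputs are given as words with the arguments numbered by \<open>{..<n}\<close>: the number \<open>n\<close> in unary, the
  adjacency matrix of the attack relation, two bits per label, and the characteristic vectors of
  \<open>g\<close> and \<open>g'\<close>.
\<close>

fun encode_label :: "label \<Rightarrow> word" where
  "encode_label In = [True, False]"
| "encode_label Out = [False, True]"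
| "encode_label Und = [False, False]"

definition encode :: "nat \<Rightarrow> (nat \<times> nat) set \<Rightarrow> nat \<Rightarrow> (nat \<Rightarrow> label) \<Rightarrow> nat \<Rightarrow> word" where
  "encode n R g L g' =
     replicate n True @ [False] @
     concat (map (\<lambda>i. map (\<lambda>j. (i, j) \<in> R) [0..<n]) [0..<n]) @
     concat (map (\<lambda>i. encode_label (L i)) [0..<n]) @
     map (\<lambda>i. i = g) [0..<n] @
     map (\<lambda>i. i = g') [0..<n]"

definition valid_input :: "sem \<Rightarrow> 'a af \<Rightarrow> 'a \<Rightarrow> ('a \<Rightarrow> label) \<Rightarrow> 'a \<Rightarrow> bool" where
  "valid_input s F g L g' \<longleftrightarrow> is_af F \<and> g \<in> args F \<and> L \<in> labellings s F \<and> g' \<in> args F"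

definition CF_SA_inputs :: "sem \<Rightarrow> word set" where
  "CF_SA_inputs s = {encode n R g L g' | n R g L g'.
     valid_input s \<lparr>args = {..<n}, attacks = R\<rparr> g L g'}"

definition CF_SA :: "sem \<Rightarrow> word set" where
  "CF_SA s = {encode n R g L g' | n R g L g'.
     valid_input s \<lparr>args = {..<n}, attacks = R\<rparr> g L g' \<and>
     (\<forall>L'\<in>counterfactuals s \<lparr>args = {..<n}, attacks = R\<rparr> g L. L' g' = In)}"

end

(*
  Membership. A Turing machine with an oracle of the form "is there a labelling at distance at most
  k that changes g" finds the distance of the counterfactuals by binary search, and one more query
  decides whether one of them does not accept g'. The oracles are guess-and-check problems whose
  checks (and, for pr and sst, the words sent on to a second oracle) are first-order formulas with
  counting over an initial segment of the naturals of polynomial length; these are evaluated by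
  register programs, which are compiled to multi-tape machines.

  Hardness. By the argument of Fagin's theorem a language in NP^B with B in NP is defined by a
  formula EX Y. ALL Z. psi with psi first-order: Y describes an accepting run and accepting runs for
  the queries answered positively, Z ranges over candidate accepting runs for the others. A framework
  that evaluates psi has a counterfactual iff psi is satisfiable (co, st), respectively iff for some Y
  no Z satisfies its negation (pr, sst). The argument g' is never accepted, so that the question
  asked by CF-SA is whether there are no counterfactuals.
*)
theory Submission imports Defs begin

section \<open>Structured Turing machine programs\<close>

text \<open>The membership problem is about words, so besides searching for the distance a machine
  must reject words that encode no legal input. The format is a formula, but that the given
  labelling really belongs to the semantics is left to one further query. Bounds on time and queries
  are demanded of all runs, whatever is guessed; guesses are therefore separated from the rest of a
  program as a stream of bits, given which everything is deterministic. In the reductions distances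
  never matter: as soon as some labelling differs at \<open>g\<close>, a nearest one exists. The
  obstacle is maximality. A set that encodes a choice of \<open>Y\<close> may grow when it is
  extended to a preferred extension, and a semi-stable one need not even contain it, because only
  ranges are compared. Hence the literals of the universal relations are attacked by an argument
  that the circuit rejects only by accepting the formula, and self-attacking copies of the literals
  make the choice of \<open>Y\<close> visible in the range. Stable extensions tolerate no undecided
  argument and complete ones no forced choice, so each semantics needs its own self-attacks and its
  own \<open>g\<close>.\<close>

abbreviation nz :: "nat \<Rightarrow> bool" where "nz \<equiv> \<lambda>a. a \<noteq> 0"

datatype cmd = Nop | Act nat "nat => nat \<times> dir" | Guess nat | Seq cmd cmd
  | Cond nat "nat => bool" cmd cmd | Loop nat "nat => bool" cmd

type_synonym tapes = "nat => tape"
type_synonym stream = "nat => bool"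

definition idle :: "(nat => nat) => nat => nat \<times> dir" where
  "idle sc = (\<lambda>k. (sc k, Stay))"

text \<open>A step is a function of the scanned symbols and of one bit \<open>b\<close>, so
  nondeterminism enters only through the stream of guesses. \<open>None\<close> marks an exhausted
  command.\<close>

primrec cstep :: "cmd => (nat => nat) => bool => (cmd \<times> (nat => nat \<times> dir)) option" where
  "cstep Nop sc b = None"
| "cstep (Act k f) sc b = Some (Nop, (idle sc)(k := f (sc k)))"
| "cstep (Guess k) sc b = Some (Nop, (idle sc)(k := (bit_symbol b, Right)))"
| "cstep (Seq c d) sc b =
     (case cstep c sc b of None => Some (d, idle sc) | Some (c', a) => Some (Seq c' d, a))"
| "cstep (Cond k P c d) sc b = Some (if P (sc k) then c else d, idle sc)"
| "cstep (Loop k P c) sc b = Some (if P (sc k) then Seq c (Loop k P c) else Nop, idle sc)"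

primrec guessing :: "cmd => bool" where
  "guessing Nop = False"
| "guessing (Act k f) = False"
| "guessing (Guess k) = True"
| "guessing (Seq c d) = guessing c"
| "guessing (Cond k P c d) = False"
| "guessing (Loop k P c) = False"

primrec guess_free :: "cmd => bool" where
  "guess_free Nop = True"
| "guess_free (Act k f) = True"
| "guess_free (Guess k) = False"
| "guess_free (Seq c d) = (guess_free c & guess_free d)"
| "guess_free (Cond k P c d) = (guess_free c & guess_free d)"
| "guess_free (Loop k P c) = guess_free c"

text \<open>What may remain to be executed of a command. These commands become the control states of
  the machine; there are finitely many of them because a loop unfolds to its body followed by the
  same loop.\<close>

primrec residuals :: "cmd => cmd set" where
  "residuals Nop = {Nop}"
| "residuals (Act k f) = {Act k f, Nop}"
| "residuals (Guess k) = {Guess k, Nop}"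
| "residuals (Seq c d) = (\<lambda>c'. Seq c' d) ` residuals c \<union> residuals d"
| "residuals (Cond k P c d) = insert (Cond k P c d) (residuals c \<union> residuals d)"
| "residuals (Loop k P c) = {Loop k P c, Nop} \<union> (\<lambda>c'. Seq c' (Loop k P c)) ` residuals c"

primrec wf_cmd :: "nat => nat => cmd => bool" where
  "wf_cmd K S Nop = True"
| "wf_cmd K S (Act k f) = (k < K & (\<forall>a<S. fst (f a) < S))"
| "wf_cmd K S (Guess k) = (k < K & 2 < S)"
| "wf_cmd K S (Seq c d) = (wf_cmd K S c & wf_cmd K S d)"
| "wf_cmd K S (Cond k P c d) = (k < K & wf_cmd K S c & wf_cmd K S d)"
| "wf_cmd K S (Loop k P c) = (k < K & wf_cmd K S c)"

lemma finite_residuals [simp]: "finite (residuals c)" by (induction c) auto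

lemma residuals_refl [simp]: "c \<in> residuals c" by (induction c) auto

lemma cstep_residuals:
  "c' \<in> residuals c ==> cstep c' sc b = Some (c'', a) ==> c'' \<in> residuals c"
proof (induction c arbitrary: c' c'' a)
  case (Seq c d)
  from Seq.prems(1) consider x where "x \<in> residuals c" "c' = Seq x d" | "c' \<in> residuals d" by auto
  then show ?case
  proof cases
    case 1
    then show ?thesis using Seq.IH(1)[OF 1(1)] Seq.prems(2)
      by (cases "cstep x sc b") (auto simp del: cstep.simps(1))
  next
    case 2
    then show ?thesis using Seq.IH(2)[OF 2 Seq.prems(2)] by simp
  qed
next
  case (Cond k P c d)
  from Cond.prems(1) consider "c' = Cond k P c d" | "c' \<in> residuals c" | "c' \<in> residuals d" by auto
  then show ?case
  proof cases
    case 1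
    then show ?thesis using Cond.prems(2) by (auto split: if_splits)
  next
    case 2
    then show ?thesis using Cond.IH(1)[OF 2 Cond.prems(2)] by simp
  next
    case 3
    then show ?thesis using Cond.IH(2)[OF 3 Cond.prems(2)] by simp
  qed
next
  case (Loop k P c)
  from Loop.prems(1) consider "c' = Loop k P c" | "c' = Nop"
    | x where "x \<in> residuals c" "c' = Seq x (Loop k P c)" by auto
  then show ?case
  proof cases
    case 1
    then show ?thesis using Loop.prems(2) by (auto split: if_splits)
  next
    case 2
    then show ?thesis using Loop.prems(2) by simp
  next
    case 3
    then show ?thesis using Loop.IH[OF 3(1)] Loop.prems(2) by (cases "cstep x sc b") auto
  qed
qed auto

lemma residuals_wf: "c' \<in> residuals c ==> wf_cmd K S c ==> wf_cmd K S c'"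
proof (induction c arbitrary: c')
  case (Seq c d)
  from Seq.prems(1) consider x where "x \<in> residuals c" "c' = Seq x d" | "c' \<in> residuals d" by auto
  then show ?case using Seq.IH Seq.prems(2) by cases simp_all
next
  case (Cond k P c d)
  from Cond.prems(1) consider "c' = Cond k P c d" | "c' \<in> residuals c" | "c' \<in> residuals d" by auto
  then show ?case using Cond.IH Cond.prems(2) by cases simp_all
next
  case (Loop k P c)
  from Loop.prems(1) consider "c' = Loop k P c" | "c' = Nop"
    | x where "x \<in> residuals c" "c' = Seq x (Loop k P c)" by auto
  then show ?case using Loop.IH Loop.prems(2) by cases simp_all
next
  case (Act k f)
  then show ?case by (simp, elim disjE) simp_all
qed auto

lemma residuals_guess_free: "c' \<in> residuals c ==> guess_free c ==> guess_free c'"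
  by (induction c arbitrary: c') auto

lemma guess_free_not_guessing: "guess_free c ==> ~ guessing c" by (induction c) auto

lemma cstep_not_guessing: "~ guessing c ==> cstep c sc b = cstep c sc b'" by (induction c) simp_all

text \<open>Programs act on infinitely many tapes, the machine only has \<open>K\<close>; this makes
  it harmless to cut off the others.\<close>

lemma cstep_local:
  "wf_cmd K S c ==> cstep c sc b = Some (c', a) ==> K \<le> k ==> a k = (sc k, Stay)"
proof (induction c arbitrary: c')
  case (Seq c d)
  show ?case
  proof (cases "cstep c sc b")
    case None
    then show ?thesis using Seq.prems(2) by (auto simp: idle_def)
  next
    case (Some y)
    then show ?thesis using Seq.prems Seq.IH(1)[of "fst y"] by (cases y) auto
  qed
qed (auto simp: idle_def)

lemma cstep_symbols:
  "wf_cmd K S c ==> cstep c sc b = Some (c', a) ==> \<forall>k. sc k < S ==> fst (a k) < S"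
proof (induction c arbitrary: c')
  case (Seq c d)
  show ?case
  proof (cases "cstep c sc b")
    case None
    then show ?thesis using Seq.prems(2,3) by (auto simp: idle_def)
  next
    case (Some y)
    then show ?thesis using Seq.prems Seq.IH(1)[of "fst y"] by (cases y) auto
  qed
qed (auto simp: idle_def bit_symbol_def)

section \<open>Executions of commands and their running times\<close>

definition shift :: "stream => stream" where
  "shift gs = (\<lambda>n. gs (Suc n))"

type_synonym conf = "tapes \<times> stream"

definition apply_acts :: "tapes => (nat => nat \<times> dir) => tapes" where
  "apply_acts s a = (\<lambda>k. act (s k) (a k))"

abbreviation scans :: "tapes => nat => nat" where
  "scans s \<equiv> (\<lambda>k. scan (s k))"

lemma act_idle [simp]: "act t (scan t, Stay) = t" by (simp add: act_def scan_def)

lemma apply_idle [simp]: "apply_acts s (idle (scans s)) = s" by (simp add: apply_acts_def idle_def)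

lemma apply_idle_upd [simp]:
  "apply_acts s ((idle (scans s))(k := x)) = s(k := act (s k) x)"
  by (auto simp: apply_acts_def idle_def)

text \<open>Exact running times of terminating executions, given the stream of guesses.\<close>

inductive ex :: "cmd => conf => nat => conf => bool" where
  ex_Nop: "ex Nop s 0 s"
| ex_Act: "ex (Act k f) (s, gs) 1 (s(k := act (s k) (f (scan (s k)))), gs)"
| ex_Guess: "ex (Guess k) (s, gs) 1 (s(k := act (s k) (bit_symbol (gs 0), Right)), shift gs)"
| ex_Seq: "ex c s t s' ==> ex d s' t' s'' ==> ex (Seq c d) s (t + Suc t') s''"
| ex_Cond_True: "P (scan (fst s k)) ==> ex c s t s' ==> ex (Cond k P c d) s (Suc t) s'"
| ex_Cond_False: "~ P (scan (fst s k)) ==> ex d s t s' ==> ex (Cond k P c d) s (Suc t) s'"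
| ex_Loop_True: "P (scan (fst s k)) ==> ex (Seq c (Loop k P c)) s t s' ==>
    ex (Loop k P c) s (Suc t) s'"
| ex_Loop_False: "~ P (scan (fst s k)) ==> ex (Loop k P c) s 1 s"

inductive cpath :: "nat => cmd \<times> conf => cmd \<times> conf => bool" where
  cpath_0: "cpath 0 x x"
| cpath_Suc: "cstep c (scans s) (gs 0) = Some (c', a) ==>
    cpath n (c', apply_acts s a, if guessing c then shift gs else gs) y ==>
    cpath (Suc n) (c, s, gs) y"

lemma cpath_trans: "cpath n x y ==> cpath m y z ==> cpath (n + m) x z"
proof (induction rule: cpath.induct)
  case (cpath_Suc c s gs c' a n y)
  show ?case
    unfolding add_Suc by (rule cpath.cpath_Suc[OF cpath_Suc.hyps(1) cpath_Suc.IH[OF cpath_Suc.prems]])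
qed simp

lemma cpath_Seq: "cpath n (c, s) (c', s') ==> cpath n (Seq c d, s) (Seq c' d, s')"
proof (induction n "(c, s)" "(c', s')" arbitrary: c s rule: cpath.induct)
  case cpath_0
  then show ?case by (rule cpath.intros)
next
  case (cpath_Suc c s gs c'' a n)
  show ?case by (rule cpath.cpath_Suc[where c' = "Seq c'' d" and a = a]) (use cpath_Suc in simp_all)
qed

lemma cpath_idle:
  assumes "cstep c (scans (fst s)) (snd s 0) = Some (c', idle (scans (fst s)))" "~ guessing c"
    "cpath n (c', s) y"
  shows "cpath (Suc n) (c, s) y"
  using cpath_Suc[of c "fst s" "snd s" c' "idle (scans (fst s))" n y] assms by simp

text \<open>The times of \<open>ex\<close> are exact: a sequence pays one step for passing from an
  exhausted \<open>Nop\<close> to its second part, and every test of a condition or of a loop is a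
  step of its own.\<close>

lemma ex_cpath: "ex c s t s' ==> cpath t (c, s) (Nop, s')"
proof (induction rule: ex.induct)
  case (ex_Nop s)
  show ?case by (rule cpath_0)
next
  case (ex_Act k f s gs)
  show ?case
    using cpath_Suc[of "Act k f" s gs Nop "(idle (scans s))(k := f (scan (s k)))" 0] cpath_0 by simp
next
  case (ex_Guess k s gs)
  show ?case
    using cpath_Suc[of "Guess k" s gs Nop "(idle (scans s))(k := (bit_symbol (gs 0), Right))" 0] cpath_0 by simp
next
  case (ex_Seq c s t s' d t' s'')
  have "cpath (Suc t') (Seq Nop d, s') (Nop, s'')"
    by (rule cpath_idle[OF _ _ ex_Seq.IH(2)]) simp_all
  with cpath_Seq[OF ex_Seq.IH(1)] show ?case by (rule cpath_trans)
next
  case (ex_Cond_True P s k c t s' d)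
  show ?case by (rule cpath_idle[OF _ _ ex_Cond_True.IH]) (use ex_Cond_True in simp_all)
next
  case (ex_Cond_False P s k d t s' c)
  show ?case by (rule cpath_idle[OF _ _ ex_Cond_False.IH]) (use ex_Cond_False in simp_all)
next
  case (ex_Loop_True P s k c t s')
  show ?case by (rule cpath_idle[OF _ _ ex_Loop_True.IH]) (use ex_Loop_True in simp_all)
next
  case (ex_Loop_False P s k c)
  then show ?case using cpath_idle[of "Loop k P c" s Nop 0] by (simp add: cpath_0)
qed

text \<open>\<open>run\<close> grows at the end of a computation, whereas the guesses of a program
  are consumed from the start; this lemma and the next one translate between the two
  directions.\<close>

lemma run_front_intro:
  "run M B c' n k c'' ==> step M B c c' ==>
     run M B c (Suc n) (if fst c = query_state M then Suc k else k) c''"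
proof (induction rule: run.induct)
  case (run_refl c')
  then show ?case using run_step[OF run.run_refl, of M B c c'] by simp
next
  case (run_step c' n k d d')
  then show ?case
    using run.run_step[OF run_step.IH[OF run_step.prems] run_step.hyps(2)] by (simp split: if_splits)
qed

lemma run_front_elim:
  "run M B c n k c'' ==> (n = 0 & k = 0 & c'' = c) |
     (\<exists>c' n' k'. n = Suc n' & step M B c c' & run M B c' n' k' c'' &
       k = (if fst c = query_state M then Suc k' else k'))"
proof (induction rule: run.induct)
  case (run_refl c)
  then show ?case by simp
next
  case (run_step c n k c' c'')
  from run_step.IH show ?case
  proof (elim disjE exE conjE)
    assume "n = 0" "k = 0" "c' = c"
    then show ?thesis using run_step.hyps(2) run.run_refl[of M B c'']
      by (intro disjI2 exI[of _ c''] exI[of _ 0] exI[of _ "0::nat"]) simp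
  next
    fix d n' k'
    assume *: "n = Suc n'" "step M B c d" "run M B d n' k' c'"
      "k = (if fst c = query_state M then Suc k' else k')"
    have "run M B d (Suc n') (if fst c' = query_state M then Suc k' else k') c''"
      using *(3) run_step.hyps(2) by (rule run.run_step)
    then show ?thesis using *
      by (intro disjI2 exI[of _ d] exI[of _ "Suc n'"] exI[of _ "if fst c' = query_state M then Suc k' else k'"]) simp
  qed
qed

lemma bit_symbol_inj: "bit_symbol a = bit_symbol b \<longleftrightarrow> a = b" by (auto simp: bit_symbol_def)

lemma holds_word_unique:
  assumes "holds_word t w" "holds_word t w'"
  shows "w = w'"
proof (rule nth_equalityI)
  show "length w = length w'"
    using assms unfolding holds_word_def by (metis linorder_neqE_nat rangeI)
  then show "w ! i = w' ! i" if "i < length w" for i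
    using assms that unfolding holds_word_def by (metis bit_symbol_inj)
qed

section \<open>From programs to oracle machines\<close>

datatype ctl = Run cmd | Ask | Accept | Reject

fun delta :: "ctl => (nat => nat) => bool => (ctl \<times> (nat => nat \<times> dir)) option" where
  "delta (Run c) sc b = (case cstep c sc b of Some (c', a) => Some (Run c', a)
      | None => Some (if sc 4 = 0 then Ask else if sc 4 = 2 then Accept else Reject, idle sc))"
| "delta _ sc b = None"

fun ctl_guessing :: "ctl => bool" where
  "ctl_guessing (Run c) = guessing c"
| "ctl_guessing _ = False"

definition init_tapes :: "word => tapes" where
  "init_tapes w = (\<lambda>k. if k = 0 then input_tape w else blank_tape)"

text \<open>
  A driver runs \<open>pre\<close> and then repeats \<open>body\<close>. After each round it stops if tape 4 holds a symbol
  (2 for acceptance); otherwise it queries the oracle and runs \<open>yes\<close> or \<open>no\<close> before the next round.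
\<close>

locale driver = fixes K S :: nat and pre body yes no :: cmd
  assumes K: "5 \<le> K" and S: "3 \<le> S"
    and wf: "wf_cmd K S pre" "wf_cmd K S body" "wf_cmd K S yes" "wf_cmd K S no"
    and gf: "guess_free body" "guess_free yes" "guess_free no"
begin

definition controls :: "ctl set" where
  "controls = Run ` (residuals (Seq pre body) \<union> residuals (Seq yes body) \<union> residuals (Seq no body))
     \<union> {Ask, Accept, Reject}"

lemma finite_controls: "finite controls" by (simp add: controls_def)

definition enc :: "ctl => nat" where
  "enc = (SOME h. bij_betw h controls {0..<card controls})"

lemma bij_enc: "bij_betw enc controls {0..<card controls}"
  unfolding enc_def using ex_bij_betw_finite_nat[OF finite_controls] by (rule someI_ex)

lemma enc_inj: "q \<in> controls ==> q' \<in> controls ==> enc q = enc q' \<longleftrightarrow> q = q'"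
  using bij_enc by (auto simp: bij_betw_def inj_on_def)

lemma enc_less: "q \<in> controls ==> enc q < card controls" using bij_enc by (auto simp: bij_betw_def)

text \<open>Guesses turn into nondeterminism here: \<open>b\<close> ranges freely in the
  comprehension, so a control state has more than one transition only if it is about to guess. Tapes
  from \<open>K\<close> on are read as blank, in accordance with \<open>good\<close>.\<close>

definition machine :: otm where
  "machine = \<lparr>num_tapes = K, num_symbols = S, num_states = card controls,
     trans = (\<lambda>i rs. {(enc q', map a [0..<K]) | q q' a b.
        q \<in> controls & i = enc q & length rs = K & set rs \<subseteq> {..<S} &
        delta q (\<lambda>k. if k < K then rs ! k else 0) b = Some (q', a)}),
     start_state = enc (Run (Seq pre body)), accept_state = enc Accept, query_state = enc Ask,
     yes_state = enc (Run (Seq yes body)), no_state = enc (Run (Seq no body))\<rparr>"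

lemma controls_special [simp]:
  "Ask \<in> controls" "Accept \<in> controls" "Reject \<in> controls" "Run (Seq pre body) \<in> controls"
  "Run (Seq yes body) \<in> controls" "Run (Seq no body) \<in> controls"
  unfolding controls_def by (auto simp del: residuals.simps intro!: imageI)

lemma controls_Run:
  assumes "Run c \<in> controls"
  obtains d where "c \<in> residuals d" "d \<in> {Seq pre body, Seq yes body, Seq no body}"
  using assms unfolding controls_def by (auto simp del: residuals.simps)

lemma controls_wf:
  assumes "Run c \<in> controls"
  shows "wf_cmd K S c"
proof -
  from assms obtain d where "c \<in> residuals d" "d \<in> {Seq pre body, Seq yes body, Seq no body}"
    by (rule controls_Run)
  then show ?thesis using residuals_wf[of c d K S] wf by (auto simp del: residuals.simps)
qed

lemma controls_guess_free:
  assumes "guess_free pre" "Run c \<in> controls"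
  shows "guess_free c"
proof -
  from assms(2) obtain d where "c \<in> residuals d" "d \<in> {Seq pre body, Seq yes body, Seq no body}"
    by (rule controls_Run)
  then show ?thesis using residuals_guess_free[of c d] gf assms(1) by (auto simp del: residuals.simps)
qed

lemma controls_step:
  assumes "q \<in> controls" "delta q sc b = Some (q', a)"
  shows "q' \<in> controls"
proof (cases q)
  case (Run c)
  show ?thesis
  proof (cases "cstep c sc b")
    case None
    then show ?thesis using assms Run by auto
  next
    case (Some y)
    then obtain c' where c': "cstep c sc b = Some (c', a)" "q' = Run c'"
      using assms Run by (cases y) auto
    obtain d where "c \<in> residuals d" "d \<in> {Seq pre body, Seq yes body, Seq no body}"
      using assms(1) unfolding Run by (rule controls_Run)
    with cstep_residuals[OF _ c'(1), of d] show ?thesis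
      unfolding controls_def c'(2) by (auto simp del: residuals.simps)
  qed
qed (use assms in auto)

lemma delta_local:
  assumes "q \<in> controls" "delta q sc b = Some (q', a)" "K \<le> k"
  shows "a k = (sc k, Stay)"
proof (cases q)
  case (Run c)
  then show ?thesis using assms cstep_local[OF controls_wf[of c], of sc b _ a k]
    by (auto simp: idle_def split: option.splits)
qed (use assms in auto)

lemma delta_symbols:
  assumes "q \<in> controls" "delta q sc b = Some (q', a)" "\<forall>k. sc k < S"
  shows "fst (a k) < S"
proof (cases q)
  case (Run c)
  then show ?thesis using assms cstep_symbols[OF controls_wf[of c], of sc b _ a k]
    by (auto simp: idle_def split: option.splits)
qed (use assms in auto)

lemma delta_not_guessing: "~ ctl_guessing q ==> delta q sc b = delta q sc b'"
  by (cases q) (simp_all add: cstep_not_guessing[of _ sc b b'])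

lemma wf_machine: "wf_otm machine"
proof -
  have "q' < num_states machine & length acts = num_tapes machine &
      fst ` set acts \<subseteq> {..<num_symbols machine}"
    if "(q', acts) \<in> trans machine i rs" for i rs q' acts
  proof -
    from that obtain p p' a b where *: "p \<in> controls" "set rs \<subseteq> {..<S}" "length rs = K"
      "delta p (\<lambda>k. if k < K then rs ! k else 0) b = Some (p', a)" "q' = enc p'" "acts = map a [0..<K]"
      unfolding machine_def by auto
    have "\<forall>k. (if k < K then rs ! k else 0) < S" using * S by (auto simp: subset_iff)
    from delta_symbols[OF *(1,4) this] controls_step[OF *(1,4)] show ?thesis
      using * by (auto simp: machine_def enc_less)
  qed
  then have *: "\<forall>(q', acts)\<in>trans machine i rs. q' < num_states machine & length acts = num_tapes machine &
      fst ` set acts \<subseteq> {..<num_symbols machine}" for i rs by blast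
  have c: "{start_state machine, accept_state machine, query_state machine, yes_state machine,
      no_state machine} \<subseteq> {..<num_states machine}" by (simp add: machine_def enc_less)
  have "2 \<le> num_tapes machine" "3 \<le> num_symbols machine" using K S by (simp_all add: machine_def)
  with c show ?thesis unfolding wf_otm_def by (intro conjI allI impI) (assumption | rule *)+
qed

lemma machine_deterministic:
  assumes "guess_free pre"
  shows "deterministic machine"
proof -
  have ng: "~ ctl_guessing q" if "q \<in> controls" for q
    using controls_guess_free[OF assms] that guess_free_not_guessing by (cases q) auto
  have "x = y" if "x \<in> trans machine i rs" "y \<in> trans machine i rs" for x y i rs
  proof -
    let ?sc = "\<lambda>k. if k < K then rs ! k else 0"
    from that(1) obtain p p' a b where 1: "p \<in> controls" "i = enc p" "delta p ?sc b = Some (p', a)"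
      "x = (enc p', map a [0..<K])" unfolding machine_def by auto
    from that(2) obtain q q' a' b' where 2: "q \<in> controls" "i = enc q" "delta q ?sc b' = Some (q', a')"
      "y = (enc q', map a' [0..<K])" unfolding machine_def by auto
    have "p = q" using 1 2 enc_inj by simp
    then have "Some (p', a) = Some (q', a')"
      using 1(3) 2(3) delta_not_guessing[OF ng[OF 1(1)], of ?sc b b'] by simp
    then show ?thesis using 1(4) 2(4) by simp
  qed
  then show ?thesis unfolding deterministic_def by blast
qed

text \<open>A transition system between programs and the machine: it still has infinitely many tapes
  and named controls, but it already asks the oracle. Carrying the stream along makes it
  deterministic.\<close>

inductive mv :: "word set => ctl \<times> conf => ctl \<times> conf => bool" for B where
  mv_delta: "delta q (scans s) (gs 0) = Some (q', a) ==>
    mv B (q, s, gs) (q', apply_acts s a, if ctl_guessing q then shift gs else gs)"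
| mv_ask: "holds_word (s 1) w ==>
    mv B (Ask, s, gs) (Run (Seq (if w \<in> B then yes else no) body), s, gs)"

inductive path :: "word set => nat => nat => ctl \<times> conf => ctl \<times> conf => bool" for B where
  path_0: "path B 0 0 x x"
| path_Suc: "mv B x z ==> path B n k z y ==>
    path B (Suc n) (if fst x = Ask then Suc k else k) x y"

lemma mv_det: "mv B x y ==> mv B x z ==> y = z" by (elim mv.cases) (auto dest: holds_word_unique)

lemma mv_halted: "fst x \<in> {Accept, Reject} ==> ~ mv B x y" by (auto elim!: mv.cases)

lemma path_trans: "path B n k x y ==> path B n' k' y z ==> path B (n + n') (k + k') x z"
proof (induction rule: path.induct)
  case (path_Suc x y n k z)
  then show ?case using path.path_Suc[OF path_Suc.hyps(1) path_Suc.IH] by (auto split: if_splits)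
qed simp

text \<open>By determinism a halting path bounds every other path from the same start. One
  terminating execution per stream therefore bounds all runs of the machine.\<close>

lemma path_det:
  "path B n k x y ==> fst y \<in> {Accept, Reject} ==> path B n' k' x y' ==>
     n' \<le> n & k' \<le> k & (fst y' \<in> {Accept, Reject} --> y' = y)"
proof (induction arbitrary: n' k' rule: path.induct)
  case (path_0 x)
  from path_0(2) show ?case by (cases rule: path.cases) (use path_0(1) mv_halted in auto)
next
  case (path_Suc x z n k y)
  from path_Suc.prems(2) show ?case
  proof (cases rule: path.cases)
    case path_0
    then show ?thesis using mv_halted[of x B z] path_Suc.hyps(1) by auto
  next
    case (path_Suc z' n'' k'')
    have "z' = z" using mv_det[OF path_Suc(3)] \<open>mv B x z\<close> by blast
    then show ?thesis
      using path_Suc(1,2,4) \<open>fst y \<in> _\<close> path_Suc.IH[of n'' k''] by (auto split: if_splits)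
  qed
qed

definition cfg :: "ctl => tapes => config" where
  "cfg q s = (enc q, map s [0..<K])"

definition good :: "tapes => bool" where
  "good s = ((\<forall>k\<ge>K. s k = blank_tape) & (\<forall>k i. fst (s k) i < S))"

lemma good_init: "good (init_tapes w)"
  using K S by (auto simp: good_def init_tapes_def blank_tape_def input_tape_def bit_symbol_def)

lemma good_scans:
  assumes "good s"
  shows "(\<lambda>k. if k < K then map scan (map s [0..<K]) ! k else 0) = scans s"
  using assms by (auto simp: good_def scan_def blank_tape_def)

lemma good_apply:
  assumes "good s" "q \<in> controls" "delta q (scans s) b = Some (q', a)"
  shows "good (apply_acts s a)"
proof -
  have "\<forall>k. scan (s k) < S" using assms(1) by (auto simp: good_def scan_def)
  then have "\<forall>k. fst (a k) < S" using delta_symbols[OF assms(2,3)] by blast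
  moreover have "\<forall>k\<ge>K. act (s k) (a k) = s k" using delta_local[OF assms(2,3)] by simp
  ultimately show ?thesis
    using assms(1) by (auto simp: good_def apply_acts_def) (auto simp: act_def)
qed

lemma map2_act: "map2 act (map s [0..<K]) (map a [0..<K]) = map (apply_acts s a) [0..<K]"
  by (rule nth_equalityI) (auto simp: apply_acts_def)

lemma mv_step:
  assumes "mv B (q, s, gs) (q', s', gs')" "q \<in> controls" "good s"
  shows "step machine B (cfg q s) (cfg q' s')" "q' \<in> controls" "good s'"
proof -
  from assms(1) have "step machine B (cfg q s) (cfg q' s') & q' \<in> controls & good s'"
  proof cases
    case (mv_delta a)
    have "set (map scan (map s [0..<K])) \<subseteq> {..<S}" using assms(3) by (auto simp: good_def scan_def)
    moreover have "delta q (\<lambda>k. if k < K then map scan (map s [0..<K]) ! k else 0) (gs 0) = Some (q', a)"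
      unfolding good_scans[OF assms(3)] by (rule mv_delta)
    ultimately have "(enc q', map a [0..<K]) \<in> trans machine (enc q) (map scan (map s [0..<K]))"
      unfolding machine_def otm.select_convs mem_Collect_eq using assms(2)
      by (intro exI[of _ q] exI[of _ q'] exI[of _ a] exI[of _ "gs 0"]) simp
    moreover have "enc q ~= query_state machine"
      using mv_delta assms(2) enc_inj[of q Ask] by (auto simp: machine_def)
    ultimately have "step machine B (enc q, map s [0..<K]) (enc q', map2 act (map s [0..<K]) (map a [0..<K]))"
      by (intro move)
    with map2_act controls_step[OF assms(2)] good_apply[OF assms(3,2)] mv_delta show ?thesis
      unfolding cfg_def by auto
  next
    case (mv_ask w)
    have "map s [0..<K] ! 1 = s 1" using K by simp
    with mv_ask query_yes[of "map s [0..<K]" w B machine] query_no[of "map s [0..<K]" w B machine] assms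
    show ?thesis unfolding cfg_def by (auto simp: machine_def)
  qed
  then show "step machine B (cfg q s) (cfg q' s')" "q' \<in> controls" "good s'" by auto
qed

text \<open>The stream behind a given run is reconstructed from its end: whatever stream
  \<open>gs'\<close> remains after the step, the bit consumed by the step can be put in front of
  it.\<close>

lemma step_mv:
  assumes "step machine B (cfg q s) c'" "q \<in> controls" "good s"
  shows "\<exists>q' s'. c' = cfg q' s' & (\<forall>gs'. \<exists>gs. mv B (q, s, gs) (q', s', gs'))" using assms(1)
proof cases
  case (move p p' acts ts)
  then obtain q0 q' a b where *: "q0 \<in> controls" "enc q = enc q0" "acts = map a [0..<K]" "p' = enc q'"
    "delta q0 (\<lambda>k. if k < K then map scan (map s [0..<K]) ! k else 0) b = Some (q', a)"
    unfolding machine_def cfg_def by auto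
  have q: "q0 = q" using * assms(2) enc_inj by metis
  have d: "delta q (scans s) b = Some (q', a)" using *(5) unfolding q good_scans[OF assms(3)] .
  have "\<exists>gs. mv B (q, s, gs) (q', apply_acts s a, gs')" for gs'
  proof (cases "ctl_guessing q")
    case True
    have "shift (case_nat b gs') = gs'" by (simp add: shift_def)
    then show ?thesis using mv_delta[of q s "case_nat b gs'" q' a B] d True by auto
  next
    case False
    have "delta q (scans s) (gs' 0) = Some (q', a)" using d delta_not_guessing[OF False] by metis
    then show ?thesis using mv_delta[of q s gs' q' a B] False by auto
  qed
  moreover have "c' = cfg q' (apply_acts s a)" using move * map2_act unfolding cfg_def by auto
  ultimately show ?thesis by blast
next
  case (query_yes ts w)
  have "q = Ask" using query_yes assms(2) enc_inj[of q Ask] by (auto simp: cfg_def machine_def)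
  moreover have "ts ! 1 = s 1" using query_yes K by (auto simp: cfg_def)
  ultimately show ?thesis using query_yes mv_ask[of s w B]
    by (intro exI[of _ "Run (Seq yes body)"] exI[of _ s]) (auto simp: cfg_def machine_def)
next
  case (query_no ts w)
  have "q = Ask" using query_no assms(2) enc_inj[of q Ask] by (auto simp: cfg_def machine_def)
  moreover have "ts ! 1 = s 1" using query_no K by (auto simp: cfg_def)
  ultimately show ?thesis using query_no mv_ask[of s w B]
    by (intro exI[of _ "Run (Seq no body)"] exI[of _ s]) (auto simp: cfg_def machine_def)
qed

lemma cfg_query: "q \<in> controls ==> fst (cfg q s) = query_state machine \<longleftrightarrow> q = Ask"
  by (simp add: cfg_def machine_def enc_inj)

lemma path_run:
  "path B n k x y ==> fst x \<in> controls ==> good (fst (snd x)) ==>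
     run machine B (cfg (fst x) (fst (snd x))) n k (cfg (fst y) (fst (snd y)))"
proof (induction rule: path.induct)
  case (path_0 x)
  then show ?case by (simp add: run_refl)
next
  case (path_Suc x z n k y)
  obtain q s gs q' s' gs' where xz: "x = (q, s, gs)" "z = (q', s', gs')" by (metis prod_cases3)
  have "step machine B (cfg q s) (cfg q' s')" "q' \<in> controls" "good s'"
    using mv_step[of B q s gs q' s' gs'] path_Suc.hyps(1) path_Suc.prems xz by auto
  then show ?case
    using run_front_intro[OF path_Suc.IH, of "cfg q s"] cfg_query[of q s] path_Suc.prems xz by simp
qed

lemma run_path:
  "run machine B c n k c' ==> c = cfg q s ==> q \<in> controls ==> good s ==>
     \<exists>gs q' s' gs'. path B n k (q, s, gs) (q', s', gs') & c' = cfg q' s' & q' \<in> controls"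
proof (induction n arbitrary: c k q s)
  case 0
  from run_front_elim[OF 0(1)] have "k = 0" "c' = c" by auto
  with 0 path_0[of B "(q, s, undefined)"] show ?case by blast
next
  case (Suc n)
  from run_front_elim[OF Suc(2)] obtain d k' where
    *: "step machine B c d" "run machine B d n k' c'"
    "k = (if fst c = query_state machine then Suc k' else k')" by auto
  from step_mv[of B q s d] * Suc obtain q1 s1 where
    d: "d = cfg q1 s1" "\<And>gs'. \<exists>gs. mv B (q, s, gs) (q1, s1, gs')" by auto
  then have "q1 \<in> controls" "good s1" using mv_step(2,3) Suc.prems by blast+
  from Suc.IH[OF *(2) d(1) this] obtain gs1 q' s' gs' where
    p: "path B n k' (q1, s1, gs1) (q', s', gs')" "c' = cfg q' s'" "q' \<in> controls" by blast
  from d(2)[of gs1] obtain gs where "mv B (q, s, gs) (q1, s1, gs1)" by blast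
  from path_Suc[OF this p(1)] show ?case using p *(3) cfg_query[of q s] Suc.prems
    by (intro exI[of _ gs] exI[of _ q'] exI[of _ s'] exI[of _ gs']) (simp split: if_splits)
qed

lemma init_cfg: "init_config machine w = cfg (Run (Seq pre body)) (init_tapes w)"
proof -
  have "map (init_tapes w) [0..<K] = input_tape w # replicate (K - 1) blank_tape"
    using K by (intro nth_equalityI) (auto simp: init_tapes_def nth_Cons split: nat.splits)
  then show ?thesis by (simp add: init_config_def cfg_def machine_def)
qed

abbreviation start :: "word => stream => ctl \<times> conf" where
  "start w gs \<equiv> (Run (Seq pre body), init_tapes w, gs)"

lemma runs_bounded:
  assumes "\<And>gs. \<exists>n k y. path B n k (start w gs) y & fst y \<in> {Accept, Reject} & n \<le> T & k \<le> T'"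
    and "run machine B (init_config machine w) n k c"
  shows "n \<le> T & k \<le> T'"
proof -
  from run_path[OF assms(2) init_cfg _ good_init] obtain gs q s gs'
    where p: "path B n k (start w gs) (q, s, gs')" by auto
  from assms(1)[of gs] path_det[OF _ _ p] show ?thesis by (metis le_trans)
qed

lemma accepts_iff:
  assumes "\<And>gs. \<exists>n k y. path B n k (start w gs) y & fst y = (if A gs then Accept else Reject)"
  shows "accepts machine B w = (\<exists>gs. A gs)"
proof
  assume "accepts machine B w"
  then obtain n k c where r: "run machine B (init_config machine w) n k c" "fst c = enc Accept"
    unfolding accepts_def by (auto simp: machine_def)
  from run_path[OF r(1) init_cfg _ good_init] obtain gs q s gs'
    where p: "path B n k (start w gs) (q, s, gs')" "c = cfg q s" "q \<in> controls" by auto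
  then have "q = Accept" using r(2) enc_inj by (simp add: cfg_def)
  obtain n' k' y where y: "path B n' k' (start w gs) y" "fst y = (if A gs then Accept else Reject)"
    using assms[of gs] by blast
  with path_det[OF y(1) _ p(1)] \<open>q = Accept\<close> have "A gs" by (cases "A gs") auto
  then show "\<exists>gs. A gs" by blast
next
  assume "\<exists>gs. A gs"
  then obtain gs where "A gs" by blast
  with assms[of gs] obtain n k y where "path B n k (start w gs) y" "fst y = Accept" by auto
  with path_run[OF this(1)] have "run machine B (init_config machine w) n k (cfg Accept (fst (snd y)))"
    by (simp add: init_cfg good_init)
  moreover have "fst (cfg Accept (fst (snd y))) = accept_state machine"
    by (simp add: cfg_def machine_def)
  ultimately show "accepts machine B w" unfolding accepts_def by blast
qed

lemma computes:
  assumes "path B n k (start w gs) (Accept, s, gs')" "holds_word (s 1) v"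
  shows "\<exists>n k c. run machine B (init_config machine w) n k c & ~ (\<exists>c'. step machine B c c') &
    holds_word (snd c ! 1) v"
proof -
  have r: "run machine B (init_config machine w) n k (cfg Accept s)"
    using path_run[OF assms(1)] by (simp add: init_cfg good_init)
  have "~ step machine B (cfg Accept s) c'" for c'
  proof
    assume "step machine B (cfg Accept s) c'"
    then show False by cases (auto simp: machine_def cfg_def enc_inj)
  qed
  moreover have "holds_word (snd (cfg Accept s) ! 1) v" using assms(2) K by (simp add: cfg_def)
  ultimately show ?thesis using r by blast
qed

end

section \<open>Programs on registers\<close>

type_synonym regs = "nat => nat list"

text \<open>A register is a tape that holds a list without blanks, with the head on cell 0. Numbers
  are lengths of registers: \<open>Test A x\<close> inspects the symbol of \<open>A\<close> at the
  position given by the length of \<open>x\<close>, and \<open>For x y\<close> counts in unary up to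
  the length of \<open>y\<close>. As loops are bounded, programs terminate and a time bound can be
  read off their syntax.\<close>

datatype prog = Skip | Clear nat | App nat nat | Test nat nat "nat => bool" prog prog
  | Semi prog prog (infixr ";;" 60) | For nat nat prog

definition nth0 :: "nat list => nat => nat" where
  "nth0 xs i = (if i < length xs then xs ! i else 0)"

abbreviation ones :: "nat => nat list" where
  "ones n \<equiv> replicate n 1"

primrec sem :: "prog => regs => regs" where
  "sem Skip r = r"
| "sem (Clear k) r = r(k := [])"
| "sem (App k a) r = r(k := r k @ [a])"
| "sem (Test A x P p q) r = (if P (nth0 (r A) (length (r x))) then sem p r else sem q r)"
| "sem (p ;; q) r = sem q (sem p r)"
| "sem (For x y p) r =
     (fold (\<lambda>i r. sem p (r(x := ones i))) [0..<length (r y)] r)(x := ones (length (r y)))"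

primrec assigned :: "prog => nat set" where
  "assigned Skip = {}"
| "assigned (Clear k) = {k}"
| "assigned (App k a) = {k}"
| "assigned (Test A x P p q) = assigned p \<union> assigned q"
| "assigned (p ;; q) = assigned p \<union> assigned q"
| "assigned (For x y p) = insert x (assigned p)"

text \<open>The registers in \<open>Bs\<close> bound all loops and are never assigned; tape 3 is reserved for loop tests.\<close>

primrec wf_prog :: "nat => nat => nat set => prog => bool" where
  "wf_prog K S Bs Skip = True"
| "wf_prog K S Bs (Clear k) = (k < K & k ~= 3 & k \<notin> Bs)"
| "wf_prog K S Bs (App k a) = (k < K & k ~= 3 & k \<notin> Bs & 0 < a & a < S)"
| "wf_prog K S Bs (Test A x P p q) =
     (A < K & A ~= 3 & x < K & x ~= 3 & A ~= x & wf_prog K S Bs p & wf_prog K S Bs q)"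
| "wf_prog K S Bs (p ;; q) = (wf_prog K S Bs p & wf_prog K S Bs q)"
| "wf_prog K S Bs (For x y p) =
     (x < K & x ~= 3 & x \<notin> Bs & y < K & y ~= 3 & y \<in> Bs & x \<notin> assigned p & wf_prog K S Bs p)"

text \<open>Bounds two quantities at once, the number of elementary operations and the growth of any
  register, when the loop bounds have length at most \<open>m\<close>. The summands 3 in a loop pay
  for clearing or extending the counter and for comparing it with the bound.\<close>

primrec ops :: "prog => nat => nat" where
  "ops Skip m = 1"
| "ops (Clear k) m = 1"
| "ops (App k a) m = 1"
| "ops (Test A x P p q) m = 1 + ops p m + ops q m"
| "ops (p ;; q) m = 1 + ops p m + ops q m"
| "ops (For x y p) m = m * (ops p m + 3) + 3"

lemma sem_unassigned: "k \<notin> assigned p ==> sem p r k = r k"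
proof (induction p arbitrary: r)
  case (For x y p)
  have "fold (\<lambda>i r. sem p (r(x := ones i))) is r k = r k" for "is"
    using For by (induction "is" arbitrary: r) auto
  then show ?case using For by simp
qed auto

lemma wf_prog_assigned: "wf_prog K S Bs p ==> assigned p \<subseteq> {..<K} - {3} - Bs" by (induction p) auto

definition nonzero :: "regs => bool" where
  "nonzero r = (\<forall>k. 0 \<notin> set (r k))"

lemma nonzero_upd: "nonzero r ==> 0 \<notin> set xs ==> nonzero (r(k := xs))" by (auto simp: nonzero_def)

lemma sem_nonzero: "wf_prog K S Bs p ==> nonzero r ==> nonzero (sem p r)"
proof (induction p arbitrary: r)
  case (For x y p)
  have "nonzero (fold (\<lambda>i r. sem p (r(x := ones i))) is r)" for "is"
    using For by (induction "is" arbitrary: r) (auto simp: nonzero_upd)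
  then show ?case unfolding sem.simps by (rule nonzero_upd) simp
qed (auto simp: nonzero_def)

lemma sem_length:
  assumes "wf_prog K S Bs p" "\<forall>b\<in>Bs. length (r b) \<le> m" "\<forall>k. length (r k) \<le> l"
  shows "length (sem p r k) \<le> l + ops p m" using assms
proof (induction p arbitrary: r k l)
  case (Test A x P p q)
  then have "length (sem p r k) \<le> l + ops p m" "length (sem q r k) \<le> l + ops q m" by simp_all
  then show ?case by (simp only: sem.simps ops.simps split: if_split) linarith
next
  case (Semi p q)
  have "\<forall>b\<in>Bs. length (sem p r b) \<le> m"
    using Semi.prems wf_prog_assigned[of K S Bs p] sem_unassigned[of _ p r] by force
  then show ?case
    using Semi.IH(2)[of "sem p r" "l + ops p m" k] Semi.IH(1)[of r l] Semi.prems by auto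
next
  case (For x y p)
  let ?f = "\<lambda>i r. sem p (r(x := ones i))"
  have B: "\<forall>b\<in>Bs. fold ?f is r b = r b" for "is"
    using sem_unassigned[of _ "For x y p" r] wf_prog_assigned[OF For.prems(1)]
  proof (induction "is" rule: rev_induct)
    case (snoc i "is")
    have "b \<notin> assigned p & b ~= x" if "b \<in> Bs" for b
      using wf_prog_assigned[OF For.prems(1)] that by auto
    then show ?case using snoc by (simp add: sem_unassigned)
  qed simp
  have y: "length (r y) \<le> m" "length (r y) \<le> l" using For.prems by auto
  have "\<forall>k. length (fold ?f [0..<n] r k) \<le> l + n * ops p m" if "n \<le> length (r y)" for n using that
  proof (induction n)
    case 0
    then show ?case using For.prems by simp
  next
    case (Suc n)
    define r' where "r' = (fold ?f [0..<n] r)(x := ones n)"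
    have B': "\<forall>b\<in>Bs. length (r' b) \<le> m" using B For.prems by (auto simp: r'_def)
    have IH: "\<forall>k. length (fold ?f [0..<n] r k) \<le> l + n * ops p m"
      by (rule Suc.IH) (use Suc.prems in simp)
    have "\<forall>k. length (r' k) \<le> l + n * ops p m" using IH Suc.prems y by (auto simp: r'_def)
    with B' have "length (sem p r' k) \<le> l + n * ops p m + ops p m" for k
      using For.IH[of r' "l + n * ops p m"] For.prems(1) by simp
    moreover have "fold ?f [0..<Suc n] r = sem p r'" by (simp add: r'_def)
    ultimately have "\<forall>k. length (fold ?f [0..<Suc n] r k) \<le> l + Suc n * ops p m"
      by (simp add: algebra_simps)
    then show ?case .
  qed
  from this[of "length (r y)"] have "length (fold ?f [0..<length (r y)] r k) \<le> l + length (r y) * ops p m"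
    by simp
  moreover have "length (r y) * ops p m \<le> m * (ops p m + 3)" using y by (intro mult_mono) auto
  ultimately show ?case using y by auto
qed (auto simp: le_SucI)

section \<open>Tapes that hold lists, and commands on them\<close>

definition list_tape :: "nat list => int => tape" where
  "list_tape xs i = (\<lambda>j. if 0 \<le> j & j < int (length xs) then xs ! nat j else 0, i)"

lemma list_tape_Nil: "list_tape [] 0 = blank_tape" by (auto simp: list_tape_def blank_tape_def)

lemma scan_list_tape: "scan (list_tape xs i) = (if 0 \<le> i & i < int (length xs) then xs ! nat i else 0)"
  by (simp add: scan_def list_tape_def)

lemma act_move: "act (list_tape xs i) (scan (list_tape xs i), d) = list_tape xs (i + offset d)"
  by (auto simp: act_def scan_def list_tape_def)

lemma act_snoc:
  "act (list_tape xs (int (length xs))) (a, d) = list_tape (xs @ [a]) (int (length xs) + offset d)"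
  by (auto simp: act_def list_tape_def fun_eq_iff nth_append)

lemma act_butlast:
  "act (list_tape (xs @ [a]) (int (length xs))) (0, d) = list_tape xs (int (length xs) + offset d)"
  by (auto simp: act_def list_tape_def fun_eq_iff nth_append)

lemma act_flag: "length xs \<le> 1 ==> act (list_tape xs 0) (a, Stay) = list_tape [a] 0"
  by (cases xs) (auto simp: act_def list_tape_def fun_eq_iff)

text \<open>Meant for commands without guesses: the stream comes out unchanged, and one time
  \<open>t\<close> serves all streams.\<close>

definition exb :: "cmd => tapes => nat => tapes => bool" where
  "exb c s T s' = (\<exists>t\<le>T. \<forall>gs. ex c (s, gs) t (s', gs))"

lemma exb_mono: "exb c s T s' ==> T \<le> T' ==> exb c s T' s'"
  unfolding exb_def using le_trans by blast

lemma exb_Nop: "exb Nop s T s" unfolding exb_def using ex_Nop by blast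

lemma exb_Act: "s' = s(k := act (s k) (f (scan (s k)))) ==> exb (Act k f) s 1 s'"
  unfolding exb_def using ex_Act by blast

lemma exb_Seq: "exb c s T s' ==> exb d s' T' s'' ==> T + T' + 1 \<le> T'' ==> exb (Seq c d) s T'' s''"
  unfolding exb_def
  by (elim exE conjE) (rule_tac x = "t + Suc ta" in exI, auto intro: ex_Seq simp del: add_Suc_right)

lemma exb_Cond:
  "(P (scan (s k)) ==> exb c s T s') ==> (~ P (scan (s k)) ==> exb d s T s') ==>
    exb (Cond k P c d) s (Suc T) s'" unfolding exb_def
  by (cases "P (scan (s k))") (fastforce intro: ex_Cond_True ex_Cond_False)+

lemma exb_Loop_True:
  "P (scan (s k)) ==> exb c s T s' ==> exb (Loop k P c) s' T' s'' ==> T + T' + 2 \<le> T'' ==>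
    exb (Loop k P c) s T'' s''" unfolding exb_def
  by (elim exE conjE) (rule_tac x = "Suc (t + Suc ta)" in exI, auto intro!: ex_Loop_True intro: ex_Seq simp del: add_Suc_right)

lemma exb_Loop_False: "~ P (scan (s k)) ==> exb (Loop k P c) s 1 s"
  unfolding exb_def by (auto intro!: exI[of _ "1::nat"] ex_Loop_False[unfolded One_nat_def])

definition go_end :: "nat => cmd" where
  "go_end k = Loop k nz (Act k (\<lambda>a. (a, Right)))"

text \<open>The first step to the left is unconditional because the head may stand on the blank
  behind the word. The loop then stops on cell -1.\<close>

definition rewind :: "nat => cmd" where
  "rewind k = Seq (Act k (\<lambda>a. (a, Left)))
     (Seq (Loop k nz (Act k (\<lambda>a. (a, Left)))) (Act k (\<lambda>a. (a, Right))))"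

definition append_cmd :: "nat => nat => cmd" where
  "append_cmd k b = Seq (go_end k) (Seq (Act k (\<lambda>a. (b, Right))) (rewind k))"

definition clear_cmd :: "nat => cmd" where
  "clear_cmd k = Seq (go_end k) (Seq (Act k (\<lambda>a. (a, Left)))
     (Seq (Loop k nz (Act k (\<lambda>a. (0, Left)))) (Act k (\<lambda>a. (a, Right)))))"

text \<open>While the head of \<open>x\<close> runs to the end of its word, the head of
  \<open>A\<close> follows until its own word is exhausted. It ends on the cell with number
  \<open>length (r x)\<close>, or on the blank behind the word if that is shorter; in both cases it
  scans the symbol that \<open>nth0\<close> returns.\<close>

definition parallel :: "nat => nat => cmd" where
  "parallel x A = Loop x nz
     (Seq (Act x (\<lambda>a. (a, Right))) (Cond A nz (Act A (\<lambda>a. (a, Right))) Nop))"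

definition test_cmd :: "nat => nat => (nat => bool) => cmd => cmd => cmd" where
  "test_cmd A x P c d = Seq (parallel x A)
     (Cond A P (Seq (rewind A) (Seq (rewind x) c)) (Seq (rewind A) (Seq (rewind x) d)))"

definition set_flag :: "nat => cmd" where
  "set_flag b = Act 3 (\<lambda>_. (b, Stay))"

text \<open>Whether a loop goes on depends on a comparison of two lengths, but \<open>Loop\<close>
  can only look at a scanned symbol. The outcome is therefore written on tape 3, 2 for another round
  and 1 for the end.\<close>

primrec compile :: "prog => cmd" where
  "compile Skip = Nop"
| "compile (Clear k) = clear_cmd k"
| "compile (App k a) = append_cmd k a"
| "compile (Test A x P p q) = test_cmd A x P (compile p) (compile q)"
| "compile (p ;; q) = Seq (compile p) (compile q)"
| "compile (For x y p) = Seq (clear_cmd x) (Seq (test_cmd y x nz (set_flag 2) (set_flag 1))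
     (Loop 3 (\<lambda>a. a = 2) (Seq (compile p)
       (Seq (append_cmd x 1) (test_cmd y x nz (set_flag 2) (set_flag 1))))))"

lemma wf_compile: "wf_prog K S Bs p ==> 4 \<le> K ==> 3 \<le> S ==> wf_cmd K S (compile p)" by (induction p)
    (auto simp: clear_cmd_def append_cmd_def test_cmd_def go_end_def rewind_def parallel_def set_flag_def)

lemma guess_free_compile: "guess_free (compile p)" by (induction p)
    (auto simp: clear_cmd_def append_cmd_def test_cmd_def go_end_def rewind_def parallel_def set_flag_def)

lemma nth_pos: "0 \<notin> set xs ==> i < length xs ==> 0 < (xs ! i :: nat)" by (metis gr0I nth_mem)

lemma go_end:
  assumes "s k = list_tape xs (int i)" "i \<le> length xs" "0 \<notin> set xs"
  shows "exb (go_end k) s (3 * (length xs - i) + 1) (s(k := list_tape xs (int (length xs))))"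
  using assms
proof (induction "length xs - i" arbitrary: i s)
  case 0
  then have "exb (go_end k) s 1 s"
    unfolding go_end_def by (intro exb_Loop_False) (simp add: scan_list_tape)
  moreover have "s(k := list_tape xs (int (length xs))) = s" using 0 by auto
  ultimately show ?case using 0 by simp
next
  case (Suc n)
  let ?s = "s(k := list_tape xs (int (Suc i)))"
  have i: "i < length xs" using Suc(2) by simp
  have "exb (go_end k) ?s (3 * (length xs - Suc i) + 1) (?s(k := list_tape xs (int (length xs))))"
    by (rule Suc.hyps(1)) (use Suc(2-) in auto)
  moreover have "exb (Act k (\<lambda>a. (a, Right))) s 1 ?s"
    by (rule exb_Act) (simp add: Suc.prems(1) act_move add.commute)
  moreover have "scan (s k) ~= 0" using Suc.prems i by (simp add: scan_list_tape nth_pos)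
  ultimately show ?case unfolding go_end_def
    using i by (intro exb_Loop_True[of _ s k _ 1 ?s "3 * (length xs - Suc i) + 1"]) auto
qed

lemma go_left:
  assumes "s k = list_tape xs (int i - 1)" "i \<le> length xs" "0 \<notin> set xs"
  shows "exb (Loop k nz (Act k (\<lambda>a. (a, Left)))) s (3 * i + 1) (s(k := list_tape xs (- 1)))"
  using assms
proof (induction i arbitrary: s)
  case 0
  then have "exb (Loop k nz (Act k (\<lambda>a. (a, Left)))) s 1 s"
    by (intro exb_Loop_False) (simp add: scan_list_tape)
  moreover have "s(k := list_tape xs (- 1)) = s" using 0 by auto
  ultimately show ?case by simp
next
  case (Suc i)
  let ?s = "s(k := list_tape xs (int i - 1))"
  have "exb (Loop k nz (Act k (\<lambda>a. (a, Left)))) ?s (3 * i + 1) (?s(k := list_tape xs (- 1)))"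
    by (rule Suc.IH) (use Suc.prems in auto)
  moreover have "exb (Act k (\<lambda>a. (a, Left))) s 1 ?s"
    by (rule exb_Act) (simp add: Suc.prems(1) act_move)
  moreover have "scan (s k) ~= 0" using Suc.prems by (simp add: scan_list_tape nth_pos Suc_le_lessD)
  ultimately show ?case unfolding fun_upd_upd
    by - (rule exb_Loop_True[of _ s k _ 1 ?s "3 * i + 1"], assumption+, simp)
qed

lemma rewind:
  assumes "s k = list_tape xs (int i)" "i \<le> length xs" "0 \<notin> set xs"
  shows "exb (rewind k) s (3 * i + 5) (s(k := list_tape xs 0))" unfolding rewind_def
proof (rule exb_Seq[OF exb_Act exb_Seq[OF _ exb_Act]])
  show "s(k := list_tape xs (int i - 1)) = s(k := act (s k) (scan (s k), Left))"
    by (simp add: assms(1) act_move)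
  show "exb (Loop k nz (Act k (\<lambda>a. (a, Left)))) (s(k := list_tape xs (int i - 1)))
      (3 * i + 1) (s(k := list_tape xs (- 1)))"
    using go_left[of "s(k := list_tape xs (int i - 1))" k xs i] assms by simp
  show "s(k := list_tape xs 0) = (s(k := list_tape xs (- 1)))
      (k := act ((s(k := list_tape xs (- 1))) k) (scan ((s(k := list_tape xs (- 1))) k), Right))"
    by (simp add: act_move)
  show "3 * i + 1 + 1 + 1 \<le> 3 * i + 3" by simp
qed simp

lemma append_cmd:
  assumes "s k = list_tape xs 0" "0 \<notin> set xs" "b ~= 0"
  shows "exb (append_cmd k b) s (6 * length xs + 12) (s(k := list_tape (xs @ [b]) 0))"
  unfolding append_cmd_def
proof (rule exb_Seq[OF _ exb_Seq[OF exb_Act]])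
  show "exb (go_end k) s (3 * length xs + 1) (s(k := list_tape xs (int (length xs))))"
    using go_end[of s k xs 0] assms by simp
  let ?s = "s(k := list_tape xs (int (length xs)))"
  show "s(k := list_tape (xs @ [b]) (int (Suc (length xs)))) = ?s(k := act (?s k) (b, Right))"
    by (simp add: act_snoc add.commute)
  show "exb (rewind k) (s(k := list_tape (xs @ [b]) (int (Suc (length xs))))) (3 * Suc (length xs) + 5)
      (s(k := list_tape (xs @ [b]) 0))"
    using rewind[of "s(k := list_tape (xs @ [b]) (int (Suc (length xs))))" k "xs @ [b]" "Suc (length xs)"] assms
    by simp
qed auto

lemma erase_left:
  assumes "s k = list_tape xs (int (length xs) - 1)" "0 \<notin> set xs"
  shows "exb (Loop k nz (Act k (\<lambda>a. (0, Left)))) s (3 * length xs + 1) (s(k := list_tape [] (- 1)))"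
  using assms
proof (induction xs arbitrary: s rule: rev_induct)
  case Nil
  then have "exb (Loop k nz (Act k (\<lambda>a. (0, Left)))) s 1 s"
    by (intro exb_Loop_False) (simp add: scan_list_tape)
  moreover have "s(k := list_tape [] (- 1)) = s" using Nil by auto
  ultimately show ?case by (metis add.left_neutral list.size(3) mult_0_right)
next
  case (snoc x xs)
  let ?s = "s(k := list_tape xs (int (length xs) - 1))"
  have "exb (Loop k nz (Act k (\<lambda>a. (0, Left)))) ?s (3 * length xs + 1) (?s(k := list_tape [] (- 1)))"
    by (rule snoc.IH) (use snoc.prems in auto)
  moreover have "exb (Act k (\<lambda>a. (0, Left))) s 1 ?s"
    by (rule exb_Act) (simp add: snoc.prems(1) act_butlast)
  moreover have "scan (s k) ~= 0" using snoc.prems by (simp add: scan_list_tape)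
  ultimately show ?case unfolding fun_upd_upd
    by - (rule exb_Loop_True[of _ s k _ 1 ?s "3 * length xs + 1"], assumption+, simp)
qed

lemma clear_cmd:
  assumes "s k = list_tape xs 0" "0 \<notin> set xs"
  shows "exb (clear_cmd k) s (6 * length xs + 7) (s(k := list_tape [] 0))" unfolding clear_cmd_def
proof (rule exb_Seq[OF _ exb_Seq[OF exb_Act exb_Seq[OF _ exb_Act]]])
  let ?s = "s(k := list_tape xs (int (length xs)))"
  show "exb (go_end k) s (3 * length xs + 1) ?s" using go_end[of s k xs 0] assms by simp
  show "s(k := list_tape xs (int (length xs) - 1)) = ?s(k := act (?s k) (scan (?s k), Left))"
    by (simp add: act_move)
  show "exb (Loop k nz (Act k (\<lambda>a. (0, Left)))) (s(k := list_tape xs (int (length xs) - 1)))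
      (3 * length xs + 1) (s(k := list_tape [] (- 1)))"
    using erase_left[of "s(k := list_tape xs (int (length xs) - 1))" k xs] assms by simp
  show "s(k := list_tape [] 0) = (s(k := list_tape [] (- 1)))
      (k := act ((s(k := list_tape [] (- 1))) k) (scan ((s(k := list_tape [] (- 1))) k), Right))"
    by (simp add: act_move)
  show "3 * length xs + 1 + 1 + 1 \<le> 3 * length xs + 3" by simp
qed auto

lemma parallel:
  assumes "x ~= A" "s x = list_tape xs (int i)" "s A = list_tape ys (int (min i (length ys)))"
    "i \<le> length xs" "0 \<notin> set xs" "0 \<notin> set ys"
  shows "exb (parallel x A) s (6 * (length xs - i) + 1)
    (s(x := list_tape xs (int (length xs)), A := list_tape ys (int (min (length xs) (length ys)))))"
  using assms
proof (induction "length xs - i" arbitrary: i s)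
  case 0
  then have "exb (parallel x A) s 1 s"
    unfolding parallel_def by (intro exb_Loop_False) (simp add: scan_list_tape)
  moreover have "s(x := list_tape xs (int (length xs)), A := list_tape ys (int (min (length xs) (length ys)))) = s"
    using 0 by (auto simp: fun_eq_iff)
  ultimately show ?case using exb_mono[of _ _ 1] le_add2 by metis
next
  case (Suc n)
  let ?s1 = "s(x := list_tape xs (int (Suc i)))"
  let ?s = "s(x := list_tape xs (int (Suc i)), A := list_tape ys (int (min (Suc i) (length ys))))"
  have i: "i < length xs" using Suc(2) by simp
  have "exb (parallel x A) ?s (6 * (length xs - Suc i) + 1)
    (?s(x := list_tape xs (int (length xs)), A := list_tape ys (int (min (length xs) (length ys)))))"
    by (rule Suc.hyps(1)) (use Suc(2-) in auto)
  moreover have "?s(x := list_tape xs (int (length xs)), A := list_tape ys (int (min (length xs) (length ys))))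
      = s(x := list_tape xs (int (length xs)), A := list_tape ys (int (min (length xs) (length ys))))"
    using Suc.prems(1) by (auto simp: fun_eq_iff)
  moreover have "exb (Act x (\<lambda>a. (a, Right))) s 1 ?s1"
    by (rule exb_Act) (simp add: Suc.prems(2) act_move add.commute)
  moreover have "exb (Cond A nz (Act A (\<lambda>a. (a, Right))) Nop) ?s1 2 ?s" unfolding numeral_2_eq_2
  proof (rule exb_Cond)
    have sc: "scan (?s1 A) ~= 0 \<longleftrightarrow> i < length ys"
      using Suc.prems by (auto simp: scan_list_tape min_def nth_pos)
    show "exb (Act A (\<lambda>a. (a, Right))) ?s1 (Suc 0) ?s" if "scan (?s1 A) ~= 0"
      unfolding One_nat_def[symmetric]
      using that sc Suc.prems by (intro exb_Act) (simp add: act_move add.commute)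
    show "exb Nop ?s1 (Suc 0) ?s" if "~ scan (?s1 A) ~= 0"
    proof -
      have "?s = ?s1" using that sc Suc.prems(1,3) by (auto simp: fun_eq_iff)
      then show ?thesis using exb_Nop by metis
    qed
  qed
  ultimately have "exb (Seq (Act x (\<lambda>a. (a, Right))) (Cond A nz (Act A (\<lambda>a. (a, Right))) Nop)) s 4 ?s"
    and *: "exb (parallel x A) ?s (6 * (length xs - Suc i) + 1)
      (s(x := list_tape xs (int (length xs)), A := list_tape ys (int (min (length xs) (length ys)))))"
    by (auto intro: exb_Seq)
  moreover have "scan (s x) ~= 0" using Suc.prems i by (simp add: scan_list_tape nth_pos)
  ultimately show ?case unfolding parallel_def
    using i by (intro exb_Loop_True[of _ s x _ 4 ?s "6 * (length xs - Suc i) + 1"]) auto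
qed

lemma test_cmd:
  assumes "x ~= A" "s x = list_tape xs 0" "s A = list_tape ys 0" "0 \<notin> set xs" "0 \<notin> set ys"
    and "if P (nth0 ys (length xs)) then exb c s T s' else exb d s T s'"
  shows "exb (test_cmd A x P c d) s (T + 12 * length xs + 15) s'" unfolding test_cmd_def
proof (rule exb_Seq[OF _ exb_Cond])
  let ?s = "s(x := list_tape xs (int (length xs)), A := list_tape ys (int (min (length xs) (length ys))))"
  show "exb (parallel x A) s (6 * length xs + 1) ?s" using parallel[of x A s xs 0 ys] assms by simp
  have fA: "?s(A := list_tape ys 0) = s(x := list_tape xs (int (length xs)))"
    and fx: "(s(x := list_tape xs (int (length xs))))(x := list_tape xs 0) = s"
    using assms(1-3) by (auto simp: fun_eq_iff)
  have "exb (rewind A) ?s (3 * min (length xs) (length ys) + 5) (?s(A := list_tape ys 0))"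
    by (rule rewind) (use assms(5) in simp_all)
  then have rA: "exb (rewind A) ?s (3 * length xs + 5) (s(x := list_tape xs (int (length xs))))"
    unfolding fA by (rule exb_mono) simp
  have "exb (rewind x) (s(x := list_tape xs (int (length xs)))) (3 * length xs + 5)
      ((s(x := list_tape xs (int (length xs))))(x := list_tape xs 0))"
    by (rule rewind) (use assms(4) in simp_all)
  then have rx: "exb (rewind x) (s(x := list_tape xs (int (length xs)))) (3 * length xs + 5) s"
    unfolding fx .
  have *: "exb (Seq (rewind A) (Seq (rewind x) e)) ?s (6 * length xs + 12 + T) s'" if "exb e s T s'" for e
    by (rule exb_Seq[OF rA exb_Seq[OF rx that order.refl]]) simp
  have sc: "scan (?s A) = nth0 ys (length xs)"
    using assms(1) by (auto simp: scan_list_tape nth0_def)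
  show "exb (Seq (rewind A) (Seq (rewind x) c)) ?s (6 * length xs + 12 + T) s'" if "P (scan (?s A))"
    using * that sc assms(6) by simp
  show "exb (Seq (rewind A) (Seq (rewind x) d)) ?s (6 * length xs + 12 + T) s'" if "~ P (scan (?s A))"
    using * that sc assms(6) by simp
qed simp

definition rep :: "regs => tapes => bool" where
  "rep r s = ((\<forall>k. k ~= 3 --> s k = list_tape (r k) 0) & (\<exists>xs. length xs \<le> 1 & s 3 = list_tape xs 0))"

lemma rep_upd: "rep r s ==> k ~= 3 ==> rep (r(k := xs)) (s(k := list_tape xs 0))"
  by (auto simp: rep_def)

lemma set_flag:
  assumes "rep r s"
  shows "exb (set_flag b) s 1 (s(3 := list_tape [b] 0))" "rep r (s(3 := list_tape [b] 0))"
proof -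
  obtain xs where "length xs \<le> 1" "s 3 = list_tape xs 0" using assms by (auto simp: rep_def)
  then show "exb (set_flag b) s 1 (s(3 := list_tape [b] 0))"
    unfolding set_flag_def by (intro exb_Act) (simp add: act_flag)
  show "rep r (s(3 := list_tape [b] 0))" using assms by (auto simp: rep_def intro: exI[of _ "[b]"])
qed

lemma loop_test:
  assumes "rep r s" "nonzero r" "x ~= y" "x ~= 3" "y ~= 3"
  shows "exb (test_cmd y x nz (set_flag 2) (set_flag 1)) s (12 * length (r x) + 16)
      (s(3 := list_tape [if length (r x) < length (r y) then 2 else 1] 0))"
proof -
  have "nth0 (r y) (length (r x)) ~= 0 \<longleftrightarrow> length (r x) < length (r y)"
    using assms(2) unfolding nth0_def nonzero_def by (metis nth_mem)
  then have "exb (test_cmd y x nz (set_flag 2) (set_flag 1)) s (1 + 12 * length (r x) + 15)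
      (s(3 := list_tape [if length (r x) < length (r y) then 2 else 1] 0))"
    using set_flag(1)[OF assms(1)] assms
    by (intro test_cmd[of x y s "r x" "r y"]) (auto simp: rep_def nonzero_def)
  then show ?thesis by (rule exb_mono) simp
qed

lemma sum_le: "\<forall>k. f k + a \<le> (L::nat) ==> b \<le> a ==> \<forall>k. f k + b \<le> L"
  by (meson add_left_mono le_trans)

text \<open>\<open>L\<close> bounds every register during the whole execution, since by
  \<open>sem_length\<close> none grows by more than \<open>ops p m\<close>. An elementary operation
  sweeps a few times over tapes of this length, which the factor \<open>30 * (L + 1)\<close> pays
  for.\<close>

theorem compile_correct:
  assumes "wf_prog K S Bs p" "rep r s" "nonzero r" "\<forall>b\<in>Bs. length (r b) \<le> m"
    "\<forall>k. length (r k) + ops p m \<le> L"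
  shows "\<exists>s'. rep (sem p r) s' & exb (compile p) s (ops p m * (30 * (L + 1))) s'" using assms
proof (induction p arbitrary: r s)
  case Skip
  then show ?case by (auto intro: exb_Nop)
next
  case (Clear k)
  have "length (r k) + 1 \<le> L" using Clear by simp
  then have "6 * length (r k) + 7 \<le> 30 * (L + 1)" by simp
  moreover have "exb (clear_cmd k) s (6 * length (r k) + 7) (s(k := list_tape [] 0))"
    using Clear by (intro clear_cmd) (auto simp: rep_def nonzero_def)
  moreover have "rep (r(k := [])) (s(k := list_tape [] 0))" by (rule rep_upd) (use Clear in auto)
  ultimately show ?case
    unfolding sem.simps compile.simps ops.simps mult_1 by (blast intro: exb_mono)
next
  case (App k a)
  have "length (r k) + 1 \<le> L" using App by simp
  then have "6 * length (r k) + 12 \<le> 30 * (L + 1)" by simp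
  moreover have "exb (append_cmd k a) s (6 * length (r k) + 12) (s(k := list_tape (r k @ [a]) 0))"
    using App by (intro append_cmd) (auto simp: rep_def nonzero_def)
  moreover have "rep (r(k := r k @ [a])) (s(k := list_tape (r k @ [a]) 0))"
    by (rule rep_upd) (use App in auto)
  ultimately show ?case
    unfolding sem.simps compile.simps ops.simps mult_1 by (blast intro: exb_mono)
next
  case (Test A x P p q)
  let ?t = "30 * (L + 1)"
  have L: "\<forall>k. length (r k) + ops p m \<le> L" "\<forall>k. length (r k) + ops q m \<le> L"
    using sum_le[OF Test.prems(5)] by simp_all
  obtain s1 where s1: "rep (sem p r) s1" "exb (compile p) s (ops p m * ?t) s1"
    using Test.IH(1)[OF _ Test.prems(2-4)] Test.prems(1) L by auto
  obtain s2 where s2: "rep (sem q r) s2" "exb (compile q) s (ops q m * ?t) s2"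
    using Test.IH(2)[OF _ Test.prems(2-4)] Test.prems(1) L by auto
  let ?P = "P (nth0 (r A) (length (r x)))"
  have len: "length (r x) \<le> L" using Test.prems(5) le_add1 le_trans by blast
  have "exb (test_cmd A x P (compile p) (compile q)) s
      ((ops p m * ?t + ops q m * ?t) + 12 * length (r x) + 15) (if ?P then s1 else s2)"
    by (rule test_cmd[of x A s "r x" "r A"])
      (use Test.prems s1 s2 in \<open>auto simp: rep_def nonzero_def intro: exb_mono\<close>)
  then have "exb (test_cmd A x P (compile p) (compile q)) s (ops (Test A x P p q) m * ?t) (if ?P then s1 else s2)"
    by (rule exb_mono) (use len in \<open>auto simp: algebra_simps\<close>)
  then show ?case using s1 s2 by (auto intro!: exI[of _ "if ?P then s1 else s2"])
next
  case (Semi p q)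
  let ?t = "30 * (L + 1)"
  obtain s1 where s1: "rep (sem p r) s1" "exb (compile p) s (ops p m * ?t) s1"
    using Semi.IH(1)[OF _ Semi.prems(2-4)] Semi.prems(1) sum_le[OF Semi.prems(5), of "ops p m"] by auto
  have "\<forall>b\<in>Bs. length (sem p r b) \<le> m"
    using Semi.prems wf_prog_assigned[of K S Bs p] sem_unassigned[of _ p r] by force
  moreover have "length (sem p r k) + ops q m \<le> L" for k
  proof -
    have o: "ops (p ;; q) m \<le> L" using Semi.prems(5) by (meson add_leD2)
    moreover have "length (r k) \<le> L - ops (p ;; q) m" for k
      using Semi.prems(5)[rule_format, of k] by linarith
    ultimately have *: "\<forall>k. length (r k) \<le> L - ops (p ;; q) m" "ops (p ;; q) m \<le> L" by blast+
    have "length (sem p r k) \<le> L - ops (p ;; q) m + ops p m"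
      by (rule sem_length[of K S Bs]) (use Semi.prems * in auto)
    then show ?thesis using *(2) by simp
  qed
  ultimately obtain s2 where s2: "rep (sem q (sem p r)) s2" "exb (compile q) s1 (ops q m * ?t) s2"
    using Semi.IH(2)[OF _ s1(1)] Semi.prems sem_nonzero[of K S Bs p r] by auto
  from s1 s2 have "exb (Seq (compile p) (compile q)) s (ops (p ;; q) m * ?t) s2"
    by (intro exb_Seq[OF s1(2) s2(2)]) (auto simp: algebra_simps)
  then show ?case using s2 by auto
next
  case (For x y p)
  let ?t = "30 * (L + 1)" and ?f = "\<lambda>i r. sem p (r(x := ones i))"
  let ?n = "length (r y)" and ?o = "ops p m"
  let ?lt = "test_cmd y x nz (set_flag 2) (set_flag 1)"
  let ?loop = "Loop 3 (\<lambda>a. a = 2) (Seq (compile p) (Seq (append_cmd x 1) ?lt))"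
  have xy: "x ~= y" "x ~= 3" "y ~= 3" "x \<notin> assigned p" "y \<notin> assigned p" "y \<in> Bs" "wf_prog K S Bs p"
    using For.prems(1) wf_prog_assigned[of K S Bs p] by auto
  \<comment> \<open>The registers before round \<open>i\<close>, with the counter already set to
    \<open>i\<close>; the value for \<open>i = ?n\<close> is the final state.\<close>
  define R where "R i = (fold ?f [0..<i] r)(x := ones i)" for i
  define fl where "fl i = [if i < ?n then 2 else 1 :: nat]" for i
  have Rx: "R i x = ones i" for i by (simp add: R_def)
  have R0: "R 0 = r(x := [])" by (simp add: R_def)
  have RS: "R (Suc i) = (sem p (R i))(x := ones (Suc i))" for i by (simp add: R_def)
  have RB: "R i b = r b" if b: "b \<in> Bs" for i b
  proof -
    have "b ~= x" "b \<notin> assigned p" using wf_prog_assigned[OF For.prems(1)] b by auto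
    then show ?thesis by (induction i) (simp_all add: R0 RS sem_unassigned)
  qed
  have Rnz: "nonzero (R i)" for i
  proof (induction i)
    case 0
    show ?case unfolding R0 using For.prems(3) by (rule nonzero_upd) simp
  next
    case (Suc i)
    show ?case unfolding RS by (rule nonzero_upd[OF sem_nonzero[OF xy(7) Suc]]) simp
  qed
  have n: "?n \<le> m" using For.prems(4) xy(6) by auto
  \<comment> \<open>A bound on the initial lengths that leaves exactly the growth
    \<open>ops (For x y p) m\<close> below \<open>L\<close>.\<close>
  define l where "l = L - ops (For x y p) m"
  have l: "\<forall>k. length (r k) \<le> l" "l + ops (For x y p) m = L"
    using For.prems(5) unfolding l_def by (metis le_diff_conv2 add_leD2, metis add_leD2 le_add_diff_inverse2)
  have Rlen: "i \<le> ?n ==> length (R i k) \<le> l + i * ?o" for i k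
  proof (induction i arbitrary: k)
    case 0
    then show ?case using l by (simp add: R0)
  next
    case (Suc i)
    have "length (sem p (R i) k) \<le> (l + i * ?o) + ?o"
      by (rule sem_length[of K S Bs]) (use Suc xy RB For.prems(4) in auto)
    moreover have "Suc i \<le> l" using Suc.prems l(1) le_trans by blast
    ultimately show ?case by (auto simp: RS)
  qed
  have RL: "length (R i k) + ?o \<le> L" if "i < ?n" for i k
  proof -
    have "length (R i k) \<le> l + i * ?o" using Rlen[of i k] that by simp
    moreover have "i * ?o + ?o \<le> m * (?o + 3)"
      using that n mult_le_mono[of "Suc i" m ?o "?o + 3"] by simp
    ultimately show ?thesis using l(2) by simp
  qed
  have nL: "?n + 3 \<le> L" using l by (metis add_mono le_add2 ops.simps(6))
  \<comment> \<open>Induction on the number \<open>j\<close> of remaining rounds. The flag on tape 3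
    already contains the comparison for round \<open>i\<close>.\<close>
  have loop: "\<exists>s'. rep (R ?n) s' & exb ?loop s (j * ((?o + 3) * ?t) + 1) s'"
    if "rep (R i) s" "s 3 = list_tape (fl i) 0" "i + j = ?n" for i j s using that
  proof (induction j arbitrary: i s)
    case 0
    then have "exb ?loop s 1 s" by (intro exb_Loop_False) (simp add: scan_list_tape fl_def)
    then show ?case using 0 by auto
  next
    case (Suc j)
    have i: "i < ?n" using Suc.prems(3) by simp
    obtain s1 where s1: "rep (sem p (R i)) s1" "exb (compile p) s (?o * ?t) s1"
      using For.IH[OF xy(7) Suc.prems(1) Rnz] RL[OF i] RB For.prems(4) by auto
    let ?s2 = "s1(x := list_tape (ones (Suc i)) 0)"
    have xi: "sem p (R i) x = ones i" using sem_unassigned[OF xy(4)] Rx by simp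
    have "s1 x = list_tape (ones i) 0" using s1(1) xi xy(2) by (simp add: rep_def)
    then have "exb (append_cmd x 1) s1 (6 * length (ones i) + 12) (s1(x := list_tape (ones i @ [1]) 0))"
      by (intro append_cmd) auto
    then have a: "exb (append_cmd x 1) s1 (6 * i + 12) ?s2"
      unfolding replicate_append_same length_replicate replicate_Suc .
    have r2: "rep (R (Suc i)) ?s2" unfolding RS using s1(1) xy(2) by (rule rep_upd)
    let ?s3 = "?s2(3 := list_tape (fl (Suc i)) 0)"
    have b: "exb ?lt ?s2 (12 * Suc i + 16) ?s3"
      using loop_test[OF r2 Rnz xy(1-3)] Rx[of "Suc i"] RB[OF xy(6), of "Suc i"] by (simp add: fl_def)
    have r3: "rep (R (Suc i)) ?s3" using set_flag(2)[OF r2] by (simp add: fl_def)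
    have "?s3 3 = list_tape (fl (Suc i)) 0" "Suc i + j = ?n" using Suc.prems(3) by simp_all
    from Suc.IH[OF r3 this] obtain s' where
      s': "rep (R ?n) s'" "exb ?loop ?s3 (j * ((?o + 3) * ?t) + 1) s'" by blast
    have "exb (Seq (compile p) (Seq (append_cmd x 1) ?lt)) s (?o * ?t + (18 * i + 42)) ?s3"
      by (rule exb_Seq[OF s1(2) exb_Seq[OF a b order.refl]]) simp
    moreover have "scan (s 3) = 2" using Suc.prems(2) i by (simp add: scan_list_tape fl_def)
    moreover have "?o * ?t + (18 * i + 42) + (j * ((?o + 3) * ?t) + 1) + 2 \<le> Suc j * ((?o + 3) * ?t) + 1"
      using i nL by (simp add: algebra_simps)
    ultimately have "exb ?loop s (Suc j * ((?o + 3) * ?t) + 1) s'"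
      by (intro exb_Loop_True[OF _ _ s'(2)])
    then show ?case using s'(1) by blast
  qed
  let ?s1 = "s(x := list_tape [] 0)" and ?s2 = "s(x := list_tape [] 0, 3 := list_tape (fl 0) 0)"
  have c: "exb (clear_cmd x) s (6 * length (r x) + 7) ?s1"
    using For.prems xy by (intro clear_cmd) (auto simp: rep_def nonzero_def)
  have r1: "rep (R 0) ?s1" unfolding R0 using For.prems(2) xy(2) by (rule rep_upd)
  have d: "exb ?lt ?s1 16 ?s2"
    using loop_test[OF r1 Rnz xy(1-3)] Rx[of 0] RB[OF xy(6), of 0] by (simp add: fl_def)
  have r2: "rep (R 0) ?s2" using set_flag(2)[OF r1] by (simp add: fl_def)
  have "?s2 3 = list_tape (fl 0) 0" "0 + ?n = ?n" by simp_all
  from loop[OF r2 this] obtain s' where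
    s': "rep (R ?n) s'" "exb ?loop ?s2 (?n * ((?o + 3) * ?t) + 1) s'" by blast
  have "length (r x) \<le> L" using l trans_le_add1 by metis
  moreover have "?n * ((?o + 3) * ?t) \<le> m * ((?o + 3) * ?t)" using n by (rule mult_le_mono1)
  ultimately have "6 * length (r x) + 7 + (16 + (?n * ((?o + 3) * ?t) + 1) + 1) + 1 \<le> ops (For x y p) m * ?t"
    by (simp add: algebra_simps)
  then have "exb (compile (For x y p)) s (ops (For x y p) m * ?t) s'"
    unfolding compile.simps by (intro exb_Seq[OF c exb_Seq[OF d s'(2) order.refl]])
  moreover have "R ?n = sem (For x y p) r" by (simp add: R_def)
  ultimately show ?case using s'(1) by metis
qed

section \<open>Polynomial bounds\<close>

definition polyb :: "(nat => nat) => bool" where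
  "polyb f = (\<exists>p :: nat poly. \<forall>n. f n \<le> poly p n)"

lemma poly_nat_mono: "x \<le> y ==> poly (p :: nat poly) x \<le> poly p y"
  by (induction p) (auto intro!: add_mono mult_mono)

lemma polyb_const: "polyb (\<lambda>_. c)" unfolding polyb_def by (rule exI[of _ "[:c:]"]) simp

lemma polyb_id: "polyb (\<lambda>n. n)" unfolding polyb_def by (rule exI[of _ "[:0, 1:]"]) simp

lemma polyb_add: "polyb f ==> polyb g ==> polyb (\<lambda>n. f n + g n)"
  unfolding polyb_def by (elim exE, rule_tac x = "p + pa" in exI) (auto intro: add_mono)

lemma polyb_mult: "polyb f ==> polyb g ==> polyb (\<lambda>n. f n * g n)"
  unfolding polyb_def by (elim exE, rule_tac x = "p * pa" in exI) (auto intro: mult_mono)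

lemma polyb_power: "polyb f ==> polyb (\<lambda>n. f n ^ k)"
  by (induction k) (auto intro: polyb_const polyb_mult)

lemma polyb_poly: "polyb f ==> polyb (\<lambda>n. poly p (f n))"
  unfolding polyb_def by (elim exE, rule_tac x = "pcompose p pa" in exI)
    (auto simp: poly_pcompose intro: poly_nat_mono)

lemma polyb_ops: "polyb f ==> polyb (\<lambda>n. ops p (f n))"
proof -
  assume f: "polyb f"
  have "\<exists>q :: nat poly. \<forall>m. ops p m = poly q m"
  proof (induction p)
    case (Test A x P p q)
    then obtain a b where "\<forall>m. ops p m = poly a m" "\<forall>m. ops q m = poly b m" by blast
    then show ?case by (intro exI[of _ "1 + a + b"]) simp
  next
    case (Semi p q)
    then obtain a b where "\<forall>m. ops p m = poly a m" "\<forall>m. ops q m = poly b m" by blast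
    then show ?case by (intro exI[of _ "1 + a + b"]) simp
  next
    case (For x y p)
    then obtain a where "\<forall>m. ops p m = poly a m" by blast
    then show ?case by (intro exI[of _ "[:0, 1:] * (a + [:3:]) + [:3:]"]) simp
  qed (rule exI[of _ 1], simp)+
  then obtain q :: "nat poly" where "\<forall>m. ops p m = poly q m" ..
  then show ?thesis using polyb_poly[OF f, of q] by simp
qed

lemmas polyb_intros = polyb_const polyb_id polyb_add polyb_mult polyb_power polyb_ops

definition bits :: "word => nat list" where
  "bits = map bit_symbol"

text \<open>Follows \<open>holds_word\<close>: the word of a register ends before the first symbol
  that is not a bit.\<close>

definition word_of :: "nat list => word" where
  "word_of xs = map (\<lambda>a. a = 2) (takeWhile (\<lambda>a. a = 1 | a = 2) xs)"

lemma word_of_bits: "word_of (bits w) = w"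
proof -
  have "takeWhile (\<lambda>a. a = 1 | a = 2) (bits w) = bits w"
    by (auto simp: takeWhile_eq_all_conv bits_def bit_symbol_def)
  then have "word_of (bits w) = map ((\<lambda>a. a = 2) \<circ> bit_symbol) w"
    unfolding word_of_def by (simp only:) (simp add: bits_def)
  also have "(\<lambda>a. a = 2) \<circ> bit_symbol = id" by (auto simp: fun_eq_iff bit_symbol_def)
  finally show ?thesis by simp
qed

lemma length_bits [simp]: "length (bits w) = length w" by (simp add: bits_def)

lemma zero_notin_bits [simp]: "0 \<notin> set (bits w)" by (auto simp: bits_def bit_symbol_def)

lemma holds_word_list_tape: "holds_word (list_tape xs 0) (word_of xs)"
proof -
  let ?P = "\<lambda>a. a = 1 | a = (2::nat)" and ?ys = "takeWhile (\<lambda>a. a = 1 | a = (2::nat)) xs"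
  have le: "length ?ys \<le> length xs" by (rule length_takeWhile_le)
  have "fst (list_tape xs 0) (int i) = bit_symbol (word_of xs ! i)" if "i < length ?ys" for i
  proof -
    have "?P (?ys ! i)" using set_takeWhileD[OF nth_mem[OF that]] by blast
    then have "?ys ! i = bit_symbol (?ys ! i = 2)" by (auto simp: bit_symbol_def)
    also have "(?ys ! i = 2) = word_of xs ! i" unfolding word_of_def by (rule nth_map[OF that, symmetric])
    also have "?ys ! i = xs ! i" using that by (rule takeWhile_nth)
    finally show ?thesis using that le by (simp add: list_tape_def)
  qed
  moreover have "fst (list_tape xs 0) (int (length ?ys)) \<notin> range bit_symbol"
  proof (cases "length ?ys < length xs")
    case True
    then have "~ ?P (xs ! length ?ys)" by (rule nth_length_takeWhile)
    then show ?thesis using True by (auto simp: list_tape_def bit_symbol_def)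
  next
    case False
    then show ?thesis by (auto simp: list_tape_def bit_symbol_def)
  qed
  ultimately show ?thesis by (simp add: holds_word_def word_of_def)
qed

text \<open>
  Registers: 0 input, 1 output and queries, 2 the bound \<open>(|w| + a) ^ a\<close> in unary, 3 loop tests,
  4 verdict, 5 last answer of the oracle, 6 scratch, 7 guessed word.
\<close>

definition bound :: "nat => word => nat" where
  "bound a w = (length w + a) ^ a"

text \<open>A power is obtained by nesting loops over register 6: the innermost operation is
  executed \<open>length (r 6) ^ d\<close> times. The counters are \<open>h\<close>,
  \<open>h + 1\<close> and so on, out of reach of the main program.\<close>

primrec nest :: "nat => nat => prog" where
  "nest h 0 = App 2 1"
| "nest h (Suc d) = For (h + d) 6 (nest h d)"

primrec repeat_prog :: "nat => prog => prog" where
  "repeat_prog 0 p = Skip"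
| "repeat_prog (Suc n) p = p ;; repeat_prog n p"

definition clears :: "nat list => prog" where
  "clears ks = foldr (\<lambda>k p. Clear k ;; p) ks Skip"

definition setup_base :: "nat => nat => prog" where
  "setup_base h a = For h 0 (App 6 1) ;; repeat_prog a (App 6 1)"

definition setup_clear :: "nat => nat => prog" where
  "setup_clear h a = clears (6 # [h..<Suc h + a])"

definition fill :: cmd where
  "fill = Seq (Loop 2 nz (Seq (Act 2 (\<lambda>a. (a, Right))) (Guess 7))) (Seq (rewind 2) (rewind 7))"

definition base_regs :: "nat => word => word => regs" where
  "base_regs a w Y = (\<lambda>k. if k = 0 then bits w else if k = 2 then ones (bound a w) else if k = 7 then bits Y else [])"

lemma sem_clears: "sem (clears ks) r k = (if k \<in> set ks then [] else r k)"
  by (induction ks arbitrary: r) (auto simp: clears_def)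

lemma wf_clears: "wf_prog K S Bs (clears ks) = (\<forall>k\<in>set ks. k < K & k ~= 3 & k \<notin> Bs)"
  by (induction ks) (auto simp: clears_def)

lemma sem_repeat_App: "sem (repeat_prog n (App k b)) r = r(k := r k @ replicate n b)"
  by (induction n arbitrary: r) auto

lemma fold_App:
  assumes "\<And>i r. f i r k = r k @ xs"
  shows "fold f is r k = r k @ concat (replicate (length is) xs)"
  using assms by (induction "is" arbitrary: r) auto

lemma fold_invariant:
  assumes "P 0 r" "\<And>i s. i < n ==> P i s ==> P (Suc i) (f i s)"
  shows "P n (fold f [0..<n] r)"
proof -
  have "m \<le> n ==> P m (fold f [0..<m] r)" for m using assms by (induction m) auto
  then show ?thesis by simp
qed

lemma concat_replicate_ones: "concat (replicate n (ones m)) = ones (n * m)"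
  by (induction n) (auto simp: replicate_add)

lemma sem_nest:
  assumes "8 \<le> h"
  shows "sem (nest h d) r 2 = r 2 @ ones (length (r 6) ^ d)"
    and "k ~= 2 ==> k < h ==> sem (nest h d) r k = r k"
proof -
  have un: "k \<notin> assigned (nest h d)" if "k ~= 2" "k < h" for k d using that by (induction d) auto
  show "k ~= 2 ==> k < h ==> sem (nest h d) r k = r k" using un sem_unassigned by simp
  show "sem (nest h d) r 2 = r 2 @ ones (length (r 6) ^ d)"
  proof (induction d arbitrary: r)
    case (Suc d)
    let ?f = "\<lambda>i r. sem (nest h d) (r(h + d := ones i))" and ?m = "length (r 6) ^ d"
    have "fold ?f [0..<length (r 6)] r 2 = r 2 @ ones (length (r 6) * ?m) &
      fold ?f [0..<length (r 6)] r 6 = r 6"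
    proof (rule fold_invariant[where P = "\<lambda>n (s :: regs). s 2 = r 2 @ ones (n * ?m) & s 6 = r 6"])
      fix i :: nat and s :: regs
      assume *: "s 2 = r 2 @ ones (i * ?m) & s 6 = r 6"
      have "sem (nest h d) (s(h + d := ones i)) 2
          = (s(h + d := ones i)) 2 @ ones (length ((s(h + d := ones i)) 6) ^ d)" by (rule Suc.IH)
      then have "sem (nest h d) (s(h + d := ones i)) 2 = r 2 @ ones (Suc i * ?m)"
        using * assms by (simp add: replicate_add[symmetric] add.commute)
      then show "?f i s 2 = r 2 @ ones (Suc i * ?m) & ?f i s 6 = r 6"
        using * un[of 6 d] assms by (simp add: sem_unassigned)
    qed simp
    then show ?case using assms by simp
  qed simp
qed

definition init_regs :: "word => regs" where
  "init_regs w = (\<lambda>k. if k = 0 then bits w else [])"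

lemma sem_setup:
  assumes "8 \<le> h"
  shows "sem (setup_clear h a) (sem (nest h a) (sem (setup_base h a) (init_regs w))) = base_regs a w []"
proof
  fix k
  let ?r1 = "sem (setup_base h a) (init_regs w)"
  have f: "fold (\<lambda>i r. sem (App 6 1) (r(h := ones i))) is r 6 = r 6 @ concat (replicate (length is) [1])" for "is" r
    by (rule fold_App) (use assms in auto)
  have "?r1 6 = concat (replicate (length w) [1]) @ ones a"
    using assms f[of "[0..<length (init_regs w 0)]" "init_regs w"]
    by (simp add: setup_base_def sem_repeat_App init_regs_def)
  also have "concat (replicate (length w) [1]) = ones (length w)"
    using concat_replicate_ones[of "length w" 1] by simp
  finally have r6: "?r1 6 = ones (length w + a)" by (simp add: replicate_add)
  have r: "?r1 k = init_regs w k" if "k < h" "k ~= 6" for k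
  proof -
    have "assigned (repeat_prog a (App 6 1)) \<subseteq> {6}" by (induction a) auto
    then show ?thesis using that by (intro sem_unassigned) (auto simp: setup_base_def)
  qed
  let ?r2 = "sem (nest h a) ?r1"
  have r2: "?r2 2 = ones (bound a w)"
    using sem_nest(1)[OF assms, of a ?r1] r6 r[of 2] assms by (simp add: bound_def init_regs_def)
  have un: "k \<notin> assigned (nest h d)" if "k ~= 2" "k < h | h + d \<le> k" for k d
    using that by (induction d) auto
  have "?r2 k = init_regs w k" if "k ~= 2" "k ~= 6" "k < h | Suc h + a \<le> k"
  proof -
    have "assigned (repeat_prog a (App 6 1)) \<subseteq> {6}" by (induction a) auto
    then have "k \<notin> assigned (setup_base h a)" using that by (auto simp: setup_base_def)
    moreover have "k \<notin> assigned (nest h a)" using un[of k a] that by auto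
    ultimately show ?thesis by (simp add: sem_unassigned)
  qed
  then show "sem (setup_clear h a) ?r2 k = base_regs a w [] k"
    using r2 assms by (auto simp: setup_clear_def sem_clears base_regs_def init_regs_def bits_def)
qed

text \<open>\<open>wf_setup\<close> separates the loop bounds of the three phases of the setup.\<close>

lemma wf_setup:
  assumes "8 \<le> h" "Suc h + a < K"
  shows "wf_prog K 3 {0} (setup_base h a)" "wf_prog K 3 {6} (nest h d) | a < d"
    "wf_prog K 3 {} (setup_clear h a)"
proof -
  have "wf_prog K 3 {0} (repeat_prog n (App 6 1))" for n using assms by (induction n) auto
  then show "wf_prog K 3 {0} (setup_base h a)" using assms by (simp add: setup_base_def)
  show "wf_prog K 3 {} (setup_clear h a)" using assms by (auto simp: setup_clear_def wf_clears)
  have un: "k \<notin> assigned (nest h d)" if "k ~= 2" "h + d \<le> k" for k d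
    using that by (induction d) auto
  show "wf_prog K 3 {6} (nest h d) | a < d"
  proof (induction d)
    case (Suc d)
    then show ?case using assms un[of "h + d" d] by auto
  qed (use assms in auto)
qed

section \<open>Guessed words and rounds of queries\<close>

definition exs :: "cmd => tapes => stream => nat => tapes => stream => bool" where
  "exs c s gs T s' gs' = (\<exists>t\<le>T. ex c (s, gs) t (s', gs'))"

lemma exs_exb: "exb c s T s' ==> exs c s gs T s' gs" by (auto simp: exs_def exb_def)

lemma exs_Seq: "exs c s gs T s' gs' ==> exs d s' gs' T' s'' gs'' ==> T + T' + 1 \<le> T'' ==> exs (Seq c d) s gs T'' s'' gs''"
  unfolding exs_def
  by (elim exE conjE) (rule_tac x = "t + Suc ta" in exI, auto intro: ex_Seq simp del: add_Suc_right)

definition drop_stream :: "nat => stream => stream" where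
  "drop_stream n gs = (\<lambda>i. gs (n + i))"

lemma fill_loop:
  assumes "s 2 = list_tape xs (int i)" "i \<le> length xs" "0 \<notin> set xs" "s 7 = list_tape ys (int (length ys))"
  shows "exs (Loop 2 nz (Seq (Act 2 (\<lambda>a. (a, Right))) (Guess 7))) s gs (5 * (length xs - i) + 1)
    (s(2 := list_tape xs (int (length xs)),
       7 := list_tape (ys @ bits (map gs [0..<length xs - i])) (int (length ys + (length xs - i)))))
    (drop_stream (length xs - i) gs)" using assms
proof (induction "length xs - i" arbitrary: i s gs ys)
  case 0
  then have "exb (Loop 2 nz (Seq (Act 2 (\<lambda>a. (a, Right))) (Guess 7))) s 1 s"
    by (intro exb_Loop_False) (simp add: scan_list_tape)
  moreover have "s(2 := list_tape xs (int (length xs)), 7 := list_tape (ys @ bits (map gs [0..<length xs - i]))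
      (int (length ys + (length xs - i)))) = s" using 0 by (auto simp: fun_eq_iff bits_def)
  moreover have "length xs - i = 0" "drop_stream 0 gs = gs" using 0 by (simp_all add: drop_stream_def)
  ultimately show ?case by (simp only: exs_exb mult_0_right add_0)
next
  case (Suc n)
  let ?L = "Loop 2 nz (Seq (Act 2 (\<lambda>a. (a, Right))) (Guess 7))"
  let ?s1 = "s(2 := list_tape xs (int (Suc i)))"
  let ?ys = "ys @ [bit_symbol (gs 0)]"
  let ?s = "?s1(7 := list_tape ?ys (int (length ?ys)))"
  have i: "i < length xs" "length xs - i = Suc (length xs - Suc i)" using Suc(2) by simp_all
  have IH: "exs ?L ?s (shift gs) (5 * (length xs - Suc i) + 1)
    (?s(2 := list_tape xs (int (length xs)),
       7 := list_tape (?ys @ bits (map (shift gs) [0..<length xs - Suc i])) (int (length ?ys + (length xs - Suc i)))))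
    (drop_stream (length xs - Suc i) (shift gs))" by (rule Suc.hyps(1)) (use Suc(2-) in auto)
  have e: "?ys @ bits (map (shift gs) [0..<length xs - Suc i]) = ys @ bits (map gs [0..<length xs - i])"
    unfolding i(2) map_upt_Suc by (simp add: bits_def shift_def)
  have e2: "int (length ?ys + (length xs - Suc i)) = int (length ys + (length xs - i))" using i by simp
  have e3: "drop_stream (length xs - Suc i) (shift gs) = drop_stream (length xs - i) gs"
    using i(2) by (simp add: drop_stream_def shift_def)
  have fin: "?s(2 := list_tape xs (int (length xs)), 7 := X)
      = s(2 := list_tape xs (int (length xs)), 7 := X)" for X by (simp add: fun_eq_iff)
  have 1: "exs (Act 2 (\<lambda>a. (a, Right))) s gs 1 ?s1 gs"
    by (rule exs_exb, rule exb_Act) (simp add: Suc.prems(1) act_move add.commute)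
  have "act (?s1 7) (bit_symbol (gs 0), Right) = list_tape ?ys (int (length ?ys))"
    using Suc.prems(4) by (simp add: act_snoc add.commute)
  then have 2: "exs (Guess 7) ?s1 gs 1 ?s (shift gs)"
    using ex_Guess[of 7 ?s1 gs] unfolding exs_def by auto
  have "exs (Seq (Seq (Act 2 (\<lambda>a. (a, Right))) (Guess 7)) ?L) s gs (5 * (length xs - i))
    (s(2 := list_tape xs (int (length xs)),
       7 := list_tape (ys @ bits (map gs [0..<length xs - i])) (int (length ys + (length xs - i)))))
    (drop_stream (length xs - i) gs)"
    by (rule exs_Seq[OF exs_Seq[OF 1 2 order.refl] IH[unfolded e e2 e3 fin]]) (use i in simp)
  moreover have "scan (fst (s, gs) 2) ~= 0" using Suc.prems i by (simp add: scan_list_tape nth_pos)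
  ultimately show ?case unfolding exs_def using ex_Loop_True[of "\<lambda>a. a ~= 0" "(s, gs)" 2]
    by (metis Suc_eq_plus1 Suc_le_mono)
qed

lemma fill:
  assumes "rep r s" "nonzero r" "r 7 = []"
  shows "\<exists>s'. rep (r(7 := bits (map gs [0..<length (r 2)]))) s' &
    exs fill s gs (11 * length (r 2) + 15) s' (drop_stream (length (r 2)) gs)"
proof -
  let ?n = "length (r 2)" and ?b = "bits (map gs [0..<length (r 2)])"
  let ?s1 = "s(2 := list_tape (r 2) (int ?n), 7 := list_tape ?b (int ?n))"
  let ?s2 = "s(7 := list_tape ?b (int ?n))" and ?s3 = "s(7 := list_tape ?b 0)"
  have s2: "s 2 = list_tape (r 2) 0" "s 7 = list_tape [] 0" "0 \<notin> set (r 2)"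
    using assms by (auto simp: rep_def nonzero_def)
  have 1: "exs (Loop 2 nz (Seq (Act 2 (\<lambda>a. (a, Right))) (Guess 7))) s gs (5 * ?n + 1) ?s1
    (drop_stream ?n gs)" using fill_loop[of s "r 2" 0 "[]" gs] s2 by simp
  have e: "?s1(2 := list_tape (r 2) 0) = ?s2" using s2 by (auto simp: fun_eq_iff)
  have "exb (rewind 2) ?s1 (3 * ?n + 5) (?s1(2 := list_tape (r 2) 0))"
    by (rule rewind) (use s2 in auto)
  then have 2: "exb (rewind 2) ?s1 (3 * ?n + 5) ?s2" unfolding e .
  have "exb (rewind 7) ?s2 (3 * ?n + 5) (?s2(7 := list_tape ?b 0))" by (rule rewind) auto
  then have 3: "exb (rewind 7) ?s2 (3 * ?n + 5) ?s3" unfolding fun_upd_upd .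
  have "exs fill s gs (11 * ?n + 15) ?s3 (drop_stream ?n gs)" unfolding fill_def
    by (rule exs_Seq[OF 1 exs_Seq[OF exs_exb[OF 2] exs_exb[OF 3] order.refl]]) simp
  moreover have "rep (r(7 := ?b)) ?s3" using assms(1) by (rule rep_upd) simp
  ultimately show ?thesis by blast
qed

definition round :: "word set => prog => regs => regs" where
  "round B p r = (sem p r)(5 := [if word_of (sem p r 1) \<in> B then 2 else 1])"

text \<open>A round that leaves register 4 empty ends in an oracle call, so \<open>J\<close> is the
  number of queries and \<open>v\<close> the verdict of the round after the last one.\<close>

definition halts :: "word set => prog => regs => nat => nat => bool" where
  "halts B p r J v = ((\<forall>i<J. sem p ((round B p ^^ i) r) 4 = []) & sem p ((round B p ^^ J) r) 4 = [v])"

lemma halts_0: "halts B p r 0 v = (sem p r 4 = [v])" by (simp add: halts_def)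

lemma halts_Suc: "halts B p r (Suc J) v = (sem p r 4 = [] & halts B p (round B p r) J v)"
  by (auto simp: halts_def funpow_Suc_right less_Suc_eq_0_disj simp del: funpow.simps)

definition answer_cmd :: "nat => cmd" where
  "answer_cmd b = compile (Clear 5 ;; App 5 b)"

text \<open>A computation with \<open>J\<close> queries of \<open>o\<close> operations each on registers of length at most \<open>l\<close>.\<close>

definition rounds_time :: "nat => nat => nat => nat" where
  "rounds_time J o' l = (J + 1) * ((o' + 4) * (30 * (l + (J + 2) * (o' + 4) + 1)) + 20)"

context driver
begin

lemma cpath_path: "cpath n x y ==> path B n 0 (Run (fst x), snd x) (Run (fst y), snd y)"
proof (induction rule: cpath.induct)
  case (cpath_Suc c s gs c' a n y)
  have "mv B (Run c, s, gs) (Run c', apply_acts s a, if ctl_guessing (Run c) then shift gs else gs)"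
    by (rule mv_delta) (use cpath_Suc in simp)
  with path_Suc[of B "(Run c, s, gs)" _ n 0] cpath_Suc.IH show ?case by simp
qed (rule path_0)

lemma exs_path: "exs c s gs T s' gs' ==> \<exists>n\<le>T. path B n 0 (Run c, s, gs) (Run Nop, s', gs')"
  unfolding exs_def using cpath_path[OF ex_cpath] by fastforce

lemma exs_path_Seq:
  assumes "exs c s gs T s' gs'"
  shows "\<exists>n\<le>Suc T. path B n 0 (Run (Seq c d), s, gs) (Run d, s', gs')"
proof -
  obtain t where t: "t \<le> T" "ex c (s, gs) t (s', gs')" using assms by (auto simp: exs_def)
  have "cpath 1 (Seq Nop d, s', gs') (d, s', gs')"
    unfolding One_nat_def by (rule cpath_idle[OF _ _ cpath_0]) auto
  from cpath_path[OF cpath_trans[OF cpath_Seq[OF ex_cpath[OF t(2)]] this]] t(1)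
  show ?thesis by (intro exI[of _ "t + 1"]) simp
qed

lemma verdict_step:
  assumes "rep r s"
  shows "mv B (Run Nop, s, gs) (case r 4 of [] => Ask | v # _ => if v = 0 then Ask else if v = 2 then Accept else Reject, s, gs)"
proof -
  have "scan (s 4) = (case r 4 of [] => 0 | v # _ => v)"
    using assms by (auto simp: rep_def scan_list_tape split: list.splits)
  then show ?thesis
    using mv_delta[of "Run Nop" s gs "if scan (s 4) = 0 then Ask else if scan (s 4) = 2 then Accept else Reject"
        "idle (scans s)" B] by (auto split: list.splits)
qed

lemma rounds:
  assumes "body = compile p" "yes = answer_cmd 2" "no = answer_cmd 1" "wf_prog K 3 {2} p" "6 \<le> K"
    and "rep r s" "nonzero r" "\<forall>k. length (r k) \<le> l" "halts B p r J v" "v = 1 | v = 2"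
    and "o' = ops p (length (r 2))"
  shows "\<exists>n\<le>rounds_time J o' l. \<exists>s'. rep (sem p ((round B p ^^ J) r)) s' &
    path B n J (Run body, s, gs) (if v = 2 then Accept else Reject, s', gs)" using assms(6-)
proof (induction J arbitrary: r s l)
  case 0
  have L: "\<forall>k. length (r k) + ops p (length (r 2)) \<le> l + o'" using 0 by auto
  obtain s' where s': "rep (sem p r) s'" "exb (compile p) s (ops p (length (r 2)) * (30 * (l + o' + 1))) s'"
    using compile_correct[OF assms(4) 0(1,2) _ L] by auto
  from exs_path[OF exs_exb[OF s'(2)]] obtain n where
    n: "n \<le> o' * (30 * (l + o' + 1))" "path B n 0 (Run body, s, gs) (Run Nop, s', gs)"
    using assms(1) 0 by blast
  have "sem p r 4 = [v]" using 0 by (simp add: halts_0)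
  then have "mv B (Run Nop, s', gs) (if v = 2 then Accept else Reject, s', gs)"
    using verdict_step[OF s'(1), of B gs] \<open>v = 1 | v = 2\<close> by auto
  from path_trans[OF n(2) path_Suc[OF this path_0]]
  have "path B (n + 1) 0 (Run body, s, gs) (if v = 2 then Accept else Reject, s', gs)" by simp
  moreover have "o' * (30 * (l + o' + 1)) \<le> (o' + 4) * (30 * (l + (0 + 2) * (o' + 4) + 1))"
    by (intro mult_mono) auto
  then have "n + 1 \<le> rounds_time 0 o' l" using n(1) unfolding rounds_time_def by simp
  ultimately show ?case using s'(1) by (intro exI[of _ "n + 1"] conjI exI[of _ s']) simp_all
next
  case (Suc J)
  have L: "\<forall>k. length (r k) + ops p (length (r 2)) \<le> l + o'" using Suc.prems by auto
  obtain s1 where s1: "rep (sem p r) s1" "exb (compile p) s (ops p (length (r 2)) * (30 * (l + o' + 1))) s1"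
    using compile_correct[OF assms(4) Suc.prems(1,2) _ L] by auto
  from exs_path[OF exs_exb[OF s1(2)]] obtain n1 where
    n1: "n1 \<le> o' * (30 * (l + o' + 1))" "path B n1 0 (Run body, s, gs) (Run Nop, s1, gs)"
    using assms(1) Suc.prems by blast
  have h: "sem p r 4 = []" "halts B p (round B p r) J v" using Suc.prems by (simp_all add: halts_Suc)
  define b where "b = (if word_of (sem p r 1) \<in> B then 2 else 1 :: nat)"
  have ask: "mv B (Run Nop, s1, gs) (Ask, s1, gs)"
    using verdict_step[OF s1(1), of B gs] h(1) by simp
  have "holds_word (s1 1) (word_of (sem p r 1))"
    using s1(1) holds_word_list_tape by (simp add: rep_def)
  then have "mv B (Ask, s1, gs) (Run (Seq (answer_cmd b) body), s1, gs)"
    using mv_ask[of s1 "word_of (sem p r 1)" B gs] assms(2,3) by (auto simp: b_def split: if_splits)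
  note q = path_Suc[OF ask path_Suc[OF this path_0]]
  have wfa: "wf_prog K 3 {} (Clear 5 ;; App 5 b)" using assms(5) by (auto simp: b_def)
  have len: "length (sem p r k) \<le> l + o'" for k
    using sem_length[OF assms(4), of r "length (r 2)" l k] Suc.prems by auto
  have nz: "nonzero (sem p r)" using sem_nonzero[OF assms(4)] Suc.prems by simp
  have L2: "\<forall>k. length (sem p r k) + ops (Clear 5 ;; App 5 b) 0 \<le> l + o' + 3" using len by auto
  have "2 \<notin> assigned p" using wf_prog_assigned[OF assms(4)] by auto
  then have r2: "sem p r 2 = r 2" by (rule sem_unassigned)
  obtain s2 where s2: "rep (sem (Clear 5 ;; App 5 b) (sem p r)) s2"
    "exb (answer_cmd b) s1 (3 * (30 * (l + o' + 3 + 1))) s2"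
    using compile_correct[OF wfa s1(1) nz _ L2] by (auto simp: answer_cmd_def numeral_3_eq_3)
  have rr: "sem (Clear 5 ;; App 5 b) (sem p r) = round B p r"
    by (auto simp: round_def b_def fun_eq_iff)
  from exs_path_Seq[OF exs_exb[OF s2(2)]] obtain n2 where
    n2: "n2 \<le> Suc (3 * (30 * (l + o' + 3 + 1)))" "path B n2 0 (Run (Seq (answer_cmd b) body), s1, gs) (Run body, s2, gs)"
    by blast
  have nz': "nonzero (round B p r)" unfolding round_def using nz by (rule nonzero_upd) auto
  \<comment> \<open>The summand 1 covers the answer in register 5, which is written after the
    operations counted by \<open>o'\<close>.\<close>
  have "\<forall>k. length (round B p r k) \<le> l + o' + 1" using len by (auto simp: round_def le_SucI)
  moreover have "o' = ops p (length (round B p r 2))" using Suc.prems r2 by (simp add: round_def)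
  ultimately obtain n3 s' where n3: "n3 \<le> rounds_time J o' (l + o' + 1)"
    "rep (sem p ((round B p ^^ J) (round B p r))) s'"
    "path B n3 J (Run body, s2, gs) (if v = 2 then Accept else Reject, s', gs)"
    using Suc.IH[OF s2(1)[unfolded rr] nz' _ h(2) Suc.prems(5)] by blast
  have "path B (n1 + 2 + n2 + n3) (Suc J) (Run body, s, gs) (if v = 2 then Accept else Reject, s', gs)"
    using path_trans[OF path_trans[OF path_trans[OF n1(2) q] n2(2)] n3(3)] by simp
  moreover have "n1 + 2 + n2 + n3 \<le> rounds_time (Suc J) o' l"
  proof -
    let ?X = "30 * (l + (J + 3) * (o' + 4) + 1)"
    have "rounds_time J o' (l + o' + 1) \<le> (J + 1) * ((o' + 4) * ?X + 20)"
    proof -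
      have "30 * ((l + o' + 1) + (J + 2) * (o' + 4) + 1) \<le> ?X" by (simp add: algebra_simps)
      then show ?thesis unfolding rounds_time_def
        by - (rule mult_le_mono2, rule add_le_mono1, rule mult_le_mono2, assumption)
    qed
    moreover have "n1 \<le> o' * ?X"
    proof -
      have "o' \<le> (J + 3) * (o' + 4)" by (simp add: algebra_simps)
      then have "30 * (l + o' + 1) \<le> ?X" by simp
      then show ?thesis using n1(1) by (meson le_trans mult_le_mono2)
    qed
    moreover have "n2 \<le> 1 + 3 * ?X" using n2(1) by (rule le_trans) (auto simp: algebra_simps)
    ultimately have "n1 + 2 + n2 + n3 \<le> o' * ?X + 3 * ?X + 3 + (J + 1) * ((o' + 4) * ?X + 20)"
      using n3(1) by linarith
    also have "o' * X + 3 * X + 3 + (J + 1) * ((o' + 4) * X + 20) \<le> (J + 2) * ((o' + 4) * X + 20)" for X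
      by (simp add: algebra_simps)
    finally have "n1 + 2 + n2 + n3 \<le> (J + 2) * ((o' + 4) * ?X + 20)" .
    moreover have "Suc J + 1 = J + 2" "Suc J + 2 = J + 3" by simp_all
    ultimately show ?thesis unfolding rounds_time_def by (simp only:)
  qed
  moreover have "rep (sem p ((round B p ^^ Suc J) r)) s'"
    using n3(2) unfolding funpow_Suc_right comp_apply .
  ultimately show ?case by (intro exI[of _ "n1 + 2 + n2 + n3"] conjI exI[of _ s'])
qed

end

lemma rounds_time_mono: "J \<le> J' ==> rounds_time J o' l \<le> rounds_time J' o' l"
  unfolding rounds_time_def by (intro mult_le_mono add_le_mono) auto

lemma wf_prog_mono: "wf_prog K S Bs p ==> K \<le> K' ==> wf_prog K' S Bs p" by (induction p) auto

definition pre_cmd :: "nat => nat => bool => cmd" where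
  "pre_cmd h a g = Seq (compile (setup_base h a)) (Seq (compile (nest h a))
     (Seq (compile (setup_clear h a)) (if g then fill else Nop)))"

definition setup_time :: "nat => nat => nat => nat" where
  "setup_time h a n = (ops (setup_base h a) n + ops (nest h a) (n + a) + ops (setup_clear h a) 0) *
     (30 * (n + (ops (setup_base h a) n + ops (nest h a) (n + a) + ops (setup_clear h a) 0) + 1))
     + 11 * (n + a) ^ a + 30"

lemma list_tape_bits: "list_tape (bits w) 0 = input_tape w"
  by (auto simp: list_tape_def bits_def input_tape_def fun_eq_iff)

lemma base_regs_nonzero: "nonzero (base_regs a w Y)" by (auto simp: nonzero_def base_regs_def)

lemma setup_correct:
  assumes "8 \<le> h"
  shows "\<exists>s gs'. rep (base_regs a w (if g then map gs [0..<bound a w] else [])) s &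
    exs (pre_cmd h a g) (init_tapes w) gs (setup_time h a (length w)) s gs'"
proof -
  let ?p1 = "setup_base h a" and ?p2 = "nest h a" and ?p3 = "setup_clear h a" and ?r0 = "init_regs w"
  let ?n = "length w"
  define o1 o2 o3 where "o1 = ops ?p1 ?n" "o2 = ops ?p2 (?n + a)" "o3 = ops ?p3 0"
  let ?L = "?n + (o1 + o2 + o3)"
  define r1 r2 where "r1 = sem ?p1 ?r0" "r2 = sem ?p2 r1"
  have wf: "wf_prog (h + a + 2) 3 {0} ?p1" "wf_prog (h + a + 2) 3 {6} ?p2" "wf_prog (h + a + 2) 3 {} ?p3"
    using wf_setup[OF assms, of a "h + a + 2"] by auto
  have rep0: "rep ?r0 (init_tapes w)"
    by (auto simp: rep_def init_tapes_def init_regs_def list_tape_bits list_tape_Nil intro: exI[of _ "[]"])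
  have nz0: "nonzero ?r0" by (auto simp: nonzero_def init_regs_def)
  have l0: "\<forall>k. length (?r0 k) \<le> ?n" by (simp add: init_regs_def)
  have nz1: "nonzero r1" unfolding r1_r2_def using sem_nonzero[OF wf(1) nz0] .
  have nz2: "nonzero r2" unfolding r1_r2_def(2) using sem_nonzero[OF wf(2) nz1] .
  have l1: "\<forall>k. length (r1 k) \<le> ?n + o1"
    unfolding r1_r2_def o1_o2_o3_def using sem_length[OF wf(1), of ?r0 ?n ?n] l0 by simp
  have six: "length (r1 6) = ?n + a"
  proof -
    have f: "fold (\<lambda>i r. sem (App 6 1) (r(h := ones i))) is r 6 = r 6 @ concat (replicate (length is) [1])" for "is" r
      by (rule fold_App) (use assms in auto)
    show ?thesis
      using assms f[of "[0..<length (init_regs w 0)]" "init_regs w"] concat_replicate_ones[of ?n 1]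
      by (simp add: r1_r2_def setup_base_def sem_repeat_App init_regs_def)
  qed
  have l2: "\<forall>k. length (r2 k) \<le> ?n + o1 + o2"
    unfolding r1_r2_def(2) o1_o2_o3_def(2) using sem_length[OF wf(2), of r1 "?n + a" "?n + o1"] l1 six by simp
  obtain s1 where s1: "rep r1 s1" "exb (compile ?p1) (init_tapes w) (o1 * (30 * (?L + 1))) s1"
    using compile_correct[OF wf(1) rep0 nz0, of ?n ?L] l0 unfolding r1_r2_def o1_o2_o3_def
    by (auto simp: add.assoc[symmetric] intro!: add_le_mono trans_le_add1)
  obtain s2 where s2: "rep r2 s2" "exb (compile ?p2) s1 (o2 * (30 * (?L + 1))) s2"
  proof -
    have "\<forall>k. length (r1 k) + o2 \<le> ?L"
    proof
      show "length (r1 k) + o2 \<le> ?L" for k using l1[rule_format, of k] by linarith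
    qed
    then show ?thesis
      using compile_correct[OF wf(2) s1(1) nz1, of "?n + a" ?L] six that unfolding r1_r2_def(2) o1_o2_o3_def(2)
      by auto
  qed
  obtain s3 where s3: "rep (base_regs a w []) s3" "exb (compile ?p3) s2 (o3 * (30 * (?L + 1))) s3"
  proof -
    have "\<forall>k. length (r2 k) + o3 \<le> ?L"
    proof
      show "length (r2 k) + o3 \<le> ?L" for k using l2[rule_format, of k] by linarith
    qed
    moreover have "sem ?p3 r2 = base_regs a w []" unfolding r1_r2_def by (rule sem_setup[OF assms])
    ultimately show ?thesis
      using compile_correct[OF wf(3) s2(1) nz2, of 0 ?L] that unfolding o1_o2_o3_def(3) by auto
  qed
  have tot: "o1 * (30 * (?L + 1)) + o2 * (30 * (?L + 1)) + o3 * (30 * (?L + 1)) + 11 * bound a w + 30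
      = setup_time h a ?n"
    unfolding setup_time_def o1_o2_o3_def bound_def by (simp add: algebra_simps)
  have X: "exs (Seq (compile ?p1) (Seq (compile ?p2) (Seq (compile ?p3) c))) (init_tapes w) gs
      (setup_time h a ?n) s4 gs'" if "exs c s3 gs (11 * bound a w + 15) s4 gs'" for c s4 gs'
    by (rule exs_Seq[OF exs_exb[OF s1(2)] exs_Seq[OF exs_exb[OF s2(2)]
        exs_Seq[OF exs_exb[OF s3(2)] that order.refl] order.refl]]) (use tot in linarith)
  show ?thesis
  proof (cases g)
    case True
    have len: "length (base_regs a w [] 2) = bound a w" "base_regs a w [] 7 = []"
      by (simp_all add: base_regs_def bits_def)
    have "(base_regs a w [])(7 := bits (map gs [0..<bound a w])) = base_regs a w (map gs [0..<bound a w])"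
      by (auto simp: base_regs_def fun_eq_iff)
    with fill[OF s3(1) base_regs_nonzero len(2), of gs] len obtain s4 where
      s4: "rep (base_regs a w (map gs [0..<bound a w])) s4"
        "exs fill s3 gs (11 * bound a w + 15) s4 (drop_stream (bound a w) gs)" by auto
    have "exs (pre_cmd h a g) (init_tapes w) gs (setup_time h a ?n) s4 (drop_stream (bound a w) gs)"
      unfolding pre_cmd_def if_P[OF True] by (rule X[OF s4(2)])
    then show ?thesis using s4(1) True by auto
  next
    case False
    have "exs (pre_cmd h a g) (init_tapes w) gs (setup_time h a ?n) s3 gs"
      unfolding pre_cmd_def if_not_P[OF False]
      by (rule X, rule exs_exb, rule exb_mono[OF exb_Nop zero_le])
    then show ?thesis using s3(1) False by auto
  qed
qed

text \<open>Tapes below \<open>h\<close> belong to the program \<open>p\<close>, those from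
  \<open>h\<close> on are the counters of the setup. The flag \<open>g\<close> decides whether
  register 7 is filled with guessed bits.\<close>

definition machine_of :: "nat => nat => bool => prog => otm" where
  "machine_of h a g p = driver.machine (h + a + 2) 3 (pre_cmd h a g) (compile p) (answer_cmd 2) (answer_cmd 1)"

definition total_time :: "nat => nat => prog => (nat => nat) => nat => nat" where
  "total_time h a p jb n = setup_time h a n + 1 +
     rounds_time (jb n) (ops p ((n + a) ^ a)) ((n + a) ^ a + n)"

lemma polyb_total_time: "polyb jb ==> polyb (total_time h a p jb)"
  unfolding total_time_def setup_time_def rounds_time_def by (intro polyb_intros)

lemma driver_pre:
  assumes "8 \<le> h" "wf_prog h 3 {2} p"
  shows "driver (h + a + 2) 3 (pre_cmd h a g) (compile p) (answer_cmd 2) (answer_cmd 1)"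
proof
  have "wf_prog (h + a + 2) 3 {0} (setup_base h a)" "wf_prog (h + a + 2) 3 {6} (nest h a)"
    "wf_prog (h + a + 2) 3 {} (setup_clear h a)" "wf_prog (h + a + 2) 3 {2} p"
    using wf_setup[OF assms(1), of a "h + a + 2"] wf_prog_mono[OF assms(2)] by auto
  moreover have "wf_cmd (h + a + 2) 3 fill" using assms by (auto simp: fill_def rewind_def)
  ultimately show "wf_cmd (h + a + 2) 3 (pre_cmd h a g)" "wf_cmd (h + a + 2) 3 (compile p)"
    unfolding pre_cmd_def using assms(1) by (auto intro: wf_compile)
  have "wf_prog (h + a + 2) 3 {} (Clear 5 ;; App 5 2)" "wf_prog (h + a + 2) 3 {} (Clear 5 ;; App 5 1)"
    using assms(1) by auto
  then show "wf_cmd (h + a + 2) 3 (answer_cmd 2)" "wf_cmd (h + a + 2) 3 (answer_cmd 1)"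
    unfolding answer_cmd_def using assms(1) by (auto intro!: wf_compile simp del: wf_prog.simps compile.simps)
  show "guess_free (answer_cmd 2)" "guess_free (answer_cmd 1)"
    unfolding answer_cmd_def by (rule guess_free_compile)+
qed (use assms guess_free_compile in auto)

lemma machine_path:
  assumes "8 \<le> h" "wf_prog h 3 {2} p"
    and "halts B p (base_regs a w Y) J v" "v = 1 | v = 2" "J \<le> jb (length w)"
    and "Y = (if g then map gs [0..<bound a w] else [])"
  shows "\<exists>n s gs'. n \<le> total_time h a p jb (length w) & rep (sem p ((round B p ^^ J) (base_regs a w Y))) s &
    driver.path (compile p) (answer_cmd 2) (answer_cmd 1) B n J
      (Run (Seq (pre_cmd h a g) (compile p)), init_tapes w, gs) (if v = 2 then Accept else Reject, s, gs')"
proof -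
  interpret driver "h + a + 2" 3 "pre_cmd h a g" "compile p" "answer_cmd 2" "answer_cmd 1"
    by (rule driver_pre[OF assms(1,2)])
  obtain s gs' where s: "rep (base_regs a w Y) s"
    "exs (pre_cmd h a g) (init_tapes w) gs (setup_time h a (length w)) s gs'"
    using setup_correct[OF assms(1), of a w g gs] assms(6) by auto
  from exs_path_Seq[OF s(2)] obtain n where n: "n \<le> Suc (setup_time h a (length w))"
    "path B n 0 (Run (Seq (pre_cmd h a g) (compile p)), init_tapes w, gs) (Run (compile p), s, gs')"
    by blast
  let ?o = "ops p (bound a w)" and ?l = "bound a w + length w"
  have wf': "wf_prog (h + a + 2) 3 {2} p" using assms(2) by (rule wf_prog_mono) simp
  have "\<forall>k. length (base_regs a w Y k) \<le> ?l" using assms(6) by (auto simp: base_regs_def)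
  moreover have "?o = ops p (length (base_regs a w Y 2))" by (simp add: base_regs_def)
  moreover have "6 \<le> h + a + 2" using assms(1) by simp
  ultimately obtain n' s' where n': "n' \<le> rounds_time J ?o ?l"
    "rep (sem p ((round B p ^^ J) (base_regs a w Y))) s'"
    "path B n' J (Run (compile p), s, gs') (if v = 2 then Accept else Reject, s', gs')"
    using rounds[OF refl refl refl wf' _ s(1) base_regs_nonzero _ assms(3,4)] by blast
  have "n + n' \<le> total_time h a p jb (length w)"
    using n(1) n'(1) rounds_time_mono[OF assms(5), of ?o ?l]
    unfolding total_time_def bound_def by linarith
  moreover have "path B (n + n') J (start w gs) (if v = 2 then Accept else Reject, s', gs')"
    using path_trans[OF n(2) n'(3)] by simp
  ultimately show ?thesis using n'(2) by blast
qed

text \<open>The hypothesis on \<open>halts\<close> covers every \<open>Y\<close> of the right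
  length, good guess or not, because polynomial time and the number of queries are requirements on
  all runs and not only on accepting ones.\<close>

theorem machine_of_correct:
  assumes "8 \<le> h" "wf_prog h 3 {2} p" "polyb jb"
    and H: "\<forall>w Y. length Y = (if g then bound a w else 0) -->
      (\<exists>J\<le>jb (length w). halts B p (base_regs a w Y) J (if A w Y then 2 else 1))"
  shows "wf_otm (machine_of h a g p)" "poly_time (machine_of h a g p) B"
    "~ g ==> deterministic (machine_of h a g p)"
    "accepts (machine_of h a g p) B w = (\<exists>Y. length Y = (if g then bound a w else 0) & A w Y)"
    "run (machine_of h a g p) B (init_config (machine_of h a g p) w) n k c ==> k \<le> jb (length w)"
proof -
  interpret driver "h + a + 2" 3 "pre_cmd h a g" "compile p" "answer_cmd 2" "answer_cmd 1"
    by (rule driver_pre[OF assms(1,2)])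
  let ?Y = "\<lambda>w gs. if g then map gs [0..<bound a w] else []"
  have p: "\<exists>n J y. n \<le> total_time h a p jb (length w) & J \<le> jb (length w) &
      path B n J (start w gs) y & fst y = (if A w (?Y w gs) then Accept else Reject)" for w gs
  proof -
    have len: "length (?Y w gs) = (if g then bound a w else 0)" by simp
    obtain J where J: "J \<le> jb (length w)" "halts B p (base_regs a w (?Y w gs)) J (if A w (?Y w gs) then 2 else 1)"
      using H len by blast
    define v where "v = (if A w (?Y w gs) then 2 else 1 :: nat)"
    have h: "halts B p (base_regs a w (?Y w gs)) J v" using J(2) by (simp add: v_def)
    have v: "v = 1 | v = 2" by (simp add: v_def)
    have "v = 2 \<longleftrightarrow> A w (?Y w gs)" by (simp add: v_def)
    moreover obtain n s gs' where "n \<le> total_time h a p jb (length w)"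
      "path B n J (start w gs) (if v = 2 then Accept else Reject, s, gs')"
      using machine_path[where jb = jb, OF assms(1,2) h v J(1) refl] by blast
    ultimately show ?thesis using J(1)
      by (intro exI[of _ n] exI[of _ J] exI[of _ "(if v = 2 then Accept else Reject, s, gs')"]) simp
  qed
  have b: "n \<le> total_time h a p jb (length w) & k \<le> jb (length w)" if "run machine B (init_config machine w) n k c"
    for w n k c
  proof (rule runs_bounded[OF _ that])
    fix gs
    obtain n J y where "n \<le> total_time h a p jb (length w)" "J \<le> jb (length w)" "path B n J (start w gs) y"
      and y: "fst y = (if A w (?Y w gs) then Accept else Reject)" using p[of w gs] by blast
    moreover have "fst y \<in> {Accept, Reject}" using y by simp
    ultimately show "\<exists>n k y. path B n k (start w gs) y & fst y \<in> {Accept, Reject} &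
        n \<le> total_time h a p jb (length w) & k \<le> jb (length w)" by blast
  qed
  show "wf_otm (machine_of h a g p)" unfolding machine_of_def by (rule wf_machine)
  show "poly_time (machine_of h a g p) B"
  proof -
    obtain q :: "nat poly" where q: "\<And>n. total_time h a p jb n \<le> poly q n"
      using polyb_total_time[OF assms(3), of h a p] unfolding polyb_def by blast
    have "n \<le> poly q (length w)" if "run machine B (init_config machine w) n k c" for w n k c
      using b[OF that] q[of "length w"] by simp
    then show ?thesis unfolding machine_of_def poly_time_def by blast
  qed
  show "deterministic (machine_of h a g p)" if "~ g" unfolding machine_of_def using that
    by (intro machine_deterministic) (simp add: pre_cmd_def guess_free_compile)
  show "run (machine_of h a g p) B (init_config (machine_of h a g p) w) n k c ==> k \<le> jb (length w)"
    unfolding machine_of_def using b by blast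
  have "accepts machine B w = (\<exists>gs. A w (?Y w gs))"
  proof (rule accepts_iff)
    fix gs
    show "\<exists>n k y. path B n k (start w gs) y & fst y = (if A w (?Y w gs) then Accept else Reject)"
      using p[of w gs] by blast
  qed
  also have "\<dots> = (\<exists>Y. length Y = (if g then bound a w else 0) & A w Y)"
  proof (cases g)
    case True
    have *: "map (\<lambda>i. Y ! i) [0..<bound a w] = Y" if "length Y = bound a w" for Y :: word
      using map_nth[of Y] that by simp
    show ?thesis
    proof (intro iffI; elim exE)
      show "\<exists>Y. length Y = (if g then bound a w else 0) & A w Y" if "A w (?Y w gs)" for gs
        using that True by (intro exI[of _ "?Y w gs"]) simp
      show "\<exists>gs. A w (?Y w gs)" if "length Y = (if g then bound a w else 0) & A w Y" for Y
        using that True * by (intro exI[of _ "\<lambda>i. Y ! i"]) simp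
    qed
  qed simp
  finally show "accepts (machine_of h a g p) B w = (\<exists>Y. length Y = (if g then bound a w else 0) & A w Y)"
    unfolding machine_of_def .
qed

theorem NP_oracleI:
  assumes "8 \<le> h" "wf_prog h 3 {2} p" "polyb jb"
    and "\<And>w Y. length Y = bound a w ==>
      \<exists>J\<le>jb (length w). halts B p (base_regs a w Y) J (if A w Y then 2 else 1)"
  shows "{w. \<exists>Y. length Y = bound a w & A w Y} \<in> NP_oracle B"
proof -
  have H: "\<forall>w Y. length Y = (if True then bound a w else 0) -->
      (\<exists>J\<le>jb (length w). halts B p (base_regs a w Y) J (if A w Y then 2 else 1))"
    using assms(4) by simp
  note M = machine_of_correct[where g = True and A = A, OF assms(1-3) H]
  have "{w. \<exists>Y. length Y = bound a w & A w Y} = {w. accepts (machine_of h a True p) B w}"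
    unfolding M(4) by simp
  with M(1,2) show ?thesis unfolding NP_oracle_def by blast
qed

theorem log_query_classI:
  assumes "8 \<le> h" "wf_prog h 3 {2} p" "B \<in> C" "polyb jb" "(\<lambda>n. real (jb n)) \<in> O(\<lambda>n. ln (real n))"
    and "\<And>w. \<exists>J\<le>jb (length w). halts B p (base_regs a w []) J (if A w then 2 else 1)"
  shows "{w. A w} \<in> log_query_class C"
proof -
  have H: "\<forall>w Y. length Y = (if False then bound a w else 0) -->
      (\<exists>J\<le>jb (length w). halts B p (base_regs a w Y) J (if A w then 2 else 1))"
    using assms(6) by simp
  note M = machine_of_correct[where g = False and A = "\<lambda>w _. A w", OF assms(1,2,4) H]
  have "log_queries (machine_of h a False p) B" unfolding log_queries_def
    by (rule exI[of _ "\<lambda>n. real (jb n)"]) (use assms(5) M(5) in simp)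
  moreover have "deterministic (machine_of h a False p)" by (rule M(3)) simp
  moreover have "{w. A w} = {w. accepts (machine_of h a False p) B w}"
    unfolding M(4) by (auto intro: exI[of _ "[]"])
  ultimately show ?thesis unfolding log_query_class_def using assms(3) M(1,2) by blast
qed

theorem poly_time_computableI:
  assumes "8 \<le> h" "wf_prog h 3 {2} p"
    and "\<And>w. sem p (base_regs a w []) 4 = [2]" "\<And>w. word_of (sem p (base_regs a w []) 1) = f w"
  shows "poly_time_computable f"
proof -
  interpret driver "h + a + 2" 3 "pre_cmd h a False" "compile p" "answer_cmd 2" "answer_cmd 1"
    by (rule driver_pre[OF assms(1,2)])
  have h: "halts {} p (base_regs a w []) 0 2" for w using assms(3) by (simp add: halts_0)
  have "\<exists>n k c. run machine {} (init_config machine w) n k c & ~ (\<exists>c'. step machine {} c c') &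
      holds_word (snd c ! 1) (f w)" for w
  proof -
    obtain n s gs' where *: "rep (sem p (base_regs a w [])) s"
      "path {} n 0 (start w (\<lambda>_. False)) (Accept, s, gs')"
      using machine_path[OF assms(1,2) h, where jb = "\<lambda>_. 0" and g = False and gs = "\<lambda>_. False" and w = w]
      by auto
    have "holds_word (s 1) (f w)"
      using *(1) holds_word_list_tape[of "sem p (base_regs a w []) 1"] assms(4)[of w] by (simp add: rep_def)
    from computes[OF *(2) this] show ?thesis .
  qed
  moreover have "wf_otm machine" "deterministic machine" "poly_time machine {}"
    using machine_of_correct[of h p "\<lambda>_. 0" False a "{}" "\<lambda>_ _. True"] assms(1,2) h polyb_const[of 0]
    unfolding machine_of_def by auto
  ultimately show ?thesis unfolding poly_time_computable_def by blast
qed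

section \<open>First-order formulas\<close>

text \<open>Joint denial and nonexistence are primitive because an argument is accepted exactly if
  all its attackers are rejected: these two connectives are what an argument computes from its
  attackers. Sums and products address positions in encoded inputs, and \<open>FCnt\<close> measures
  distances of labellings.\<close>

datatype 'r fm = FEq nat nat | FLess nat nat | FSum nat nat nat | FProd nat nat nat
  | FIn nat nat | FRel 'r "nat list" | FNor "'r fm" "'r fm" | FNex nat "'r fm" | FCnt nat "'r fm" nat

text \<open>
  First-order formulas over \<open>{..<N}\<close> about an input \<open>xs\<close> and relations \<open>rho\<close>. \<open>FIn\<close> compares a symbol of
  the input (0 beyond its end), \<open>FNor\<close> and \<open>FNex\<close> are joint denial and nonexistence, and \<open>FCnt v phi y\<close>
  holds if at most \<open>y\<close> values of \<open>v\<close> satisfy \<open>phi\<close>.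
\<close>

primrec ev :: "nat => nat list => ('r => nat list => bool) => 'r fm => (nat => nat) => bool" where
  "ev N xs rho (FEq x y) e = (e x = e y)"
| "ev N xs rho (FLess x y) e = (e x < e y)"
| "ev N xs rho (FSum x y z) e = (e x + e y = e z)"
| "ev N xs rho (FProd x y z) e = (e x * e y = e z)"
| "ev N xs rho (FIn a v) e = (nth0 xs (e v) = a)"
| "ev N xs rho (FRel R vs) e = rho R (map e vs)"
| "ev N xs rho (FNor phi psi) e = (~ ev N xs rho phi e & ~ ev N xs rho psi e)"
| "ev N xs rho (FNex v phi) e = (~ (\<exists>i<N. ev N xs rho phi (e(v := i))))"
| "ev N xs rho (FCnt v phi y) e = (card {i. i < N & ev N xs rho phi (e(v := i))} \<le> e y)"

definition FNot where "FNot phi = FNor phi phi"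
definition FOr where "FOr phi psi = FNot (FNor phi psi)"
definition FAnd where "FAnd phi psi = FNor (FNot phi) (FNot psi)"
definition FImp where "FImp phi psi = FOr (FNot phi) psi"
definition FIff where "FIff phi psi = FAnd (FImp phi psi) (FImp psi phi)"
definition FEx where "FEx v phi = FNot (FNex v phi)"
definition FAll where "FAll v phi = FNex v (FNot phi)"

lemma ev_derived [simp]:
  "ev N xs rho (FNot phi) e = (~ ev N xs rho phi e)"
  "ev N xs rho (FOr phi psi) e = (ev N xs rho phi e | ev N xs rho psi e)"
  "ev N xs rho (FAnd phi psi) e = (ev N xs rho phi e & ev N xs rho psi e)"
  "ev N xs rho (FImp phi psi) e = (ev N xs rho phi e --> ev N xs rho psi e)"
  "ev N xs rho (FIff phi psi) e = (ev N xs rho phi e \<longleftrightarrow> ev N xs rho psi e)"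
  "ev N xs rho (FEx v phi) e = (\<exists>i<N. ev N xs rho phi (e(v := i)))"
  "ev N xs rho (FAll v phi) e = (\<forall>i<N. ev N xs rho phi (e(v := i)))"
  by (auto simp: FNot_def FOr_def FAnd_def FImp_def FIff_def FEx_def FAll_def)

text \<open>
  Registers of the evaluator, by family: \<open>8\<close> counter for copying, \<open>9\<close> always empty, values of
  variables, and results, loop counters and saved values by nesting depth.
\<close>

definition vreg :: "nat => nat" where "vreg v = 4 * v + 16"
definition treg :: "nat => nat" where "treg d = 4 * d + 17"
definition lreg :: "nat => nat" where "lreg d = 4 * d + 18"
definition sreg :: "nat => nat" where "sreg d = 4 * d + 19"

lemma reg_eq [simp]:
  "vreg u = vreg v \<longleftrightarrow> u = v" "treg u = treg v \<longleftrightarrow> u = v" "lreg u = lreg v \<longleftrightarrow> u = v" "sreg u = sreg v \<longleftrightarrow> u = v"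
  "vreg u ~= treg v" "treg v ~= vreg u" "vreg u ~= lreg v" "lreg v ~= vreg u" "vreg u ~= sreg v" "sreg v ~= vreg u"
  "treg u ~= lreg v" "lreg v ~= treg u" "treg u ~= sreg v" "sreg v ~= treg u" "lreg u ~= sreg v" "sreg v ~= lreg u"
  unfolding vreg_def treg_def lreg_def sreg_def by (simp_all, presburger+)

lemma reg_ge:
  "16 \<le> vreg v" "16 \<le> treg v" "16 \<le> lreg v" "16 \<le> sreg v"
  by (simp_all add: vreg_def treg_def lreg_def sreg_def)

lemma reg_neq [simp]:
  assumes "k < 16"
  shows "vreg v ~= k" "treg v ~= k" "lreg v ~= k" "sreg v ~= k" "k ~= vreg v" "k ~= treg v" "k ~= lreg v" "k ~= sreg v"
  using assms reg_ge[of v] by linarith+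

lemma reg_neq_Suc_0 [simp]:
  "vreg v ~= Suc 0" "treg v ~= Suc 0" "lreg v ~= Suc 0" "sreg v ~= Suc 0"
  "Suc 0 ~= vreg v" "Suc 0 ~= treg v" "Suc 0 ~= lreg v" "Suc 0 ~= sreg v"
  using reg_ge[of v] by linarith+

primrec prog_regs :: "prog => nat set" where
  "prog_regs Skip = {}"
| "prog_regs (Clear k) = {k}"
| "prog_regs (App k a) = {k}"
| "prog_regs (Test A x P p q) = {A, x} \<union> prog_regs p \<union> prog_regs q"
| "prog_regs (p ;; q) = prog_regs p \<union> prog_regs q"
| "prog_regs (For x y p) = {x, y} \<union> prog_regs p"

text \<open>The evaluator needs more registers for deeper formulas, so well-formedness is stated
  without their number, with register 2 as the only loop bound. A sufficient number of registers is
  chosen afterwards.\<close>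

primrec wfp :: "prog => bool" where
  "wfp Skip = True"
| "wfp (Clear k) = (k ~= 3 & k ~= 2)"
| "wfp (App k a) = (k ~= 3 & k ~= 2 & (a = 1 | a = 2))"
| "wfp (Test A x P p q) = (A ~= 3 & x ~= 3 & A ~= x & wfp p & wfp q)"
| "wfp (p ;; q) = (wfp p & wfp q)"
| "wfp (For x y p) = (x ~= 3 & x ~= 2 & y = 2 & x \<notin> assigned p & wfp p)"

lemma wfp_wf_prog:
  assumes "wfp p"
  obtains h where "8 \<le> h" "wf_prog h 3 {2} p"
proof -
  have fin: "finite (prog_regs p)" by (induction p) auto
  have *: "wfp p ==> prog_regs p \<subseteq> {..<K} ==> 8 \<le> K ==> wf_prog K 3 {2} p" for K
    by (induction p) auto
  define h where "h = Suc (Max (insert 8 (prog_regs p)))"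
  have "k < h" if "k \<in> insert 8 (prog_regs p)" for k
    unfolding h_def using fin that by (meson Max_ge finite_insert le_imp_less_Suc)
  then have "8 < h" "prog_regs p \<subseteq> {..<h}" by auto
  with *[OF assms, of h] that[of h] show ?thesis by simp
qed

lemma sem_For_invariant:
  assumes "P 0 r" "length (r y) = N"
    and "\<And>i s s'. i < N ==> P i s ==> s' x = ones i ==> (\<And>k. k ~= x ==> s' k = s k) ==> P (Suc i) (sem p s')"
  obtains s where "P N s" "sem (For x y p) r x = ones N" "\<And>k. k ~= x ==> sem (For x y p) r k = s k"
proof -
  let ?s = "fold (\<lambda>i r. sem p (r(x := ones i))) [0..<N] r"
  have "P N ?s" by (rule fold_invariant) (auto intro!: assms(1) assms(3))
  then show ?thesis using assms(2) that[of ?s] by simp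
qed

section \<open>Evaluating formulas with register programs\<close>

definition copy :: "nat => nat => prog" where
  "copy u v = Clear u ;; For 8 2 (Test v 8 nz (App u 1) Skip)"

lemma nth0_replicate [simp]: "nth0 (replicate n a) i = (if i < n then a else 0)"
  by (simp add: nth0_def)

lemma ones_snoc: "ones n @ [1] = ones (Suc n)" by (simp add: replicate_append_same)

lemma sem_copy:
  assumes "r 2 = ones N" "r v = ones n" "n \<le> N" "u ~= v" "u ~= 8" "v ~= 8" "u ~= 2"
  shows "sem (copy u v) r u = ones n" and "k ~= u ==> k ~= 8 ==> sem (copy u v) r k = r k"
proof -
  define r1 where "r1 = sem (Clear u) r"
  have r1: "r1 u = []" "\<And>k. k ~= u ==> r1 k = r k" by (simp_all add: r1_def)
  obtain s where s: "s u = ones (min N n)" "\<forall>k. k ~= u --> k ~= 8 --> s k = r k"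
    "\<And>k. k ~= 8 ==> sem (For 8 2 (Test v 8 nz (App u 1) Skip)) r1 k = s k"
  proof (rule sem_For_invariant[where N = N and x = 8 and y = 2 and r = r1 and
        p = "Test v 8 nz (App u 1) Skip" and
        P = "\<lambda>i s. s u = ones (min i n) & (\<forall>k. k ~= u --> k ~= 8 --> s k = r k)"])
    fix i s s'
    assume "i < N" and P: "s u = ones (min i n) & (\<forall>k. k ~= u --> k ~= 8 --> s k = r k)"
      and s': "s' 8 = ones i" "\<And>k. k ~= 8 ==> s' k = s k"
    have v: "s' v = ones n" "s' u = ones (min i n)" using P s' assms by auto
    have "min (Suc i) n = (if i < n then Suc (min i n) else min i n)" by auto
    then show "sem (Test v 8 nz (App u 1) Skip) s' u = ones (min (Suc i) n) &
      (\<forall>k. k ~= u --> k ~= 8 --> sem (Test v 8 nz (App u 1) Skip) s' k = r k)"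
      using v P s' ones_snoc[of i] ones_snoc[of n] by (auto simp: min_def replicate_append_same)
  qed (use r1 assms in auto)
  have "sem (copy u v) r k = sem (For 8 2 (Test v 8 nz (App u 1) Skip)) r1 k" for k
    unfolding copy_def r1_def sem.simps(5) ..
  with s assms show "sem (copy u v) r u = ones n" "k ~= u ==> k ~= 8 ==> sem (copy u v) r k = r k"
    by (simp_all add: min_def)
qed

definition set_true :: "nat => prog" where
  "set_true k = Clear k ;; App k 1"

text \<open>Two lengths agree iff neither register has a symbol at the position given by the length
  of the other one.\<close>

definition if_eq :: "nat => nat => prog => prog => prog" where
  "if_eq A B p q = Test A B nz q (Test B A nz q p)"

definition if_set :: "nat => prog => prog => prog" where
  "if_set k p q = Test k 9 nz p q"

definition add_len :: "nat => nat => nat => prog" where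
  "add_len u v l = For l 2 (Test v l nz (App u 1) Skip)"

text \<open>The old value of \<open>v\<close> is saved and restored since a quantifier may rebind a
  variable that is in use outside. The counter is a register of its own: inside the body,
  \<open>vreg v\<close> may be assigned again, which \<open>For\<close> forbids for its
  counter.\<close>

definition loop :: "nat => nat => prog => prog" where
  "loop v d p = copy (sreg d) (vreg v) ;; For (lreg d) 2 (copy (vreg v) (lreg d) ;; p) ;; copy (vreg v) (sreg d)"

definition count_prog :: "nat => nat => prog => prog" where
  "count_prog v d p = Clear (treg d) ;; loop v d (p ;; if_set (treg (Suc d)) (App (treg d) 1) Skip)"

text \<open>The result goes to \<open>treg d\<close>, empty for false, and everything nested works
  at greater depth. The only relation known to the evaluator is the guessed word in register 7,
  indexed by the first argument of an atom.\<close>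

primrec feval :: "unit fm => nat => prog" where
  "feval (FEq x y) d = Clear (treg d) ;;
     (if x = y then App (treg d) 1 else if_eq (vreg x) (vreg y) (App (treg d) 1) Skip)"
| "feval (FLess x y) d = Clear (treg d) ;;
     (if x = y then Skip else Test (vreg y) (vreg x) nz (App (treg d) 1) Skip)"
| "feval (FSum x y z) d = Clear (treg d) ;; Clear (sreg d) ;; add_len (sreg d) (vreg x) (lreg d) ;;
     add_len (sreg d) (vreg y) (lreg d) ;; if_eq (sreg d) (vreg z) (App (treg d) 1) Skip"
| "feval (FProd x y z) d = Clear (treg d) ;; Clear (sreg d) ;;
     For (lreg d) 2 (Test (vreg x) (lreg d) nz (add_len (sreg d) (vreg y) (lreg (Suc d))) Skip) ;;
     if_eq (sreg d) (vreg z) (App (treg d) 1) Skip"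
| "feval (FIn a v) d = Clear (treg d) ;; Test 0 (vreg v) (\<lambda>b. b = a) (App (treg d) 1) Skip"
| "feval (FRel R vs) d = Clear (treg d) ;; Test 7 (vreg (hd vs)) (\<lambda>b. b = 2) (App (treg d) 1) Skip"
| "feval (FNor phi psi) d = feval phi d ;; feval psi (Suc d) ;;
     if_set (treg (Suc d)) (Clear (treg d)) (if_set (treg d) (Clear (treg d)) (set_true (treg d)))"
| "feval (FNex v phi) d = count_prog v d (feval phi (Suc d)) ;;
     if_set (treg d) (Clear (treg d)) (App (treg d) 1)"
| "feval (FCnt v phi y) d = count_prog v d (feval phi (Suc d)) ;;
     Test (treg d) (vreg y) nz (Clear (treg d)) (set_true (treg d))"

definition scratch :: "nat => nat set" where
  "scratch d = {8} \<union> {treg i | i. d \<le> i} \<union> {lreg i | i. d \<le> i} \<union> {sreg i | i. d \<le> i}"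

lemma scratch_simps [simp]:
  "vreg v \<notin> scratch d" "8 \<in> scratch d" "treg i \<in> scratch d \<longleftrightarrow> d \<le> i" "lreg i \<in> scratch d \<longleftrightarrow> d \<le> i"
  "sreg i \<in> scratch d \<longleftrightarrow> d \<le> i" "k < 16 ==> k \<in> scratch d \<longleftrightarrow> k = 8" unfolding scratch_def by auto

lemma scratchD:
  "k \<notin> scratch d ==> k ~= treg d & k ~= lreg d & k ~= sreg d & k ~= treg (Suc d) & k ~= lreg (Suc d) & k ~= 8"
  unfolding scratch_def by auto

lemma scratch_Suc: "k \<notin> scratch d ==> k \<notin> scratch (Suc d)" unfolding scratch_def by auto

definition env_regs :: "nat => nat list => nat list => (nat => nat) => regs => bool" where
  "env_regs N xs ys e r = (r 0 = xs & r 2 = ones N & r 7 = ys & r 9 = [] &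
     (\<forall>v. e v < N & r (vreg v) = ones (e v)))"

lemma env_regs_scratch: "env_regs N xs ys e r ==> (\<And>k. k \<notin> scratch d ==> r' k = r k) ==> env_regs N xs ys e r'"
  unfolding env_regs_def by simp

lemma sem_if_set: "r 9 = [] ==> 0 \<notin> set (r k) ==> sem (if_set k p q) r = (if r k = [] then sem q r else sem p r)"
  by (cases "r k") (auto simp: if_set_def nth0_def)

lemma nth0_nz: "0 \<notin> set xs ==> nth0 xs i ~= 0 \<longleftrightarrow> i < length xs" by (auto simp: nth0_def nth_pos)

lemma sem_if_eq: "0 \<notin> set (r A) ==> 0 \<notin> set (r B) ==>
    sem (if_eq A B p q) r = (if length (r A) = length (r B) then sem p r else sem q r)"
  using nth0_nz[of "r A" "length (r B)"] nth0_nz[of "r B" "length (r A)"] by (auto simp: if_eq_def)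

lemma sem_add_len:
  assumes "r 2 = ones N" "r v = ones n" "n \<le> N" "u ~= v" "u ~= l" "v ~= l" "u ~= 2"
  shows "sem (add_len u v l) r u = r u @ ones n" and "k ~= u ==> k ~= l ==> sem (add_len u v l) r k = r k"
proof -
  obtain s where s: "s u = r u @ ones (min N n)" "\<forall>k. k ~= u --> k ~= l --> s k = r k"
    "\<And>k. k ~= l ==> sem (For l 2 (Test v l nz (App u 1) Skip)) r k = s k"
  proof (rule sem_For_invariant[where N = N and x = l and y = 2 and r = r and
        p = "Test v l nz (App u 1) Skip" and
        P = "\<lambda>i s. s u = r u @ ones (min i n) & (\<forall>k. k ~= u --> k ~= l --> s k = r k)"])
    fix i s s'
    assume "i < N" and P: "s u = r u @ ones (min i n) & (\<forall>k. k ~= u --> k ~= l --> s k = r k)"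
      and s': "s' l = ones i" "\<And>k. k ~= l ==> s' k = s k"
    have v: "s' v = ones n" "s' u = r u @ ones (min i n)" using P s' assms by auto
    then show "sem (Test v l nz (App u 1) Skip) s' u = r u @ ones (min (Suc i) n) &
      (\<forall>k. k ~= u --> k ~= l --> sem (Test v l nz (App u 1) Skip) s' k = r k)"
      using P s' by (auto simp: min_def replicate_append_same)
  qed (use assms in auto)
  with assms show "sem (add_len u v l) r u = r u @ ones n" "k ~= u ==> k ~= l ==> sem (add_len u v l) r k = r k"
    unfolding add_len_def by (simp_all del: sem.simps add: min_def)
qed

text \<open>The invariant \<open>P\<close> must be insensitive to the registers that the loop itself
  manages; conversely the body must preserve the value saved in \<open>sreg d\<close>.\<close>

lemma sem_loop:
  assumes "env_regs N xs ys e r" "P 0 r"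
    and P: "\<And>i s s'. P i s ==> (\<And>k. k \<notin> {vreg v, 8, lreg d, sreg d} ==> s' k = s k) ==> P i s'"
    and step: "\<And>i s. i < N ==> P i s ==> env_regs N xs ys (e(v := i)) s ==>
      P (Suc i) (sem p s) & env_regs N xs ys (e(v := i)) (sem p s) & sem p s (sreg d) = s (sreg d)"
  shows "P N (sem (loop v d p) r)" "env_regs N xs ys e (sem (loop v d p) r)"
proof -
  define r1 where "r1 = sem (copy (sreg d) (vreg v)) r"
  have N: "0 < N" using assms(1) unfolding env_regs_def by (metis gr_zeroI not_less_zero)
  have r: "r 2 = ones N" "r (vreg v) = ones (e v)" "e v \<le> N" and eN: "\<forall>v. e v < N"
    using assms(1) by (auto simp: env_regs_def intro: less_imp_le)
  have c: "r1 (sreg d) = ones (e v)" "\<And>k. k ~= sreg d ==> k ~= 8 ==> r1 k = r k"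
    unfolding r1_def using sem_copy[OF r] by simp_all
  let ?E = "\<lambda>s. \<exists>j<N. env_regs N xs ys (e(v := j)) s"
  let ?b = "copy (vreg v) (lreg d) ;; p"
  have r12: "length (r1 2) = N" using c(2)[of 2] r(1) by simp
  obtain s where s: "P N s & ?E s & s (sreg d) = ones (e v)"
    "sem (For (lreg d) 2 ?b) r1 (lreg d) = ones N" "\<And>k. k ~= lreg d ==> sem (For (lreg d) 2 ?b) r1 k = s k"
  proof (rule sem_For_invariant[where N = N and x = "lreg d" and y = 2 and r = r1 and p = ?b and
        P = "\<lambda>i s. P i s & ?E s & s (sreg d) = ones (e v)"])
    have "P 0 r1" using assms(2) by (rule P) (use c in auto)
    moreover have "env_regs N xs ys (e(v := e v)) r1" using assms(1) c by (simp add: env_regs_def)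
    ultimately show "P 0 r1 & ?E r1 & r1 (sreg d) = ones (e v)"
      using c assms(1) unfolding env_regs_def by blast
  next
    fix i s s'
    assume i: "i < N" and "P i s & ?E s & s (sreg d) = ones (e v)"
      and s': "s' (lreg d) = ones i" "\<And>k. k ~= lreg d ==> s' k = s k"
    then obtain j where *: "P i s" "env_regs N xs ys (e(v := j)) s" "s (sreg d) = ones (e v)" by blast
    define s1 where "s1 = sem (copy (vreg v) (lreg d)) s'"
    have s2: "s' 2 = ones N" using * s' by (simp add: env_regs_def)
    have c1: "s1 (vreg v) = ones i" "\<And>k. k ~= vreg v ==> k ~= 8 ==> s1 k = s' k"
      unfolding s1_def using sem_copy[OF s2 s'(1)] i by simp_all
    have "P i s1" using *(1) by (rule P) (use c1 s' in auto)
    moreover have "s (vreg u) = ones (e u)" if "u ~= v" for u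
      using *(2) that unfolding env_regs_def by (metis fun_upd_other)
    then have "env_regs N xs ys (e(v := i)) s1" using *(2) i c1 s' eN unfolding env_regs_def by auto
    ultimately have "P (Suc i) (sem p s1)" "env_regs N xs ys (e(v := i)) (sem p s1)" "sem p s1 (sreg d) = s1 (sreg d)"
      using step[OF i] by blast+
    then show "P (Suc i) (sem ?b s') & ?E (sem ?b s') & sem ?b s' (sreg d) = ones (e v)"
      using i c1 s' * unfolding sem.simps(5) s1_def[symmetric] by auto
  qed (use r12 in auto)
  define r2 where "r2 = sem (For (lreg d) 2 ?b) r1"
  have r2: "r2 (lreg d) = ones N" "\<And>k. k ~= lreg d ==> r2 k = s k" using s unfolding r2_def by auto
  obtain j where j: "env_regs N xs ys (e(v := j)) s" using s(1) by blast
  have r22: "r2 2 = ones N" "r2 (sreg d) = ones (e v)" using j r2 s(1) by (simp_all add: env_regs_def)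
  have r3: "sem (copy (vreg v) (sreg d)) r2 (vreg v) = ones (e v)"
    "\<And>k. k ~= vreg v ==> k ~= 8 ==> sem (copy (vreg v) (sreg d)) r2 k = r2 k"
    using sem_copy[OF r22 r(3)] by simp_all
  have eq: "sem (loop v d p) r = sem (copy (vreg v) (sreg d)) r2"
    unfolding loop_def r2_def r1_def sem.simps(5) ..
  have "P N s" using s(1) by blast
  then show "P N (sem (loop v d p) r)" unfolding eq by (rule P) (use r3 r2 in auto)
  show "env_regs N xs ys e (sem (loop v d p) r)"
  proof -
    have "s (vreg u) = ones (e u)" if "u ~= v" for u
      using j that unfolding env_regs_def by (metis fun_upd_other)
    then have "sem (copy (vreg v) (sreg d)) r2 (vreg u) = ones (e u)" for u
      using r3 r2 by (cases "u = v") auto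
    then show ?thesis unfolding eq using j r2 r3 assms(1) eN unfolding env_regs_def by auto
  qed
qed

primrec unary :: "'r fm => bool" where
  "unary (FEq x y) = True"
| "unary (FLess x y) = True"
| "unary (FSum x y z) = True"
| "unary (FProd x y z) = True"
| "unary (FIn a v) = True"
| "unary (FRel R vs) = (vs ~= [])"
| "unary (FNor phi psi) = (unary phi & unary psi)"
| "unary (FNex v phi) = unary phi"
| "unary (FCnt v phi y) = unary phi"

lemma unary_derived [simp]:
  "unary (FNot phi) = unary phi" "unary (FOr phi psi) = (unary phi & unary psi)"
  "unary (FAnd phi psi) = (unary phi & unary psi)" "unary (FImp phi psi) = (unary phi & unary psi)"
  "unary (FIff phi psi) = (unary phi & unary psi)" "unary (FEx v phi) = unary phi" "unary (FAll v phi) = unary phi"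
  by (auto simp: FNot_def FOr_def FAnd_def FImp_def FIff_def FEx_def FAll_def)

lemma assigned_feval: "assigned (feval phi d) \<subseteq> scratch d \<union> range vreg"
proof (induction phi arbitrary: d)
  case (FNor phi psi)
  then show ?case using scratch_Suc by (fastforce simp: if_set_def set_true_def)
next
  case (FNex v phi)
  have "assigned (feval phi (Suc d)) \<subseteq> scratch d \<union> range vreg" using FNex[of "Suc d"] scratch_Suc by blast
  then show ?case by (auto simp: count_prog_def loop_def if_set_def copy_def)
next
  case (FCnt v phi y)
  have "assigned (feval phi (Suc d)) \<subseteq> scratch d \<union> range vreg" using FCnt[of "Suc d"] scratch_Suc by blast
  then show ?case by (auto simp: count_prog_def loop_def if_set_def copy_def set_true_def)
qed (auto simp: if_eq_def add_len_def)

lemma wfp_loop: "wfp p ==> lreg d \<notin> assigned p ==> wfp (loop v d p)"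
  by (auto simp: loop_def copy_def)

lemma wfp_feval: "wfp (feval phi d)"
proof (induction phi arbitrary: d)
  case (FNex v phi)
  have "lreg d \<notin> assigned (feval phi (Suc d))" using assigned_feval[of phi "Suc d"] by auto
  then show ?case using FNex by (auto simp: count_prog_def if_set_def intro!: wfp_loop)
next
  case (FCnt v phi y)
  have "lreg d \<notin> assigned (feval phi (Suc d))" using assigned_feval[of phi "Suc d"] by auto
  then show ?case using FCnt by (auto simp: count_prog_def if_set_def set_true_def intro!: wfp_loop)
qed (auto simp: if_eq_def add_len_def if_set_def set_true_def)

definition guess_rel :: "nat list => unit => nat list => bool" where
  "guess_rel ys = (\<lambda>_ is. nth0 ys (hd is) = 2)"

definition yields :: "regs => regs => nat => bool => bool" where
  "yields r' r d b = (r' (treg d) = (if b then [1] else []) & (\<forall>k. k \<notin> scratch d --> r' k = r k))"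

definition evaluates :: "nat => nat list => nat list => unit fm => bool" where
  "evaluates N xs ys phi = (\<forall>d e r. env_regs N xs ys e r -->
     yields (sem (feval phi d) r) r d (ev N xs (guess_rel ys) phi e))"

lemma evaluatesD:
  assumes "evaluates N xs ys phi" "env_regs N xs ys e r"
  shows "sem (feval phi d) r (treg d) = (if ev N xs (guess_rel ys) phi e then [1] else [])"
    "k \<notin> scratch d ==> sem (feval phi d) r k = r k"
    "env_regs N xs ys e (sem (feval phi d) r)"
  using assms env_regs_scratch[OF assms(2)] unfolding evaluates_def yields_def by blast+

lemma count_loop:
  assumes "evaluates N xs ys phi" "env_regs N xs ys e r"
  defines "p \<equiv> \<lambda>v d. count_prog v d (feval phi (Suc d))"
  shows "sem (p v d) r (treg d) = ones (card {i. i < N & ev N xs (guess_rel ys) phi (e(v := i))})"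
    and "k \<notin> scratch d ==> sem (p v d) r k = r k" and "env_regs N xs ys e (sem (p v d) r)"
proof -
  let ?c = "\<lambda>n. card {i. i < n & ev N xs (guess_rel ys) phi (e(v := i))}"
  let ?b = "feval phi (Suc d) ;; if_set (treg (Suc d)) (App (treg d) 1) Skip"
  define r1 where "r1 = sem (Clear (treg d)) r"
  have r1: "r1 (treg d) = []" "\<And>k. k ~= treg d ==> r1 k = r k" by (simp_all add: r1_def)
  have er1: "env_regs N xs ys e r1"
    by (rule env_regs_scratch[OF assms(2), of d]) (use r1 scratchD in blast)
  let ?P = "\<lambda>i s. s (treg d) = ones (?c i) & (\<forall>k. k \<notin> scratch d \<union> {vreg v} --> s k = r k)"
  have step: "?P (Suc i) (sem ?b s) & env_regs N xs ys (e(v := i)) (sem ?b s) & sem ?b s (sreg d) = s (sreg d)"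
    if "i < N" "?P i s" "env_regs N xs ys (e(v := i)) s" for i s
  proof -
    define s1 where "s1 = sem (feval phi (Suc d)) s"
    note s1 = evaluatesD[OF assms(1) that(3), where d = "Suc d", folded s1_def]
    have 9: "s1 9 = []" using s1(3) by (simp add: env_regs_def)
    have t: "s1 (treg d) = ones (?c i)" "s1 (sreg d) = s (sreg d)"
      using s1(2)[of "treg d"] s1(2)[of "sreg d"] that(2) by simp_all
    let ?e = "ev N xs (guess_rel ys) phi (e(v := i))"
    have sb: "sem ?b s = (if ?e then sem (App (treg d) 1) s1 else s1)"
      unfolding sem.simps(5) s1_def[symmetric] using s1(1) 9 by (subst sem_if_set) auto
    have "{j. j < Suc i & ev N xs (guess_rel ys) phi (e(v := j))} =
        (if ?e then insert i {j. j < i & ev N xs (guess_rel ys) phi (e(v := j))}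
         else {j. j < i & ev N xs (guess_rel ys) phi (e(v := j))})" by (auto simp: less_Suc_eq)
    then have "?c (Suc i) = (if ?e then Suc (?c i) else ?c i)" by simp
    then have "sem ?b s (treg d) = ones (?c (Suc i))"
      unfolding sb using t ones_snoc[of "?c i"] by auto
    moreover have oth: "sem ?b s k = s1 k" if "k ~= treg d" for k unfolding sb using that by simp
    moreover have "s1 k = s k" if "k \<notin> scratch d" for k using s1(2) scratch_Suc[OF that] by blast
    moreover have "env_regs N xs ys (e(v := i)) (sem ?b s)"
      by (rule env_regs_scratch[OF s1(3), of d]) (use oth scratchD in blast)
    moreover have "sem ?b s k = r k" if k: "k \<notin> scratch d \<union> {vreg v}" for k
    proof -
      have "sem ?b s k = s1 k" "s1 k = s k" using oth scratchD s1(2) scratch_Suc k by blast+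
      moreover have "s k = r k" using \<open>?P i s\<close> k by blast
      ultimately show ?thesis by simp
    qed
    moreover have "sem ?b s (sreg d) = s (sreg d)" using oth[of "sreg d"] t(2) by simp
    ultimately show ?thesis by blast
  qed
  have P: "?P N (sem (loop v d ?b) r1) & env_regs N xs ys e (sem (loop v d ?b) r1)"
  proof
    have P0: "?P 0 r1" using r1 scratchD by auto
    have Pm: "?P i s'" if "?P i s" "\<And>k. k \<notin> {vreg v, 8, lreg d, sreg d} ==> s' k = s k" for i and s s' :: regs
    proof -
      have "s' (treg d) = s (treg d)" by (rule that(2)) simp
      moreover have "s' k = s k" if "k \<notin> scratch d \<union> {vreg v}" for k
        using \<open>\<And>k. k \<notin> {vreg v, 8, lreg d, sreg d} ==> s' k = s k\<close>[of k] scratchD[of k d] that by blast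
      ultimately show ?thesis using that(1) by auto
    qed
    show "?P N (sem (loop v d ?b) r1)"
      by (rule sem_loop(1)[where P = ?P, OF er1 P0]) (fact Pm, fact step)
    show "env_regs N xs ys e (sem (loop v d ?b) r1)"
      by (rule sem_loop(2)[where P = ?P, OF er1 P0]) (fact Pm, fact step)
  qed
  have eq: "sem (p v d) r = sem (loop v d ?b) r1" unfolding p_def count_prog_def r1_def sem.simps(5) ..
  show "sem (p v d) r (treg d) = ones (?c N)" "env_regs N xs ys e (sem (p v d) r)"
    unfolding eq using P by auto
  show "sem (p v d) r k = r k" if "k \<notin> scratch d"
  proof (cases "k = vreg v")
    case True
    then show ?thesis unfolding eq using P assms(2) by (simp add: env_regs_def)
  next
    case False
    then show ?thesis unfolding eq using P that by auto
  qed
qed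

lemma evaluates: "unary phi ==> evaluates N xs ys phi"
proof (induction phi)
  case (FEq x y)
  show ?case unfolding evaluates_def
  proof (intro allI impI)
    fix d e and r :: regs
    assume r: "env_regs N xs ys e r"
    have "0 \<notin> set (r (vreg x))" "0 \<notin> set (r (vreg y))" "length (r (vreg x)) = e x" "length (r (vreg y)) = e y"
      using r by (auto simp: env_regs_def)
    then show "yields (sem (feval (FEq x y) d) r) r d (ev N xs (guess_rel ys) (FEq x y) e)"
      by (auto simp: yields_def sem_if_eq dest: scratchD)
  qed
next
  case (FLess x y)
  then show ?case by (auto simp: evaluates_def yields_def env_regs_def dest: scratchD)
next
  case (FSum x y z)
  show ?case unfolding evaluates_def
  proof (intro allI impI)
    fix d e and r :: regs
    assume r: "env_regs N xs ys e r"
    define r1 where "r1 = sem (Clear (sreg d)) (sem (Clear (treg d)) r)"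
    have r1: "r1 (treg d) = []" "r1 (sreg d) = []" "\<And>k. k ~= treg d ==> k ~= sreg d ==> r1 k = r k"
      by (simp_all add: r1_def)
    define r2 where "r2 = sem (add_len (sreg d) (vreg x) (lreg d)) r1"
    have "r1 2 = ones N" "r1 (vreg x) = ones (e x)" "e x \<le> N" using r r1 by (auto simp: env_regs_def less_imp_le)
    from sem_add_len[OF this] have r2: "r2 (sreg d) = ones (e x)" "\<And>k. k ~= sreg d ==> k ~= lreg d ==> r2 k = r1 k"
      unfolding r2_def using r1(2) by simp_all
    define r3 where "r3 = sem (add_len (sreg d) (vreg y) (lreg d)) r2"
    have "r2 2 = ones N" "r2 (vreg y) = ones (e y)" "e y \<le> N" using r r1 r2 by (auto simp: env_regs_def less_imp_le)
    from sem_add_len[OF this] have r3: "r3 (sreg d) = ones (e x + e y)" "\<And>k. k ~= sreg d ==> k ~= lreg d ==> r3 k = r2 k"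
      unfolding r3_def using r2(1) by (simp_all add: replicate_add)
    have z: "r3 (vreg z) = ones (e z)" using r r1 r2 r3 by (simp add: env_regs_def)
    have k: "r3 k = r k" if "k \<notin> scratch d" for k using scratchD[OF that] r1 r2 r3 by simp
    have t: "r3 (treg d) = []" using r1 r2 r3 by simp
    have "sem (feval (FSum x y z) d) r = sem (if_eq (sreg d) (vreg z) (App (treg d) 1) Skip) r3"
      unfolding feval.simps sem.simps(5) r3_def r2_def r1_def ..
    also have "\<dots> = (if e x + e y = e z then sem (App (treg d) 1) r3 else r3)"
      using z r3(1) by (subst sem_if_eq) auto
    finally show "yields (sem (feval (FSum x y z) d) r) r d (ev N xs (guess_rel ys) (FSum x y z) e)"
      using k t unfolding yields_def by (auto dest: scratchD simp del: feval.simps)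
  qed
next
  case (FProd x y z)
  show ?case unfolding evaluates_def
  proof (intro allI impI)
    fix d e and r :: regs
    assume r: "env_regs N xs ys e r"
    define r1 where "r1 = sem (Clear (sreg d)) (sem (Clear (treg d)) r)"
    have r1: "r1 (treg d) = []" "r1 (sreg d) = []" "\<And>k. k ~= treg d ==> k ~= sreg d ==> r1 k = r k"
      by (simp_all add: r1_def)
    let ?b = "Test (vreg x) (lreg d) nz (add_len (sreg d) (vreg y) (lreg (Suc d))) Skip"
    have r12: "length (r1 2) = N" using r r1 by (simp add: env_regs_def)
    have e: "e x < N" "e y < N" using r by (auto simp: env_regs_def)
    obtain s where s: "s (sreg d) = ones (min N (e x) * e y) & (\<forall>k. k \<notin> {sreg d, lreg d, lreg (Suc d)} --> s k = r1 k)"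
      "\<And>k. k ~= lreg d ==> sem (For (lreg d) 2 ?b) r1 k = s k"
    proof (rule sem_For_invariant[where N = N and x = "lreg d" and y = 2 and r = r1 and p = ?b and
          P = "\<lambda>i s. s (sreg d) = ones (min i (e x) * e y) & (\<forall>k. k \<notin> {sreg d, lreg d, lreg (Suc d)} --> s k = r1 k)"])
      fix i s s'
      assume "i < N" and P: "s (sreg d) = ones (min i (e x) * e y) & (\<forall>k. k \<notin> {sreg d, lreg d, lreg (Suc d)} --> s k = r1 k)"
        and s': "s' (lreg d) = ones i" "\<And>k. k ~= lreg d ==> s' k = s k"
      have *: "s' (sreg d) = ones (min i (e x) * e y)" "s' 2 = ones N" "s' (vreg y) = ones (e y)" "s' (vreg x) = ones (e x)"
        using P s' r r1 by (auto simp: env_regs_def)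
      note a = sem_add_len[OF *(2,3), of "sreg d" "lreg (Suc d)"]
      show "sem ?b s' (sreg d) = ones (min (Suc i) (e x) * e y) &
        (\<forall>k. k \<notin> {sreg d, lreg d, lreg (Suc d)} --> sem ?b s' k = r1 k)"
      proof (cases "i < e x")
        case True
        then have "sem ?b s' = sem (add_len (sreg d) (vreg y) (lreg (Suc d))) s'" using * s'(1) by simp
        then show ?thesis
          using a P s' *(1) e True by (simp add: replicate_add[symmetric] min_def add.commute del: sem.simps)
      next
        case False
        then have "sem ?b s' = s'" using * s'(1) by simp
        then show ?thesis using P s' * False by (simp add: min_def)
      qed
    qed (use r1 r12 in auto)
    define r3 where "r3 = sem (For (lreg d) 2 ?b) r1"
    have r3: "r3 (sreg d) = ones (e x * e y)" "\<And>k. k \<notin> {sreg d, lreg d, lreg (Suc d)} ==> r3 k = r1 k"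
      using s e unfolding r3_def by (auto simp: min_def)
    have z: "r3 (vreg z) = ones (e z)" using r r1 r3 by (simp add: env_regs_def)
    have k: "r3 k = r k" if "k \<notin> scratch d" for k using scratchD[OF that] r1 r3 by simp
    have t: "r3 (treg d) = []" using r1 r3 by simp
    have "sem (feval (FProd x y z) d) r = sem (if_eq (sreg d) (vreg z) (App (treg d) 1) Skip) r3"
      unfolding feval.simps sem.simps(5) r3_def r1_def ..
    also have "\<dots> = (if e x * e y = e z then sem (App (treg d) 1) r3 else r3)"
      using z r3(1) by (subst sem_if_eq) auto
    finally show "yields (sem (feval (FProd x y z) d) r) r d (ev N xs (guess_rel ys) (FProd x y z) e)"
      using k t unfolding yields_def by (auto dest: scratchD simp del: feval.simps)
  qed
next
  case (FIn a v)
  then show ?case by (auto simp: evaluates_def yields_def env_regs_def dest: scratchD)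
next
  case (FRel R vs)
  then show ?case by (auto simp: evaluates_def yields_def env_regs_def guess_rel_def hd_map dest: scratchD)
next
  case (FNor phi psi)
  show ?case unfolding evaluates_def
  proof (intro allI impI)
    fix d e and r :: regs
    assume r: "env_regs N xs ys e r"
    define r1 where "r1 = sem (feval phi d) r"
    define r2 where "r2 = sem (feval psi (Suc d)) r1"
    have "evaluates N xs ys phi" "evaluates N xs ys psi" using FNor by simp_all
    note r1 = evaluatesD[OF this(1) r, where d = d, folded r1_def]
      and r2 = evaluatesD[OF this(2), where e = e and r = r1 and d = "Suc d", folded r2_def]
    note r2 = r2[OF r1(3)]
    have t: "r2 (treg d) = r1 (treg d)" using r2(2) by simp
    have 9: "r2 9 = []" using r2(3) by (simp add: env_regs_def)
    have "sem (feval (FNor phi psi) d) r = sem (if_set (treg (Suc d)) (Clear (treg d))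
        (if_set (treg d) (Clear (treg d)) (set_true (treg d)))) r2"
      unfolding feval.simps sem.simps(5) r2_def r1_def ..
    also have "\<dots> = (if ev N xs (guess_rel ys) (FNor phi psi) e then sem (set_true (treg d)) r2 else sem (Clear (treg d)) r2)"
      using r1(1) r2(1) 9 t by (simp add: sem_if_set del: sem.simps)
    finally have eq: "sem (feval (FNor phi psi) d) r = \<dots>" .
    have "r2 k = r k" if "k \<notin> scratch d" for k
      using r1(2)[OF that] r2(2)[OF scratch_Suc[OF that]] by simp
    then show "yields (sem (feval (FNor phi psi) d) r) r d (ev N xs (guess_rel ys) (FNor phi psi) e)"
      unfolding eq yields_def by (auto simp: set_true_def dest: scratchD)
  qed
next
  case (FNex v phi)
  show ?case unfolding evaluates_def
  proof (intro allI impI)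
    fix d e and r :: regs
    assume r: "env_regs N xs ys e r"
    have "evaluates N xs ys phi" using FNex by simp
    define r1 where "r1 = sem (count_prog v d (feval phi (Suc d))) r"
    note r1 = count_loop[OF \<open>evaluates N xs ys phi\<close> r, where d = d and v = v, folded r1_def]
    have "sem (feval (FNex v phi) d) r = sem (if_set (treg d) (Clear (treg d)) (App (treg d) 1)) r1"
      unfolding feval.simps sem.simps(5) r1_def ..
    also have "\<dots> = (if r1 (treg d) = [] then sem (App (treg d) 1) r1 else sem (Clear (treg d)) r1)"
      using r1(1,3) by (intro sem_if_set) (auto simp: env_regs_def)
    finally have eq: "sem (feval (FNex v phi) d) r = \<dots>" .
    have c: "r1 (treg d) = [] \<longleftrightarrow> ev N xs (guess_rel ys) (FNex v phi) e" unfolding r1(1) by auto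
    show "yields (sem (feval (FNex v phi) d) r) r d (ev N xs (guess_rel ys) (FNex v phi) e)"
      unfolding eq c[symmetric] yields_def using r1(2) by (auto dest: scratchD)
  qed
next
  case (FCnt v phi y)
  show ?case unfolding evaluates_def
  proof (intro allI impI)
    fix d e and r :: regs
    assume r: "env_regs N xs ys e r"
    have "evaluates N xs ys phi" using FCnt by simp
    define r1 where "r1 = sem (count_prog v d (feval phi (Suc d))) r"
    note r1 = count_loop[OF \<open>evaluates N xs ys phi\<close> r, where d = d and v = v, folded r1_def]
    have y: "length (r1 (vreg y)) = e y" using r1(3) by (simp add: env_regs_def)
    have "sem (feval (FCnt v phi y) d) r = sem (Test (treg d) (vreg y) nz (Clear (treg d)) (set_true (treg d))) r1"
      unfolding feval.simps sem.simps(5) r1_def ..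
    also have "\<dots> = (if ev N xs (guess_rel ys) (FCnt v phi y) e then sem (set_true (treg d)) r1 else sem (Clear (treg d)) r1)"
      using r1(1) y by (simp add: not_less)
    finally have eq: "sem (feval (FCnt v phi y) d) r = \<dots>" .
    show "yields (sem (feval (FCnt v phi y) d) r) r d (ev N xs (guess_rel ys) (FCnt v phi y) e)"
      unfolding eq yields_def using r1(2) by (auto simp: set_true_def dest: scratchD)
  qed
qed

text \<open>First-order descriptions of words. They serve two purposes, the words sent from one
  oracle to the next and the output of the reductions.\<close>

datatype em = EBit bool | EFm "unit fm" | ESeq em em | EFor nat em | EIf "unit fm" em

primrec emw :: "nat => nat list => (unit => nat list => bool) => em => (nat => nat) => word" where
  "emw N xs rho (EBit b) e = [b]"
| "emw N xs rho (EFm phi) e = [ev N xs rho phi e]"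
| "emw N xs rho (ESeq E F) e = emw N xs rho E e @ emw N xs rho F e"
| "emw N xs rho (EFor v E) e = concat (map (\<lambda>i. emw N xs rho E (e(v := i))) [0..<N])"
| "emw N xs rho (EIf phi E) e = (if ev N xs rho phi e then emw N xs rho E e else [])"

primrec unary_em :: "em => bool" where
  "unary_em (EBit b) = True"
| "unary_em (EFm phi) = unary phi"
| "unary_em (ESeq E F) = (unary_em E & unary_em F)"
| "unary_em (EFor v E) = unary_em E"
| "unary_em (EIf phi E) = (unary phi & unary_em E)"

primrec emit :: "em => nat => prog" where
  "emit (EBit b) d = App 1 (bit_symbol b)"
| "emit (EFm phi) d = feval phi d ;; if_set (treg d) (App 1 2) (App 1 1)"
| "emit (ESeq E F) d = emit E d ;; emit F d"
| "emit (EFor v E) d = loop v d (emit E (Suc d))"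
| "emit (EIf phi E) d = feval phi d ;; if_set (treg d) (emit E (Suc d)) Skip"

lemma assigned_emit: "assigned (emit E d) \<subseteq> scratch d \<union> range vreg \<union> {1}"
proof (induction E arbitrary: d)
  case (EFm phi)
  then show ?case using assigned_feval[of phi d] by (auto simp: if_set_def)
next
  case (EFor v E)
  have "assigned (emit E (Suc d)) \<subseteq> scratch d \<union> range vreg \<union> {1}" using EFor[of "Suc d"] scratch_Suc by blast
  then show ?case by (auto simp: loop_def copy_def)
next
  case (EIf phi E)
  have "assigned (emit E (Suc d)) \<subseteq> scratch d \<union> range vreg \<union> {1}" using EIf[of "Suc d"] scratch_Suc by blast
  then show ?case using assigned_feval[of phi d] by (auto simp: if_set_def)
qed auto

lemma wfp_emit: "wfp (emit E d)"
proof (induction E arbitrary: d)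
  case (EFor v E)
  have "lreg d \<notin> assigned (emit E (Suc d))" using assigned_emit[of E "Suc d"] by auto
  then show ?case using EFor by (auto intro!: wfp_loop)
qed (auto simp: wfp_feval if_set_def bit_symbol_def)

lemma bits_append: "bits (u @ v) = bits u @ bits v" by (simp add: bits_def)

lemma emit:
  assumes "unary_em E" "env_regs N xs ys e r"
  shows "sem (emit E d) r 1 = r 1 @ bits (emw N xs (guess_rel ys) E e) &
    (\<forall>k. k \<notin> scratch d --> k ~= 1 --> sem (emit E d) r k = r k)" using assms
proof (induction E arbitrary: d e r)
  case (EBit b)
  then show ?case by (simp add: bits_def)
next
  case (EFm phi)
  define r1 where "r1 = sem (feval phi d) r"
  have u: "unary phi" using EFm by simp
  note r1 = evaluatesD[OF evaluates[OF u] EFm(2), where d = d, folded r1_def]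
  have "r1 9 = []" using r1(3) by (simp add: env_regs_def)
  then have "sem (emit (EFm phi) d) r =
      (if ev N xs (guess_rel ys) phi e then sem (App 1 2) r1 else sem (App 1 1) r1)"
    unfolding emit.simps sem.simps(5) r1_def[symmetric] using r1(1) by (subst sem_if_set) auto
  then show ?case using r1(2) by (auto simp: bits_def bit_symbol_def)
next
  case (ESeq E F)
  define r1 where "r1 = sem (emit E d) r"
  have 1: "r1 1 = r 1 @ bits (emw N xs (guess_rel ys) E e) & (\<forall>k. k \<notin> scratch d --> k ~= 1 --> r1 k = r k)"
    unfolding r1_def by (rule ESeq.IH(1)) (use ESeq.prems in auto)
  have "env_regs N xs ys e r1" using ESeq.prems(2) 1 unfolding env_regs_def by auto
  then have 2: "sem (emit F d) r1 1 = r1 1 @ bits (emw N xs (guess_rel ys) F e) &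
      (\<forall>k. k \<notin> scratch d --> k ~= 1 --> sem (emit F d) r1 k = r1 k)"
    by (intro ESeq.IH(2)) (use ESeq.prems in auto)
  have "sem (emit (ESeq E F) d) r = sem (emit F d) r1" by (simp add: r1_def)
  then show ?case using 1 2 by (auto simp: bits_append)
next
  case (EFor v E)
  let ?w = "\<lambda>n. concat (map (\<lambda>i. emw N xs (guess_rel ys) E (e(v := i))) [0..<n])"
  let ?P = "\<lambda>i s. s 1 = r 1 @ bits (?w i) & (\<forall>k. k \<notin> scratch d \<union> {vreg v, 1} --> s k = r k)"
  have P0: "?P 0 r" by (simp add: bits_def)
  have Pm: "?P i s'" if "?P i s" "\<And>k. k \<notin> {vreg v, 8, lreg d, sreg d} ==> s' k = s k" for i and s s' :: regs
  proof -
    have "s' 1 = s 1" by (rule that(2)) simp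
    moreover have "s' k = s k" if "k \<notin> scratch d \<union> {vreg v, 1}" for k
      using \<open>\<And>k. k \<notin> {vreg v, 8, lreg d, sreg d} ==> s' k = s k\<close>[of k] scratchD[of k d] that by blast
    ultimately show ?thesis using that(1) by auto
  qed
  have step: "?P (Suc i) (sem (emit E (Suc d)) s) & env_regs N xs ys (e(v := i)) (sem (emit E (Suc d)) s) &
      sem (emit E (Suc d)) s (sreg d) = s (sreg d)"
    if "i < N" "?P i s" "env_regs N xs ys (e(v := i)) s" for i s
  proof -
    have *: "sem (emit E (Suc d)) s 1 = s 1 @ bits (emw N xs (guess_rel ys) E (e(v := i))) &
      (\<forall>k. k \<notin> scratch (Suc d) --> k ~= 1 --> sem (emit E (Suc d)) s k = s k)"
    proof (rule EFor.IH)
      show "unary_em E" using EFor.prems(1) by simp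
      show "env_regs N xs ys (e(v := i)) s" by fact
    qed
    have "?P (Suc i) (sem (emit E (Suc d)) s)"
      using * that(2) scratch_Suc by (auto simp: bits_append)
    moreover have "env_regs N xs ys (e(v := i)) (sem (emit E (Suc d)) s)"
      using * that(3) unfolding env_regs_def by auto
    moreover have "sem (emit E (Suc d)) s (sreg d) = s (sreg d)" using * by simp
    ultimately show ?thesis by blast
  qed
  have "?P N (sem (emit (EFor v E) d) r)" and e: "env_regs N xs ys e (sem (emit (EFor v E) d) r)"
    unfolding emit.simps
    by (rule sem_loop[where P = ?P, OF EFor.prems(2) P0]; (fact Pm | fact step))+
  moreover have "sem (emit (EFor v E) d) r (vreg v) = r (vreg v)"
    using e EFor.prems(2) unfolding env_regs_def by simp
  ultimately have "sem (emit (EFor v E) d) r k = r k" if "k \<notin> scratch d" "k ~= 1" for k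
    using that by (cases "k = vreg v") auto
  with \<open>?P N (sem (emit (EFor v E) d) r)\<close> show ?case unfolding emw.simps by blast
next
  case (EIf phi E)
  define r1 where "r1 = sem (feval phi d) r"
  have u: "unary phi" using EIf by simp
  note r1 = evaluatesD[OF evaluates[OF u] EIf.prems(2), where d = d, folded r1_def]
  have "r1 9 = []" using r1(3) by (simp add: env_regs_def)
  then have eq: "sem (emit (EIf phi E) d) r =
      (if ev N xs (guess_rel ys) phi e then sem (emit E (Suc d)) r1 else r1)"
    unfolding emit.simps sem.simps(5) r1_def[symmetric] using r1(1) by (subst sem_if_set) auto
  have "sem (emit E (Suc d)) r1 1 = r1 1 @ bits (emw N xs (guess_rel ys) E e) &
    (\<forall>k. k \<notin> scratch (Suc d) --> k ~= 1 --> sem (emit E (Suc d)) r1 k = r1 k)"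
    by (rule EIf.IH) (use EIf.prems r1(3) in auto)
  then show ?case unfolding eq using r1(2) scratch_Suc by (auto simp: bits_def)
qed

lemma bound_pos: "0 < a ==> 0 < bound a w" by (simp add: bound_def)

lemma env_base_regs: "0 < a ==> env_regs (bound a w) (bits w) (bits Y) (\<lambda>_. 0) (base_regs a w Y)"
  by (simp add: env_regs_def base_regs_def bound_pos bits_def)

text \<open>The easy direction of Fagin's theorem: the guessed word acts as a single unary relation
  on a universe of polynomial size.\<close>

theorem NP_fm:
  assumes "unary phi" "0 < a"
  shows "{w. \<exists>Y. length Y = bound a w & ev (bound a w) (bits w) (guess_rel (bits Y)) phi (\<lambda>_. 0)} \<in> NP"
proof -
  define p where "p = feval phi 0 ;; if_set (treg 0) (App 4 2) (App 4 1)"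
  have "wfp p" by (simp add: p_def wfp_feval if_set_def)
  then obtain h where h: "8 \<le> h" "wf_prog h 3 {2} p" by (rule wfp_wf_prog)
  show ?thesis unfolding NP_def
  proof (rule NP_oracleI[OF h polyb_const[of 0]])
    fix w Y
    let ?N = "bound a w" and ?r = "base_regs a w Y"
    let ?A = "ev ?N (bits w) (guess_rel (bits Y)) phi (\<lambda>_. 0)"
    define r1 where "r1 = sem (feval phi 0) ?r"
    note r1 = evaluatesD[OF evaluates[OF assms(1)] env_base_regs[OF assms(2), of w Y], where d = 0, folded r1_def]
    have "r1 9 = []" "r1 4 = []" using r1(2)[of 4] r1(3) by (simp_all add: env_regs_def base_regs_def)
    then have "sem p ?r = (if ?A then sem (App 4 2) r1 else sem (App 4 1) r1)"
      unfolding p_def sem.simps(5) r1_def[symmetric] using r1(1) by (subst sem_if_set) auto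
    then have "sem p ?r 4 = [if ?A then 2 else 1]" using \<open>r1 4 = []\<close> by simp
    then show "\<exists>J\<le>0. halts {} p ?r J (if ?A then 2 else 1)" by (simp add: halts_0)
  qed
qed

text \<open>The shape of a second-level problem: a guess that passes a local check and for which the
  oracle finds no objection. The query is only asked if the check succeeds, and the negative answer
  accepts.\<close>

theorem NP_oracle_fm:
  assumes "unary phi" "unary_em E" "0 < a"
  shows "{w. \<exists>Y. length Y = bound a w & ev (bound a w) (bits w) (guess_rel (bits Y)) phi (\<lambda>_. 0) &
    emw (bound a w) (bits w) (guess_rel (bits Y)) E (\<lambda>_. 0) \<notin> B} \<in> NP_oracle B"
proof -
  \<comment> \<open>Register 5 tells the two rounds apart: it is empty in the first one and holds
    the answer in the second, 2 for yes and 1 for no. Register 9 is always empty and serves as index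
    0.\<close>
  define p where "p = Test 5 9 (\<lambda>b. b = 0)
    (feval phi 0 ;; if_set (treg 0) (emit E 0) (App 4 1))
    (Test 5 9 (\<lambda>b. b = 1) (App 4 2) (App 4 1))"
  have "wfp p" by (simp add: p_def wfp_feval wfp_emit if_set_def)
  then obtain h where h: "8 \<le> h" "wf_prog h 3 {2} p" by (rule wfp_wf_prog)
  show ?thesis
  proof (rule NP_oracleI[OF h polyb_const[of 1]])
    fix w Y
    let ?N = "bound a w" and ?r = "base_regs a w Y"
    let ?e = "ev ?N (bits w) (guess_rel (bits Y)) phi (\<lambda>_. 0)"
    let ?u = "emw ?N (bits w) (guess_rel (bits Y)) E (\<lambda>_. 0)"
    let ?A = "?e & ?u \<notin> B"
    define r1 where "r1 = sem (feval phi 0) ?r"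
    note r1 = evaluatesD[OF evaluates[OF assms(1)] env_base_regs[OF assms(3), of w Y], where d = 0, folded r1_def]
    have r1': "r1 9 = []" "r1 4 = []" "r1 1 = []"
      using r1(2)[of 4] r1(2)[of 1] r1(3) by (simp_all add: env_regs_def base_regs_def)
    have "?r 5 = []" "?r 9 = []" by (simp_all add: base_regs_def)
    then have p: "sem p ?r = (if ?e then sem (emit E 0) r1 else sem (App 4 1) r1)"
      unfolding p_def sem.simps(4,5) r1_def[symmetric] using r1(1) r1'(1) by (subst sem_if_set) (auto simp: nth0_def)
    show "\<exists>J\<le>1. halts B p ?r J (if ?A then 2 else 1)"
    proof (cases ?e)
      case False
      then have "halts B p ?r 0 1" using p r1' by (simp add: halts_0)
      then show ?thesis using False by auto
    next
      case True
      define r2 where "r2 = round B p ?r"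
      have em: "sem (emit E 0) r1 1 = bits ?u" "sem (emit E 0) r1 4 = []" "sem (emit E 0) r1 9 = []"
        using emit[OF assms(2) r1(3), of 0] r1' by auto
      have r2: "r2 5 = [if ?u \<in> B then 2 else 1]" "r2 4 = []" "r2 9 = []"
        using True em p word_of_bits[of ?u] by (simp_all add: r2_def round_def)
      then have "sem p r2 4 = [if ?u \<in> B then 1 else 2]" by (simp add: p_def nth0_def)
      then have "halts B p ?r 1 (if ?A then 2 else 1)"
        using True em p unfolding One_nat_def halts_Suc halts_0 r2_def by auto
      then show ?thesis by blast
    qed
  qed
qed

theorem poly_time_computable_em:
  assumes "unary_em E" "0 < a"
  shows "poly_time_computable (\<lambda>w. emw (bound a w) (bits w) (guess_rel []) E (\<lambda>_. 0))"
proof -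
  define p where "p = emit E 0 ;; App 4 2"
  have "wfp p" by (simp add: p_def wfp_emit)
  then obtain h where h: "8 \<le> h" "wf_prog h 3 {2} p" by (rule wfp_wf_prog)
  have *: "sem p (base_regs a w []) 4 = [2] &
      sem p (base_regs a w []) 1 = bits (emw (bound a w) (bits w) (guess_rel []) E (\<lambda>_. 0))" for w
    using emit[OF assms(1) env_base_regs[OF assms(2), of w "[]"], of 0]
    by (simp add: p_def base_regs_def bits_def)
  show ?thesis by (rule poly_time_computableI[OF h, of a]) (use * word_of_bits in simp_all)
qed

section \<open>Binary search by oracle queries\<close>

definition Ecopy :: em where
  "Ecopy = EFor 0 (EIf (FNot (FIn 0 0)) (EFm (FIn 2 0)))"

lemma nth0_bits: "nth0 (bits w) i = (if i < length w then bit_symbol (w ! i) else 0)"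
  by (simp add: nth0_def bits_def)

lemma emw_Ecopy:
  assumes "length w \<le> N"
  shows "emw N (bits w) rho Ecopy e = w"
proof -
  have 1: "concat (map (\<lambda>i. if i < length w then [w ! i] else []) [0..<n]) = take n w" for n
    by (induction n) (auto simp: take_Suc_conv_app_nth)
  have 2: "(if nth0 (bits w) i ~= 0 then [nth0 (bits w) i = 2] else []) = (if i < length w then [w ! i] else [])" for i
    by (auto simp: nth0_bits bit_symbol_def)
  have "emw N (bits w) rho Ecopy e =
      concat (map (\<lambda>i. if nth0 (bits w) i ~= 0 then [nth0 (bits w) i = 2] else []) [0..<N])"
    unfolding Ecopy_def emw.simps ev_derived ev.simps fun_upd_same ..
  then show ?thesis unfolding 2 1 using assms by simp
qed

lemma sem_copy_bound:
  assumes "r 2 = ones N" "u ~= 2" "u ~= 8"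
  shows "sem (copy u 2) r u = ones N" "k ~= u ==> k ~= 8 ==> sem (copy u 2) r k = r k"
proof -
  show "sem (copy u 2) r u = ones N" by (rule sem_copy(1)[where N = N]) (use assms in auto)
  show "sem (copy u 2) r k = r k" if "k ~= u" "k ~= 8"
    by (rule sem_copy(2)[where N = N and n = N]) (use assms that in auto)
qed

text \<open>
  Binary search with an oracle that decides \<open>d \<le> k\<close> for queries \<open>w @ [False, False] @ replicate k False\<close>.
  Register 10 holds the lower end \<open>l\<close> and register 11 the length \<open>m\<close> of the interval \<open>[l, l + m]\<close>.
  The other two kinds of queries are marked by \<open>[True, False]\<close> and \<open>[False, True]\<close>.
\<close>

definition query :: "word => bool => bool => nat => word" where
  "query w b c k = w @ [b, c] @ replicate k False"

text \<open>Both halves continue with length \<open>m div 2\<close>, so the number of queries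
  depends on \<open>m\<close> alone. For even \<open>m\<close> the upper half then reaches one
  beyond the interval, which does no harm.\<close>

fun search :: "(nat => bool) => nat => nat => nat" where
  "search Q l m = (if m = 0 then l
     else if Q (l + m div 2) then search Q l (m div 2) else search Q (l + m div 2 + 1) (m div 2))"

declare search.simps [simp del]

lemma search_finds:
  assumes "l \<le> d" "d \<le> l + m" "\<And>k. Q k = (d \<le> k)"
  shows "search Q l m = d" using assms(1,2)
proof (induction m arbitrary: l rule: less_induct)
  case (less m)
  show ?case
  proof (cases "m = 0")
    case True
    then show ?thesis using less by (simp add: search.simps)
  next
    case False
    then have lt: "m div 2 < m" by simp
    show ?thesis
    proof (cases "d \<le> l + m div 2")
      case True
      then have "Q (l + m div 2)" using assms(3) by blast
      then show ?thesis using less.IH[OF lt less.prems(1) True] False by (subst search.simps) simp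
    next
      case F: False
      then have "~ Q (l + m div 2)" using assms(3) by blast
      moreover have "d \<le> l + m div 2 + 1 + m div 2" using less.prems(2) by presburger
      ultimately show ?thesis
        using less.IH[OF lt, of "l + m div 2 + 1"] F False by (subst search.simps) simp
    qed
  qed
qed

text \<open>The marks of register 11 are dealt alternately to 13 and 14, beginning with 13 whenever
  both are equally long, so register 14 ends with the half rounded down.\<close>

definition halve :: prog where
  "halve = Clear 13 ;; Clear 14 ;;
     For 8 2 (Test 11 8 nz (if_eq 13 14 (App 13 1) (App 14 1)) Skip) ;; copy 11 14"

lemma sem_halve:
  assumes "r 2 = ones N" "r 11 = ones m" "m \<le> N"
  shows "sem halve r 11 = ones (m div 2)" "k \<notin> {8, 11, 13, 14} ==> sem halve r k = r k"
proof -
  define r1 where "r1 = sem (Clear 14) (sem (Clear 13) r)"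
  have r1: "r1 13 = []" "r1 14 = []" "\<And>k. k \<notin> {13, 14} ==> r1 k = r k" by (simp_all add: r1_def)
  let ?b = "Test 11 8 nz (if_eq 13 14 (App 13 1) (App 14 1)) Skip"
  let ?P = "\<lambda>i s. s 13 = ones ((min i m + 1) div 2) & s 14 = ones (min i m div 2) & (\<forall>k. k \<notin> {8, 13, 14} --> s k = r k)"
  obtain s where s: "?P N s" "\<And>k. k ~= 8 ==> sem (For 8 2 ?b) r1 k = s k"
  proof (rule sem_For_invariant[where N = N and x = 8 and y = 2 and r = r1 and p = ?b and P = ?P])
    show "?P 0 r1" using r1 by simp
    show "length (r1 2) = N" using r1(3)[of 2] assms by simp
  next
    fix i and s s' :: regs
    assume "i < N" "?P i s" and s': "s' 8 = ones i" "\<And>k. k ~= 8 ==> s' k = s k"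
    have *: "s' 13 = ones ((min i m + 1) div 2)" "s' 14 = ones (min i m div 2)"
      "\<And>k. k \<notin> {8, 13, 14} ==> s' k = r k" "s' 11 = ones m" using \<open>?P i s\<close> s' assms by simp_all
    show "?P (Suc i) (sem ?b s')"
    proof (cases "i < m")
      case True
      then have "sem ?b s' = (if (i + 1) div 2 = i div 2 then sem (App 13 1) s' else sem (App 14 1) s')"
        using * s'(1) by (simp add: sem_if_eq del: sem.simps(3))
      note b = this
      have mins: "min i m = i" "min (Suc i) m = i + 1" using True by auto
      show ?thesis
      proof (cases "(i + 1) div 2 = i div 2")
        case True
        then have "(i + 1 + 1) div 2 = Suc ((i + 1) div 2)" by presburger
        then have "sem ?b s' 13 = ones ((i + 1 + 1) div 2)" "sem ?b s' 14 = ones ((i + 1) div 2)"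
          "\<And>k. k \<notin> {8, 13, 14} ==> sem ?b s' k = s' k"
          unfolding b using True *(1,2) mins by (simp_all add: replicate_append_same)
        then show ?thesis using *(3) mins by simp
      next
        case False
        then have "(i + 1) div 2 = Suc (i div 2)" "(i + 1 + 1) div 2 = (i + 1) div 2" by presburger+
        then have "sem ?b s' 13 = ones ((i + 1 + 1) div 2)" "sem ?b s' 14 = ones ((i + 1) div 2)"
          "\<And>k. k \<notin> {8, 13, 14} ==> sem ?b s' k = s' k"
          unfolding b using False *(1,2) mins by (simp_all add: replicate_append_same)
        then show ?thesis using *(3) mins by simp
      qed
    next
      case False
      then have "sem ?b s' = s'" using * s'(1) by simp
      then show ?thesis using * False by (simp add: min_def)
    qed
  qed blast
  define r2 where "r2 = sem (For 8 2 ?b) r1"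
  have r2: "r2 14 = ones (m div 2)" "r2 2 = ones N" "\<And>k. k \<notin> {8, 13, 14} ==> r2 k = r k"
    using s assms unfolding r2_def by (auto simp: min_def)
  have eq: "sem halve r = sem (copy 11 14) r2" unfolding halve_def r2_def r1_def sem.simps(5) ..
  have "m div 2 \<le> N" using assms(3) by linarith
  note c = sem_copy[OF r2(2,1) this, of 11]
  show "sem halve r 11 = ones (m div 2)" unfolding eq using c(1) by simp
  show "k \<notin> {8, 11, 13, 14} ==> sem halve r k = r k" unfolding eq using c(2) r2(3) by simp
qed

definition ask :: "bool => bool => prog => prog" where
  "ask b c p = Clear 1 ;; emit (ESeq Ecopy (ESeq (EBit b) (EBit c))) 0 ;; p"

definition search_prog :: prog where
  "search_prog = Test 11 9 (\<lambda>b. b ~= 0)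
     (halve ;; ask False False (add_len 1 10 8 ;; add_len 1 11 8)) (App 6 1 ;; ask True False Skip)"

text \<open>Register 6 records the phase: empty during the search, \<open>[1]\<close> once it has
  been asked whether the labelling is legal, \<open>[2]\<close> once the last query has been asked.
  Register 5 holds the answer to the previous query and is empty only in the first round. The last
  query looks for a nearest labelling that fails at \<open>g'\<close>, so here the answer no is the
  favourable one; the format \<open>phi\<close> is evaluated only then.\<close>

definition theta_prog :: "unit fm => prog" where
  "theta_prog phi = Test 5 9 (\<lambda>b. b = 0) (copy 11 2 ;; halve) Skip ;;
     Test 6 9 (\<lambda>b. b = 0)
       (Test 5 9 (\<lambda>b. b = 1) (add_len 10 11 8 ;; App 10 1) Skip ;;
        search_prog)
       (Test 6 9 (\<lambda>b. b = 1)
          (Test 5 9 (\<lambda>b. b = 1) (App 4 1) (Clear 6 ;; App 6 2 ;; ask False True (add_len 1 10 8)))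
          (Test 5 9 (\<lambda>b. b = 1) (feval phi 0 ;; if_set (treg 0) (App 4 2) (App 4 1)) (App 4 1)))"

lemma wfp_theta: "wfp (theta_prog phi)"
  by (simp add: theta_prog_def search_prog_def ask_def halve_def copy_def add_len_def if_eq_def if_set_def wfp_feval wfp_emit bit_symbol_def)

definition theta_regs :: "nat => word => regs => bool" where
  "theta_regs N w r = (env_regs N (bits w) [] (\<lambda>_. 0) r & r 4 = [])"

lemma theta_regs_upd:
  "theta_regs N w r ==> (\<And>k. k \<notin> {1, 5, 6, 8, 10, 11, 13, 14} ==> k \<notin> scratch 0 ==> r' k = r k) ==> theta_regs N w r'"
  unfolding theta_regs_def env_regs_def by auto

lemma sem_ask:
  assumes "theta_regs N w r" "length w \<le> N"
  shows "\<exists>s. sem (ask b c p) r = sem p s & s 1 = bits (query w b c 0) & theta_regs N w s &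
    (\<forall>k. k \<notin> scratch 0 \<union> {1} --> s k = r k)"
proof -
  define r1 where "r1 = sem (Clear 1) r"
  have r1: "r1 1 = []" "\<And>k. k ~= 1 ==> r1 k = r k" by (simp_all add: r1_def)
  have t1: "theta_regs N w r1" by (rule theta_regs_upd[OF assms(1)]) (use r1 in auto)
  let ?E = "ESeq Ecopy (ESeq (EBit b) (EBit c))"
  define s where "s = sem (emit ?E 0) r1"
  have "unary_em ?E" by (simp add: Ecopy_def)
  from emit[OF this, of N "bits w" "[]" "\<lambda>_. 0" r1 0] t1
  have s: "s 1 = bits (emw N (bits w) (guess_rel []) ?E (\<lambda>_. 0))" "\<forall>k. k \<notin> scratch 0 --> k ~= 1 --> s k = r1 k"
    unfolding theta_regs_def s_def using r1 by auto
  have "s 1 = bits (query w b c 0)"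
    unfolding s(1) using emw_Ecopy[OF assms(2)] by (simp add: query_def)
  moreover have "theta_regs N w s" by (rule theta_regs_upd[OF t1]) (use s(2) in auto)
  moreover have "sem (ask b c p) r = sem p s" unfolding ask_def s_def r1_def sem.simps(5) ..
  ultimately show ?thesis using s(2) r1(2) by auto
qed

lemma bits_query: "bits (query w b c k) @ ones j = bits (query w b c (k + j))"
  by (simp add: query_def bits_def bit_symbol_def replicate_add)

fun halvings :: "nat => nat" where
  "halvings m = (if m = 0 then 0 else Suc (halvings (m div 2)))"

declare halvings.simps [simp del]

lemma halvings_le: "m < 2 ^ k ==> halvings m \<le> k"
proof (induction k arbitrary: m)
  case 0
  then show ?case by (simp add: halvings.simps)
next
  case (Suc k)
  show ?case
  proof (cases "m = 0")
    case False
    have "halvings (m div 2) \<le> k" by (rule Suc.IH) (use Suc.prems in auto)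
    then show ?thesis by (subst halvings.simps) simp
  qed (simp add: halvings.simps)
qed

lemma search_prog_query:
  assumes "theta_regs N w r" "length w \<le> N" "r 6 = []" "r 10 = ones l" "r 11 = ones m" "l + 2 * m \<le> N" "m ~= 0"
  defines "s \<equiv> sem search_prog r"
  shows "theta_regs N w s" "s 6 = []" "s 10 = ones l" "s 11 = ones (m div 2)"
    "s 1 = bits (query w False False (l + m div 2))"
proof -
  have r2: "r 2 = ones N" "r 9 = []" using assms(1) by (simp_all add: theta_regs_def env_regs_def)
  define r1 where "r1 = sem halve r"
  have r1: "r1 11 = ones (m div 2)" "\<And>k. k \<notin> {8, 11, 13, 14} ==> r1 k = r k"
    unfolding r1_def using sem_halve[OF r2(1) assms(5)] assms(6) by simp_all
  have t1: "theta_regs N w r1" by (rule theta_regs_upd[OF assms(1)]) (use r1(2) in auto)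
  obtain r3 where r3: "sem (ask False False (add_len 1 10 8 ;; add_len 1 11 8)) r1 = sem (add_len 1 10 8 ;; add_len 1 11 8) r3"
    "r3 1 = bits (query w False False 0)" "theta_regs N w r3" "\<forall>k. k \<notin> scratch 0 \<union> {1} --> r3 k = r1 k"
    using sem_ask[OF t1 assms(2)] by blast
  have v: "r3 2 = ones N" "r3 10 = ones l" "r3 11 = ones (m div 2)" "r3 6 = []"
    using r3(4) r1 r2 assms by simp_all
  define r4 where "r4 = sem (add_len 1 10 8) r3"
  have l: "l \<le> N" "m div 2 \<le> N" using assms(6) by auto
  note a = sem_add_len[OF v(1,2) l(1), of 1 8, folded r4_def]
  have r4: "r4 1 = bits (query w False False l)" "\<And>k. k ~= 1 ==> k ~= 8 ==> r4 k = r3 k"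
    using a r3(2) bits_query[of w False False 0 l] by simp_all
  have v4: "r4 2 = ones N" "r4 11 = ones (m div 2)" using r4(2) v by simp_all
  note b = sem_add_len[OF v4 l(2), of 1 8]
  have s: "s = sem (add_len 1 11 8) r4"
    using assms(7) r2 assms(5) r3(1) unfolding s_def search_prog_def r4_def r1_def by simp
  show "s 1 = bits (query w False False (l + m div 2))"
    unfolding s using b(1) r4(1) bits_query[of w False False l "m div 2"] by simp
  have o: "s k = r3 k" if "k ~= 1" "k ~= 8" for k unfolding s using b(2) r4(2) that by simp
  show "theta_regs N w s" by (rule theta_regs_upd[OF r3(3)]) (use o in auto)
  show "s 6 = []" "s 10 = ones l" "s 11 = ones (m div 2)" using o v by simp_all
qed

lemma search_prog_end:
  assumes "theta_regs N w r" "length w \<le> N" "r 6 = []" "r 10 = ones l" "r 11 = []"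
  defines "s \<equiv> sem search_prog r"
  shows "theta_regs N w s" "s 6 = [1]" "s 10 = ones l" "s 1 = bits (query w True False 0)"
proof -
  have r9: "r 9 = []" using assms(1) by (simp add: theta_regs_def env_regs_def)
  define r1 where "r1 = sem (App 6 1) r"
  have r1: "r1 6 = [1]" "\<And>k. k ~= 6 ==> r1 k = r k" using assms(3) by (simp_all add: r1_def)
  have t1: "theta_regs N w r1" by (rule theta_regs_upd[OF assms(1)]) (use r1(2) in auto)
  obtain r3 where r3: "sem (ask True False Skip) r1 = sem Skip r3"
    "r3 1 = bits (query w True False 0)" "theta_regs N w r3" "\<forall>k. k \<notin> scratch 0 \<union> {1} --> r3 k = r1 k"
    using sem_ask[OF t1 assms(2)] by blast
  have s: "s = r3"
    using r9 assms(5) r3(1) unfolding s_def search_prog_def r1_def by (simp add: nth0_def)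
  show "theta_regs N w s" "s 6 = [1]" "s 10 = ones l" "s 1 = bits (query w True False 0)"
    unfolding s using r3 r1 assms(4) by simp_all
qed

definition theta_accepts :: "word set => unit fm => nat => word => nat => bool" where
  "theta_accepts B phi N w d = (ev N (bits w) (guess_rel []) phi (\<lambda>_. 0) &
     query w True False 0 \<in> B & query w False True d \<notin> B)"

text \<open>The upper half of an interval may overshoot by one in each round. The invariant
  \<open>l + 2 * m \<le> N\<close> absorbs this and keeps all numbers within the bound of the loops
  that append them to a query; it is the reason for starting with half of \<open>N\<close>. At most
  two queries follow the search.\<close>

lemma theta_halts:
  assumes "unary phi" "length w \<le> N"
    and "sem (theta_prog phi) r0 = sem search_prog r" "theta_regs N w r" "r 6 = []" "r 10 = ones l" "r 11 = ones m"
    and "l + 2 * m \<le> N"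
  shows "\<exists>J\<le>halvings m + 2. halts B (theta_prog phi) r0 J
    (if theta_accepts B phi N w (search (\<lambda>k. query w False False k \<in> B) l m) then 2 else 1)"
  using assms(3-)
proof (induction m arbitrary: l r0 r rule: less_induct)
  case (less m)
  define Q where "Q = (\<lambda>k. query w False False k \<in> B)"
  let ?p = "theta_prog phi"
  show ?case
  proof (cases "m = 0")
    case False
    define s where "s = sem search_prog r"
    note s = search_prog_query[OF less.prems(2) assms(2) less.prems(3-6) False, folded s_def]
    define r1 where "r1 = round B ?p r0"
    have wo: "word_of (s 1) = query w False False (l + m div 2)" unfolding s(5) by (rule word_of_bits)
    have r1: "r1 5 = [if Q (l + m div 2) then 2 else 1]" "\<And>k. k ~= 5 ==> r1 k = s k"
      unfolding r1_def round_def less.prems(1) s_def[symmetric] wo by (simp_all add: Q_def)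
    have t1: "theta_regs N w r1" by (rule theta_regs_upd[OF s(1)]) (use r1(2) in auto)
    have r9: "r1 9 = []" "r1 2 = ones N" using t1 by (simp_all add: theta_regs_def env_regs_def)
    have v: "r1 6 = []" "r1 10 = ones l" "r1 11 = ones (m div 2)" using s r1(2) by simp_all
    let ?l = "if Q (l + m div 2) then l else l + m div 2 + 1"
    define r2 where "r2 = (if Q (l + m div 2) then r1 else sem (App 10 1) (sem (add_len 10 11 8) r1))"
    have p: "sem ?p r1 = sem search_prog r2"
      unfolding theta_prog_def r2_def using r1(1) r9 v(1) by (simp add: nth0_def)
    have m2: "m div 2 \<le> N" "m div 2 + 1 \<le> m" using less.prems(6) False by auto
    have r2: "r2 10 = ones ?l" "\<And>k. k \<notin> {8, 10} ==> r2 k = r1 k"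
    proof -
      note a = sem_add_len[OF r9(2) v(3) m2(1), of 10 8]
      show "r2 10 = ones ?l"
        using a(1) v(2) by (simp add: r2_def replicate_add[symmetric] replicate_append_same)
      show "\<And>k. k \<notin> {8, 10} ==> r2 k = r1 k" using a(2) by (auto simp: r2_def)
    qed
    have "theta_regs N w r2" by (rule theta_regs_upd[OF t1]) (use r2(2) in auto)
    moreover have "r2 6 = []" "r2 11 = ones (m div 2)" using r2(2) v by simp_all
    moreover have "?l + 2 * (m div 2) \<le> N" using less.prems(6) m2 by auto
    moreover have "m div 2 < m" using False by simp
    ultimately obtain J where J: "J \<le> halvings (m div 2) + 2"
      "halts B ?p r1 J (if theta_accepts B phi N w (search Q ?l (m div 2)) then 2 else 1)"
      using less.IH[of "m div 2" r1 r2 ?l] p r2(1) unfolding Q_def by blast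
    have se: "search Q l m = search Q ?l (m div 2)" using False by (subst search.simps) simp
    have "sem ?p r0 4 = []" using s(1) unfolding less.prems(1) s_def by (simp add: theta_regs_def)
    then have "halts B ?p r0 (Suc J) (if theta_accepts B phi N w (search Q l m) then 2 else 1)"
      unfolding halts_Suc se using J(2) by (simp add: r1_def)
    moreover have "Suc J \<le> halvings m + 2" using J(1) False by (subst halvings.simps) simp
    ultimately show ?thesis unfolding Q_def by blast
  next
    case True
    have "r 11 = []" using less.prems(5) True by simp
    define s where "s = sem search_prog r"
    note s = search_prog_end[OF less.prems(2) assms(2) less.prems(3,4) \<open>r 11 = []\<close>, folded s_def]
    have se: "search Q l m = l" using True by (simp add: search.simps)
    define r1 where "r1 = round B ?p r0"
    have wo: "word_of (s 1) = query w True False 0" unfolding s(4) by (rule word_of_bits)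
    have r1: "r1 5 = [if query w True False 0 \<in> B then 2 else 1]" "\<And>k. k ~= 5 ==> r1 k = s k"
      unfolding r1_def round_def less.prems(1) s_def[symmetric] wo by simp_all
    have t1: "theta_regs N w r1" by (rule theta_regs_upd[OF s(1)]) (use r1(2) in auto)
    have r9: "r1 9 = []" "r1 2 = ones N" "r1 4 = []" using t1 by (simp_all add: theta_regs_def env_regs_def)
    have s4: "sem ?p r0 4 = []" using s(1) unfolding less.prems(1) s_def by (simp add: theta_regs_def)
    show ?thesis
    proof (cases "query w True False 0 \<in> B")
      case False
      have "sem ?p r1 4 = [1]"
        unfolding theta_prog_def using r1(1) r9 s(2) r1(2)[of 6] False by (simp add: nth0_def)
      then have "halts B ?p r0 1 1" unfolding One_nat_def halts_Suc halts_0 using s4 by (simp add: r1_def)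
      then show ?thesis using False by (intro exI[of _ 1]) (simp add: theta_accepts_def)
    next
      case T: True
      define r2 where "r2 = sem (App 6 2) (sem (Clear 6) r1)"
      have r2: "r2 6 = [2]" "\<And>k. k ~= 6 ==> r2 k = r1 k" by (simp_all add: r2_def)
      have t2: "theta_regs N w r2" by (rule theta_regs_upd[OF t1]) (use r2(2) in auto)
      have p1: "sem ?p r1 = sem (ask False True (add_len 1 10 8)) r2"
        unfolding theta_prog_def r2_def using r1(1) r9 s(2) r1(2)[of 6] T by (simp add: nth0_def)
      obtain r3 where r3: "sem (ask False True (add_len 1 10 8)) r2 = sem (add_len 1 10 8) r3"
        "r3 1 = bits (query w False True 0)" "theta_regs N w r3" "\<forall>k. k \<notin> scratch 0 \<union> {1} --> r3 k = r2 k"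
        using sem_ask[OF t2 assms(2)] by blast
      have v3: "r3 2 = ones N" "r3 10 = ones l" "l \<le> N" "r3 6 = [2]"
        using r3(3,4) r2 r1(2) s less.prems(6) by (simp_all add: theta_regs_def env_regs_def)
      define r4 where "r4 = sem (add_len 1 10 8) r3"
      note a = sem_add_len[OF v3(1-3), of 1 8, folded r4_def]
      have r4: "r4 1 = bits (query w False True l)" "\<And>k. k ~= 1 ==> k ~= 8 ==> r4 k = r3 k"
        using a r3(2) bits_query[of w False True 0 l] by simp_all
      have t4: "theta_regs N w r4" by (rule theta_regs_upd[OF r3(3)]) (use r4(2) in auto)
      have p1': "sem ?p r1 = r4" using p1 r3(1) by (simp add: r4_def)
      define r5 where "r5 = round B ?p r1"
      have wo: "word_of (r4 1) = query w False True l" unfolding r4(1) by (rule word_of_bits)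
      have r5: "r5 5 = [if query w False True l \<in> B then 2 else 1]" "\<And>k. k ~= 5 ==> r5 k = r4 k"
        unfolding r5_def round_def p1' wo by simp_all
      have t5: "theta_regs N w r5" by (rule theta_regs_upd[OF t4]) (use r5(2) in auto)
      have r59: "r5 9 = []" "r5 4 = []" "r5 6 = [2]"
        using t5 r5(2)[of 6] r4(2)[of 6] v3 by (simp_all add: theta_regs_def env_regs_def)
      define r6 where "r6 = sem (feval phi 0) r5"
      have e5: "env_regs N (bits w) [] (\<lambda>_. 0) r5" using t5 by (simp add: theta_regs_def)
      note r6 = evaluatesD[OF evaluates[OF assms(1)] e5, where d = 0, folded r6_def]
      have r69: "r6 9 = []" "r6 4 = []" using r6(2)[of 4] r6(3) r59 by (simp_all add: env_regs_def)
      have fin: "sem ?p r5 4 = [if theta_accepts B phi N w l then 2 else 1]"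
      proof (cases "query w False True l \<in> B")
        case True
        then show ?thesis
          unfolding theta_prog_def using r5(1) r59 by (simp add: nth0_def theta_accepts_def)
      next
        case False
        then have "sem ?p r5 = sem (if_set (treg 0) (App 4 2) (App 4 1)) r6"
          unfolding theta_prog_def r6_def using r5(1) r59 by (simp add: nth0_def)
        also have "\<dots> = (if ev N (bits w) (guess_rel []) phi (\<lambda>_. 0) then sem (App 4 2) r6 else sem (App 4 1) r6)"
          using r6(1) r69 by (subst sem_if_set) auto
        finally show ?thesis using r69 False T by (simp add: theta_accepts_def)
      qed
      have "halts B ?p r0 2 (if theta_accepts B phi N w l then 2 else 1)"
        unfolding numeral_2_eq_2 halts_Suc halts_0 r1_def[symmetric] r5_def[symmetric]
        using s4 p1' t4 fin by (simp add: theta_regs_def)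
      then show ?thesis using se unfolding Q_def by (intro exI[of _ 2]) simp
    qed
  qed
qed

text \<open>The search halves a number below \<open>(n + a) ^ a\<close>, which takes at most
  \<open>a\<close> times the binary logarithm of \<open>n + a + 1\<close>, rounded up. The summand 2
  stands for the queries after the search.\<close>

definition log_bound :: "nat => nat => nat" where
  "log_bound a n = a * nat \<lceil>log 2 (real (n + a + 1))\<rceil> + 2"

lemma less_log_bound:
  assumes "0 < a"
  shows "halvings (bound a w) + 2 \<le> log_bound a (length w)"
proof -
  define k where "k = nat \<lceil>log 2 (real (length w + a + 1))\<rceil>"
  have "real (length w + a + 1) = 2 powr log 2 (real (length w + a + 1))" by simp
  also have "\<dots> \<le> 2 powr real k"
    unfolding k_def by (intro powr_mono) (auto simp: real_nat_ceiling_ge)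
  also have "\<dots> = real (2 ^ k)" by (simp add: powr_realpow)
  finally have "length w + a + 1 \<le> 2 ^ k" unfolding of_nat_le_iff .
  then have "length w + a < 2 ^ k" by simp
  then have "bound a w < (2 ^ k) ^ a" unfolding bound_def using assms by (intro power_strict_mono) auto
  then have "halvings (bound a w) \<le> k * a" by (intro halvings_le) (simp add: power_mult)
  then show ?thesis by (simp add: log_bound_def k_def mult.commute)
qed

lemma log_bound_bigo: "(\<lambda>n. real (log_bound a n)) \<in> O(\<lambda>n. ln (real n))"
proof -
  have 1: "(\<lambda>n::nat. 1 :: real) \<in> O(\<lambda>n. ln (real n))"
  proof (rule bigoI[of _ 1])
    show "\<forall>\<^sub>F n in sequentially. norm (1::real) \<le> 1 * norm (ln (real n))"
    proof (rule eventually_sequentiallyI[of 3])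
      fix n :: nat assume "3 \<le> n"
      then have "exp 1 \<le> real n" using exp_le by linarith
      then have "1 \<le> ln (real n)" using \<open>3 \<le> n\<close> by (subst ln_ge_iff) auto
      then show "norm (1::real) \<le> 1 * norm (ln (real n))" by simp
    qed
  qed
  have 2: "(\<lambda>n. real (nat \<lceil>log 2 (real (n + a + 1))\<rceil>)) \<in> O(\<lambda>n. ln (real n))"
  proof (rule bigoI[of _ "2 / ln 2 + 1"])
    show "\<forall>\<^sub>F n in sequentially. norm (real (nat \<lceil>log 2 (real (n + a + 1))\<rceil>)) \<le> (2 / ln 2 + 1) * norm (ln (real n))"
    proof (rule eventually_sequentiallyI[of "a + 3"])
      fix n :: nat assume n: "a + 3 \<le> n"
      have "exp 1 \<le> real n" using exp_le n by linarith
      then have l1: "1 \<le> ln (real n)" using n by (subst ln_ge_iff) auto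
      \<comment> \<open>Passing to \<open>n * n\<close> turns the shift by \<open>a + 1\<close> into
        a factor 2 in front of the logarithm.\<close>
      have "n + a + 1 \<le> 2 * n" "2 * n \<le> n * n" using n by auto
      then have "real (n + a + 1) \<le> real n * real n"
        by (metis of_nat_le_iff of_nat_mult order_trans)
      then have "ln (real (n + a + 1)) \<le> ln (real n * real n)" using n by (subst ln_le_cancel_iff) auto
      also have "\<dots> = 2 * ln (real n)" using n by (subst ln_mult) auto
      finally have "log 2 (real (n + a + 1)) \<le> 2 * ln (real n) / ln 2"
        unfolding log_def by (intro divide_right_mono) auto
      moreover have "real (nat \<lceil>log 2 (real (n + a + 1))\<rceil>) \<le> log 2 (real (n + a + 1)) + 1"
      proof -
        have "0 \<le> log 2 (real (n + a + 1))" by (subst zero_le_log_cancel_iff) auto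
        then show ?thesis by linarith
      qed
      ultimately have "real (nat \<lceil>log 2 (real (n + a + 1))\<rceil>) \<le> 2 * ln (real n) / ln 2 + ln (real n)"
        using l1 by linarith
      also have "\<dots> = (2 / ln 2 + 1) * ln (real n)" by (simp add: algebra_simps)
      finally show "norm (real (nat \<lceil>log 2 (real (n + a + 1))\<rceil>)) \<le> (2 / ln 2 + 1) * norm (ln (real n))"
        unfolding real_norm_def using l1 by (simp only: abs_of_nat)
    qed
  qed
  have "(\<lambda>n. real a * real (nat \<lceil>log 2 (real (n + a + 1))\<rceil>) + 2 * 1) \<in> O(\<lambda>n. ln (real n))"
    using 1 2 by (intro sum_in_bigo(1) landau_o.big.mult_in_1 cmult_in_bigo_iff[THEN iffD2]) auto
  then show ?thesis unfolding log_bound_def of_nat_add of_nat_mult by simp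
qed

lemma polyb_log_bound: "polyb (log_bound a)"
proof -
  have "log_bound a n \<le> a * (n + a + 1) + 2" for n
  proof -
    define m where "m = n + a + 1"
    have "real m < 2 ^ m" by (rule of_nat_less_two_power)
    also have "\<dots> = 2 powr real m" by (simp add: powr_realpow)
    finally have "log 2 (real m) \<le> real m" by (subst log_le_iff) (auto simp: m_def)
    then have "log 2 (real (n + a + 1)) \<le> real (n + a + 1)" by (simp only: m_def)
    then have "nat \<lceil>log 2 (real (n + a + 1))\<rceil> \<le> n + a + 1" by linarith
    then show ?thesis unfolding log_bound_def by (intro add_le_mono1 mult_le_mono2)
  qed
  moreover have "polyb (\<lambda>n. a * (n + a + 1) + 2)" by (intro polyb_intros)
  ultimately show ?thesis unfolding polyb_def by (meson order_trans)
qed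

theorem log_query_class_search:
  assumes "unary phi" "2 \<le> a" "B \<in> C"
  shows "{w. theta_accepts B phi (bound a w) w (search (\<lambda>k. query w False False k \<in> B) 0 (bound a w div 2))}
    \<in> log_query_class C"
proof -
  obtain h where h: "8 \<le> h" "wf_prog h 3 {2} (theta_prog phi)" using wfp_theta by (rule wfp_wf_prog)
  show ?thesis
  proof (rule log_query_classI[OF h assms(3) polyb_log_bound log_bound_bigo])
    fix w
    let ?N = "bound a w" and ?r = "base_regs a w []"
    have e: "env_regs ?N (bits w) [] (\<lambda>_. 0) ?r" using env_base_regs[of a w "[]"] assms(2) by (simp add: bits_def)
    have len: "length w \<le> ?N"
    proof -
      have "length w \<le> (length w + a) ^ 1" by simp
      also have "\<dots> \<le> ?N" unfolding bound_def using assms(2) by (intro power_increasing) auto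
      finally show ?thesis .
    qed
    have t: "theta_regs ?N w ?r" using e by (simp add: theta_regs_def base_regs_def)
    have v: "?r 2 = ones ?N" "?r 5 = []" "?r 6 = []" "?r 9 = []" "?r 10 = []" by (simp_all add: base_regs_def)
    define r1 where "r1 = sem (copy 11 2) ?r"
    have r1: "r1 11 = ones ?N" "\<And>k. k ~= 11 ==> k ~= 8 ==> r1 k = ?r k"
      unfolding r1_def using sem_copy_bound[where r = ?r and N = ?N and u = 11] v(1) by simp_all
    define r2 where "r2 = sem halve r1"
    have r12: "r1 2 = ones ?N" using r1(2) v by simp
    have r2: "r2 11 = ones (?N div 2)" "\<And>k. k \<notin> {8, 11, 13, 14} ==> r2 k = r1 k"
      unfolding r2_def using sem_halve[OF r12 r1(1)] by simp_all
    have t2: "theta_regs ?N w r2" by (rule theta_regs_upd[OF t]) (use r1(2) r2(2) in auto)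
    have v2: "r2 5 = []" "r2 6 = []" "r2 9 = []" "r2 10 = ones 0" using v r1(2) r2(2) by simp_all
    have "sem (theta_prog phi) ?r = sem search_prog r2"
      unfolding theta_prog_def using v v2 by (simp add: nth0_def r2_def r1_def)
    from theta_halts[OF assms(1) len this t2 v2(2,4) r2(1), of B] obtain J where
      J: "J \<le> halvings (?N div 2) + 2"
      "halts B (theta_prog phi) ?r J (if theta_accepts B phi ?N w (search (\<lambda>k. query w False False k \<in> B) 0 (?N div 2)) then 2 else 1)"
      by auto
    have "halvings (?N div 2) \<le> halvings ?N" by (subst (2) halvings.simps) (simp add: halvings.simps)
    with J(1) less_log_bound[of a w] assms(2) have "J \<le> log_bound a (length w)" by linarith
    with J(2) show "\<exists>J\<le>log_bound a (length w). halts B (theta_prog phi) ?r J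
      (if theta_accepts B phi ?N w (search (\<lambda>k. query w False False k \<in> B) 0 (?N div 2)) then 2 else 1)"
      by blast
  qed
qed

section \<open>Argumentation frameworks\<close>

lemma Def_mono: "S \<subseteq> T ==> Def F S \<subseteq> Def F T" by (auto simp: Def_def)

lemma Acc_mono: "S \<subseteq> T ==> Acc F S \<subseteq> Acc F T" using Def_mono[of S T F] by (auto simp: Acc_def)

lemma Def_subset: "Def F S \<subseteq> args F" by (auto simp: Def_def)

lemma complete_iff: "complete_ext F S = (S = Acc F S & S \<inter> Def F S = {})"
  unfolding complete_ext_def admissible_def conflict_free_def Acc_def by blast

lemma complete_subset: "complete_ext F S ==> S \<subseteq> args F"
  unfolding complete_ext_def admissible_def by blast

text \<open>Dung's fundamental lemma.\<close>

lemma admissible_insert: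
  assumes "is_af F" "admissible F S" "a \<in> Acc F S"
  shows "admissible F (insert a S)"
proof -
  have R: "attacks F \<subseteq> args F \<times> args F" using assms(1) by (simp add: is_af_def)
  have S: "S \<subseteq> args F" "S \<inter> Def F S = {}" "S \<subseteq> Acc F S"
    using assms(2) by (auto simp: admissible_def conflict_free_def)
  have a: "a \<in> args F" using assms(3) by (simp add: Acc_def)
  have sub: "insert a S \<subseteq> Acc F S" using S(3) assms(3) by blast
  have D: "Def F S \<inter> Acc F S = {}"
  proof (rule ccontr)
    assume "Def F S \<inter> Acc F S ~= {}"
    then obtain x b where "x \<in> Acc F S" "b \<in> S" "(b, x) \<in> attacks F" by (auto simp: Def_def)
    then have "b \<in> Def F S" by (auto simp: Acc_def)
    with \<open>b \<in> S\<close> S(2) show False by blast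
  qed
  have "Def F (insert a S) \<inter> insert a S = {}"
  proof (rule ccontr)
    assume "Def F (insert a S) \<inter> insert a S ~= {}"
    then obtain x b where xb: "x \<in> insert a S" "b \<in> insert a S" "(b, x) \<in> attacks F" by (auto simp: Def_def)
    then have "b \<in> Def F S" using sub by (auto simp: Acc_def)
    then show False using D sub xb(2) by blast
  qed
  moreover have "insert a S \<subseteq> Acc F (insert a S)" using sub Acc_mono[of S "insert a S" F] by blast
  ultimately show ?thesis using S a by (auto simp: admissible_def conflict_free_def)
qed

text \<open>A maximal admissible superset exists by finiteness; by the fundamental lemma it contains
  everything it defends, so it is complete and hence preferred.\<close>

lemma admissible_extends:
  assumes "is_af F" "admissible F S"
  obtains T where "S \<subseteq> T" "preferred_ext F T"
proof -
  have fin: "finite {T. admissible F T & S \<subseteq> T}"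
    by (rule finite_subset[of _ "Pow (args F)"]) (use assms(1) in \<open>auto simp: is_af_def admissible_def\<close>)
  have "S \<in> {T. admissible F T & S \<subseteq> T}" using assms(2) by simp
  from finite_has_maximal2[OF fin this] obtain T where
    "T \<in> {T. admissible F T & S \<subseteq> T}" "\<forall>U\<in>{T. admissible F T & S \<subseteq> T}. T \<subseteq> U --> T = U"
    by (elim bexE conjE)
  then have T: "admissible F T" "S \<subseteq> T"
    and mx: "\<And>U. admissible F U ==> S \<subseteq> U ==> T \<subseteq> U ==> T = U" by simp_all
  have "Acc F T \<subseteq> T"
  proof
    fix a assume "a \<in> Acc F T"
    from admissible_insert[OF assms(1) T(1) this] mx[of "insert a T"] T(2) show "a \<in> T" by blast
  qed
  then have c: "complete_ext F T" using T(1) unfolding complete_ext_def admissible_def by blast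
  moreover have "~ (\<exists>U. complete_ext F U & T \<subset> U)" using mx T(2) unfolding complete_ext_def by blast
  ultimately show ?thesis using that[of T] T(2) unfolding preferred_ext_def by blast
qed

lemma complete_extends:
  assumes "is_af F" "complete_ext F S"
  obtains T where "S \<subseteq> T" "preferred_ext F T"
  using admissible_extends[OF assms(1), of S] assms(2) unfolding complete_ext_def by blast

lemma complete_full_preferred:
  assumes "complete_ext F S" "S \<union> Def F S = args F"
  shows "preferred_ext F S"
proof -
  have False if T: "complete_ext F T" "S \<subset> T" for T
  proof -
    obtain x where "x \<in> T" "x \<notin> S" using T(2) by blast
    then have "x \<in> Def F S" using complete_subset[OF T(1)] assms(2) by blast
    then have "x \<in> Def F T" using Def_mono[of S T F] T(2) by blast
    with \<open>x \<in> T\<close> T(1) show False by (auto simp: complete_iff)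
  qed
  then show ?thesis using assms(1) unfolding preferred_ext_def by blast
qed

lemma stable_iff: "stable_ext F S = (complete_ext F S & S \<union> Def F S = args F)"
  using complete_full_preferred unfolding stable_ext_def preferred_ext_def by blast

text \<open>Competitors may be taken among the complete extensions, since each of them extends to a
  preferred one of no smaller range. This makes the condition on a competitor first-order.\<close>

lemma semi_stable_iff:
  assumes "is_af F"
  shows "semi_stable_ext F S = (preferred_ext F S &
    ~ (\<exists>T. complete_ext F T & S \<union> Def F S \<subset> T \<union> Def F T))"
proof -
  have "\<exists>U. preferred_ext F U & S \<union> Def F S \<subset> U \<union> Def F U"
    if T: "complete_ext F T" "S \<union> Def F S \<subset> T \<union> Def F T" for T
  proof -
    obtain U where "T \<subseteq> U" "preferred_ext F U" using complete_extends[OF assms T(1)] .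
    moreover have "T \<union> Def F T \<subseteq> U \<union> Def F U" using \<open>T \<subseteq> U\<close> Def_mono[of T U F] by blast
    ultimately show ?thesis using psubset_subset_trans[OF T(2)] by (intro exI[of _ U] conjI)
  qed
  moreover have "complete_ext F T" if "preferred_ext F T" for T
    using that by (simp add: preferred_ext_def)
  ultimately show ?thesis unfolding semi_stable_ext_def by meson
qed

text \<open>Finiteness gives a maximal range above that of \<open>S\<close>. Only the range is
  preserved: the extension found need not contain \<open>S\<close>, so choices have to be recovered
  from the range.\<close>

lemma preferred_range_extends:
  assumes "is_af F" "preferred_ext F S"
  obtains T where "semi_stable_ext F T" "S \<union> Def F S \<subseteq> T \<union> Def F T"
proof -
  let ?X = "{T. preferred_ext F T & S \<union> Def F S \<subseteq> T \<union> Def F T}"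
  have fin: "finite ?X" by (rule finite_subset[of _ "Pow (args F)"])
      (use assms(1) complete_subset in \<open>auto simp: is_af_def preferred_ext_def\<close>)
  let ?r = "\<lambda>T. T \<union> Def F T"
  have "finite (?r ` ?X)" "?r S \<in> ?r ` ?X" using fin assms(2) by auto
  from finite_has_maximal2[OF this] obtain m where m: "m \<in> ?r ` ?X" "\<forall>b\<in>?r ` ?X. m \<subseteq> b --> m = b"
    by (elim bexE conjE)
  then obtain T where T: "preferred_ext F T" "?r S \<subseteq> ?r T" "m = ?r T" by auto
  have mx: "?r T = ?r U" if "preferred_ext F U" "?r S \<subseteq> ?r U" "?r T \<subseteq> ?r U" for U
    using m(2) that unfolding T(3) by blast
  have "semi_stable_ext F T" unfolding semi_stable_ext_def
  proof
    show "~ (\<exists>U. preferred_ext F U & ?r T \<subset> ?r U)"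
    proof
      assume "\<exists>U. preferred_ext F U & ?r T \<subset> ?r U"
      then obtain U where U: "preferred_ext F U" "?r T \<subset> ?r U" by (elim exE conjE)
      have 1: "?r T \<subseteq> ?r U" using U(2) by (rule psubset_imp_subset)
      have 2: "?r S \<subseteq> ?r U" using T(2) 1 by (rule subset_trans)
      from mx[OF U(1) 2 1] U(2) show False by (simp only: psubset_eq) blast
    qed
  qed (rule T(1))
  then show ?thesis using that T(2) by simp
qed

lemma extension_complete: "extension s F S ==> complete_ext F S"
  by (cases s) (auto simp: stable_ext_def preferred_ext_def semi_stable_ext_def)

lemma labelling_of_In: "labelling_of F S a = In \<longleftrightarrow> a \<in> S" by (simp add: labelling_of_def)

lemma labelling_of_Out: "complete_ext F S ==> labelling_of F S a = Out \<longleftrightarrow> a \<in> Def F S"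
  by (auto simp: labelling_of_def complete_iff)

lemma label_eq_iff: "x = y \<longleftrightarrow> (x = In \<longleftrightarrow> y = In) & (x = Out \<longleftrightarrow> y = Out)" by (cases x; cases y) auto

text \<open>Distances are natural numbers, so among the labellings that differ at \<open>g\<close>
  some are nearest. Emptiness thus depends on no distance at all, which is what the reductions rely
  on.\<close>

lemma counterfactuals_empty_iff:
  "counterfactuals s F g L = {} \<longleftrightarrow> ~ (\<exists>L'\<in>labellings s F. L g ~= L' g)"
proof
  assume e: "counterfactuals s F g L = {}"
  show "~ (\<exists>L'\<in>labellings s F. L g ~= L' g)"
  proof
    assume "\<exists>L'\<in>labellings s F. L g ~= L' g"
    then obtain L0 where "L0 \<in> labellings s F & L g ~= L0 g" by blast
    from ex_has_least_nat[of "\<lambda>L'. L' \<in> labellings s F & L g ~= L' g", OF this, of "label_dist F L"] obtain L1 where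
      "L1 \<in> labellings s F & L g ~= L1 g"
      "\<forall>y. y \<in> labellings s F & L g ~= y g --> label_dist F L L1 \<le> label_dist F L y" by blast
    then have "L1 \<in> counterfactuals s F g L" by (auto simp: counterfactuals_def not_less)
    then show False using e by simp
  qed
qed (auto simp: counterfactuals_def)

text \<open>The position at which the labels start: before it come the unary number with its
  terminator and the matrix.\<close>

definition base :: "nat => nat" where
  "base n = n + 1 + n * n"

lemma mul_add_less:
  assumes "i < n" "j < (c::nat)"
  shows "i * c + j < n * c"
proof -
  have "i * c + j < Suc i * c" using assms(2) by simp
  also have "\<dots> \<le> n * c" using assms(1) by (intro mult_le_mono1) simp
  finally show ?thesis .
qed

lemma nth_concat_uniform:
  assumes "\<forall>i<m. length (f i) = c" "i < m" "j < c"
  shows "concat (map f [0..<m]) ! (i * c + j) = f i ! j" using assms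
proof (induction m)
  case (Suc m)
  have len: "length (concat (map f [0..<m])) = m * c" using Suc.prems(1) by (induction m) auto
  show ?case
  proof (cases "i < m")
    case True
    then have "i * c + j < m * c" using Suc.prems(3) by (rule mul_add_less)
    then show ?thesis using Suc True len by (simp add: nth_append)
  next
    case False
    then have "i = m" using Suc.prems(2) by simp
    then show ?thesis using len Suc.prems by (simp add: nth_append)
  qed
qed simp

lemma length_concat_uniform: "\<forall>i<m. length (f i) = c ==> length (concat (map f [0..<m])) = m * c"
  by (induction m) auto

lemma length_encode_label [simp]: "length (encode_label l) = 2" by (cases l) auto

lemma length_encode: "length (encode n R g L g') = base n + 4 * n"
proof -
  have "length (concat (map (\<lambda>i. map (\<lambda>j. (i, j) \<in> R) [0..<n]) [0..<n])) = n * n"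
    "length (concat (map (\<lambda>i. encode_label (L i)) [0..<n])) = n * 2"
    by (intro length_concat_uniform; simp)+
  then show ?thesis by (simp add: encode_def base_def)
qed

lemma nth_encode:
  fixes n g g' :: nat and R :: "(nat \<times> nat) set" and L :: "nat => label"
  defines "w \<equiv> encode n R g L g'"
  shows "i < n ==> w ! i" "~ w ! n"
    "i < n ==> j < n ==> w ! (n + 1 + i * n + j) = ((i, j) \<in> R)"
    "i < n ==> w ! (base n + 2 * i) = (L i = In)"
    "i < n ==> w ! (base n + 2 * i + 1) = (L i = Out)"
    "i < n ==> w ! (base n + 2 * n + i) = (i = g)"
    "i < n ==> w ! (base n + 3 * n + i) = (i = g')"
proof -
  let ?A = "replicate n True" and ?M = "concat (map (\<lambda>i. map (\<lambda>j. (i, j) \<in> R) [0..<n]) [0..<n])"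
    and ?L = "concat (map (\<lambda>i. encode_label (L i)) [0..<n])" and ?g = "map (\<lambda>i. i = g) [0..<n]"
    and ?g' = "map (\<lambda>i. i = g') [0..<n]"
  have len: "length ?M = n * n" "length ?L = n * 2" by (intro length_concat_uniform; simp)+
  have w: "w = (?A @ [False]) @ ?M @ ?L @ ?g @ ?g'" by (simp add: w_def encode_def)
  show "i < n ==> w ! i" "~ w ! n" by (simp_all add: w nth_append)
  have 1: "w ! (n + 1 + p) = (?M @ ?L @ ?g @ ?g') ! p" for p
    unfolding w by (subst nth_append_length_plus[of "?A @ [False]", symmetric]) simp
  have 2: "w ! (base n + p) = (?L @ ?g @ ?g') ! p" for p
    using 1[of "n * n + p"] nth_append_length_plus[of ?M "?L @ ?g @ ?g'" p] len(1)
    by (simp add: base_def add.assoc)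
  have 3: "w ! (base n + 2 * n + p) = (?g @ ?g') ! p" for p
    using 2[of "2 * n + p"] nth_append_length_plus[of ?L "?g @ ?g'" p] len(2)
    by (simp add: add.assoc mult.commute)
  show "i < n ==> j < n ==> w ! (n + 1 + i * n + j) = ((i, j) \<in> R)"
  proof -
    assume ij: "i < n" "j < n"
    have "?M ! (i * n + j) = map (\<lambda>j. (i, j) \<in> R) [0..<n] ! j"
      by (rule nth_concat_uniform) (use ij in auto)
    then show ?thesis
      using 1[of "i * n + j"] ij len(1) mul_add_less[OF ij] by (simp add: nth_append add.assoc)
  qed
  have lab: "?L ! (i * 2 + b) = encode_label (L i) ! b" if "i < n" "b < 2" for b
    by (rule nth_concat_uniform) (use that in auto)
  show "i < n ==> w ! (base n + 2 * i) = (L i = In)"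
    using 2[of "2 * i"] lab[of 0] len(2) by (cases "L i") (auto simp: nth_append mult.commute)
  show "i < n ==> w ! (base n + 2 * i + 1) = (L i = Out)"
    using 2[of "2 * i + 1"] lab[of 1] len(2) by (cases "L i") (auto simp: nth_append mult.commute)
  show "i < n ==> w ! (base n + 2 * n + i) = (i = g)" using 3[of i] by (simp add: nth_append)
  have 4: "base n + 3 * n + i = base n + 2 * n + (n + i)" by simp
  show "i < n ==> w ! (base n + 3 * n + i) = (i = g')" unfolding 4 3 by (simp add: nth_append)
qed

section \<open>Membership\<close>

text \<open>Positions in an encoded input are polynomials in the variables. Formulas have no
  function symbols, so terms are unfolded by quantifying over the values of subterms, with the
  variables from \<open>d\<close> on as fresh ones.\<close>

datatype tm = TV nat | TOne | TPlus tm tm | TMul nat nat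

primrec tval :: "tm => (nat => nat) => nat" where
  "tval (TV x) e = e x"
| "tval TOne e = 1"
| "tval (TPlus s t) e = tval s e + tval t e"
| "tval (TMul x y) e = e x * e y"

primrec tbelow :: "tm => nat => bool" where
  "tbelow (TV x) d = (x < d)"
| "tbelow TOne d = True"
| "tbelow (TPlus s t) d = (tbelow s d & tbelow t d)"
| "tbelow (TMul x y) d = (x < d & y < d)"

primrec tmeq :: "tm => nat => nat => 'r fm" where
  "tmeq (TV x) v d = FEq x v"
| "tmeq TOne v d = FAnd (FProd v v v) (FEx d (FLess d v))"
| "tmeq (TPlus s t) v d = FEx d (FAnd (tmeq s d (Suc (Suc d)))
     (FEx (Suc d) (FAnd (tmeq t (Suc d) (Suc (Suc d))) (FSum d (Suc d) v))))"
| "tmeq (TMul x y) v d = FProd x y v"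

lemma tbelow_mono: "tbelow t d ==> d \<le> d' ==> tbelow t d'" by (induction t) auto

lemma tval_upd: "tbelow t d ==> d \<le> d' ==> tval t (e(d' := i)) = tval t e" by (induction t) auto

lemma unary_tmeq [simp]: "unary (tmeq t v d)" by (induction t arbitrary: v d) auto

text \<open>The summands never exceed the value of a sum, so if that value is below \<open>N\<close>
  the bounded quantifiers find them; if it is not, it differs from \<open>e v\<close>
  anyway.\<close>

lemma ev_tmeq:
  "tbelow t d ==> v < d ==> e v < N ==> ev N xs rho (tmeq t v d) e = (e v = tval t e)"
proof (induction t arbitrary: v d e)
  case TOne
  have "e v * e v = e v & (\<exists>i<N. i < e v) \<longleftrightarrow> e v = 1"
  proof
    assume "e v * e v = e v & (\<exists>i<N. i < e v)"
    then have "e v * e v = e v * 1" "e v ~= 0" by auto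
    then show "e v = 1" by (metis mult_cancel1)
  next
    assume "e v = 1"
    then show "e v * e v = e v & (\<exists>i<N. i < e v)" using TOne.prems(3) by (auto intro: exI[of _ 0])
  qed
  then show ?case using TOne.prems(2) by simp
next
  case (TPlus s t)
  have s: "ev N xs rho (tmeq s d (Suc (Suc d))) (e(d := i)) = (i = tval s e)" if "i < N" for i
  proof -
    have "ev N xs rho (tmeq s d (Suc (Suc d))) (e(d := i)) = ((e(d := i)) d = tval s (e(d := i)))"
      by (rule TPlus.IH(1)) (use TPlus.prems that in \<open>simp_all add: tbelow_mono[of s d]\<close>)
    then show ?thesis using TPlus.prems by (simp add: tval_upd[of s d])
  qed
  have t: "ev N xs rho (tmeq t (Suc d) (Suc (Suc d))) (e(d := i, Suc d := j)) = (j = tval t e)" if "j < N" for i j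
  proof -
    have "ev N xs rho (tmeq t (Suc d) (Suc (Suc d))) (e(d := i, Suc d := j)) =
        ((e(d := i, Suc d := j)) (Suc d) = tval t (e(d := i, Suc d := j)))"
      by (rule TPlus.IH(2)) (use TPlus.prems that in \<open>simp_all add: tbelow_mono[of t d]\<close>)
    then show ?thesis using TPlus.prems by (simp add: tval_upd[of t d])
  qed
  have "ev N xs rho (tmeq (TPlus s t) v d) e =
      (\<exists>i<N. i = tval s e & (\<exists>j<N. j = tval t e & i + j = e v))"
    using TPlus.prems(2) by (simp add: s t cong: conj_cong)
  also have "\<dots> = (e v = tval (TPlus s t) e)" using TPlus.prems(3) by auto
  finally show ?case .
qed auto

definition FAt :: "nat => tm => nat => 'r fm" where
  "FAt a t d = FEx d (FAnd (tmeq t d (Suc d)) (FIn a d))"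

lemma unary_FAt [simp]: "unary (FAt a t d)" by (simp add: FAt_def)

lemma ev_FAt:
  assumes "tbelow t d"
  shows "ev N xs rho (FAt a t d) e = (tval t e < N & nth0 xs (tval t e) = a)"
proof -
  have "ev N xs rho (tmeq t d (Suc d)) (e(d := i)) = (i = tval t e)" if "i < N" for i
    using ev_tmeq[of t "Suc d" d "e(d := i)"] assms that by (simp add: tval_upd[of t d] tbelow_mono[of t d])
  then show ?thesis by (auto simp: FAt_def)
qed

text \<open>Variable 0 is the number of arguments, variable 1 the bound on the distance.\<close>

definition "PBase = TPlus (TPlus (TV 0) TOne) (TMul 0 0)"
definition "PAtt i j = TPlus (TPlus (TV 0) TOne) (TPlus (TMul i 0) (TV j))"
definition "PIn i = TPlus PBase (TPlus (TV i) (TV i))"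
definition "POut i = TPlus (PIn i) TOne"
definition "PG i = TPlus PBase (TPlus (TPlus (TV 0) (TV 0)) (TV i))"
definition "PG' i = TPlus PBase (TPlus (TPlus (TV 0) (TPlus (TV 0) (TV 0))) (TV i))"
definition "P4 = TPlus (TPlus (TV 0) (TV 0)) (TPlus (TV 0) (TV 0))"
text \<open>\<open>PK0\<close> and \<open>PK1\<close> are the positions of the two marks of a query,
  and \<open>PK2\<close> is where its unary number starts. \<open>PLast\<close> is the last position
  of an encoded input, written without subtraction.\<close>

definition "PK0 = TPlus PBase P4"
definition "PK1 = TPlus PK0 TOne"
definition "PK2 = TPlus PK1 TOne"
definition "PLast = TPlus (TPlus (TV 0) (TMul 0 0)) P4"

lemmas P_defs = PBase_def PAtt_def PIn_def POut_def PG_def PG'_def P4_def PK0_def PK1_def PK2_def PLast_def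

lemma tval_P:
  "tval PBase e = base (e 0)" "tval (PAtt i j) e = e 0 + 1 + e i * e 0 + e j"
  "tval (PIn i) e = base (e 0) + 2 * e i" "tval (POut i) e = base (e 0) + 2 * e i + 1"
  "tval (PG i) e = base (e 0) + 2 * e 0 + e i" "tval (PG' i) e = base (e 0) + 3 * e 0 + e i"
  "tval PK0 e = base (e 0) + 4 * e 0" "tval PK1 e = base (e 0) + 4 * e 0 + 1" "tval PK2 e = base (e 0) + 4 * e 0 + 2"
  "tval PLast e = base (e 0) + 4 * e 0 - 1" by (simp_all add: P_defs base_def)

lemma tbelow_P:
  "tbelow PBase 10" "i < 10 ==> j < 10 ==> tbelow (PAtt i j) 10" "i < 10 ==> tbelow (PIn i) 10" "i < 10 ==> tbelow (POut i) 10"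
  "i < 10 ==> tbelow (PG i) 10" "i < 10 ==> tbelow (PG' i) 10" "tbelow PK0 10" "tbelow PK1 10" "tbelow PK2 10" "tbelow PLast 10"
  by (simp_all add: P_defs)

definition Att :: "nat => nat => unit fm" where "Att i j = FAt 2 (PAtt i j) 10"
definition Sin :: "nat => unit fm" where "Sin i = FRel () [i]"
definition Outf :: "(nat => unit fm) => nat => unit fm" where
  "Outf X i = FEx 9 (FAnd (FLess 9 0) (FAnd (X 9) (Att 9 i)))"
definition Lead :: "unit fm" where
  "Lead = FAnd (FIn 1 0) (FAll 3 (FImp (FLess 3 0) (FIn 2 3)))"
definition Compl :: "unit fm" where
  "Compl = FAll 3 (FImp (FLess 3 0) (FAnd
     (FIff (Sin 3) (FAll 4 (FImp (FAnd (FLess 4 0) (Att 4 3)) (Outf Sin 4))))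
     (FNot (FAnd (Sin 3) (Outf Sin 3)))))"
definition Full :: "unit fm" where
  "Full = FAll 3 (FImp (FLess 3 0) (FOr (Sin 3) (Outf Sin 3)))"
definition Diff :: "nat => unit fm" where
  "Diff i = FNot (FAnd (FIff (FAt 2 (PIn i) 10) (Sin i)) (FIff (FAt 2 (POut i) 10) (Outf Sin i)))"
text \<open>The first mark asks whether the guessed set yields the given labelling itself. Without
  it the labelling must differ at \<open>g\<close> and lie within the distance given by variable 1;
  the second mark adds that \<open>g'\<close> is not accepted.\<close>

definition Kind :: "unit fm" where
  "Kind = FOr
     (FAnd (FAt 2 PK0 10) (FAll 3 (FImp (FLess 3 0) (FNot (Diff 3)))))
     (FAnd (FNot (FAt 2 PK0 10)) (FAnd
       (FEx 3 (FAnd (FLess 3 0) (FAnd (FAt 2 (PG 3) 10) (Diff 3))))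
       (FAnd (FCnt 3 (FAnd (FLess 3 0) (Diff 3)) 1)
         (FImp (FAt 2 PK1 10) (FNot (FEx 3 (FAnd (FLess 3 0) (FAnd (FAt 2 (PG' 3) 10) (Sin 3)))))))))"
text \<open>Variable 1 is the length of the unary number at the end of a query: the first blank lies
  that far behind \<open>PK2\<close>.\<close>

definition Tail :: "unit fm" where
  "Tail = FAnd (FAt 0 (TPlus PK2 (TV 1)) 10) (FAll 3 (FImp (FLess 3 1) (FNot (FAt 0 (TPlus PK2 (TV 3)) 10))))"
definition Check :: "unit fm => unit fm" where
  "Check X = FEx 0 (FAnd Lead (FEx 1 (FAnd Tail (FAnd Compl (FAnd X Kind)))))"

lemmas fm_defs = Att_def Sin_def Outf_def Lead_def Compl_def Full_def Diff_def Kind_def Tail_def Check_def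

definition AF :: "nat => (nat \<times> nat) set => nat af" where
  "AF n R = \<lparr>args = {..<n}, attacks = R\<rparr>"

definition starts :: "word => nat => (nat \<times> nat) set => bool" where
  "starts u n R = (base n \<le> length u & (\<forall>i<n. u ! i) & ~ u ! n & R \<subseteq> {..<n} \<times> {..<n} &
     (\<forall>i<n. \<forall>j<n. u ! (n + 1 + i * n + j) \<longleftrightarrow> (i, j) \<in> R))"

lemma nth0_bits_2: "nth0 (bits u) p = 2 \<longleftrightarrow> p < length u & u ! p"
  by (auto simp: nth0_bits bit_symbol_def)

lemma nth0_bits_1: "nth0 (bits u) p = 1 \<longleftrightarrow> p < length u & ~ u ! p"
  by (auto simp: nth0_bits bit_symbol_def)

lemma nth0_bits_0: "nth0 (bits u) p = 0 \<longleftrightarrow> length u \<le> p" by (auto simp: nth0_bits bit_symbol_def)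

lemma att_pos: "i < n ==> j < n ==> n + 1 + i * n + j < base n"
  using mul_add_less[of i n j n] by (simp add: base_def)

context
  fixes u :: word and n N :: nat and R :: "(nat \<times> nat) set" and rho :: "unit => nat list => bool"
  assumes u: "starts u n R" and N: "length u < N"
begin

lemma n_less: "n < N" using u N by (simp add: starts_def base_def)

lemma ev_Lead:
  assumes "e 0 < N"
  shows "ev N (bits u) rho Lead e = (e 0 = n)"
proof
  assume "ev N (bits u) rho Lead e"
  then have *: "e 0 < length u" "~ u ! e 0" "\<forall>i<N. i < e 0 --> i < length u & u ! i"
    by (auto simp: Lead_def nth0_bits_1[unfolded One_nat_def] nth0_bits_2)
  show "e 0 = n"
  proof (rule linorder_cases)
    assume "e 0 < n"
    then show ?thesis using * u by (auto simp: starts_def)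
  next
    assume "n < e 0"
    then show ?thesis using * u n_less by (auto simp: starts_def)
  qed
next
  assume "e 0 = n"
  then show "ev N (bits u) rho Lead e"
    using u n_less by (auto simp: Lead_def starts_def base_def nth0_bits_1[unfolded One_nat_def] nth0_bits_2)
qed

lemma ev_Att:
  assumes "e 0 = n" "e i < n" "e j < n" "i < 10" "j < 10"
  shows "ev N (bits u) rho (Att i j) e = ((e i, e j) \<in> R)" using u N att_pos[OF assms(2,3)] assms
  by (auto simp: Att_def ev_FAt tbelow_P tval_P nth0_bits_2 starts_def)

lemma ev_Outf:
  assumes "e 0 = n" "e i < n" "i < 9" "\<And>e. e 0 = n ==> e 9 < n ==> ev N (bits u) rho (X 9) e = (e 9 \<in> S)" "S \<subseteq> {..<n}"
  shows "ev N (bits u) rho (Outf X i) e = (e i \<in> Def (AF n R) S)"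
proof -
  have "ev N (bits u) rho (Outf X i) e = (\<exists>l<N. l < n & l \<in> S & (l, e i) \<in> R)"
    unfolding Outf_def using assms ev_Att[of "e(9 := _)" 9 i] by (auto split: if_splits)
  also have "\<dots> = (e i \<in> Def (AF n R) S)"
  proof -
    have "l < N" "l < n" if "l \<in> S" for l using subsetD[OF assms(5) that] n_less by auto
    then show ?thesis using assms(2) by (auto simp: Def_def AF_def)
  qed
  finally show ?thesis .
qed

end

context
  fixes u :: word and n N :: nat and R :: "(nat \<times> nat) set" and ys :: "nat list" and S :: "nat set"
  assumes u: "starts u n R" and N: "length u < N"
  defines "S \<equiv> {i. i < n & nth0 ys i = 2}"
begin

lemma S_sub: "S \<subseteq> {..<n}" by (auto simp: S_def)

lemma ev_Sin: "e i < n ==> ev N (bits u) (guess_rel ys) (Sin i) e = (e i \<in> S)"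
  by (simp add: Sin_def guess_rel_def S_def)

lemma ev_Sout:
  assumes "e 0 = n" "e i < n" "i < 9"
  shows "ev N (bits u) (guess_rel ys) (Outf Sin i) e = (e i \<in> Def (AF n R) S)"
  by (rule ev_Outf[OF u N assms _ S_sub]) (rule ev_Sin)

lemma ev_Compl:
  assumes "e 0 = n"
  shows "ev N (bits u) (guess_rel ys) Compl e = complete_ext (AF n R) S"
proof -
  have R: "R \<subseteq> {..<n} \<times> {..<n}" using u by (simp add: starts_def)
  have acc: "ev N (bits u) (guess_rel ys) (FAll 4 (FImp (FAnd (FLess 4 0) (Att 4 3)) (Outf Sin 4))) (e(3 := j)) =
      (j \<in> Acc (AF n R) S)" if "j < n" for j
  proof -
    have "ev N (bits u) (guess_rel ys) (FAll 4 (FImp (FAnd (FLess 4 0) (Att 4 3)) (Outf Sin 4))) (e(3 := j)) =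
        (\<forall>i<N. i < n --> (i, j) \<in> R --> i \<in> Def (AF n R) S)"
      using assms that ev_Att[OF u N, of "e(3 := j, 4 := _)" 4 3] ev_Sout[of "e(3 := j, 4 := _)" 4] by auto
    also have "\<dots> = (j \<in> Acc (AF n R) S)" using that R n_less[OF u N] by (auto simp: Acc_def AF_def)
    finally show ?thesis .
  qed
  have "ev N (bits u) (guess_rel ys) Compl e =
      (\<forall>j<N. j < n --> (j \<in> S \<longleftrightarrow> j \<in> Acc (AF n R) S) & ~ (j \<in> S & j \<in> Def (AF n R) S))"
    unfolding Compl_def ev_derived(4,7) by (intro all_cong imp_cong)
      (use assms acc ev_Sin[of "e(3 := _)" 3] ev_Sout[of "e(3 := _)" 3] in \<open>simp_all del: ev_derived(7)\<close>)
  also have "\<dots> = (S = Acc (AF n R) S & S \<inter> Def (AF n R) S = {})"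
    using S_sub n_less[OF u N] by (auto simp: Acc_def AF_def)
  finally show ?thesis by (simp add: complete_iff)
qed

lemma ev_Full:
  assumes "e 0 = n"
  shows "ev N (bits u) (guess_rel ys) Full e = (S \<union> Def (AF n R) S = args (AF n R))"
proof -
  have "ev N (bits u) (guess_rel ys) Full e = (\<forall>j<N. j < n --> j \<in> S | j \<in> Def (AF n R) S)"
    unfolding Full_def using assms ev_Sin[of "e(3 := _)" 3] ev_Sout[of "e(3 := _)" 3] by auto
  also have "\<dots> = (S \<union> Def (AF n R) S = args (AF n R))"
  proof -
    have "j < N" if "j < n" for j using that n_less[OF u N] by simp
    moreover have "Def (AF n R) S \<subseteq> {..<n}" using Def_subset[of "AF n R" S] by (simp add: AF_def)
    ultimately show ?thesis using S_sub unfolding AF_def af.simps by blast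
  qed
  finally show ?thesis .
qed

end

definition sat :: "nat af => nat => (nat => label) => nat => bool => bool => nat => (nat => label) => bool" where
  "sat F g L g' a b k L' = (if a then \<forall>i\<in>args F. L i = L' i
     else L g ~= L' g & label_dist F L L' \<le> k & (b --> L' g' ~= In))"

definition inst :: "word => nat => (nat \<times> nat) set => nat => (nat => label) => nat => bool => bool => nat => bool" where
  "inst u n R g L g' a b k = (starts u n R & length u = base n + 4 * n + 2 + k & g < n & g' < n &
     (\<forall>i<n. (u ! (base n + 2 * i) \<longleftrightarrow> L i = In) & (u ! (base n + 2 * i + 1) \<longleftrightarrow> L i = Out) &
       (u ! (base n + 2 * n + i) \<longleftrightarrow> i = g) & (u ! (base n + 3 * n + i) \<longleftrightarrow> i = g')) &
     (u ! (base n + 4 * n) \<longleftrightarrow> a) & (u ! (base n + 4 * n + 1) \<longleftrightarrow> b))"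

lemma inst_query:
  assumes "R \<subseteq> {..<n} \<times> {..<n}" "g < n" "g' < n"
  shows "inst (query (encode n R g L g') a b k) n R g L g' a b k"
proof -
  let ?w = "encode n R g L g'" and ?u = "query (encode n R g L g') a b k"
  have len: "length ?w = base n + 4 * n" by (rule length_encode)
  have pre: "?u ! p = ?w ! p" if "p < base n + 4 * n" for p
    using that len by (simp add: query_def nth_append)
  have "starts ?u n R" unfolding starts_def
  proof (intro conjI allI impI)
    show "base n \<le> length ?u" by (simp add: query_def len)
    show "?u ! i" if "i < n" for i using pre[of i] that nth_encode(1)[of i n R g L g'] by (simp add: base_def)
    show "~ ?u ! n" using pre[of n] nth_encode(2)[of n R g L g'] by (simp add: base_def)
    show "?u ! (n + 1 + i * n + j) = ((i, j) \<in> R)" if "i < n" "j < n" for i j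
      using pre[of "n + 1 + i * n + j"] att_pos[OF that] nth_encode(3)[OF that, of R g L g'] by simp
  qed (fact assms(1))
  moreover have "(?u ! (base n + 2 * i) \<longleftrightarrow> L i = In) & (?u ! (base n + 2 * i + 1) \<longleftrightarrow> L i = Out) &
       (?u ! (base n + 2 * n + i) \<longleftrightarrow> i = g) & (?u ! (base n + 3 * n + i) \<longleftrightarrow> i = g')" if "i < n" for i
    using pre[of "base n + 2 * i"] pre[of "base n + 2 * i + 1"] pre[of "base n + 2 * n + i"]
      pre[of "base n + 3 * n + i"] nth_encode(4-7)[OF that, of R g L g'] that by simp
  moreover have "?u ! (base n + 4 * n) = a" "?u ! (base n + 4 * n + 1) = b"
    by (simp_all add: query_def nth_append len)
  ultimately show ?thesis using assms by (simp add: inst_def query_def len)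
qed

context
  fixes u :: word and n N k g g' :: nat and R :: "(nat \<times> nat) set" and L :: "nat => label" and a b :: bool
    and ys :: "nat list" and S :: "nat set"
  assumes inst: "inst u n R g L g' a b k" and N: "length u < N"
  defines "S \<equiv> {i. i < n & nth0 ys i = 2}"
begin

lemma inst_starts: "starts u n R" using inst by (simp add: inst_def)

lemma inst_less: "n < N" "k < N" using inst N by (auto simp: inst_def base_def)

lemma inst_nth:
  "i < n ==> u ! (base n + 2 * i) = (L i = In)" "i < n ==> u ! Suc (base n + 2 * i) = (L i = Out)"
  "i < n ==> u ! (base n + 2 * n + i) = (i = g)" "i < n ==> u ! (base n + 3 * n + i) = (i = g')"
  "u ! (base n + 4 * n) = a" "u ! Suc (base n + 4 * n) = b" using inst by (simp_all add: inst_def)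

lemma inst_length: "length u = base n + 4 * n + 2 + k" "base n + 4 * n + 2 + k < N"
  using inst N by (simp_all add: inst_def)

lemma ev_bit:
  assumes "tbelow t 10" "tval t e = p" "p < base n + 4 * n + 2"
  shows "ev N (bits u) rho (FAt 2 t 10) e = u ! p"
proof -
  have "p < length u" "p < N" using assms(3) inst_length by linarith+
  then show ?thesis by (simp add: ev_FAt[OF assms(1)] assms(2) nth0_bits_2)
qed

lemma ev_bits:
  assumes "e 0 = n"
  shows "ev N (bits u) rho (FAt 2 PK0 10) e = a" "ev N (bits u) rho (FAt 2 PK1 10) e = b"
    "e i < n ==> i < 10 ==> ev N (bits u) rho (FAt 2 (PIn i) 10) e = (L (e i) = In)"
    "e i < n ==> i < 10 ==> ev N (bits u) rho (FAt 2 (POut i) 10) e = (L (e i) = Out)"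
    "e i < n ==> i < 10 ==> ev N (bits u) rho (FAt 2 (PG i) 10) e = (e i = g)"
    "e i < n ==> i < 10 ==> ev N (bits u) rho (FAt 2 (PG' i) 10) e = (e i = g')"
proof -
  note tv = tval_P[where e = e, unfolded assms]
  show "ev N (bits u) rho (FAt 2 PK0 10) e = a" "ev N (bits u) rho (FAt 2 PK1 10) e = b"
    by (subst ev_bit[OF _ refl]; simp add: tbelow_P tv inst_nth)+
  assume i: "e i < n" "i < 10"
  have b: "tbelow (PIn i) 10" "tbelow (POut i) 10" "tbelow (PG i) 10" "tbelow (PG' i) 10"
    using i(2) tbelow_P by blast+
  have p: "base n + 2 * e i < base n + 4 * n + 2" "base n + 2 * e i + 1 < base n + 4 * n + 2"
    "base n + 2 * n + e i < base n + 4 * n + 2" "base n + 3 * n + e i < base n + 4 * n + 2"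
    using i(1) by linarith+
  show "ev N (bits u) rho (FAt 2 (PIn i) 10) e = (L (e i) = In)"
    unfolding ev_bit[OF b(1) tv(3) p(1)] by (rule inst_nth(1)[OF i(1)])
  show "ev N (bits u) rho (FAt 2 (POut i) 10) e = (L (e i) = Out)"
    unfolding ev_bit[OF b(2) tv(4) p(2)] using inst_nth(2)[OF i(1)] by (simp only: Suc_eq_plus1)
  show "ev N (bits u) rho (FAt 2 (PG i) 10) e = (e i = g)"
    unfolding ev_bit[OF b(3) tv(5) p(3)] by (rule inst_nth(3)[OF i(1)])
  show "ev N (bits u) rho (FAt 2 (PG' i) 10) e = (e i = g')"
    unfolding ev_bit[OF b(4) tv(6) p(4)] by (rule inst_nth(4)[OF i(1)])
qed

lemmas SI = ev_Sin[OF inst_starts N, of _ _ ys, folded S_def]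
  ev_Sout[OF inst_starts N, of _ _ ys, folded S_def] ev_Compl[OF inst_starts N, of _ ys, folded S_def]

lemma ev_Diff:
  assumes "complete_ext (AF n R) S" "e 0 = n" "e i < n" "i < 9"
  shows "ev N (bits u) (guess_rel ys) (Diff i) e = (L (e i) ~= labelling_of (AF n R) S (e i))"
proof -
  let ?l = "labelling_of (AF n R) S (e i)"
  have "L (e i) = ?l \<longleftrightarrow> (L (e i) = In \<longleftrightarrow> e i \<in> S) & (L (e i) = Out \<longleftrightarrow> e i \<in> Def (AF n R) S)"
    using label_eq_iff[of "L (e i)" ?l] unfolding labelling_of_In labelling_of_Out[OF assms(1)] .
  moreover have "i < 10" using assms(4) by simp
  ultimately show ?thesis
    unfolding Diff_def ev_derived ev_bits(3,4)[OF assms(2,3) \<open>i < 10\<close>] SI(1)[of e i, OF assms(3)] SI(2)[OF assms(2-4)] by simp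
qed

lemma ev_Kind:
  assumes "complete_ext (AF n R) S" "e 0 = n" "e 1 = k"
  shows "ev N (bits u) (guess_rel ys) Kind e = sat (AF n R) g L g' a b k (labelling_of (AF n R) S)"
proof -
  let ?L = "labelling_of (AF n R) S" and ?ev = "ev N (bits u) (guess_rel ys)"
  have lN: "i < N" if "i < n" for i using that inst_less by simp
  have D: "?ev (Diff 3) (e(3 := i)) = (L i ~= ?L i)" if "i < n" for i
    using ev_Diff[OF assms(1), of "e(3 := i)" 3] assms that by simp
  have k: "?ev (FAt 2 PK0 10) e = a" "?ev (FAt 2 PK1 10) e = b" by (rule ev_bits; fact)+
  have g: "?ev (FAt 2 (PG 3) 10) (e(3 := i)) = (i = g)" "?ev (FAt 2 (PG' 3) 10) (e(3 := i)) = (i = g')"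
    if "i < n" for i using ev_bits(5,6)[of "e(3 := i)" 3] assms that by simp_all
  have gn: "g < n" "g' < n" using inst by (simp_all add: inst_def)
  have 1: "?ev (FAll 3 (FImp (FLess 3 0) (FNot (Diff 3)))) e = (\<forall>i\<in>args (AF n R). L i = ?L i)"
    using assms(2) D lN by (auto simp: AF_def)
  have 2: "?ev (FEx 3 (FAnd (FLess 3 0) (FAnd (FAt 2 (PG 3) 10) (Diff 3)))) e = (L g ~= ?L g)"
    using assms(2) D g gn lN by (auto cong: conj_cong)
  have 3: "?ev (FEx 3 (FAnd (FLess 3 0) (FAnd (FAt 2 (PG' 3) 10) (Sin 3)))) e = (g' \<in> S)"
    using assms(2) SI(1)[of "e(3 := _)" 3] g gn lN by (auto cong: conj_cong)
  have "{i. i < N & ?ev (FAnd (FLess 3 0) (Diff 3)) (e(3 := i))} = {i \<in> args (AF n R). L i ~= ?L i}"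
    using assms(2) D lN by (auto simp: AF_def)
  then have 4: "?ev (FCnt 3 (FAnd (FLess 3 0) (Diff 3)) 1) e = (label_dist (AF n R) L ?L \<le> k)"
    using assms(3) by (simp add: label_dist_def)
  show ?thesis
    unfolding Kind_def sat_def using 1 2 3 4 k by (simp add: labelling_of_In del: ev.simps)
qed

lemma ev_Tail:
  assumes "e 0 = n" "e 1 < N"
  shows "ev N (bits u) (guess_rel ys) Tail e = (e 1 = k)"
proof -
  let ?ev = "ev N (bits u) (guess_rel ys)"
  have 1: "?ev (FAt 0 (TPlus PK2 (TV x)) 10) (e(3 := i)) = (base n + 4 * n + 2 + (e(3 := i)) x < N & k \<le> (e(3 := i)) x)"
    if "x < 10" "x ~= 0" for x i
  proof -
    have t: "tbelow (TPlus PK2 (TV x)) 10" using that by (simp add: tbelow_P)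
    have v: "tval (TPlus PK2 (TV x)) (e(3 := i)) = base n + 4 * n + 2 + (e(3 := i)) x"
      using assms by (simp add: tval_P)
    show ?thesis unfolding ev_FAt[OF t] v nth0_bits_0 inst_length(1) by auto
  qed
  from 1[of 1 "e 3"] have 2: "?ev (FAt 0 (TPlus PK2 (TV 1)) 10) e = (base n + 4 * n + 2 + e 1 < N & k \<le> e 1)"
    by simp
  have 3: "?ev Tail e = (base n + 4 * n + 2 + e 1 < N & k \<le> e 1 &
      (\<forall>i<N. i < e 1 --> ~ (base n + 4 * n + 2 + i < N & k \<le> i)))"
    unfolding Tail_def using 1[of 3] 2 by simp
  note kN = inst_length(2)
  show ?thesis
  proof
    assume "?ev Tail e"
    then have "k \<le> e 1" "~ k < e 1" unfolding 3 using kN inst_less(2) by blast+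
    then show "e 1 = k" by simp
  next
    assume "e 1 = k"
    then show "?ev Tail e" unfolding 3 using kN by auto
  qed
qed

lemma ev_Check:
  assumes "\<And>e. e 0 = n ==> ev N (bits u) (guess_rel ys) X e = P"
  shows "ev N (bits u) (guess_rel ys) (Check X) e =
    (complete_ext (AF n R) S & P & sat (AF n R) g L g' a b k (labelling_of (AF n R) S))"
proof -
  let ?ev = "ev N (bits u) (guess_rel ys)"
  let ?T = "complete_ext (AF n R) S & P & sat (AF n R) g L g' a b k (labelling_of (AF n R) S)"
  have "?ev Lead (e(0 := i)) = (i = n)" if "i < N" for i
    using ev_Lead[OF inst_starts N, of "e(0 := i)"] that by simp
  moreover have "?ev Tail (e(0 := n, 1 := j)) = (j = k)" if "j < N" for j
    using ev_Tail[of "e(0 := n, 1 := j)"] that by simp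
  moreover have "?ev (FAnd Compl (FAnd X Kind)) (e(0 := n, 1 := k)) = ?T"
    using SI(3)[of "e(0 := n, 1 := k)"] ev_Kind[of "e(0 := n, 1 := k)"] assms[of "e(0 := n, 1 := k)"] by auto
  moreover have "?ev (Check X) e = (\<exists>i<N. ?ev Lead (e(0 := i)) &
      (\<exists>j<N. ?ev Tail (e(0 := i, 1 := j)) & ?ev (FAnd Compl (FAnd X Kind)) (e(0 := i, 1 := j))))"
    by (simp add: Check_def)
  ultimately show ?thesis using inst_less by (auto cong: conj_cong)
qed

end

lemma ex_guess:
  assumes "n \<le> N"
  shows "(\<exists>Y :: word. length Y = N & P {i. i < n & nth0 (bits Y) i = 2}) = (\<exists>S. S \<subseteq> {..<n} & P S)"
proof
  assume "\<exists>S. S \<subseteq> {..<n} & P S"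
  then obtain S where S: "S \<subseteq> {..<n}" "P S" by blast
  define Y where "Y = map (\<lambda>i. i \<in> S) [0..<N]"
  have "{i. i < n & nth0 (bits Y) i = 2} = S" using S(1) assms by (auto simp: nth0_bits_2 Y_def)
  then show "\<exists>Y :: word. length Y = N & P {i. i < n & nth0 (bits Y) i = 2}"
    using S(2) by (intro exI[of _ Y]) (simp add: Y_def)
next
  assume "\<exists>Y :: word. length Y = N & P {i. i < n & nth0 (bits Y) i = 2}"
  then obtain Y :: word where "P {i. i < n & nth0 (bits Y) i = 2}" by blast
  then show "\<exists>S. S \<subseteq> {..<n} & P S" by (intro exI[of _ "{i. i < n & nth0 (bits Y) i = 2}"]) auto
qed

lemma length_less_bound: "length u < bound 2 u" by (simp add: bound_def power2_eq_square)

definition witnessed :: "sem => nat => (nat \<times> nat) set => nat => (nat => label) => nat => bool => bool => nat => bool" where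
  "witnessed s n R g L g' a b k = (\<exists>S. extension s (AF n R) S &
     sat (AF n R) g L g' a b k (labelling_of (AF n R) S))"

text \<open>Words that are not well-formed queries may be answered arbitrarily. Queries about an
  input of wrong shape do no harm because that input is rejected by \<open>Fmt\<close> whatever the
  answers are.\<close>

definition decides :: "sem => word set => bool" where
  "decides s B = (\<forall>u n R g L g' a b k. inst u n R g L g' a b k --> u \<in> B \<longleftrightarrow> witnessed s n R g L g' a b k)"

lemma decidesD: "decides s B ==> inst u n R g L g' a b k ==> u \<in> B \<longleftrightarrow> witnessed s n R g L g' a b k"
  by (simp add: decides_def)

lemma unary_Outf [simp]: "unary (Outf X i) = unary (X 9)" by (simp add: Outf_def Att_def)

lemma unary_fms [simp]: "unary (Att i j)" "unary (Sin i)" "unary Lead" "unary Compl" "unary Full" "unary (Diff i)" "unary Kind"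
  "unary Tail" "unary (Check X) = unary X" by (simp_all add: fm_defs)

lemma oracle_Co_St:
  assumes "s \<in> {Co, St}"
  obtains B where "B \<in> NP" "decides s B"
proof -
  define X where "X = (if s = Co then FEq 0 0 else Full)"
  define B where "B = {u. \<exists>Y. length Y = bound 2 u & ev (bound 2 u) (bits u) (guess_rel (bits Y)) (Check X) (\<lambda>_. 0)}"
  have "B \<in> NP" unfolding B_def by (rule NP_fm) (simp_all add: X_def)
  moreover have "u \<in> B \<longleftrightarrow> witnessed s n R g L g' a b k" if i: "inst u n R g L g' a b k" for u n R g L g' a b k
  proof -
    note st = inst_starts[OF i length_less_bound]
    let ?F = "AF n R"
    have "u \<in> B \<longleftrightarrow> (\<exists>Y :: word. length Y = bound 2 u &
        (\<lambda>S. complete_ext ?F S & (s = St --> S \<union> Def ?F S = args ?F) & sat ?F g L g' a b k (labelling_of ?F S))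
          {i. i < n & nth0 (bits Y) i = 2})" unfolding B_def mem_Collect_eq
    proof (intro ex_cong1 conj_cong refl)
      fix Y :: word
      show "ev (bound 2 u) (bits u) (guess_rel (bits Y)) (Check X) (\<lambda>_. 0) =
        (\<lambda>S. complete_ext ?F S & (s = St --> S \<union> Def ?F S = args ?F) & sat ?F g L g' a b k (labelling_of ?F S))
          {i. i < n & nth0 (bits Y) i = 2}" by (rule ev_Check[OF i length_less_bound])
          (use assms ev_Full[OF st length_less_bound] in \<open>auto simp: X_def\<close>)
    qed
    also have "\<dots> = (\<exists>S. S \<subseteq> {..<n} & complete_ext ?F S & (s = St --> S \<union> Def ?F S = args ?F) &
        sat ?F g L g' a b k (labelling_of ?F S))"
      by (rule ex_guess) (use inst_less(1)[OF i length_less_bound] in simp)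
    also have "\<dots> = witnessed s n R g L g' a b k"
    proof -
      have "S \<subseteq> {..<n}" if "complete_ext ?F S" for S
        using complete_subset[OF that] by (simp add: AF_def)
      then show ?thesis using assms unfolding witnessed_def by (cases s) (auto simp: stable_iff)
    qed
    finally show ?thesis .
  qed
  ultimately show ?thesis using that[of B] unfolding decides_def by blast
qed

section \<open>Refuting maximality: the second oracle for preferred and semi-stable
  extensions\<close>

definition Old :: "nat => unit fm" where "Old i = FAt 2 (TPlus PBase (TV i)) 10"
definition Rn :: "(nat => unit fm) => nat => unit fm" where "Rn X i = FOr (X i) (Outf X i)"
definition Subf :: "(nat => unit fm) => (nat => unit fm) => unit fm" where
  "Subf A B = FAnd (FAll 3 (FImp (FLess 3 0) (FImp (A 3) (B 3))))
     (FEx 3 (FAnd (FLess 3 0) (FAnd (B 3) (FNot (A 3)))))"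
definition Larger :: "sem => unit fm" where
  "Larger s = FEx 0 (FAnd Lead (FAnd Compl (if s = Pr then Subf Old Sin else FOr (Subf Old Sin) (Subf (Rn Old) (Rn Sin)))))"

lemma unary_Larger: "unary (Larger s)" by (simp add: Larger_def Subf_def Rn_def Old_def)

lemma ev_Subf:
  assumes "e 0 = n" "n < N" "S \<subseteq> {..<n}" "T \<subseteq> {..<n}"
    and "\<And>j. j < n ==> ev N xs rho (A 3) (e(3 := j)) = (j \<in> S)" "\<And>j. j < n ==> ev N xs rho (B 3) (e(3 := j)) = (j \<in> T)"
  shows "ev N xs rho (Subf A B) e = (S \<subset> T)"
proof -
  have "ev N xs rho (Subf A B) e = ((\<forall>j<N. j < n --> j \<in> S --> j \<in> T) & (\<exists>j<N. j < n & j \<in> T & j \<notin> S))"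
    using assms(1,5,6) by (simp add: Subf_def cong: conj_cong imp_cong)
  also have "\<dots> = (S \<subset> T)"
  proof -
    have "j < N & j < n" if "j \<in> S | j \<in> T" for j using that assms(2-4) by auto
    then show ?thesis unfolding psubset_eq subset_iff set_eq_iff by blast
  qed
  finally show ?thesis .
qed

text \<open>Certificates against maximality. For \<open>Sst\<close> a larger complete set counts as
  well, because a semi-stable extension must be preferred.\<close>

definition refutes :: "sem => nat af => nat set => nat set => bool" where
  "refutes s F S T = (complete_ext F T & (S \<subset> T | s = Sst & S \<union> Def F S \<subset> T \<union> Def F T))"

lemma refutes_extension:
  assumes "is_af F" "s \<in> {Pr, Sst}"
  shows "extension s F S = (complete_ext F S & ~ (\<exists>T. refutes s F S T))"
  using assms(2) unfolding refutes_def
  by (elim insertE) (auto simp: preferred_ext_def semi_stable_iff[OF assms(1)])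

lemma ev_Larger:
  assumes v: "starts v n R" and N: "length v < N" and len: "length v = base n + n"
    and S: "S \<subseteq> {..<n}" "\<And>i. i < n ==> v ! (base n + i) = (i \<in> S)"
    and s: "s \<in> {Pr, Sst}"
  shows "ev N (bits v) (guess_rel ys) (Larger s) (\<lambda>_. 0) = refutes s (AF n R) S {i. i < n & nth0 ys i = 2}"
proof -
  let ?ev = "ev N (bits v) (guess_rel ys)" and ?e = "(\<lambda>_. 0)(0 := n)" and ?T = "{i. i < n & nth0 ys i = 2}"
  let ?F = "AF n R"
  have nN: "n < N" using n_less[OF v N] .
  have old: "?ev (Old i) e = (e i \<in> S)" if "e 0 = n" "e i < n" "i < 10" for e i
  proof -
    have t: "tbelow (TPlus PBase (TV i)) 10" using that by (simp add: tbelow_P)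
    have "tval (TPlus PBase (TV i)) e = base n + e i" using that by (simp add: tval_P)
    then show ?thesis
      using that(2) N len S(2)[OF that(2)] by (simp add: Old_def ev_FAt[OF t] nth0_bits_2)
  qed
  have new: "?ev (Sin i) e = (e i \<in> ?T)" if "e i < n" for e i using that by (rule ev_Sin[OF v N])
  have lead: "?ev Lead ((\<lambda>_. 0)(0 := i)) = (i = n)" if "i < N" for i
    using ev_Lead[OF v N, of "(\<lambda>_. 0)(0 := i)"] that by simp
  have D: "Def ?F X \<subseteq> {..<n}" for X using Def_subset[of ?F X] by (simp add: AF_def)
  have sub1: "?ev (Subf Old Sin) ?e = (S \<subset> ?T)"
    by (rule ev_Subf[OF _ nN S(1)]) (use old[of "?e(3 := _)" 3] new[of "?e(3 := _)" 3] in auto)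
  have rn: "?ev (Rn X 3) (?e(3 := j)) = (j \<in> A \<union> Def ?F A)"
    if X: "\<And>e. e 0 = n ==> e 9 < n ==> ?ev (X 9) e = (e 9 \<in> A)" "A \<subseteq> {..<n}" "?ev (X 3) (?e(3 := j)) = (j \<in> A)" and "j < n" for X A j
    using ev_Outf[OF v N, of "?e(3 := j)" 3 _ X A] X \<open>j < n\<close> by (simp add: Rn_def)
  have sub2: "?ev (Subf (Rn Old) (Rn Sin)) ?e = (S \<union> Def ?F S \<subset> ?T \<union> Def ?F ?T)"
  proof (rule ev_Subf[OF _ nN])
    show "?ev (Rn Old 3) (?e(3 := j)) = (j \<in> S \<union> Def ?F S)" if "j < n" for j
      by (rule rn[of Old S j, OF old S(1) _ that]) (use old[of "?e(3 := j)" 3] that in auto)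
    show "?ev (Rn Sin 3) (?e(3 := j)) = (j \<in> ?T \<union> Def ?F ?T)" if "j < n" for j
      by (rule rn[of Sin ?T j, OF new _ _ that]) (use new[of "?e(3 := j)" 3] that in auto)
  qed (use S(1) D in auto)
  have "?ev (Larger s) (\<lambda>_. 0) = (?ev Compl ?e & (?ev (Subf Old Sin) ?e | s = Sst & ?ev (Subf (Rn Old) (Rn Sin)) ?e))"
    unfolding Larger_def using lead nN s by (auto cong: conj_cong)
  also have "\<dots> = refutes s ?F S ?T"
    unfolding sub1 sub2 refutes_def using ev_Compl[OF v N, of ?e ys] by simp
  finally show ?thesis .
qed

text \<open>The question put to the second oracle: the framework, cut from the beginning of the
  query, followed by the characteristic vector of the guessed set.\<close>

definition Copy :: em where
  "Copy = EFor 0 (EIf Lead (ESeq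
     (EFor 3 (EIf (FEx 5 (FAnd (tmeq PBase 5 10) (FLess 3 5))) (EFm (FIn 2 3))))
     (EFor 3 (EIf (FLess 3 0) (EFm (Sin 3))))))"

lemma concat_single:
  assumes "n < N" "\<And>i. i < N ==> i ~= n ==> f i = []"
  shows "concat (map f [0..<N]) = f n"
proof -
  have s: "[0..<N] = [0..<n] @ n # [Suc n..<N]"
    using assms(1) by (metis upt_conv_Cons upt_add_eq_append le0 less_imp_add_positive)
  have "concat (map f [0..<n]) = []" "concat (map f [Suc n..<N]) = []" using assms by auto
  then show ?thesis unfolding s map_append concat_append list.map concat.simps by (simp only: append_Nil append_Nil2)
qed

lemma concat_initial:
  assumes "m \<le> N"
  shows "concat (map (\<lambda>i. if i < m then [f i] else []) [0..<N]) = map f [0..<m]"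
proof -
  have s: "[0..<N] = [0..<m] @ [m..<N]"
    using assms by (metis upt_add_eq_append le0 le_add_diff_inverse)
  have "concat (map (\<lambda>i. if i < m then [f i] else []) xs) = map f xs" if "set xs \<subseteq> {..<m}" for xs
    using that by (induction xs) auto
  from this[of "[0..<m]"] have "concat (map (\<lambda>i. if i < m then [f i] else []) [0..<m]) = map f [0..<m]" by fastforce
  moreover have "concat (map (\<lambda>i. if i < m then [f i] else []) [m..<N]) = []" by auto
  ultimately show ?thesis unfolding s map_append concat_append by (simp only: append_Nil2)
qed

lemma emw_Copy:
  assumes "starts u n R" "length u < N"
  shows "emw N (bits u) (guess_rel ys) Copy e = take (base n) u @ map (\<lambda>i. nth0 ys i = 2) [0..<n]"
proof -
  let ?w = "\<lambda>E e. emw N (bits u) (guess_rel ys) E e"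
  have nN: "n < N" "base n < N" using n_less[OF assms] assms by (auto simp: starts_def)
  let ?E = "ESeq (EFor 3 (EIf (FEx 5 (FAnd (tmeq PBase 5 10) (FLess 3 5))) (EFm (FIn 2 3))))
     (EFor 3 (EIf (FLess 3 0) (EFm (Sin 3))))"
  have lead: "ev N (bits u) (guess_rel ys) Lead (e(0 := i)) = (i = n)" if "i < N" for i
    using ev_Lead[OF assms, of "e(0 := i)"] that by simp
  have "?w Copy e = concat (map (\<lambda>i. ?w (EIf Lead ?E) (e(0 := i))) [0..<N])" by (simp add: Copy_def)
  also have "\<dots> = ?w (EIf Lead ?E) (e(0 := n))" by (rule concat_single[OF nN(1)]) (use lead in simp)
  also have "\<dots> = ?w ?E (e(0 := n))" using lead[OF nN(1)] by simp
  also have "\<dots> = take (base n) u @ map (\<lambda>i. nth0 ys i = 2) [0..<n]"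
  proof -
    have pb: "ev N (bits u) (guess_rel ys) (FEx 5 (FAnd (tmeq PBase 5 10) (FLess 3 5))) (e(0 := n, 3 := i)) = (i < base n)" for i
    proof -
      have "ev N (bits u) (guess_rel ys) (tmeq PBase 5 10) (e(0 := n, 3 := i, 5 := j)) = (j = base n)" if "j < N" for j
        using ev_tmeq[of PBase 10 5 "e(0 := n, 3 := i, 5 := j)"] that by (simp add: tbelow_P tval_P)
      then show ?thesis using nN(2) by (auto cong: conj_cong)
    qed
    have "?w (EFor 3 (EIf (FEx 5 (FAnd (tmeq PBase 5 10) (FLess 3 5))) (EFm (FIn 2 3)))) (e(0 := n)) =
        concat (map (\<lambda>i. if i < base n then [nth0 (bits u) i = 2] else []) [0..<N])"
      using pb by (simp cong: if_cong)
    also have "\<dots> = map (\<lambda>i. nth0 (bits u) i = 2) [0..<base n]"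
      by (rule concat_initial) (use nN in simp)
    also have "\<dots> = take (base n) u"
      using assms(1) by (intro nth_equalityI) (auto simp: starts_def nth0_bits_2)
    finally have 1: "?w (EFor 3 (EIf (FEx 5 (FAnd (tmeq PBase 5 10) (FLess 3 5))) (EFm (FIn 2 3)))) (e(0 := n)) =
      take (base n) u" .
    have "?w (EFor 3 (EIf (FLess 3 0) (EFm (Sin 3)))) (e(0 := n)) =
        concat (map (\<lambda>i. if i < n then [nth0 ys i = 2] else []) [0..<N])"
      by (simp add: Sin_def guess_rel_def cong: if_cong)
    also have "\<dots> = map (\<lambda>i. nth0 ys i = 2) [0..<n]" by (rule concat_initial) (use nN in simp)
    finally show ?thesis using 1 by simp
  qed
  finally show ?thesis .
qed


text \<open>That the guessed set is complete and meets the conditions of the query is checked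
  directly. Its maximality says that no complete set refutes it, which is a single negative answer
  of an NP oracle.\<close>

lemma oracle_Pr_Sst:
  assumes "s \<in> {Pr, Sst}"
  obtains B where "B \<in> Sigma2p" "decides s B"
proof -
  define B2 where "B2 = {v. \<exists>Y. length Y = bound 2 v & ev (bound 2 v) (bits v) (guess_rel (bits Y)) (Larger s) (\<lambda>_. 0)}"
  define B where "B = {u. \<exists>Y. length Y = bound 2 u & ev (bound 2 u) (bits u) (guess_rel (bits Y)) (Check (FEq 0 0)) (\<lambda>_. 0) &
    emw (bound 2 u) (bits u) (guess_rel (bits Y)) Copy (\<lambda>_. 0) \<notin> B2}"
  have "B2 \<in> NP" unfolding B2_def by (rule NP_fm) (simp_all add: unary_Larger)
  moreover have "unary_em Copy" by (simp add: Copy_def)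
  then have "B \<in> NP_oracle B2" unfolding B_def by (intro NP_oracle_fm) simp_all
  ultimately have "B \<in> Sigma2p" unfolding Sigma2p_def by blast
  moreover have "u \<in> B \<longleftrightarrow> witnessed s n R g L g' a b k" if i: "inst u n R g L g' a b k" for u n R g L g' a b k
  proof -
    note st = inst_starts[OF i length_less_bound]
    let ?F = "AF n R"
    have F: "is_af ?F" using st by (simp add: is_af_def AF_def starts_def)
    have sub: "S \<subseteq> {..<n}" if "complete_ext ?F S" for S
      using complete_subset[OF that] by (simp add: AF_def)
    have B2: "take (base n) u @ map (\<lambda>i. i \<in> S) [0..<n] \<in> B2 \<longleftrightarrow> (\<exists>T. refutes s ?F S T)" (is "?v \<in> B2 \<longleftrightarrow> _")
      if "S \<subseteq> {..<n}" for S
    proof -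
      have b: "base n \<le> length u" using st by (simp add: starts_def)
      have pre: "?v ! p = u ! p" if "p < base n" for p using that b by (simp add: nth_append)
      have v: "starts ?v n R" unfolding starts_def
      proof (intro conjI allI impI)
        show "?v ! i" if "i < n" for i using pre[of i] that st by (simp add: base_def starts_def)
        show "~ ?v ! n" using pre[of n] st by (simp add: base_def starts_def)
        show "?v ! (n + 1 + i * n + j) = ((i, j) \<in> R)" if "i < n" "j < n" for i j
          using pre[OF att_pos[OF that]] st that by (simp add: starts_def)
      qed (use b st in \<open>simp_all add: starts_def\<close>)
      have "?v \<in> B2 \<longleftrightarrow> (\<exists>Y :: word. length Y = bound 2 ?v & refutes s ?F S {i. i < n & nth0 (bits Y) i = 2})"
        unfolding B2_def mem_Collect_eq
      proof (intro ex_cong1 conj_cong refl)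
        fix Y :: word
        show "ev (bound 2 ?v) (bits ?v) (guess_rel (bits Y)) (Larger s) (\<lambda>_. 0) =
            refutes s ?F S {i. i < n & nth0 (bits Y) i = 2}"
          by (rule ev_Larger[OF v length_less_bound _ that _ assms]) (use b in \<open>simp_all add: nth_append\<close>)
      qed
      also have "\<dots> = (\<exists>T. T \<subseteq> {..<n} & refutes s ?F S T)"
        by (rule ex_guess) (use n_less[OF v length_less_bound] in simp)
      also have "\<dots> = (\<exists>T. refutes s ?F S T)" using sub unfolding refutes_def by blast
      finally show ?thesis .
    qed
    let ?P = "\<lambda>S. extension s ?F S & sat ?F g L g' a b k (labelling_of ?F S)"
    have "u \<in> B \<longleftrightarrow> (\<exists>Y :: word. length Y = bound 2 u & ?P {i. i < n & nth0 (bits Y) i = 2})"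
      unfolding B_def mem_Collect_eq
    proof (rule ex_cong1, rule conj_cong[OF refl])
      fix Y :: word
      let ?S = "{i. i < n & nth0 (bits Y) i = 2}"
      have "emw (bound 2 u) (bits u) (guess_rel (bits Y)) Copy (\<lambda>_. 0) = take (base n) u @ map (\<lambda>i. i \<in> ?S) [0..<n]"
        unfolding emw_Copy[OF st length_less_bound] by simp
      moreover have "ev (bound 2 u) (bits u) (guess_rel (bits Y)) (Check (FEq 0 0)) (\<lambda>_. 0) =
          (complete_ext ?F ?S & True & sat ?F g L g' a b k (labelling_of ?F ?S))"
        by (rule ev_Check[OF i length_less_bound]) simp
      ultimately show "ev (bound 2 u) (bits u) (guess_rel (bits Y)) (Check (FEq 0 0)) (\<lambda>_. 0) &
          emw (bound 2 u) (bits u) (guess_rel (bits Y)) Copy (\<lambda>_. 0) \<notin> B2 \<longleftrightarrow> ?P ?S"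
        using B2[of ?S] refutes_extension[OF F assms, of ?S] by auto
    qed
    also have "\<dots> = (\<exists>S. S \<subseteq> {..<n} & ?P S)"
      by (rule ex_guess) (use inst_less(1)[OF i length_less_bound] in simp)
    also have "\<dots> = witnessed s n R g L g' a b k"
      unfolding witnessed_def using sub extension_complete by blast
    finally show ?thesis .
  qed
  ultimately show ?thesis using that[of B] unfolding decides_def by blast
qed

section \<open>The format of inputs and the answer of the searching machine\<close>

definition OneHot :: "(nat => tm) => unit fm" where
  "OneHot P = FEx 3 (FAnd (FLess 3 0) (FAnd (FAt 2 (P 3) 10)
     (FAll 4 (FImp (FLess 4 0) (FImp (FAt 2 (P 4) 10) (FEq 4 3))))))"

definition Labs :: "unit fm" where
  "Labs = FAll 3 (FImp (FLess 3 0) (FNot (FAnd (FAt 2 (PIn 3) 10) (FAt 2 (POut 3) 10))))"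

text \<open>The length is fixed by two tests: the input is blank at position
  \<open>base n + 4 * n\<close> and not blank one position earlier.\<close>

definition Fmt :: "unit fm" where
  "Fmt = FEx 0 (FAnd Lead (FAnd (FAt 0 PK0 10) (FAnd (FNot (FAt 0 PLast 10)) (FAnd Labs
     (FAnd (OneHot PG) (OneHot PG'))))))"

lemma unary_Fmt: "unary Fmt" by (simp add: Fmt_def Labs_def OneHot_def)

lemma ev_OneHot:
  assumes "e 0 = n" "n < N"
    and "\<And>j. j < n ==> ev N xs rho (FAt 2 (P 3) 10) (e(3 := j)) = Q j"
    and "\<And>i j. i < n ==> j < n ==> ev N xs rho (FAt 2 (P 4) 10) (e(3 := i, 4 := j)) = Q j"
  shows "ev N xs rho (OneHot P) e = (\<exists>g<n. \<forall>j<n. Q j \<longleftrightarrow> j = g)"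
proof -
  have "ev N xs rho (OneHot P) e = (\<exists>g<N. g < n & Q g & (\<forall>j<N. j < n --> Q j --> j = g))"
    using assms(1,3,4) by (simp add: OneHot_def cong: conj_cong imp_cong)
  also have "\<dots> = (\<exists>g<n. \<forall>j<n. Q j \<longleftrightarrow> j = g)"
  proof -
    have "j < N" if "j < n" for j using that assms(2) by simp
    then show ?thesis by blast
  qed
  finally show ?thesis .
qed

definition shape :: "word => nat => bool" where
  "shape w n = ((\<forall>i<n. w ! i) & ~ w ! n & length w = base n + 4 * n &
     (\<forall>i<n. ~ (w ! (base n + 2 * i) & w ! (base n + 2 * i + 1))) &
     (\<exists>g<n. \<forall>j<n. w ! (base n + 2 * n + j) \<longleftrightarrow> j = g) & (\<exists>g'<n. \<forall>j<n. w ! (base n + 3 * n + j) \<longleftrightarrow> j = g'))"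

lemma ev_Fmt:
  assumes "length w < N"
  shows "ev N (bits w) rho Fmt e = (\<exists>n. shape w n)"
proof -
  let ?ev = "ev N (bits w) rho"
  define E where "E n = e(0 := n)" for n
  have lead: "?ev Lead (E n) = (n < length w & ~ w ! n & (\<forall>i<n. w ! i))" if "n < N" for n
    using that by (auto simp: E_def Lead_def nth0_bits_1[unfolded One_nat_def] nth0_bits_2)
  have len: "?ev (FAt 0 PK0 10) (E n) & ~ ?ev (FAt 0 PLast 10) (E n) \<longleftrightarrow> length w = base n + 4 * n" for n
    using assms by (auto simp: E_def ev_FAt tbelow_P tval_P nth0_bits_0 base_def)
  have bit: "?ev (FAt 2 t 10) f = w ! p" if "tbelow t 10" "tval t f = p" "p < length w" for t f p
    using that assms by (simp add: ev_FAt nth0_bits_2)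
  have "?ev Labs (E n) = (\<forall>i<n. ~ (w ! (base n + 2 * i) & w ! (base n + 2 * i + 1)))"
    "?ev (OneHot PG) (E n) = (\<exists>g<n. \<forall>j<n. w ! (base n + 2 * n + j) \<longleftrightarrow> j = g)"
    "?ev (OneHot PG') (E n) = (\<exists>g<n. \<forall>j<n. w ! (base n + 3 * n + j) \<longleftrightarrow> j = g)"
    if l: "length w = base n + 4 * n" for n
  proof -
    have nN: "n < N" using l assms by (simp add: base_def)
    have 1: "?ev (FAt 2 (PIn 3) 10) ((E n)(3 := i)) = w ! (base n + 2 * i)"
      "?ev (FAt 2 (POut 3) 10) ((E n)(3 := i)) = w ! (base n + 2 * i + 1)" if "i < n" for i
      by (rule bit; use that l in \<open>simp add: tbelow_P tval_P E_def\<close>)+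
    show "?ev Labs (E n) = (\<forall>i<n. ~ (w ! (base n + 2 * i) & w ! (base n + 2 * i + 1)))"
    proof -
      have "?ev Labs (E n) =
        (\<forall>i<N. i < n --> ~ (?ev (FAt 2 (PIn 3) 10) ((E n)(3 := i)) & ?ev (FAt 2 (POut 3) 10) ((E n)(3 := i))))"
        by (simp add: E_def Labs_def)
      also have "\<dots> = (\<forall>i<N. i < n --> ~ (w ! (base n + 2 * i) & w ! (base n + 2 * i + 1)))"
        using 1 by blast
      finally show ?thesis using nN less_trans by blast
    qed
    show "?ev (OneHot PG) (E n) = (\<exists>g<n. \<forall>j<n. w ! (base n + 2 * n + j) \<longleftrightarrow> j = g)"
      by (rule ev_OneHot[OF _ nN]; (rule bit)?; use l in \<open>simp add: tbelow_P tval_P E_def\<close>)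
    show "?ev (OneHot PG') (E n) = (\<exists>g<n. \<forall>j<n. w ! (base n + 3 * n + j) \<longleftrightarrow> j = g)"
      by (rule ev_OneHot[OF _ nN]; (rule bit)?; use l in \<open>simp add: tbelow_P tval_P E_def\<close>)
  qed
  note parts = this
  have "?ev Fmt e = (\<exists>n<N. ?ev Lead (E n) & (?ev (FAt 0 PK0 10) (E n) & ~ ?ev (FAt 0 PLast 10) (E n)) &
      ?ev Labs (E n) &
      ?ev (OneHot PG) (E n) & ?ev (OneHot PG') (E n))"
    unfolding Fmt_def E_def ev_derived(3,6) ev_derived(1)[of _ _ _ "FAt 0 PLast 10"] by blast
  also have "\<dots> = (\<exists>n<N. shape w n)"
    unfolding len shape_def using lead parts by (intro ex_cong) (auto simp: base_def)
  also have "\<dots> = (\<exists>n. shape w n)"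
  proof -
    have "n < N" if "shape w n" for n using that assms by (simp add: shape_def base_def)
    then show ?thesis by blast
  qed
  finally show ?thesis .
qed

lemma shape_encode:
  assumes "g < n" "g' < n"
  shows "shape (encode n R g L g') n"
proof -
  note e = nth_encode[where n = n and R = R and g = g and L = L and g' = g']
  have "~ (encode n R g L g' ! (base n + 2 * i) & encode n R g L g' ! (base n + 2 * i + 1))" if "i < n" for i
    unfolding e(4,5)[OF that] by simp
  moreover have "\<exists>h<n. \<forall>j<n. encode n R g L g' ! (base n + 2 * n + j) \<longleftrightarrow> j = h"
    using e(6) assms(1) by blast
  moreover have "\<exists>h<n. \<forall>j<n. encode n R g L g' ! (base n + 3 * n + j) \<longleftrightarrow> j = h"
    using e(7) assms(2) by blast
  ultimately show ?thesis unfolding shape_def length_encode using e(1,2) by blast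
qed

lemma shape_decode:
  assumes "shape w n"
  obtains R g L g' where "w = encode n R g L g'" "R \<subseteq> {..<n} \<times> {..<n}" "g < n" "g' < n" "\<forall>i. n \<le> i --> L i = Und"
proof -
  obtain g g' where g: "g < n" "\<forall>j<n. w ! (base n + 2 * n + j) \<longleftrightarrow> j = g"
    "g' < n" "\<forall>j<n. w ! (base n + 3 * n + j) \<longleftrightarrow> j = g'" using assms unfolding shape_def by blast
  have lead: "\<forall>i<n. w ! i" "~ w ! n" and len: "length w = base n + 4 * n"
    and lab: "\<forall>i<n. ~ (w ! (base n + 2 * i) & w ! (base n + 2 * i + 1))"
    using assms unfolding shape_def by auto
  define R where "R = {(i, j). i < n & j < n & w ! (n + 1 + i * n + j)}"
  define L where "L i = (if n \<le> i then Und else if w ! (base n + 2 * i) then In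
    else if w ! (base n + 2 * i + 1) then Out else Und)" for i
  have "w = encode n R g L g'"
  proof (rule nth_equalityI)
    show "length w = length (encode n R g L g')" by (simp add: len length_encode)
    fix p assume p: "p < length w"
    note e = nth_encode[where n = n and R = R and g = g and L = L and g' = g']
    consider "p < n" | "p = n" | "n < p" "p < base n" | "base n \<le> p" "p < base n + 2 * n"
      | "base n + 2 * n \<le> p" "p < base n + 3 * n" | "base n + 3 * n \<le> p" "p < base n + 4 * n"
      using p len by linarith
    then show "w ! p = encode n R g L g' ! p"
    proof cases
      case 1
      then show ?thesis using lead e(1) by simp
    next
      case 2
      then show ?thesis using lead e by simp
    next
      case 3
      define i j where "i = (p - n - 1) div n" and "j = (p - n - 1) mod n"
      have "0 < n" using g(1) by simp
      have "p - n - 1 < n * n" using 3 by (simp add: base_def)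
      then have "i < n" unfolding i_def by (simp add: less_mult_imp_div_less)
      moreover have "j < n" unfolding j_def using \<open>0 < n\<close> by simp
      moreover have "p = n + 1 + i * n + j"
        using 3 div_mult_mod_eq[of "p - n - 1" n] unfolding i_def j_def by linarith
      ultimately show ?thesis using e(3)[of i j] by (simp add: R_def)
    next
      case 4
      define i where "i = (p - base n) div 2"
      have i: "i < n" using 4 unfolding i_def by linarith
      have "p = base n + 2 * i | p = base n + 2 * i + 1" using 4 unfolding i_def by linarith
      moreover have "L i = In \<longleftrightarrow> w ! (base n + 2 * i)" "L i = Out \<longleftrightarrow> w ! (base n + 2 * i + 1)"
        using lab i by (simp_all add: L_def)
      ultimately show ?thesis using e(4,5)[OF i] by auto
    next
      case 5
      define i where "i = p - (base n + 2 * n)"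
      have "p = base n + 2 * n + i" "i < n" using 5 unfolding i_def by linarith+
      then show ?thesis using e(6)[of i] g(2) by simp
    next
      case 6
      define i where "i = p - (base n + 3 * n)"
      have "p = base n + 3 * n + i" "i < n" using 6 unfolding i_def by linarith+
      then show ?thesis using e(7)[of i] g(4) by simp
    qed
  qed
  moreover have "R \<subseteq> {..<n} \<times> {..<n}" by (auto simp: R_def)
  moreover have "\<forall>i. n \<le> i --> L i = Und" by (simp add: L_def)
  ultimately show ?thesis using that g by blast
qed

lemma label_dist_le:
  "label_dist (AF n R) L L' \<le> n"
proof -
  have "card {a \<in> {..<n}. L a ~= L' a} \<le> card {..<n}" by (intro card_mono) auto
  then show ?thesis by (simp add: label_dist_def AF_def)
qed

lemma labellings_Und:
  assumes "L \<in> labellings s (AF n R)" "n \<le> i"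
  shows "L i = Und"
proof -
  obtain S where S: "extension s (AF n R) S" "L = labelling_of (AF n R) S" using assms(1) by (auto simp: labellings_def)
  have "i \<notin> S" "i \<notin> Def (AF n R) S"
    using assms(2) complete_subset[OF extension_complete[OF S(1)]] Def_subset[of "AF n R" S] by (auto simp: AF_def)
  then show ?thesis using S(2) by (simp add: labelling_of_def)
qed

text \<open>If some labelling differs at \<open>g\<close>, the search returns the least distance of
  such labellings, and those within this distance are exactly the counterfactuals. A single query
  for one that fails at \<open>g'\<close> then settles the universal question.\<close>

lemma theta_answer:
  fixes n g g' :: nat and R :: "(nat \<times> nat) set" and L :: "nat => label"
  defines "w \<equiv> encode n R g L g'"
  assumes R: "R \<subseteq> {..<n} \<times> {..<n}" and g: "g < n" "g' < n" and L: "\<forall>i. n \<le> i --> L i = Und"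
    and B: "decides s B"
  shows "theta_accepts B Fmt (bound 2 w) w (search (\<lambda>k. query w False False k \<in> B) 0 (bound 2 w div 2)) =
    (valid_input s (AF n R) g L g' & (\<forall>L'\<in>counterfactuals s (AF n R) g L. L' g' = In))"
proof -
  let ?F = "AF n R" and ?d = "label_dist (AF n R) L"
  let ?D = "\<lambda>L'. L' \<in> labellings s ?F & L g ~= L' g"
  let ?k = "search (\<lambda>k. query w False False k \<in> B) 0 (bound 2 w div 2)"
  have F: "is_af ?F" using R by (simp add: is_af_def AF_def)
  have q: "query w a b k \<in> B \<longleftrightarrow> (\<exists>L'\<in>labellings s ?F. sat ?F g L g' a b k L')" for a b k
    unfolding w_def decidesD[OF B inst_query[OF R g]] witnessed_def labellings_def by blast
  have q1: "query w True False 0 \<in> B \<longleftrightarrow> L \<in> labellings s ?F"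
  proof -
    \<comment> \<open>Both are \<open>Und\<close> outside the arguments, \<open>L\<close> by the way
      words are decoded and \<open>L'\<close> as the labelling of an extension.\<close>
    have "L' = L" if L': "L' \<in> labellings s ?F" "\<forall>i\<in>args ?F. L i = L' i" for L'
    proof
      have "L' i = Und" if "n \<le> i" for i using labellings_Und[OF L'(1) that] .
      then show "L' i = L i" for i using L L'(2) by (cases "i < n") (auto simp: AF_def)
    qed
    then show ?thesis unfolding q sat_def by auto
  qed
  have q2: "query w False False k \<in> B \<longleftrightarrow> (\<exists>L'. ?D L' & ?d L' \<le> k)" for k unfolding q sat_def by auto
  have q3: "query w False True k \<in> B \<longleftrightarrow> (\<exists>L'. ?D L' & ?d L' \<le> k & L' g' ~= In)" for k
    unfolding q sat_def by auto
  have fmt: "ev (bound 2 w) (bits w) rho Fmt e" for rho e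
    unfolding ev_Fmt[OF length_less_bound] w_def using shape_encode[OF g] by blast
  have "query w False True ?k \<notin> B \<longleftrightarrow> (\<forall>L'\<in>counterfactuals s ?F g L. L' g' = In)"
  proof (cases "\<exists>L'. ?D L'")
    case False
    \<comment> \<open>There is no distance to be found here, but whatever the search returns, the
      last query is answered no, which agrees with the vacuous truth.\<close>
    then have "counterfactuals s ?F g L = {}" unfolding counterfactuals_empty_iff by blast
    then show ?thesis using False q3 by auto
  next
    case True
    then obtain L0 where "?D L0" by blast
    from ex_has_least_nat[of ?D, OF this, of ?d] obtain L1 where
      L1: "?D L1" "\<forall>L'. ?D L' --> ?d L1 \<le> ?d L'" by blast
    have cf: "counterfactuals s ?F g L = {L'. ?D L' & ?d L' \<le> ?d L1}"
      unfolding counterfactuals_def using L1 by (auto simp: not_less intro: order_trans)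
    have "?k = ?d L1"
    proof (rule search_finds)
      have "n \<le> length w" by (simp add: w_def length_encode)
      also have "\<dots> \<le> bound 2 w div 2" by (simp add: bound_def power2_eq_square)
      finally show "?d L1 \<le> 0 + bound 2 w div 2" using label_dist_le[of n R L L1] by simp
      show "query w False False k \<in> B \<longleftrightarrow> ?d L1 \<le> k" for k
        unfolding q2 using L1 by (meson order_trans)
    qed simp
    then show ?thesis unfolding cf q3 by auto
  qed
  then show ?thesis
    unfolding theta_accepts_def valid_input_def using fmt q1 F g by (simp add: AF_def)
qed

lemma CF_SA_theta:
  assumes "B \<in> C"
    and B: "decides s B"
  shows "CF_SA s \<in> log_query_class C"
proof -
  let ?A = "\<lambda>w. theta_accepts B Fmt (bound 2 w) w (search (\<lambda>k. query w False False k \<in> B) 0 (bound 2 w div 2))"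
  have "w \<in> CF_SA s \<longleftrightarrow> ?A w" for w
  proof
    assume "w \<in> CF_SA s"
    then obtain n R g L g' where w: "w = encode n R g L g'" "valid_input s (AF n R) g L g'"
      "\<forall>L'\<in>counterfactuals s (AF n R) g L. L' g' = In" unfolding CF_SA_def AF_def by blast
    have 1: "R \<subseteq> {..<n} \<times> {..<n}" "g < n" "g' < n" using w(2) by (auto simp: valid_input_def is_af_def AF_def)
    have "\<forall>i. n \<le> i --> L i = Und" using w(2) labellings_Und by (auto simp: valid_input_def)
    from theta_answer[OF 1 this B] w show "?A w" by simp
  next
    assume a: "?A w"
    then have "ev (bound 2 w) (bits w) (guess_rel []) Fmt (\<lambda>_. 0)" by (simp add: theta_accepts_def)
    then obtain n where "shape w n" unfolding ev_Fmt[OF length_less_bound] by blast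
    then obtain R g L g' where w: "w = encode n R g L g'" and 1: "R \<subseteq> {..<n} \<times> {..<n}" "g < n" "g' < n"
      "\<forall>i. n \<le> i --> L i = Und" by (rule shape_decode)
    from theta_answer[OF 1 B] a w have "valid_input s (AF n R) g L g' & (\<forall>L'\<in>counterfactuals s (AF n R) g L. L' g' = In)"
      by simp
    then show "w \<in> CF_SA s" unfolding CF_SA_def w AF_def by blast
  qed
  then have "CF_SA s = {w. ?A w}" by blast
  then show ?thesis using log_query_class_search[OF unary_Fmt _ assms(1), of 2] by simp
qed

theorem CF_SA_Theta2p: "s \<in> {Co, St} ==> CF_SA s \<in> Theta2p"
  unfolding Theta2p_def using oracle_Co_St CF_SA_theta by metis

theorem CF_SA_Theta3p: "s \<in> {Pr, Sst} ==> CF_SA s \<in> Theta3p"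
  unfolding Theta3p_def using oracle_Pr_Sst CF_SA_theta by metis

section \<open>The gadget\<close>

text \<open>
  The reduction evaluates \<open>phi\<close> by a circuit of NOR gates: \<open>NF\<close> at an assignment of the variables is
  the gate of a subformula, \<open>LP\<close> and \<open>LN\<close> are the literals of a relation at a tuple. In an extension
  either \<open>NE\<close> switches everything off, or \<open>NT\<close> switches the circuit on. In the second case \<open>NB\<close> is
  undecided unless the gate of \<open>phi\<close> is accepted, and then so are the literals of the universal
  relations (those in \<open>U\<close>). The primed nodes record the choices made in the range of an extension, so
  that extensions with different choices are incomparable for the semi-stable semantics.
\<close>

datatype 'r node = NE | NT | NB | NE' | NT' | LP 'r | LN 'r | LP' 'r | LN' 'r | NF "'r fm"

text \<open>The formulas that can be turned into circuits. All gates are indexed by assignments to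
  the same \<open>V\<close> variables and all literals by \<open>V\<close>-tuples; counting has no
  counterpart among the gates.\<close>

primrec plain :: "nat => 'r fm => bool" where
  "plain V (FEq x y) = (x < V & y < V)"
| "plain V (FLess x y) = (x < V & y < V)"
| "plain V (FSum x y z) = (x < V & y < V & z < V)"
| "plain V (FProd x y z) = (x < V & y < V & z < V)"
| "plain V (FIn a v) = (v < V)"
| "plain V (FRel r vs) = (length vs = V & set vs \<subseteq> {..<V})"
| "plain V (FNor phi psi) = (plain V phi & plain V psi)"
| "plain V (FNex v phi) = (v < V & plain V phi)"
| "plain V (FCnt v phi y) = False"

primrec subs :: "'r fm => 'r fm list" where
  "subs (FEq x y) = [FEq x y]"
| "subs (FLess x y) = [FLess x y]"
| "subs (FSum x y z) = [FSum x y z]"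
| "subs (FProd x y z) = [FProd x y z]"
| "subs (FIn a v) = [FIn a v]"
| "subs (FRel r vs) = [FRel r vs]"
| "subs (FNor phi psi) = FNor phi psi # subs phi @ subs psi"
| "subs (FNex v phi) = FNex v phi # subs phi"
| "subs (FCnt v phi y) = FCnt v phi y # subs phi"

primrec rels :: "'r fm => 'r list" where
  "rels (FEq x y) = []"
| "rels (FLess x y) = []"
| "rels (FSum x y z) = []"
| "rels (FProd x y z) = []"
| "rels (FIn a v) = []"
| "rels (FRel r vs) = [r]"
| "rels (FNor phi psi) = rels phi @ rels psi"
| "rels (FNex v phi) = rels phi"
| "rels (FCnt v phi y) = rels phi"

lemma subs_self: "phi \<in> set (subs phi)" by (cases phi) auto

lemma subs_closed:
  "FNor a b \<in> set (subs phi) ==> a \<in> set (subs phi) & b \<in> set (subs phi)"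
  "FNex v a \<in> set (subs phi) ==> a \<in> set (subs phi)"
  "FRel r vs \<in> set (subs phi) ==> r \<in> set (rels phi)" by (induction phi) (auto simp: subs_self)

lemma subs_plain: "plain V phi ==> psi \<in> set (subs phi) ==> plain V psi" by (induction phi) auto

definition special :: "'r node list" where "special = [NE, NT, NB, NE', NT']"

definition nodes :: "'r fm => 'r node list" where
  "nodes phi = special @ remdups (concat (map (\<lambda>r. [LP r, LN r, LP' r, LN' r]) (rels phi))) @ remdups (map NF (subs phi))"

abbreviation origin :: "nat => nat" where "origin \<equiv> \<lambda>_. 0"

text \<open>Turns the tuple of an atom into an assignment, so that literals and gates share one
  index set.\<close>

definition tup :: "nat => nat list => (nat => nat) => nat => nat" where
  "tup V vs e = (\<lambda>i. if i < V then e (vs ! i) else 0)"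

definition merge :: "('r => bool) => ('r => nat list => bool) => ('r => nat list => bool) => 'r => nat list => bool" where
  "merge U Y Z r = (if U r then Z r else Y r)"

locale gadget =
  fixes s :: sem and N V :: nat and xs :: "nat list" and U :: "'r => bool" and phi :: "'r fm"
  assumes N: "0 < N" and plain: "plain V phi"
begin

definition co :: bool where "co = (s = Co)"
definition st :: bool where "st = (s = St)"
definition semi :: bool where "semi = (s = Sst)"

lemma extension_kinds:
  "co ==> extension s X S = complete_ext X S" "st ==> extension s X S = stable_ext X S"
  "semi ==> extension s X S = semi_stable_ext X S"
  "~ co ==> ~ st ==> ~ semi ==> extension s X S = preferred_ext X S"
  "co ==> ~ st" "co ==> ~ semi" "st ==> ~ semi"
  unfolding co_def st_def semi_def by simp_all (cases s; simp)

definition envs :: "(nat => nat) set" where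
  "envs = {e. (\<forall>v<V. e v < N) & (\<forall>v. V \<le> v --> e v = 0)}"

definition A :: "('r node \<times> (nat => nat)) set" where
  "A = {(c, e). c \<in> set (nodes phi) & (if c \<in> set special then e = origin else e \<in> envs)}"

text \<open>\<open>NE\<close> attacks everything but \<open>NT'\<close> and, except for
  \<open>Co\<close>, itself, so accepting it switches the circuit off. For \<open>Co\<close> it
  attacks itself, since otherwise \<open>{NE}\<close> would be a complete extension that rejects
  \<open>NB\<close> whatever \<open>phi\<close> is. The primed nodes attack themselves so that they
  count only in the range; for \<open>St\<close> they must not, because a self-attacking node whose
  other attackers are not accepted would destroy stability. \<open>NB\<close> attacks the universal
  literals, which can be accepted only once \<open>NB\<close> is rejected. False atomic gates are
  attacked by \<open>NT\<close>, true ones are not.\<close>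

fun att :: "'r node \<times> (nat => nat) => 'r node \<times> (nat => nat) => bool" where
  "att x (NE, e) = (x = (NT, origin) | x = (NE, origin) & co)"
| "att x (NT, e) = (x = (NE, origin))"
| "att x (NB, e) = (x = (NE, origin) | x = (NB, origin) | x = (NF phi, origin))"
| "att x (NE', e) = (x = (NE, origin) | x = (NE', origin) & ~ st)"
| "att x (NT', e) = (x = (NT, origin) | x = (NT', origin) & ~ st)"
| "att x (LP r, e) = (x = (NE, origin) | x = (NB, origin) & U r | x = (LN r, e))"
| "att x (LN r, e) = (x = (NE, origin) | x = (NB, origin) & U r | x = (LP r, e))"
| "att x (LP' r, e) = (x = (NE, origin) | x = (LP r, e) | x = (LP' r, e) & ~ st)"
| "att x (LN' r, e) = (x = (NE, origin) | x = (LN r, e) | x = (LN' r, e) & ~ st)"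
| "att x (NF (FRel r vs), e) = (x = (NE, origin) | x = (LN r, tup V vs e))"
| "att x (NF (FNor a b), e) = (x = (NE, origin) | x = (NF a, e) | x = (NF b, e))"
| "att x (NF (FNex v a), e) = (x = (NE, origin) | (\<exists>i<N. x = (NF a, e(v := i))))"
| "att x (NF psi, e) = (x = (NE, origin) | x = (NT, origin) & ~ ev N xs (\<lambda>_ _. False) psi e)"

definition F :: "('r node \<times> (nat => nat)) af" where
  "F = \<lparr>args = A, attacks = {(x, y). x \<in> A & y \<in> A & att x y}\<rparr>"

lemma Def_F: "S \<subseteq> A ==> y \<in> Def F S \<longleftrightarrow> y \<in> A & (\<exists>x\<in>S. att x y)" by (auto simp: Def_def F_def)

lemma Acc_F: "y \<in> Acc F S \<longleftrightarrow> y \<in> A & (\<forall>x\<in>A. att x y --> x \<in> Def F S)" by (auto simp: Acc_def F_def)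

lemma finite_envs: "finite envs"
proof -
  have "envs \<subseteq> {e. \<forall>v. (v \<in> {..<V} --> e v \<in> {..<N}) & (v \<notin> {..<V} --> e v = 0)}"
    by (auto simp: envs_def)
  then show ?thesis by (rule finite_subset) (intro finite_set_of_finite_funs; simp)
qed

lemma is_af_F: "is_af F"
proof -
  have "A \<subseteq> set (nodes phi) \<times> insert origin envs" by (auto simp: A_def split: if_splits)
  then have "finite A" by (rule finite_subset) (simp add: finite_envs)
  then show ?thesis by (auto simp: is_af_def F_def)
qed

lemma origin_envs: "origin \<in> envs" using N by (simp add: envs_def)

lemma in_A_special [simp]: "(NE, e) \<in> A \<longleftrightarrow> e = origin" "(NT, e) \<in> A \<longleftrightarrow> e = origin" "(NB, e) \<in> A \<longleftrightarrow> e = origin"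
  "(NE', e) \<in> A \<longleftrightarrow> e = origin" "(NT', e) \<in> A \<longleftrightarrow> e = origin"
  by (simp_all add: A_def nodes_def special_def)

lemma in_A_rel [simp]: "(LP r, e) \<in> A \<longleftrightarrow> r \<in> set (rels phi) & e \<in> envs" "(LN r, e) \<in> A \<longleftrightarrow> r \<in> set (rels phi) & e \<in> envs"
  "(LP' r, e) \<in> A \<longleftrightarrow> r \<in> set (rels phi) & e \<in> envs" "(LN' r, e) \<in> A \<longleftrightarrow> r \<in> set (rels phi) & e \<in> envs"
  by (auto simp: A_def nodes_def special_def)

lemma in_A_NF [simp]: "(NF psi, e) \<in> A \<longleftrightarrow> psi \<in> set (subs phi) & e \<in> envs"
  by (auto simp: A_def nodes_def special_def)

lemma NF_phi [simp]: "phi \<in> set (subs phi)" "origin \<in> envs" by (rule subs_self) (rule origin_envs)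

lemma NF_FNex: "FNex v a \<in> set (subs phi) ==> e \<in> envs ==> i < N ==> e(v := i) \<in> envs & a \<in> set (subs phi)"
  using subs_plain[OF plain, of "FNex v a"] subs_closed(2)[of v a phi] by (auto simp: envs_def)

lemma NF_FRel:
  assumes "FRel r vs \<in> set (subs phi)" "e \<in> envs"
  shows "tup V vs e \<in> envs" "r \<in> set (rels phi)" "map (tup V vs e) [0..<V] = map e vs"
proof -
  have p: "length vs = V" "set vs \<subseteq> {..<V}" using subs_plain[OF plain assms(1)] by auto
  then have "vs ! i < V" if "i < V" for i using that nth_mem by fastforce
  then show "tup V vs e \<in> envs" using assms(2) by (auto simp: envs_def tup_def)
  show "r \<in> set (rels phi)" using assms(1) by (rule subs_closed(3))
  show "map (tup V vs e) [0..<V] = map e vs" by (rule nth_equalityI) (simp_all add: p tup_def)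
qed

lemma no_FCnt: "FCnt v a y \<notin> set (subs phi)" using subs_plain[OF plain, of "FCnt v a y"] by auto

text \<open>The nodes accepted under an interpretation \<open>rho\<close> that satisfies
  \<open>phi\<close>; \<open>rej\<close> gives the rejected ones. Except for \<open>St\<close> some
  primed nodes are neither, and remain undecided.\<close>

fun val :: "('r => nat list => bool) => 'r node \<times> (nat => nat) => bool" where
  "val rho (NE, e) = False"
| "val rho (NT, e) = True"
| "val rho (NB, e) = False"
| "val rho (NE', e) = (st)"
| "val rho (NT', e) = False"
| "val rho (LP r, e) = rho r (map e [0..<V])"
| "val rho (LN r, e) = (~ rho r (map e [0..<V]))"
| "val rho (LP' r, e) = (st & ~ rho r (map e [0..<V]))"
| "val rho (LN' r, e) = (st & rho r (map e [0..<V]))"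
| "val rho (NF psi, e) = ev N xs rho psi e"

fun rej :: "('r => nat list => bool) => 'r node \<times> (nat => nat) => bool" where
  "rej rho (NE, e) = True"
| "rej rho (NT, e) = False"
| "rej rho (NB, e) = True"
| "rej rho (NE', e) = False"
| "rej rho (NT', e) = True"
| "rej rho (LP r, e) = (~ rho r (map e [0..<V]))"
| "rej rho (LN r, e) = rho r (map e [0..<V])"
| "rej rho (LP' r, e) = rho r (map e [0..<V])"
| "rej rho (LN' r, e) = (~ rho r (map e [0..<V]))"
| "rej rho (NF psi, e) = (~ ev N xs rho psi e)"

definition model :: "('r => nat list => bool) => ('r node \<times> (nat => nat)) set" where
  "model rho = {x \<in> A. val rho x}"

lemma bex_cases:
  "(\<exists>x\<in>X. P x & (x = a | Q x)) = (a \<in> X & P a | (\<exists>x\<in>X. P x & Q x))"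
  "(\<exists>x\<in>X. P x & (x = a & c | Q x)) = (a \<in> X & P a & c | (\<exists>x\<in>X. P x & Q x))"
  "(\<exists>x\<in>X. P x & x = a) = (a \<in> X & P a)" "(\<exists>x\<in>X. P x & x = a & c) = (a \<in> X & P a & c)"
  "(\<exists>x\<in>X. P x & (\<exists>i<n. x = f i)) = (\<exists>i<n. f i \<in> X & P (f i))" by blast+

lemma Def_model:
  assumes "ev N xs rho phi origin" "y \<in> A"
  shows "y \<in> Def F (model rho) \<longleftrightarrow> rej rho y"
proof -
  have "model rho \<subseteq> A" by (auto simp: model_def)
  then have "y \<in> Def F (model rho) \<longleftrightarrow> (\<exists>x\<in>A. val rho x & att x y)"
    using assms(2) Def_F[of "model rho" y] by (auto simp: model_def)
  also have "\<dots> = rej rho y"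
  proof (cases y)
    case (Pair c e)
    show ?thesis
    proof (cases c)
      case (NF psi)
      then have psi: "psi \<in> set (subs phi)" "e \<in> envs" using assms(2) Pair by simp_all
      show ?thesis
      proof (cases psi)
        case (FRel r vs)
        show ?thesis using Pair NF FRel NF_FRel[of r vs e] psi by (simp add: bex_cases)
      next
        case (FNor a b)
        then show ?thesis using Pair NF psi subs_closed(1)[of a b phi] by (auto simp: bex_cases)
      next
        case (FNex v a)
        then show ?thesis using Pair NF psi NF_FNex[of v a e] by (auto simp: bex_cases)
      next
        case (FCnt v a y)
        then show ?thesis using psi no_FCnt by simp
      qed (use Pair NF in \<open>auto simp: bex_cases\<close>)
    qed (use assms Pair in \<open>auto simp: bex_cases\<close>)
  qed
  finally show ?thesis .
qed

lemma ball_cases: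
  "(\<forall>x\<in>X. x = a | Q x --> P x) = ((a \<in> X --> P a) & (\<forall>x\<in>X. Q x --> P x))"
  "(\<forall>x\<in>X. x = a & c | Q x --> P x) = ((a \<in> X & c --> P a) & (\<forall>x\<in>X. Q x --> P x))"
  "(\<forall>x\<in>X. x = a --> P x) = (a \<in> X --> P a)" "(\<forall>x\<in>X. x = a & c --> P x) = (a \<in> X & c --> P a)"
  "(\<forall>x\<in>X. (\<exists>i<n. x = f i) --> P x) = (\<forall>i<n. f i \<in> X --> P (f i))" by blast+

text \<open>For gates, being accepted iff all attackers are rejected is the recursion of
  \<open>ev\<close> on joint denial and nonexistence. Truth of \<open>phi\<close> enters at one
  place only: it rejects \<open>NB\<close>, without which the universal literals would not be
  defended.\<close>

lemma model_complete:
  assumes "ev N xs rho phi origin"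
  shows "complete_ext F (model rho)"
proof -
  have 1: "y \<in> Acc F (model rho) \<longleftrightarrow> val rho y" if y: "y \<in> A" for y
  proof -
    have "y \<in> Acc F (model rho) \<longleftrightarrow> (\<forall>x\<in>A. att x y --> rej rho x)"
      using y Def_model[OF assms] by (auto simp: Acc_F)
    also have "\<dots> = val rho y"
    proof (cases y)
      case (Pair c e)
      show ?thesis
      proof (cases c)
        case (NF psi)
        then have psi: "psi \<in> set (subs phi)" "e \<in> envs" using y Pair by simp_all
        show ?thesis
        proof (cases psi)
          case (FRel r vs)
          then show ?thesis using Pair NF NF_FRel[of r vs e] psi by (simp add: ball_cases)
        next
          case (FNor a b)
          then show ?thesis using Pair NF psi subs_closed(1)[of a b phi] by (simp add: ball_cases ball_conj_distrib)
        next
          case (FNex v a)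
          then show ?thesis using Pair NF psi NF_FNex[of v a e] by (simp add: ball_cases)
        next
          case (FCnt v a y)
          then show ?thesis using psi no_FCnt by simp
        qed (use Pair NF in \<open>simp_all add: ball_cases\<close>)
      qed (use assms y Pair in \<open>simp_all add: ball_cases ball_conj_distrib, blast+\<close>)
    qed
    finally show ?thesis .
  qed
  have "~ (val rho y & rej rho y)" for y by (cases "(rho, y)" rule: val.cases) auto
  moreover have "Acc F (model rho) \<subseteq> A" by (auto simp: Acc_F)
  moreover have "Def F (model rho) \<subseteq> A" using Def_subset[of F] by (simp add: F_def)
  ultimately show ?thesis
    unfolding complete_iff using 1 Def_model[OF assms] by (auto simp: model_def)
qed

lemma complete_A: "complete_ext F S ==> S \<subseteq> A" using complete_subset[of F S] by (simp add: F_def)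

lemma complete_no_attack: "complete_ext F S ==> x \<in> S ==> y \<in> S ==> ~ att x y"
  using complete_A[of S] Def_F[of S y] unfolding complete_iff by blast

lemma complete_attacker:
  "complete_ext F S ==> y \<in> S ==> x \<in> A ==> att x y ==> \<exists>z\<in>S. att z x"
  using complete_A[of S] Def_F[of S x] Acc_F[of y S] by (auto simp: complete_iff)

lemma NE_notin: "complete_ext F S ==> (NT, origin) \<in> S ==> (NE, origin) \<notin> S"
  using complete_no_attack[of S "(NT, origin)" "(NE, origin)"] by auto

text \<open>Only implications can be expected: literals may be undecided in a complete extension,
  and then gates may be so too. Accepted gates are true and attacked gates are false under every
  interpretation that agrees with the accepted literals, by mutual support along the formula, as an
  accepted gate has all its attackers attacked.\<close>

lemma sound:
  assumes S: "complete_ext F S" "(NT, origin) \<in> S"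
    and lits: "\<And>r e. (LP r, e) \<in> S ==> rho r (map e [0..<V])" "\<And>r e. (LN r, e) \<in> S ==> ~ rho r (map e [0..<V])"
  shows "(NF psi, e) \<in> A ==> ((NF psi, e) \<in> S --> ev N xs rho psi e) & ((\<exists>x\<in>S. att x (NF psi, e)) --> ~ ev N xs rho psi e)"
proof (induction psi arbitrary: e)
  case (FRel r vs)
  have NE: "(NE, origin) \<notin> S" and NB: "(NB, origin) \<notin> S"
    using NE_notin[OF S] complete_no_attack[OF S(1), of "(NB, origin)" "(NB, origin)"] by auto
  have rel: "tup V vs e \<in> envs" "r \<in> set (rels phi)" "map (tup V vs e) [0..<V] = map e vs"
    using NF_FRel[of r vs e] FRel by simp_all
  have "(LP r, tup V vs e) \<in> S" if "(NF (FRel r vs), e) \<in> S"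
    using complete_attacker[OF S(1) that, of "(LN r, tup V vs e)"] rel NE NB by auto
  then show ?case using lits[of r "tup V vs e"] rel NE by auto
next
  case (FNor a b)
  note NE = NE_notin[OF S]
  have A: "(NF a, e) \<in> A" "(NF b, e) \<in> A" using FNor.prems subs_closed(1)[of a b phi] by auto
  have "(\<exists>z\<in>S. att z (NF a, e)) & (\<exists>z\<in>S. att z (NF b, e))" if "(NF (FNor a b), e) \<in> S"
    using complete_attacker[OF S(1) that A(1)] complete_attacker[OF S(1) that A(2)] by simp
  then show ?case using FNor.IH(1)[OF A(1)] FNor.IH(2)[OF A(2)] NE by auto
next
  case (FNex v a)
  note NE = NE_notin[OF S]
  have A: "(NF a, e(v := i)) \<in> A" if "i < N" for i using FNex.prems NF_FNex[of v a e i] that by auto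
  have "\<exists>z\<in>S. att z (NF a, e(v := i))" if "(NF (FNex v a), e) \<in> S" "i < N" for i
    using complete_attacker[OF S(1) that(1) A[OF that(2)]] that(2) by auto
  then have 1: "~ ev N xs rho a (e(v := i))" if "(NF (FNex v a), e) \<in> S" "i < N" for i
    using FNex.IH[OF A[OF that(2)]] that by blast
  have 2: "ev N xs rho a (e(v := i))" if "(NF a, e(v := i)) \<in> S" "i < N" for i
    using FNex.IH[OF A[OF that(2)]] that by blast
  have "(\<exists>x\<in>S. att x (NF (FNex v a), e)) = (\<exists>i<N. (NF a, e(v := i)) \<in> S)"
    using NE by (auto simp del: in_A_NF)
  then show ?case using 1 2 unfolding ev.simps by blast
next
  case (FCnt v a y)
  then show ?case using no_FCnt by simp
qed (use NE_notin[OF S] in \<open>auto dest: complete_no_attack[OF S]\<close>)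


text \<open>The extension whose labelling is given to the problem. It must be an extension whatever
  \<open>phi\<close> is: for \<open>Co\<close> nothing is decided, otherwise the circuit is switched
  off.\<close>

definition base_ext :: "('r node \<times> (nat => nat)) set" where
  "base_ext = (if co then {} else if st then {(NE, origin), (NT', origin)} else {(NE, origin)})"

text \<open>A stable extension rejects the self-attacking \<open>NB\<close> in any case, so for
  \<open>St\<close> the switch \<open>NE\<close> is observed instead.\<close>

definition target :: "'r node \<times> (nat => nat)" where
  "target = (if st then NE else NB, origin)"

definition flips :: bool where
  "flips = (\<exists>S. extension s F S & labelling_of F base_ext target ~= labelling_of F S target)"

lemma att_NE: "fst y ~= NT' ==> fst y ~= NE ==> att (NE, origin) y"
  by (cases "((NE, origin) :: 'r node \<times> (nat => nat), y)" rule: att.cases) auto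

lemma target_A: "target \<in> A" by (simp add: target_def)

lemma base_A: "base_ext \<subseteq> A" by (auto simp: base_ext_def)

lemma Def_base: "y \<in> Def F base_ext \<longleftrightarrow> ~ co & y \<in> A & fst y ~= NT' & fst y ~= NE"
proof (cases "fst y = NT' | fst y = NE")
  case True
  then show ?thesis using Def_F[OF base_A, of y] extension_kinds(5) by (cases y) (auto simp: base_ext_def)
next
  case False
  have "(\<exists>x\<in>base_ext. att x y) = (~ co)" using att_NE[of y] False by (auto simp: base_ext_def)
  then show ?thesis using Def_F[OF base_A, of y] False by blast
qed

lemma base_complete: "complete_ext F base_ext"
proof -
  note sub = base_A and D = Def_base
  have "y \<in> Acc F base_ext \<longleftrightarrow> y \<in> base_ext" for y
  proof (cases "y \<in> A")
    case True
    obtain c e where y: "y = (c, e)" by (cases y)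
    consider "c = NE" | "c = NT'" | "c ~= NE" "c ~= NT'" by blast
    then show ?thesis
    proof cases
      case 1
      then show ?thesis using True y D extension_kinds(5) by (auto simp: Acc_F base_ext_def)
    next
      case 2
      then show ?thesis using True y D extension_kinds(5) by (auto simp: Acc_F base_ext_def)
    next
      case 3
      then have "att (NE, origin) y" using att_NE[of y] y by simp
      then show ?thesis using True y D 3 by (auto simp: Acc_F base_ext_def)
    qed
  next
    case False
    then show ?thesis using sub by (auto simp: Acc_F)
  qed
  moreover have "base_ext \<inter> Def F base_ext = {}" using D by (auto simp: base_ext_def)
  ultimately show ?thesis unfolding complete_iff by blast
qed

lemma base_range: "~ co ==> base_ext \<union> Def F base_ext \<supseteq> A - {(NT', origin)}"
proof
  fix y assume "~ co" "y \<in> A - {(NT', origin)}"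
  moreover note base_A
  moreover have "(NE, origin) \<in> base_ext" using \<open>~ co\<close> by (simp add: base_ext_def)
  ultimately show "y \<in> base_ext \<union> Def F base_ext"
    using Def_F[of base_ext y] att_NE[of y] in_A_special(1)[of "snd y"] in_A_special(5)[of "snd y"]
    by (cases "fst y = NE | fst y = NT'"; cases y) auto
qed

lemma base_extension: "extension s F base_ext"
proof -
  consider co | "~ co" st | "~ co" "~ st" by blast
  then show ?thesis
  proof cases
  case 1
  then show ?thesis using base_complete by (simp add: extension_kinds)
next
  case 2
  have "(NT', origin) \<in> base_ext" using 2 by (simp add: base_ext_def)
  then have "base_ext \<union> Def F base_ext = A"
    using base_range[OF 2(1)] Def_subset[of F base_ext] complete_A[OF base_complete] by (auto simp: F_def)
  then show ?thesis using 2(2) base_complete by (simp add: extension_kinds stable_iff F_def)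
next
  case 3
  \<comment> \<open>\<open>base_ext\<close> leaves only \<open>NT'\<close> out of its range. A
    larger range contains both \<open>NT'\<close> and \<open>NE'\<close>, which attack themselves
    and so must be attacked by \<open>NT\<close> and \<open>NE\<close>; but these two exclude each
    other.\<close>
  have r: "False" if T: "complete_ext F T" "base_ext \<union> Def F base_ext \<subset> T \<union> Def F T" for T
  proof -
    have TA: "T \<subseteq> A" using complete_A[OF T(1)] .
    have "T \<union> Def F T \<subseteq> A" using TA Def_subset[of F T] by (auto simp: F_def)
    have "(NT', origin) \<in> T \<union> Def F T" "(NE', origin) \<in> T \<union> Def F T"
    proof -
      have "(NE', origin) \<in> A - {(NT', origin)}" by simp
      then show "(NE', origin) \<in> T \<union> Def F T" using T(2) base_range[OF 3(1)] by blast
      obtain x where "x \<in> T \<union> Def F T" "x \<notin> base_ext \<union> Def F base_ext" using T(2) by blast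
      then have "x \<in> T \<union> Def F T" "x = (NT', origin)"
        using base_range[OF 3(1)] \<open>T \<union> Def F T \<subseteq> A\<close> by blast+
      then show "(NT', origin) \<in> T \<union> Def F T" by simp
    qed
    moreover have "(NT', origin) \<notin> T" "(NE', origin) \<notin> T"
      using complete_no_attack[OF T(1), of "(NT', origin)" "(NT', origin)"]
        complete_no_attack[OF T(1), of "(NE', origin)" "(NE', origin)"] 3 by auto
    ultimately have "(NT, origin) \<in> T" "(NE, origin) \<in> T" using Def_F[OF TA] by auto
    then show False using NE_notin[OF T(1)] by blast
  qed
  have "preferred_ext F base_ext" unfolding preferred_ext_def
  proof (intro conjI base_complete notI)
    assume "\<exists>T. complete_ext F T & base_ext \<subset> T"
    then obtain T where T: "complete_ext F T" "base_ext \<subset> T" by blast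
    have "base_ext \<union> Def F base_ext \<subseteq> T \<union> Def F T" using Def_mono[of base_ext T F] T(2) by blast
    moreover have "~ T \<subseteq> base_ext \<union> Def F base_ext"
      using T Def_mono[of base_ext T F] unfolding complete_iff by blast
    ultimately show False using r[OF T(1)] by blast
  qed
  then show ?thesis using 3 r semi_stable_iff[OF is_af_F] by (cases semi) (auto simp: extension_kinds)
qed
qed

lemma NB_out:
  assumes S: "complete_ext F S" "(NT, origin) \<in> S" and NB: "(NB, origin) \<in> Def F S"
  shows "(NF phi, origin) \<in> S"
proof -
  obtain x where x: "x \<in> S" "att x (NB, origin)" using NB Def_F[OF complete_A[OF S(1)]] by auto
  moreover have "(NB, origin) \<notin> S" using complete_no_attack[OF S(1), of "(NB, origin)" "(NB, origin)"] by auto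
  ultimately show ?thesis using NE_notin[OF S] by auto
qed

lemma lits_consistent: "complete_ext F S ==> (LN r, e) \<in> S ==> (LP r, e) \<notin> S"
  using complete_no_attack[of S "(LP r, e)" "(LN r, e)"] by auto

text \<open>Literals that are not accepted are read as false. This agrees with accepted negative
  literals too, since \<open>LP\<close> and \<open>LN\<close> of one tuple are never accepted
  together.\<close>

definition decode :: "('r node \<times> (nat => nat)) set => 'r => nat list => bool" where
  "decode S r t = (\<exists>e\<in>envs. t = map e [0..<V] & (LP r, e) \<in> S)"

lemma decode: "e \<in> envs ==> decode S r (map e [0..<V]) = ((LP r, e) \<in> S)"
proof -
  have "e = e'" if "e \<in> envs" "e' \<in> envs" "map e [0..<V] = map e' [0..<V]" for e e'
  proof
    show "e v = e' v" for v using that by (cases "v < V") (auto simp: envs_def)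
  qed
  then show "e \<in> envs ==> ?thesis" unfolding decode_def by metis
qed

text \<open>Only \<open>NE\<close> and the gate of \<open>phi\<close> can reject \<open>NB\<close>,
  and a flip excludes \<open>NE\<close>: for \<open>Co\<close> because it attacks itself, for
  \<open>St\<close> because it is the target. The accepted gate makes \<open>phi\<close> true under
  the accepted literals. Conversely the model of a satisfying interpretation is an extension with
  another label at the target.\<close>

lemma other_labelling_Co_St:
  assumes s: "co | st"
  shows "flips = (\<exists>rho. ev N xs rho phi origin)"
proof
  assume flips
  then obtain S where S: "extension s F S" "labelling_of F base_ext target ~= labelling_of F S target"
    unfolding flips_def by blast
  note c = extension_complete[OF S(1)]
  have NB: "(NB, origin) \<notin> S" using complete_no_attack[OF c, of "(NB, origin)" "(NB, origin)"] by auto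
  have "(NT, origin) \<in> S & (NB, origin) \<in> Def F S"
  proof (cases "co")
    case True
    have g: "target = (NB, origin)" using True extension_kinds(5) by (simp add: target_def)
    have "labelling_of F base_ext target = Und" using True by (simp add: labelling_of_def base_ext_def Def_def)
    then have "target \<in> Def F S" using S(2) NB g by (auto simp: labelling_of_def split: if_splits)
    moreover have "(NE, origin) \<notin> S" using complete_no_attack[OF c, of "(NE, origin)" "(NE, origin)"] True by auto
    ultimately have "(NF phi, origin) \<in> S" using Def_F[OF complete_A[OF c], of target] NB by (auto simp: g)
    then have "\<exists>z\<in>S. att z (NE, origin)" by (rule complete_attacker[OF c]) (simp_all add: att_NE)
    then show ?thesis using \<open>(NE, origin) \<notin> S\<close> \<open>target \<in> Def F S\<close> by (auto simp: g)
  next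
    case False
    then have st using s by simp
    then have r: "S \<union> Def F S = A" using S(1) by (auto simp: extension_kinds stable_iff F_def)
    have "labelling_of F base_ext target = In" using False \<open>st\<close> by (simp add: labelling_of_In target_def base_ext_def)
    then have "(NE, origin) \<notin> S" using S(2) \<open>st\<close> labelling_of_In[of F S target] unfolding target_def by metis
    moreover have "(NE, origin) \<in> S \<union> Def F S" "(NB, origin) \<in> S \<union> Def F S" unfolding r by simp_all
    ultimately show ?thesis using Def_F[OF complete_A[OF c]] NB False by auto
  qed
  then have "(NT, origin) \<in> S" "(NF phi, origin) \<in> S" using NB_out[OF c] by blast+
  moreover have "ev N xs (decode S) phi origin"
    using sound[OF c \<open>(NT, origin) \<in> S\<close>, of "decode S" phi origin] decode lits_consistent[OF c] complete_A[OF c]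
      \<open>(NF phi, origin) \<in> S\<close> by fastforce
  ultimately show "\<exists>rho. ev N xs rho phi origin" by blast
next
  assume "\<exists>rho. ev N xs rho phi origin"
  then obtain rho where rho: "ev N xs rho phi origin" by blast
  note c = model_complete[OF rho]
  have "extension s F (model rho)"
  proof (cases "co")
    case False
    then have st using s by simp
    have "val rho y | rej rho y" for y using \<open>st\<close> by (cases "(rho, y)" rule: val.cases) auto
    then have "model rho \<union> Def F (model rho) = A"
      using Def_model[OF rho] Def_subset[of F "model rho"] by (auto simp: model_def F_def)
    then show ?thesis using \<open>st\<close> c by (simp add: extension_kinds stable_iff F_def)
  qed (use c in \<open>simp add: extension_kinds\<close>)
  moreover have "labelling_of F base_ext target ~= labelling_of F (model rho) target"
  proof -
    have "target \<in> Def F (model rho)" unfolding Def_model[OF rho target_A] by (simp add: target_def)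
    then have "labelling_of F (model rho) target = Out" using labelling_of_Out[OF c] by blast
    moreover have "target \<notin> Def F base_ext"
      using s extension_kinds(5) Def_F[OF complete_A[OF base_complete], of target]
      by (cases co) (auto simp: target_def base_ext_def)
    then have "labelling_of F base_ext target ~= Out" using labelling_of_Out[OF base_complete] by blast
    ultimately show ?thesis by simp
  qed
  ultimately show flips unfolding flips_def by blast
qed

text \<open>A flip is an extension that does not reject \<open>NB\<close>. It fixes a choice
  \<open>Y\<close>, and its maximality forbids any completion \<open>Z\<close> that satisfies
  \<open>phi\<close>. Conversely the literals of a choice without satisfying completion form an
  admissible set; an extension with these literals that rejected \<open>NB\<close> would accept the
  gate of \<open>phi\<close> and thereby exhibit a completion.\<close>

lemma other_labelling_Pr_Sst:
  assumes s: "~ co" "~ st"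
  shows "flips = (\<exists>Y. \<forall>Z. ~ ev N xs (merge U Y Z) phi origin)"
proof
  assume flips
  then obtain S where S: "extension s F S" "labelling_of F base_ext target ~= labelling_of F S target"
    unfolding flips_def by blast
  note c = extension_complete[OF S(1)]
  have pr: "preferred_ext F S"
    using S(1) s by (cases semi) (auto simp: extension_kinds semi_stable_ext_def)
  have g: "target = (NB, origin)" using s by (auto simp: target_def)
  have sub: "base_ext \<subseteq> A" using complete_A[OF base_complete] .
  have "target \<in> Def F base_ext"
    using Def_F[OF sub, of target] target_A s by (auto simp: g base_ext_def)
  then have NB: "(NB, origin) \<notin> Def F S"
    using S(2) labelling_of_Out[OF c] labelling_of_Out[OF base_complete] g by metis
  have noNB: "(NB, origin) \<notin> S" using complete_no_attack[OF c, of "(NB, origin)" "(NB, origin)"] by auto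
  have NE: "(NE, origin) \<notin> S" using NB Def_F[OF complete_A[OF c], of "(NB, origin)"] by auto
  have NT': "(NT', origin) \<notin> S" "(NE', origin) \<notin> S" "(LP' r, e) \<notin> S" "(LN' r, e) \<notin> S" for r e
    using complete_no_attack[OF c, of "(NT', origin)" "(NT', origin)"] complete_no_attack[OF c, of "(NE', origin)" "(NE', origin)"]
      complete_no_attack[OF c, of "(LP' r, e)" "(LP' r, e)"] complete_no_attack[OF c, of "(LN' r, e)" "(LN' r, e)"] s by auto
  \<comment> \<open>Every possible element of \<open>S\<close> other than \<open>NT\<close> is
    attacked by \<open>NE\<close>, and only \<open>NT\<close> could answer. Without it
    \<open>S\<close> would be empty and properly contained in \<open>base_ext\<close>.\<close>
  have NT: "(NT, origin) \<in> S"
  proof (rule ccontr)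
    assume nt: "(NT, origin) \<notin> S"
    have "x \<notin> S" for x
    proof
      assume x: "x \<in> S"
      then have "x \<in> A" using complete_A[OF c] by blast
      then have "fst x ~= NT'" "fst x ~= NE" using x NE NT' by (cases x; auto)+
      from complete_attacker[OF c x _ att_NE[OF this]] NE nt s show False by auto
    qed
    then have "S \<subset> base_ext" using s by (auto simp: base_ext_def)
    then show False using pr base_complete by (auto simp: preferred_ext_def)
  qed
  have noU: "(LP r, e) \<notin> S" "(LN r, e) \<notin> S" if "U r" for r e
    using complete_attacker[OF c _ _, of "(LP r, e)" "(NB, origin)"] complete_attacker[OF c _ _, of "(LN r, e)" "(NB, origin)"]
      NB Def_F[OF complete_A[OF c], of "(NB, origin)"] that by auto
  have "~ ev N xs (merge U (decode S) Z) phi origin" for Z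
  proof
    assume ev: "ev N xs (merge U (decode S) Z) phi origin"
    let ?rho = "merge U (decode S) Z"
    have env: "e \<in> envs" if "(LP r, e) \<in> S | (LN r, e) \<in> S" for r e
      using that complete_A[OF c] in_A_rel by blast
    have lits: "(LP r, e) \<in> S ==> ?rho r (map e [0..<V])" "(LN r, e) \<in> S ==> ~ ?rho r (map e [0..<V])" for r e
      using env[of r e] decode[of e S r] noU[of r e] lits_consistent[OF c, of r e] by (auto simp: merge_def)
    \<comment> \<open>Accepted gates are true by soundness and no universal literal is accepted, so
      \<open>S\<close> lies in the model. The model rejects \<open>NB\<close> while \<open>S\<close>
      does not, so it is a properly larger complete extension, against maximality.\<close>
    have "S \<subseteq> model ?rho"
    proof
      fix x assume x: "x \<in> S"
      then have A: "x \<in> A" using complete_A[OF c] by blast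
      have "val ?rho x"
      proof (cases x)
        case (Pair d e)
        show ?thesis
        proof (cases d)
          case (NF psi)
          then show ?thesis using sound[where rho = ?rho and psi = psi and e = e, OF c NT lits] A x Pair by simp
        qed (use x A Pair NE noNB NT' lits in auto)
      qed
      then show "x \<in> model ?rho" using A by (simp add: model_def)
    qed
    moreover have "S ~= model ?rho" using NB Def_model[OF ev target_A[unfolded g]] by auto
    ultimately have "S \<subset> model ?rho" by (rule psubsetI)
    then show False using pr model_complete[OF ev] unfolding preferred_ext_def by blast
  qed
  then show "\<exists>Y. \<forall>Z. ~ ev N xs (merge U Y Z) phi origin" by blast
next
  assume "\<exists>Y. \<forall>Z. ~ ev N xs (merge U Y Z) phi origin"
  then obtain Y where Y: "\<And>Z. ~ ev N xs (merge U Y Z) phi origin" by blast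
  \<comment> \<open>The choice \<open>Y\<close> as a set of arguments: the circuit is switched on,
    and exactly the literals of the existential relations are decided.\<close>
  define T0 where "T0 = insert (NT, origin)
    ({(LP r, e) | r e. r \<in> set (rels phi) & e \<in> envs & ~ U r & Y r (map e [0..<V])} \<union>
     {(LN r, e) | r e. r \<in> set (rels phi) & e \<in> envs & ~ U r & ~ Y r (map e [0..<V])})"
  have T0A: "T0 \<subseteq> A" by (auto simp: T0_def)
  have "admissible F T0" unfolding admissible_def conflict_free_def
  proof (intro conjI)
    show "T0 \<subseteq> args F" using T0A by (simp add: F_def)
    show "T0 \<inter> Def F T0 = {}" using Def_F[OF T0A] by (auto simp: T0_def)
    show "T0 \<subseteq> Acc F T0"
    proof
      fix y assume y: "y \<in> T0"
      have NE: "(NE, origin) \<in> Def F T0" using Def_F[OF T0A] by (auto simp: T0_def)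
      have LP: "(LN r, e) \<in> Def F T0" if "(LP r, e) \<in> T0" for r e
        using Def_F[OF T0A, of "(LN r, e)"] that T0A by auto
      have LN: "(LP r, e) \<in> Def F T0" if "(LN r, e) \<in> T0" for r e
        using Def_F[OF T0A, of "(LP r, e)"] that T0A by auto
      show "y \<in> Acc F T0" using y T0A NE LP LN unfolding Acc_F by (auto simp: T0_def)
    qed
  qed
  then obtain T1 where T1: "T0 \<subseteq> T1" "preferred_ext F T1" by (rule admissible_extends[OF is_af_F])
  have "\<exists>T. extension s F T & T0 \<subseteq> T"
  proof (cases semi)
    case False
    then show ?thesis using T1 s extension_kinds(4) by blast
  next
    case True
    note Sst = s True
    obtain T where T: "semi_stable_ext F T" "T1 \<union> Def F T1 \<subseteq> T \<union> Def F T"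
      using preferred_range_extends[OF is_af_F T1(2)] .
    have c: "complete_ext F T" using T(1) by (simp add: semi_stable_ext_def preferred_ext_def)
    have r: "x \<in> T | (\<exists>z\<in>T. att z x)" if "x \<in> Def F T0" for x
      using that Def_mono[OF T1(1), of F] T(2) Def_F[OF complete_A[OF c], of x] by blast
    have self: "x \<notin> T" if "att x x" for x using complete_no_attack[OF c, of x x] that by blast
    \<comment> \<open>The primed nodes attacked by \<open>T0\<close> stay in the range. As they
      attack themselves, they must be attacked by their other attackers, which are \<open>NT\<close>
      for \<open>NT'\<close> and the literal or \<open>NE\<close> for a copy of a literal. In this
      way the range gives back the whole of \<open>T0\<close>.\<close>
    have "(NT', origin) \<in> Def F T0" using Def_F[OF T0A] by (auto simp: T0_def)
    from r[OF this] have NT: "(NT, origin) \<in> T" using self[of "(NT', origin)"] Sst by auto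
    have "(LP r, e) \<in> T" if "(LP r, e) \<in> T0" for r e
    proof -
      have "(LP' r, e) \<in> Def F T0" using Def_F[OF T0A, of "(LP' r, e)"] that T0A by auto
      from r[OF this] show ?thesis using self[of "(LP' r, e)"] Sst NE_notin[OF c NT] by auto
    qed
    moreover have "(LN r, e) \<in> T" if "(LN r, e) \<in> T0" for r e
    proof -
      have "(LN' r, e) \<in> Def F T0" using Def_F[OF T0A, of "(LN' r, e)"] that T0A by auto
      from r[OF this] show ?thesis using self[of "(LN' r, e)"] Sst NE_notin[OF c NT] by auto
    qed
    ultimately have "T0 \<subseteq> T" using NT unfolding T0_def by blast
    then show ?thesis using T(1) True extension_kinds(3) by blast
  qed
  then obtain T where T: "extension s F T" "T0 \<subseteq> T" by blast
  note c = extension_complete[OF T(1)]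
  have NT: "(NT, origin) \<in> T" using T(2) by (auto simp: T0_def)
  \<comment> \<open>The existential relations are fixed by \<open>T0\<close>, and \<open>T\<close>
    itself supplies a candidate for the universal ones.\<close>
  let ?rho = "merge U Y (decode T)"
  have lits: "?rho r (map e [0..<V])" if "(LP r, e) \<in> T" for r e
  proof -
    have A: "r \<in> set (rels phi)" "e \<in> envs" using that complete_A[OF c] in_A_rel by blast+
    have "(LN r, e) \<notin> T0" using lits_consistent[OF c] that T(2) by blast
    then show ?thesis using A decode[OF A(2)] that by (auto simp: T0_def merge_def)
  qed
  have lits': "~ ?rho r (map e [0..<V])" if "(LN r, e) \<in> T" for r e
  proof -
    have A: "r \<in> set (rels phi)" "e \<in> envs" using that complete_A[OF c] in_A_rel by blast+
    have "(LP r, e) \<notin> T" using lits_consistent[OF c] that by blast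
    then show ?thesis using A decode[OF A(2)] T(2) by (auto simp: T0_def merge_def)
  qed
  have "(NB, origin) \<notin> Def F T"
  proof
    assume "(NB, origin) \<in> Def F T"
    then have "(NF phi, origin) \<in> T" by (rule NB_out[OF c NT])
    then show False using sound[where rho = ?rho and psi = phi and e = origin, OF c NT lits lits'] Y by simp
  qed
  moreover have "(NB, origin) \<in> Def F base_ext"
    using Def_F[OF complete_A[OF base_complete], of "(NB, origin)"] s by (auto simp: base_ext_def)
  ultimately have "labelling_of F T (NB, origin) ~= Out" "labelling_of F base_ext (NB, origin) = Out"
    using labelling_of_Out[OF c, of "(NB, origin)"] labelling_of_Out[OF base_complete, of "(NB, origin)"] by simp_all
  moreover have "target = (NB, origin)" using s by (simp add: target_def)
  ultimately have "labelling_of F base_ext target ~= labelling_of F T target" by auto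
  then show flips unfolding flips_def using T(1) by blast
qed

lemma NB_never_In: "complete_ext F S ==> labelling_of F S (NB, origin) ~= In"
  using complete_no_attack[of S "(NB, origin)" "(NB, origin)"] by (auto simp: labelling_of_In)

end

section \<open>Invariance of all four semantics under renaming of arguments\<close>

locale relabelled = fixes F :: "'b af" and n :: nat and f :: "nat => 'b" and R :: "(nat \<times> nat) set"
  assumes F: "is_af F" and f: "bij_betw f {..<n} (args F)"
    and R: "R = {(i, j). i < n & j < n & (f i, f j) \<in> attacks F}"
begin

lemma af: "is_af (AF n R)" by (auto simp: is_af_def AF_def R)

lemma inj: "inj_on f {..<n}" and img: "f ` {..<n} = args F" using f by (auto simp: bij_betw_def)

lemma mem: "S \<subseteq> {..<n} ==> i < n ==> f i \<in> f ` S \<longleftrightarrow> i \<in> S" using inj_on_image_mem_iff[OF inj] by auto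

lemma subset: "S \<subseteq> {..<n} ==> T \<subseteq> {..<n} ==> f ` S \<subseteq> f ` T \<longleftrightarrow> S \<subseteq> T" using mem by blast

lemma psubset: "S \<subseteq> {..<n} ==> T \<subseteq> {..<n} ==> f ` S \<subset> f ` T \<longleftrightarrow> S \<subset> T"
  using subset[of S T] subset[of T S] by (simp add: less_le_not_le)

lemma Def_sub: "Def (AF n R) S \<subseteq> {..<n}" using Def_subset[of "AF n R" S] by (simp add: AF_def)

lemma Acc_sub: "Acc (AF n R) S \<subseteq> {..<n}" by (auto simp: Acc_def AF_def)

lemma Def_iff: "S \<subseteq> {..<n} ==> i < n ==> f i \<in> Def F (f ` S) \<longleftrightarrow> i \<in> Def (AF n R) S"
proof -
  assume S: "S \<subseteq> {..<n}" and i: "i < n"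
  have "f i \<in> args F" using img i by blast
  moreover have "(b, i) \<in> R \<longleftrightarrow> (f b, f i) \<in> attacks F" if "b \<in> S" for b
    unfolding R using S that i by auto
  ultimately show ?thesis using i by (simp add: Def_def AF_def cong: bex_cong)
qed

lemma image_eqI:
  assumes "X \<subseteq> args F" "Y \<subseteq> {..<n}" "\<And>i. i < n ==> f i \<in> X \<longleftrightarrow> i \<in> Y"
  shows "X = f ` Y"
proof -
  have "Z = f ` {i. i < n & f i \<in> Z}" if "Z \<subseteq> args F" for Z
    using that unfolding img[symmetric] by auto
  moreover have "{i. i < n & f i \<in> X} = Y" using assms(2,3) by auto
  ultimately show ?thesis using assms(1) by metis
qed

lemma Def_image: "S \<subseteq> {..<n} ==> Def F (f ` S) = f ` Def (AF n R) S"
  by (rule image_eqI[OF Def_subset Def_sub Def_iff])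

lemma Acc_image:
  assumes "S \<subseteq> {..<n}"
  shows "Acc F (f ` S) = f ` Acc (AF n R) S"
proof (rule image_eqI[OF _ Acc_sub])
  show "Acc F (f ` S) \<subseteq> args F" by (auto simp: Acc_def)
  fix i assume i: "i < n"
  have "f i \<in> Acc F (f ` S) \<longleftrightarrow> (\<forall>b\<in>args F. (b, f i) \<in> attacks F --> b \<in> Def F (f ` S))"
    using i img F by (auto simp: Acc_def is_af_def)
  also have "\<dots> = (\<forall>j<n. (f j, f i) \<in> attacks F --> j \<in> Def (AF n R) S)"
    unfolding img[symmetric] using Def_iff[OF assms] by auto
  also have "\<dots> = (i \<in> Acc (AF n R) S)" using i by (auto simp: Acc_def AF_def R)
  finally show "f i \<in> Acc F (f ` S) \<longleftrightarrow> i \<in> Acc (AF n R) S" .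
qed

lemma complete_image: "S \<subseteq> {..<n} ==> complete_ext F (f ` S) = complete_ext (AF n R) S"
  unfolding complete_iff Def_image Acc_image
  using inj_on_image_eq_iff[OF inj, of S "Acc (AF n R) S"] Acc_sub Def_sub[of S]
    inj_on_image_Int[OF inj, of S "Def (AF n R) S"] by (metis image_is_empty)

lemma preimage: "T \<subseteq> args F ==> \<exists>S. S \<subseteq> {..<n} & T = f ` S"
  unfolding img[symmetric] subset_image_iff by blast

lemma complete_AF: "complete_ext (AF n R) S ==> S \<subseteq> {..<n}"
  using complete_subset[of "AF n R" S] by (simp add: AF_def)

lemma ex_complete: "(\<exists>T. complete_ext F T & P T) = (\<exists>S. complete_ext (AF n R) S & P (f ` S))"
proof
  assume "\<exists>T. complete_ext F T & P T"
  then obtain T where T: "complete_ext F T" "P T" by blast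
  then obtain S where "S \<subseteq> {..<n}" "T = f ` S" using preimage[OF complete_subset] by blast
  then show "\<exists>S. complete_ext (AF n R) S & P (f ` S)" using T complete_image by blast
next
  assume "\<exists>S. complete_ext (AF n R) S & P (f ` S)"
  then obtain S where "complete_ext (AF n R) S" "P (f ` S)" by blast
  then show "\<exists>T. complete_ext F T & P T" using complete_image[OF complete_AF] by blast
qed

lemma range_psubset:
  assumes "S \<subseteq> {..<n}" "T \<subseteq> {..<n}"
  shows "f ` S \<union> Def F (f ` S) \<subset> f ` T \<union> Def F (f ` T) \<longleftrightarrow> S \<union> Def (AF n R) S \<subset> T \<union> Def (AF n R) T"
  unfolding Def_image[OF assms(1)] Def_image[OF assms(2)] image_Un[symmetric]
  by (rule psubset[OF Un_least[OF assms(1) Def_sub] Un_least[OF assms(2) Def_sub]])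

lemma preferred_image:
  assumes S: "S \<subseteq> {..<n}"
  shows "preferred_ext F (f ` S) = preferred_ext (AF n R) S"
proof -
  have "(\<exists>T. complete_ext F T & f ` S \<subset> T) = (\<exists>T. complete_ext (AF n R) T & S \<subset> T)"
    unfolding ex_complete using psubset[OF S complete_AF] by blast
  then show ?thesis unfolding preferred_ext_def complete_image[OF S] by simp
qed

lemma extension_image:
  assumes S: "S \<subseteq> {..<n}"
  shows "extension s F (f ` S) = extension s (AF n R) S"
proof (cases s)
  case St
  have a: "f ` S \<union> Def F (f ` S) = f ` (S \<union> Def (AF n R) S)" unfolding Def_image[OF S] image_Un ..
  have b: "f ` (S \<union> Def (AF n R) S) = f ` {..<n} \<longleftrightarrow> S \<union> Def (AF n R) S = {..<n}"
    by (rule inj_on_image_eq_iff[OF inj Un_least[OF S Def_sub] order_refl])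
  have c: "args (AF n R) = {..<n}" by (simp add: AF_def)
  have "stable_ext F (f ` S) = stable_ext (AF n R) S"
    using stable_iff[of F "f ` S"] stable_iff[of "AF n R" S] complete_image[OF S] a b img c by metis
  then show ?thesis using St by simp
next
  case Sst
  have "(\<exists>T. complete_ext F T & f ` S \<union> Def F (f ` S) \<subset> T \<union> Def F T) =
      (\<exists>T. complete_ext (AF n R) T & S \<union> Def (AF n R) S \<subset> T \<union> Def (AF n R) T)"
    unfolding ex_complete by (intro ex_cong1 conj_cong refl range_psubset[OF S] complete_AF)
  then have "semi_stable_ext F (f ` S) = semi_stable_ext (AF n R) S"
    using preferred_image[OF S] semi_stable_iff[OF F, of "f ` S"] semi_stable_iff[OF af, of S] by blast
  then show ?thesis unfolding Sst extension.simps .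
next
  case Co
  show ?thesis unfolding Co extension.simps by (rule complete_image[OF S])
next
  case Pr
  show ?thesis unfolding Pr extension.simps by (rule preferred_image[OF S])
qed

lemma labelling_image: "S \<subseteq> {..<n} ==> i < n ==> labelling_of F (f ` S) (f i) = labelling_of (AF n R) S i"
  by (simp add: labelling_of_def mem Def_iff)

lemma ex_extension: "(\<exists>T. extension s F T & P T) = (\<exists>S. S \<subseteq> {..<n} & extension s (AF n R) S & P (f ` S))"
proof
  assume "\<exists>T. extension s F T & P T"
  then obtain T where T: "extension s F T" "P T" by blast
  then obtain S where "S \<subseteq> {..<n}" "T = f ` S" using preimage[OF complete_subset[OF extension_complete]] by blast
  then show "\<exists>S. S \<subseteq> {..<n} & extension s (AF n R) S & P (f ` S)" using T extension_image by blast
next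
  assume "\<exists>S. S \<subseteq> {..<n} & extension s (AF n R) S & P (f ` S)"
  then show "\<exists>T. extension s F T & P T" using extension_image by blast
qed

end

text \<open>A word belongs to \<open>CF_SA\<close> if some decoding of it is a yes-instance, so
  excluding a word requires that its decoding is unique. Labels beyond \<open>n\<close> leave no
  trace in the word and are therefore assumed to be \<open>Und\<close>.\<close>

lemma encode_inject:
  assumes e: "encode n R g L g' = encode m Q h M h'"
    and n: "R \<subseteq> {..<n} \<times> {..<n}" "g < n" "g' < n" "\<forall>i. n \<le> i --> L i = Und"
    and m: "Q \<subseteq> {..<m} \<times> {..<m}" "h < m" "h' < m" "\<forall>i. m \<le> i --> M i = Und"
  shows "n = m & R = Q & g = h & L = M & g' = h'"
proof -
  note a = nth_encode[where n = n and R = R and g = g and L = L and g' = g']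
    and b = nth_encode[where n = m and R = Q and g = h and L = M and g' = h', folded e]
  have nm: "n = m" using a(1)[of m] a(2) b(1)[of n] b(2) by (metis linorder_cases)
  note b = b[folded nm]
  have "(i, j) \<in> R \<longleftrightarrow> (i, j) \<in> Q" for i j
    using a(3)[of i j] b(3)[of i j] n(1) m(1) nm by (cases "i < n & j < n") auto
  moreover have "L i = M i" for i
    using a(4,5)[of i] b(4,5)[of i] n(4) m(4) nm label_eq_iff[of "L i" "M i"] by (cases "i < n") auto
  moreover have "g = h" using a(6)[OF n(2)] b(6)[OF n(2)] by simp
  moreover have "g' = h'" using a(7)[OF n(3)] b(7)[OF n(3)] by simp
  ultimately show ?thesis using nm by auto
qed

text \<open>The assignments in the order in which nested \<open>EFor\<close> loops run through them.
  This order determines the numbering of the arguments.\<close>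

primrec envl :: "nat => nat list => (nat => nat) => (nat => nat) list" where
  "envl N [] e = [e]"
| "envl N (v # vs) e = concat (map (\<lambda>i. envl N vs (e(v := i))) [0..<N])"

lemma set_envl: "distinct vs ==> e' \<in> set (envl N vs e) \<longleftrightarrow> (\<forall>v\<in>set vs. e' v < N) & (\<forall>v. v \<notin> set vs --> e' v = e v)"
proof (induction vs arbitrary: e)
  case Nil
  then show ?case by (auto simp: fun_eq_iff)
next
  case (Cons v vs)
  have "e' \<in> set (envl N (v # vs) e) \<longleftrightarrow> (\<exists>i<N. e' \<in> set (envl N vs (e(v := i))))" by auto
  also have "\<dots> = (\<exists>i<N. (\<forall>u\<in>set vs. e' u < N) & (\<forall>u. u \<notin> set vs --> e' u = (e(v := i)) u))"
    using Cons.IH Cons.prems by simp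
  also have "\<dots> = ((\<forall>u\<in>set (v # vs). e' u < N) & (\<forall>u. u \<notin> set (v # vs) --> e' u = e u))"
    using Cons.prems by (auto split: if_splits)
  finally show ?case .
qed

lemma distinct_concat_map:
  assumes "distinct xs" "\<And>x. distinct (g x)" "\<And>x y. x ~= y ==> set (g x) \<inter> set (g y) = {}"
  shows "distinct (concat (map g xs))" using assms(1)
proof (induction xs)
  case (Cons x xs)
  have "set (g x) \<inter> set (g y) = {}" if "y \<in> set xs" for y
    using assms(3)[of x y] Cons.prems that by auto
  then have "set (g x) \<inter> set (concat (map g xs)) = {}" by auto
  then show ?case using Cons assms(2) by simp
qed simp

lemma distinct_envl: "distinct vs ==> distinct (envl N vs e)"
proof (induction vs arbitrary: e)
  case (Cons v vs)
  have v: "e' v = i" if "e' \<in> set (envl N vs (e(v := i)))" for e' i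
    using that set_envl[of vs e' N "e(v := i)"] Cons.prems by simp
  show ?case unfolding envl.simps
  proof (rule distinct_concat_map)
    show "distinct (envl N vs (e(v := i)))" for i by (rule Cons.IH) (use Cons.prems in simp)
    show "set (envl N vs (e(v := i))) \<inter> set (envl N vs (e(v := j))) = {}" if "i ~= j" for i j
      using v that by blast
  qed simp
qed simp

lemma envl_map:
  assumes "\<And>e v i. v \<in> set vs ==> (h e)(k v := i) = h (e(v := i))"
  shows "envl N (map k vs) (h e) = map h (envl N vs e)" using assms
proof (induction vs arbitrary: e)
  case (Cons v vs)
  have "envl N (map k vs) (h (e(v := i))) = map h (envl N vs (e(v := i)))" for i
    by (rule Cons.IH) (rule Cons.prems, simp)
  moreover have "(h e)(k v := i) = h (e(v := i))" for i by (rule Cons.prems) simp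
  ultimately show ?case by (simp only: list.map envl.simps map_concat map_map o_def)
qed simp

definition ENil :: em where "ENil = EIf (FNor (FEq 0 0) (FEq 0 0)) (EBit True)"

definition EFors :: "nat list => em => em" where "EFors vs E = foldr EFor vs E"

lemma emw_EFors: "emw N xs rho (EFors vs E) e = concat (map (emw N xs rho E) (envl N vs e))"
proof (induction vs arbitrary: e)
  case (Cons v vs)
  have c: "concat (map (\<lambda>i. concat (map h (k i))) l) = concat (map h (concat (map k l)))"
    for h :: "(nat => nat) => word" and k :: "nat => (nat => nat) list" and l by (induction l) auto
  have "emw N xs rho (EFors (v # vs) E) e = concat (map (\<lambda>i. emw N xs rho (EFors vs E) (e(v := i))) [0..<N])"
    by (simp only: EFors_def foldr.simps o_apply emw.simps)
  also have "\<dots> = concat (map (emw N xs rho E) (envl N (v # vs) e))"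
    by (simp only: Cons.IH c envl.simps)
  finally show ?case .
qed (simp add: EFors_def)

lemma unary_EFors: "unary_em E ==> unary_em (EFors vs E)" unfolding EFors_def by (induction vs) auto

definition ESeqs :: "em list => em" where "ESeqs Es = foldr ESeq Es ENil"

lemma emw_ESeqs: "emw N xs rho (ESeqs Es) e = concat (map (\<lambda>E. emw N xs rho E e) Es)"
  unfolding ESeqs_def by (induction Es) (auto simp: ENil_def)

lemma unary_ESeqs: "(\<And>E. E \<in> set Es ==> unary_em E) ==> unary_em (ESeqs Es)"
  unfolding ESeqs_def by (induction Es) (auto simp: ENil_def)

definition FAnds :: "'r fm list => 'r fm" where "FAnds phis = foldr FAnd phis (FEq 0 0)"

lemma ev_FAnds [simp]: "ev N xs rho (FAnds phis) e = (\<forall>phi\<in>set phis. ev N xs rho phi e)"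
  unfolding FAnds_def by (induction phis) auto

lemma unary_FAnds: "(\<And>phi. phi \<in> set phis ==> unary phi) ==> unary (FAnds phis)"
  unfolding FAnds_def by (induction phis) auto

text \<open>Loads an assignment into the block of variables that starts at \<open>off\<close>, so
  that the indices of two nodes can be described by one assignment.\<close>

definition put :: "nat => nat => (nat => nat) => (nat => nat) => nat => nat" where
  "put V off e' e = (\<lambda>v. if off \<le> v & v < off + V then e' (v - off) else e v)"

definition Bool :: "bool => 'r fm" where "Bool b = (if b then FEq 0 0 else FNot (FEq 0 0))"

lemma ev_Bool [simp]: "ev N xs rho (Bool b) e = b" by (simp add: Bool_def)

lemma unary_Bool [simp]: "unary (Bool b)" by (simp add: Bool_def)

lemma concat_concat_map: "concat (map (\<lambda>i. concat (map h (k i))) l) = concat (map h (concat (map k l)))"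
  by (induction l) auto

lemma concat_map_single: "concat (map (\<lambda>x. [f x]) l) = map f l" by (induction l) auto

text \<open>Formulas about two tuples, held by the variables below \<open>V\<close> and by those from \<open>V\<close> to \<open>2 * V\<close>.\<close>

definition zero_fm :: "nat => unit fm" where "zero_fm V = FAnds (map (\<lambda>v. FSum v v v) [0..<V])"
definition eq_fm :: "nat => unit fm" where "eq_fm V = FAnds (map (\<lambda>v. FEq v (V + v)) [0..<V])"
definition tup_fm :: "nat => nat list => unit fm" where "tup_fm V vs = FAnds (map (\<lambda>v. FEq v (V + vs ! v)) [0..<V])"
definition upd_fm :: "nat => nat => unit fm" where
  "upd_fm V u = FAnds (map (\<lambda>v. FEq v (V + v)) (filter (\<lambda>v. v ~= u) [0..<V]))"

fun shift_fm :: "nat => 'r fm => unit fm" where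
  "shift_fm V (FEq x y) = FEq (V + x) (V + y)"
| "shift_fm V (FLess x y) = FLess (V + x) (V + y)"
| "shift_fm V (FSum x y z) = FSum (V + x) (V + y) (V + z)"
| "shift_fm V (FProd x y z) = FProd (V + x) (V + y) (V + z)"
| "shift_fm V (FIn a v) = FIn a (V + v)"
| "shift_fm V phi = FEq 0 0"

section \<open>Writing down the framework as an encoded input\<close>

context gadget
begin

definition alist :: "('r node \<times> (nat => nat)) list" where
  "alist = concat (map (\<lambda>c. map (Pair c) (if c \<in> set special then [origin] else envl N [0..<V] origin)) (nodes phi))"

lemma set_envs: "set (envl N [0..<V] origin) = envs"
proof -
  have "e \<in> set (envl N [0..<V] origin) \<longleftrightarrow> e \<in> envs" for e
    using set_envl[of "[0..<V]" e N origin] by (auto simp: envs_def)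
  then show ?thesis by blast
qed

lemma set_alist: "set alist = A" by (auto simp: alist_def A_def set_envs split: if_splits)

lemma distinct_nodes: "distinct (nodes phi)" by (auto simp: nodes_def special_def)

lemma distinct_alist: "distinct alist"
proof -
  have "distinct (concat (map (\<lambda>c. map (Pair c) (L c)) xs))" if "distinct xs" "\<And>c. distinct (L c)"
    for xs :: "'r node list" and L :: "'r node => (nat => nat) list"
    by (rule distinct_concat_map) (use that in \<open>auto simp: distinct_map inj_on_def\<close>)
  from this[OF distinct_nodes] show ?thesis unfolding alist_def by (simp add: distinct_envl)
qed

text \<open>One block of output per argument, in the order of \<open>alist\<close>. The kinds of
  nodes are spelled out in the description, which depends on \<open>phi\<close> only, while the
  assignments are run through by loops at run time.\<close>

definition EArgs :: "nat => ('r node => em) => em" where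
  "EArgs off G = ESeqs (map (\<lambda>c. EFors (if c \<in> set special then [] else [off..<off + V]) (G c)) (nodes phi))"

lemma unary_EArgs: "(\<And>c. c \<in> set (nodes phi) ==> unary_em (G c)) ==> unary_em (EArgs off G)"
  unfolding EArgs_def by (rule unary_ESeqs) (auto simp: unary_EFors)

lemma emw_EArgs:
  assumes "\<And>v. v < V ==> e (off + v) = 0"
  shows "emw N xs rho (EArgs off G) e = concat (map (\<lambda>x. emw N xs rho (G (fst x)) (put V off (snd x) e)) alist)"
proof -
  let ?h = "\<lambda>e'. put V off e' e"
  have o: "?h origin = e"
  proof
    show "?h origin v = e v" for v using assms[of "v - off"] by (auto simp: put_def)
  qed
  have "map ((+) off) [0..<V] = [off..<off + V]" by (rule nth_equalityI) auto
  moreover have "envl N (map ((+) off) [0..<V]) (?h origin) = map ?h (envl N [0..<V] origin)"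
    by (rule envl_map) (auto simp: put_def fun_eq_iff)
  ultimately have envl: "envl N [off..<off + V] e = map ?h (envl N [0..<V] origin)" using o by simp
  let ?L = "\<lambda>c :: 'r node. if c \<in> set special then [origin] else envl N [0..<V] origin"
  have 1: "emw N xs rho (EFors (if c \<in> set special then [] else [off..<off + V]) (G c)) e =
      concat (map (\<lambda>x. emw N xs rho (G (fst x)) (?h (snd x))) (map (Pair c) (?L c)))" for c
    unfolding emw_EFors using envl o by (simp add: o_def)
  have 2: "map (\<lambda>E. emw N xs rho E e) (map (\<lambda>c. EFors (if c \<in> set special then [] else [off..<off + V]) (G c)) (nodes phi)) =
      map (\<lambda>c. concat (map (\<lambda>x. emw N xs rho (G (fst x)) (?h (snd x))) (map (Pair c) (?L c)))) (nodes phi)"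
    by (rule nth_equalityI) (simp_all only: length_map nth_map 1)
  show ?thesis unfolding EArgs_def emw_ESeqs 2 alist_def by (rule concat_concat_map)
qed

text \<open>For fixed kinds of two nodes, an attack is a condition on their assignments alone, so
  \<open>att\<close> becomes a finite table of formulas. Attacks by special nodes are constants
  because these occur at \<open>origin\<close> only.\<close>

fun att_fm :: "'r node => 'r node => unit fm" where
  "att_fm c NE = Bool (c = NT | c = NE & co)"
| "att_fm c NT = Bool (c = NE)"
| "att_fm c NB = (if c = NF phi then zero_fm V else Bool (c = NE | c = NB))"
| "att_fm c NE' = Bool (c = NE | c = NE' & ~ st)"
| "att_fm c NT' = Bool (c = NT | c = NT' & ~ st)"
| "att_fm c (LP r) = (if c = LN r then eq_fm V else Bool (c = NE | c = NB & U r))"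
| "att_fm c (LN r) = (if c = LP r then eq_fm V else Bool (c = NE | c = NB & U r))"
| "att_fm c (LP' r) = (if c = LP r | c = LP' r & ~ st then eq_fm V else Bool (c = NE))"
| "att_fm c (LN' r) = (if c = LN r | c = LN' r & ~ st then eq_fm V else Bool (c = NE))"
| "att_fm c (NF (FRel r vs)) = (if c = LN r then tup_fm V vs else Bool (c = NE))"
| "att_fm c (NF (FNor a b)) = (if c = NF a | c = NF b then eq_fm V else Bool (c = NE))"
| "att_fm c (NF (FNex v a)) = (if c = NF a then upd_fm V v else Bool (c = NE))"
| "att_fm c (NF psi) = (if c = NT then FNot (shift_fm V psi) else Bool (c = NE))"

lemma unary_att_fm: "unary (att_fm c c')"
proof -
  have "unary (shift_fm V psi)" for psi :: "'r fm" by (cases psi) auto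
  moreover have "unary (zero_fm V)" "unary (eq_fm V)" "unary (tup_fm V vs)" "unary (upd_fm V u)" for vs u
    unfolding zero_fm_def eq_fm_def tup_fm_def upd_fm_def by (rule unary_FAnds, force)+
  ultimately show ?thesis by (cases "(c, c')" rule: att_fm.cases) auto
qed

lemma ev_att_fm:
  assumes "(c, e) \<in> A" "(c', e') \<in> A"
  shows "ev N xs rho (att_fm c c') (put V V e' (put V 0 e origin)) = att (c, e) (c', e')"
proof -
  let ?E = "put V V e' (put V 0 e origin)"
  have E: "?E v = e v" "?E (V + v) = e' v" if "v < V" for v using that by (auto simp: put_def)
  have sp: "e = origin" if "c \<in> set special" using assms(1) that by (simp add: A_def)
  have range: "e v = 0" "e' v = 0" if "V \<le> v" for v
    using assms that by (auto simp: A_def envs_def split: if_splits)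
  have eqI: "e = h" if "\<forall>v<V. e v = h v" "\<forall>v. V \<le> v --> h v = 0" for h
  proof
    show "e v = h v" for v using that range(1)[of v] by (cases "v < V") auto
  qed
  have zero: "ev N xs rho (zero_fm V) ?E = (e = origin)"
    using E(1) eqI[of origin] by (auto simp: zero_fm_def)
  have eq: "ev N xs rho (eq_fm V) ?E = (e = e')"
    using E eqI[of e'] range(2) by (auto simp: eq_fm_def)
  have tup: "ev N xs rho (tup_fm V vs) ?E = (e = tup V vs e')" if "length vs = V" "set vs \<subseteq> {..<V}" for vs
  proof -
    have "vs ! v < V" if "v < V" for v using that \<open>length vs = V\<close> \<open>set vs \<subseteq> {..<V}\<close> nth_mem by fastforce
    then have "ev N xs rho (tup_fm V vs) ?E = (\<forall>v<V. e v = tup V vs e' v)"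
      using E by (auto simp: tup_fm_def tup_def)
    also have "\<dots> = (e = tup V vs e')" using eqI[of "tup V vs e'"] by (auto simp: tup_def)
    finally show ?thesis .
  qed
  have upd: "ev N xs rho (upd_fm V u) ?E = (\<exists>i<N. e = e'(u := i))" if "u < V" "c \<notin> set special" for u
  proof -
    have "ev N xs rho (upd_fm V u) ?E = (\<forall>v<V. v ~= u --> e v = e' v)"
      using E by (auto simp: upd_fm_def)
    also have "\<dots> = (\<forall>v. v ~= u --> e v = e' v)" using range by (metis linorder_not_less)
    also have "\<dots> = (e = e'(u := e u))" unfolding fun_eq_iff by (metis fun_upd_apply)
    also have "\<dots> = (\<exists>i<N. e = e'(u := i))"
    proof -
      have "e u < N" using assms(1) that by (auto simp: A_def envs_def)
      then show ?thesis by (metis fun_upd_same)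
    qed
    finally show ?thesis .
  qed
  show ?thesis
  proof (cases "\<exists>psi. c' = NF psi")
    case False
    then show ?thesis
      using zero eq sp by (cases "(c, c')" rule: att_fm.cases) (auto simp: special_def)
  next
    case True
    then obtain psi where c': "c' = NF psi" by blast
    then have psi: "psi \<in> set (subs phi)" using assms(2) by simp
    have pl: "plain V psi" using subs_plain[OF plain psi] .
    have NE: "c = NE ==> e = origin" "c = NT ==> e = origin" using sp by (simp_all add: special_def)
    show ?thesis
    proof (cases psi)
      case (FRel r vs)
      then show ?thesis using c' tup[of vs] pl NE by auto
    next
      case (FNor a b)
      then show ?thesis using c' eq NE by auto
    next
      case (FNex v a)
      then show ?thesis using c' upd[of v] pl NE by (auto simp: special_def)
    qed (use c' pl NE E in auto)
  qed
qed

text \<open>The label under \<open>base_ext\<close> depends on nothing but the kind of a node, so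
  the builder can write it as a constant.\<close>

fun node_label :: "'r node => label" where
  "node_label NE = (if co then Und else In)"
| "node_label NT' = (if st then In else Und)"
| "node_label c = (if co then Und else Out)"

lemma base_label:
  assumes "x \<in> A"
  shows "labelling_of F base_ext x = node_label (fst x)"
proof -
  obtain c e where x: "x = (c, e)" by (cases x)
  have b: "(c, e) \<in> base_ext \<longleftrightarrow> ~ co & c = NE | st & c = NT'"
    using assms extension_kinds(5) unfolding x base_ext_def by auto
  show ?thesis using assms Def_base[of x] extension_kinds(5) unfolding x labelling_of_def b
    by (cases c) auto
qed

definition builder :: em where
  "builder = ESeqs [EArgs 0 (\<lambda>_. EBit True), EBit False,
     EArgs 0 (\<lambda>c. EArgs V (\<lambda>c'. EFm (att_fm c c'))),
     EArgs 0 (\<lambda>c. ESeq (EBit (node_label c = In)) (EBit (node_label c = Out))),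
     EArgs 0 (\<lambda>c. EBit (c = fst target)), EArgs 0 (\<lambda>c. EBit (c = NB))]"

lemma unary_builder: "unary_em builder"
  unfolding builder_def by (rule unary_ESeqs) (auto intro!: unary_EArgs simp: unary_att_fm)

abbreviation "num \<equiv> length alist"
definition rel :: "(nat \<times> nat) set" where
  "rel = {(i, j). i < num & j < num & (alist ! i, alist ! j) \<in> attacks F}"
definition lab :: "nat => label" where
  "lab i = (if i < num then node_label (fst (alist ! i)) else Und)"
definition pos :: "'r node \<times> (nat => nat) => nat" where
  "pos x = (SOME i. i < num & alist ! i = x)"

lemma pos: "x \<in> A ==> pos x < num & alist ! pos x = x"
  unfolding pos_def by (rule someI_ex) (metis in_set_conv_nth set_alist)

lemma alist_A: "i < num ==> alist ! i \<in> A" using set_alist nth_mem by blast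

lemma map_alist: "map (\<lambda>i. h (alist ! i)) [0..<num] = map h alist" by (rule nth_equalityI) auto

lemma pos_eq: "x \<in> A ==> i < num ==> i = pos x \<longleftrightarrow> alist ! i = x"
  using pos[of x] distinct_alist by (auto simp: nth_eq_iff_index_eq)

lemma special_pos:
  assumes "c \<in> set special"
  shows "map (\<lambda>i. i = pos (c, origin)) [0..<num] = map (\<lambda>x. fst x = c) alist"
proof -
  have "(c, origin) \<in> A" using assms by (auto simp: A_def nodes_def)
  moreover have "x = (c, origin) \<longleftrightarrow> fst x = c" if "x \<in> A" for x
    using that assms by (cases x) (auto simp: A_def)
  ultimately have eq: "map (\<lambda>i. i = pos (c, origin)) [0..<num] = map (\<lambda>i. fst (alist ! i) = c) [0..<num]"
    using pos_eq alist_A by auto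
  note eq
  also have "\<dots> = map (\<lambda>x. fst x = c) alist" by (rule map_alist)
  finally show ?thesis .
qed

lemma encode_label: "encode_label l = [l = In, l = Out]" by (cases l) auto

lemma emw_builder: "emw N xs rho builder origin = encode num rel (pos target) lab (pos (NB, origin))"
proof -
  have args: "emw N xs rho (EArgs 0 G) origin = concat (map (\<lambda>x. emw N xs rho (G (fst x)) (put V 0 (snd x) origin)) alist)" for G
    by (rule emw_EArgs) simp
  have "concat (map (\<lambda>x. emw N xs rho (EArgs V (\<lambda>c'. EFm (att_fm (fst x) c'))) (put V 0 (snd x) origin)) alist) =
      concat (map (\<lambda>x. map (\<lambda>y. att x y) alist) alist)"
  proof (rule arg_cong[of _ _ concat], rule map_cong[OF refl])
    fix x assume x: "x \<in> set alist"
    have "emw N xs rho (EArgs V (\<lambda>c'. EFm (att_fm (fst x) c'))) (put V 0 (snd x) origin) =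
        concat (map (\<lambda>y. [ev N xs rho (att_fm (fst x) (fst y)) (put V V (snd y) (put V 0 (snd x) origin))]) alist)"
      by (subst emw_EArgs) (auto simp: put_def)
    also have "\<dots> = map (\<lambda>y. att x y) alist" unfolding concat_map_single
    proof (rule map_cong[OF refl])
      fix y assume "y \<in> set alist"
      then show "ev N xs rho (att_fm (fst x) (fst y)) (put V V (snd y) (put V 0 (snd x) origin)) = att x y"
        using ev_att_fm[of "fst x" "snd x" "fst y" "snd y"] x set_alist by simp
    qed
    finally show "emw N xs rho (EArgs V (\<lambda>c'. EFm (att_fm (fst x) c'))) (put V 0 (snd x) origin) = map (\<lambda>y. att x y) alist" .
  qed
  also have "\<dots> = concat (map (\<lambda>i. map (\<lambda>j. att (alist ! i) (alist ! j)) [0..<num]) [0..<num])"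
    unfolding map_alist[of "\<lambda>y. att (alist ! i) y" for i] map_alist[of "\<lambda>x. map (att x) alist"] ..
  also have "\<dots> = concat (map (\<lambda>i. map (\<lambda>j. (i, j) \<in> rel) [0..<num]) [0..<num])"
    using alist_A by (intro arg_cong[of _ _ concat] map_cong refl) (auto simp: rel_def F_def)
  finally have matrix: "emw N xs rho (EArgs 0 (\<lambda>c. EArgs V (\<lambda>c'. EFm (att_fm c c')))) origin =
    concat (map (\<lambda>i. map (\<lambda>j. (i, j) \<in> rel) [0..<num]) [0..<num])" unfolding args .
  have len: "emw N xs rho (EArgs 0 (\<lambda>_. EBit True)) origin = replicate num True"
    unfolding args emw.simps concat_map_single by (rule map_replicate_const)
  have "map (\<lambda>i. encode_label (lab i)) [0..<num] = map (\<lambda>i. encode_label (node_label (fst (alist ! i)))) [0..<num]"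
    by (simp add: lab_def)
  then have labels: "emw N xs rho (EArgs 0 (\<lambda>c. ESeq (EBit (node_label c = In)) (EBit (node_label c = Out)))) origin =
      concat (map (\<lambda>i. encode_label (lab i)) [0..<num])"
    unfolding args map_alist[of "\<lambda>x. encode_label (node_label (fst x))"] by (simp add: encode_label)
  have target: "target = (fst target, origin)" "fst target \<in> set special" by (simp_all add: target_def special_def)
  have g: "emw N xs rho (EArgs 0 (\<lambda>c. EBit (c = fst target))) origin = map (\<lambda>i. i = pos target) [0..<num]"
    unfolding args emw.simps concat_map_single using special_pos[OF target(2)] target(1) by simp
  have g': "emw N xs rho (EArgs 0 (\<lambda>c. EBit (c = NB))) origin = map (\<lambda>i. i = pos (NB, origin)) [0..<num]"
    unfolding args emw.simps concat_map_single by (subst special_pos) (simp_all add: special_def)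
  show ?thesis
    unfolding builder_def emw_ESeqs list.map concat.simps matrix len labels g g' encode_def by simp
qed

sublocale rl: relabelled F num "\<lambda>i. alist ! i" rel
proof
  show "bij_betw (\<lambda>i. alist ! i) {..<num} (args F)"
    using bij_betw_nth[OF distinct_alist refl refl] by (simp add: set_alist F_def)
qed (auto simp: is_af_F rel_def)

definition start :: "nat set" where "start = {i. i < num & alist ! i \<in> base_ext}"

lemma start: "start \<subseteq> {..<num}" "(\<lambda>i. alist ! i) ` start = base_ext"
proof -
  have "x \<in> (\<lambda>i. alist ! i) ` start" if x: "x \<in> base_ext" for x
  proof -
    have "x \<in> set alist" using x base_A set_alist by blast
    then obtain i where "i < num" "x = alist ! i" by (auto simp: in_set_conv_nth)
    then show ?thesis using x by (auto simp: start_def)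
  qed
  then show "(\<lambda>i. alist ! i) ` start = base_ext" by (auto simp: start_def)
qed (auto simp: start_def)

lemma lab_start: "lab = labelling_of (AF num rel) start"
proof
  fix i
  show "lab i = labelling_of (AF num rel) start i"
  proof (cases "i < num")
    case True
    then show ?thesis
      using rl.labelling_image[OF start(1) True] start(2) base_label[OF alist_A[OF True]] by (simp add: lab_def)
  next
    case False
    then show ?thesis using start(1) rl.Def_sub[of start] by (auto simp: lab_def labelling_of_def)
  qed
qed

lemma valid: "valid_input s (AF num rel) (pos target) lab (pos (NB, origin))"
proof -
  have "extension s (AF num rel) start"
    using rl.extension_image[OF start(1)] start(2) base_extension by simp
  then have "lab \<in> labellings s (AF num rel)" using lab_start by (auto simp: labellings_def)
  then show ?thesis
    using rl.af pos[OF target_A] pos[of "(NB, origin)"] by (simp add: valid_input_def AF_def)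
qed

lemma answer:
  "(\<forall>L'\<in>counterfactuals s (AF num rel) (pos target) lab. L' (pos (NB, origin)) = In) = (~ flips)"
proof -
  let ?C = "counterfactuals s (AF num rel) (pos target) lab"
  note p = pos[OF target_A]
  have "L' (pos (NB, origin)) ~= In" if L': "L' \<in> ?C" for L'
  proof -
    obtain S where S: "extension s (AF num rel) S" "L' = labelling_of (AF num rel) S"
      using L' by (auto simp: counterfactuals_def labellings_def)
    have sub: "S \<subseteq> {..<num}" using rl.complete_AF[OF extension_complete[OF S(1)]] .
    have "complete_ext F ((\<lambda>i. alist ! i) ` S)"
      using extension_complete[OF S(1)] rl.complete_image[OF sub] by simp
    then show ?thesis
      using rl.labelling_image[OF sub, of "pos (NB, origin)"] pos[of "(NB, origin)"] NB_never_In S(2) by auto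
  qed
  then have "(\<forall>L'\<in>?C. L' (pos (NB, origin)) = In) = (?C = {})" by blast
  also have "\<dots> = (~ (\<exists>S. extension s (AF num rel) S & lab (pos target) ~= labelling_of (AF num rel) S (pos target)))"
    unfolding counterfactuals_empty_iff labellings_def by blast
  also have "\<dots> = (~ (\<exists>S. S \<subseteq> {..<num} & extension s (AF num rel) S &
      labelling_of F base_ext target ~= labelling_of F ((\<lambda>i. alist ! i) ` S) target))"
  proof -
    have "lab (pos target) = labelling_of F base_ext target"
      using p base_label[OF target_A] by (simp add: lab_def)
    moreover have "labelling_of (AF num rel) S (pos target) = labelling_of F ((\<lambda>i. alist ! i) ` S) target"
      "S \<subseteq> {..<num}" if "extension s (AF num rel) S" for S
    proof -
      show "S \<subseteq> {..<num}" using rl.complete_AF[OF extension_complete[OF that]] .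
      then show "labelling_of (AF num rel) S (pos target) = labelling_of F ((\<lambda>i. alist ! i) ` S) target"
        using rl.labelling_image[of S "pos target"] p by simp
    qed
    ultimately show ?thesis by metis
  qed
  also have "\<dots> = (~ flips)" unfolding flips_def rl.ex_extension ..
  finally show ?thesis .
qed

lemma builder_input: "emw N xs rho builder origin \<in> CF_SA_inputs s"
  unfolding emw_builder CF_SA_inputs_def using valid unfolding AF_def by blast

lemma builder_answer:
  "emw N xs rho builder origin \<in> CF_SA s \<longleftrightarrow> ~ flips"
proof -
  have und: "\<forall>i. n \<le> i --> L i = Und" "R \<subseteq> {..<n} \<times> {..<n}" "g < n" "g' < n"
    if v: "valid_input s (AF n R) g L g'" for n R g L g'
  proof -
    show "\<forall>i. n \<le> i --> L i = Und" using v labellings_Und by (auto simp: valid_input_def)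
    show "R \<subseteq> {..<n} \<times> {..<n}" "g < n" "g' < n"
      using v by (auto simp: valid_input_def is_af_def AF_def)
  qed
  have "emw N xs rho builder origin \<in> CF_SA s \<longleftrightarrow>
      (\<exists>n R g L g'. encode num rel (pos target) lab (pos (NB, origin)) = encode n R g L g' & valid_input s (AF n R) g L g' &
        (\<forall>L'\<in>counterfactuals s (AF n R) g L. L' g' = In))"
    unfolding emw_builder CF_SA_def AF_def by blast
  also have "\<dots> = (\<forall>L'\<in>counterfactuals s (AF num rel) (pos target) lab. L' (pos (NB, origin)) = In)"
  proof
    assume "\<exists>n R g L g'. encode num rel (pos target) lab (pos (NB, origin)) = encode n R g L g' & valid_input s (AF n R) g L g' &
        (\<forall>L'\<in>counterfactuals s (AF n R) g L. L' g' = In)"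
    then obtain n R g L g' where e: "encode num rel (pos target) lab (pos (NB, origin)) = encode n R g L g'"
      and v: "valid_input s (AF n R) g L g'" and a: "\<forall>L'\<in>counterfactuals s (AF n R) g L. L' g' = In" by blast
    have "num = n & rel = R & pos target = g & lab = L & pos (NB, origin) = g'"
      by (rule encode_inject[OF e und(2-4)[OF valid] und(1)[OF valid] und(2-4)[OF v] und(1)[OF v]])
    then show "\<forall>L'\<in>counterfactuals s (AF num rel) (pos target) lab. L' (pos (NB, origin)) = In" using a by simp
  next
    assume "\<forall>L'\<in>counterfactuals s (AF num rel) (pos target) lab. L' (pos (NB, origin)) = In"
    then show "\<exists>n R g L g'. encode num rel (pos target) lab (pos (NB, origin)) = encode n R g L g' & valid_input s (AF n R) g L g' &
        (\<forall>L'\<in>counterfactuals s (AF n R) g L. L' g' = In)" using valid by blast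
  qed
  finally show ?thesis unfolding answer .
qed

end

section \<open>Runs of machines in second-order logic\<close>

text \<open>Universes have size \<open>bound a w\<close>, so polynomial time bounds have to be
  brought below a power of this form.\<close>

lemma poly_le_power: "\<exists>a. \<forall>x. poly (p :: nat poly) x \<le> (x + a) ^ a"
proof (induction p)
  case (pCons c q)
  then obtain a where a: "\<And>x. poly q x \<le> (x + a) ^ a" by blast
  define b where "b = Suc (a + c)"
  have "poly (pCons c q) x \<le> (x + b) ^ b" for x
  proof -
    have 1: "1 \<le> (x + b) ^ a" by (simp add: b_def)
    have "poly (pCons c q) x \<le> c + x * (x + b) ^ a"
      using a[of x] power_mono[of "x + a" "x + b" a] by (simp add: b_def mult_le_mono order_trans)
    also have "\<dots> \<le> b * (x + b) ^ a + x * (x + b) ^ a"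
    proof -
      have "c \<le> b" by (simp add: b_def)
      then show ?thesis using mult_le_mono[OF \<open>c \<le> b\<close> 1] by simp
    qed
    also have "\<dots> = (x + b) ^ Suc a" by (simp add: algebra_simps)
    also have "\<dots> \<le> (x + b) ^ b" by (rule power_increasing) (simp_all add: b_def)
    finally show ?thesis .
  qed
  then show ?case by blast
qed auto

lemma polyb_le_bound:
  assumes "polyb f"
  obtains a where "0 < a" "\<And>w. f (length w) \<le> bound a w"
proof -
  obtain p where p: "\<And>n. f n \<le> poly p n" using assms unfolding polyb_def by blast
  obtain a where a: "\<And>x. poly p x \<le> (x + a) ^ a" using poly_le_power by blast
  have "f (length w) \<le> bound (Suc a) w" for w
  proof -
    have "f (length w) \<le> (length w + a) ^ a" using p a le_trans by blast
    also have "\<dots> \<le> (length w + Suc a) ^ a" by (rule power_mono) simp_all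
    also have "\<dots> \<le> (length w + Suc a) ^ Suc a" by (rule power_increasing) simp_all
    finally show ?thesis by (simp add: bound_def)
  qed
  then show ?thesis using that[of "Suc a"] by simp
qed

text \<open>A step in which the oracle is replaced by two conditions, \<open>y\<close> for
  permission to enter the state for yes and \<open>n\<close> for the state for no. A formula can
  supply these conditions without naming the query.\<close>

definition gstep :: "otm => bool => bool => config => config => bool" where
  "gstep M y n c c' =
    ((fst c ~= query_state M & (\<exists>(q', acts)\<in>trans M (fst c) (map scan (snd c)). c' = (q', map2 act (snd c) acts))) |
    (fst c = query_state M & snd c' = snd c & (fst c' = yes_state M & y | fst c' = no_state M & n)))"

lemma step_gstep:
  "step M B c c' = gstep M (\<exists>u. holds_word (snd c ! 1) u & u \<in> B) (\<exists>u. holds_word (snd c ! 1) u & u \<notin> B) c c'"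
proof
  assume "step M B c c'"
  then show "gstep M (\<exists>u. holds_word (snd c ! 1) u & u \<in> B) (\<exists>u. holds_word (snd c ! 1) u & u \<notin> B) c c'"
    by cases (auto simp: gstep_def)
next
  assume "gstep M (\<exists>u. holds_word (snd c ! 1) u & u \<in> B) (\<exists>u. holds_word (snd c ! 1) u & u \<notin> B) c c'"
  then show "step M B c c'" by (cases c; cases c') (auto simp: gstep_def intro: step.intros)
qed

lemma run_seq: "run M B c n k c' ==> \<exists>f. f 0 = c & f n = c' & (\<forall>i<n. step M B (f i) (f (Suc i)))"
proof (induction rule: run.induct)
  case (run_refl c)
  then show ?case by (intro exI[of _ "\<lambda>_. c"]) simp
next
  case (run_step c n k c' c'')
  then obtain f where f: "f 0 = c" "f n = c'" "\<forall>i<n. step M B (f i) (f (Suc i))" by blast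
  show ?case
  proof (intro exI conjI allI impI)
    let ?f = "f(Suc n := c'')"
    show "?f 0 = c" "?f (Suc n) = c''" using f by simp_all
    show "step M B (?f i) (?f (Suc i))" if "i < Suc n" for i
      using that f run_step.hyps by (cases "i = n") auto
  qed
qed

lemma seq_run: "\<forall>i<n. step M B (f i) (f (Suc i)) ==> \<exists>k. run M B (f 0) n k (f n)"
proof (induction n)
  case 0
  then show ?case using run.run_refl by blast
next
  case (Suc n)
  then obtain k where "run M B (f 0) n k (f n)" by auto
  from run.run_step[OF this] Suc.prems show ?case by blast
qed

lemma accepts_seq:
  "accepts M B w = (\<exists>f n. f 0 = init_config M w & (\<forall>i<n. step M B (f i) (f (Suc i))) & fst (f n) = accept_state M)"
proof
  assume "accepts M B w"
  then obtain n k c where "run M B (init_config M w) n k c" "fst c = accept_state M" unfolding accepts_def by blast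
  then show "\<exists>f n. f 0 = init_config M w & (\<forall>i<n. step M B (f i) (f (Suc i))) & fst (f n) = accept_state M"
    using run_seq by metis
next
  assume "\<exists>f n. f 0 = init_config M w & (\<forall>i<n. step M B (f i) (f (Suc i))) & fst (f n) = accept_state M"
  then obtain f n where "f 0 = init_config M w" "\<forall>i<n. step M B (f i) (f (Suc i))" "fst (f n) = accept_state M" by blast
  then show "accepts M B w" using seq_run[of n M B f] unfolding accepts_def by metis
qed

definition fits :: "nat => int => int => tape => bool" where
  "fits S l h t = ((\<forall>z. fst t z < S) & (\<forall>z. z < l | h < z --> fst t z = 0) & l \<le> snd t & snd t \<le> h)"

lemma fits_mono: "fits S l h t ==> l' \<le> l ==> h \<le> h' ==> fits S l' h' t" by (auto simp: fits_def)

lemma fits_act: "fits S l h t ==> fst a < S ==> fits S (l - 1) (h + 1) (act t a)"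
  by (cases "snd a") (auto simp: fits_def act_def)

definition reach :: "word => nat => nat => int" where
  "reach w k t = int (if k = 0 then length w else 0) + int t"

lemma wf_trans:
  assumes "wf_otm M" "q < num_states M" "length rs = num_tapes M" "set rs \<subseteq> {..<num_symbols M}" "(q', acts) \<in> trans M q rs"
  shows "q' < num_states M & length acts = num_tapes M & fst ` set acts \<subseteq> {..<num_symbols M}"
proof -
  have "\<forall>(q', acts)\<in>trans M q rs. q' < num_states M & length acts = num_tapes M & fst ` set acts \<subseteq> {..<num_symbols M}"
    using assms(1-4) unfolding wf_otm_def by simp
  from bspec[OF this assms(5)] show ?thesis by simp
qed

lemma seq_fits:
  assumes "wf_otm M" "f 0 = init_config M w"
  shows "\<forall>i<t. step M B (f i) (f (Suc i)) ==>
    fst (f t) < num_states M & length (snd (f t)) = num_tapes M &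
    (\<forall>k<num_tapes M. fits (num_symbols M) (- int t) (reach w k t) (snd (f t) ! k))"
proof (induction t)
  case 0
  have "fits (num_symbols M) 0 (int (length w)) (input_tape w)"
    using assms(1) by (auto simp: fits_def input_tape_def wf_otm_def bit_symbol_def)
  moreover have "fits (num_symbols M) 0 0 blank_tape"
    using assms(1) by (auto simp: fits_def blank_tape_def wf_otm_def)
  ultimately show ?case using assms by (auto simp: init_config_def wf_otm_def nth_Cons' reach_def)
next
  case (Suc t)
  then have IH: "fst (f t) < num_states M" "length (snd (f t)) = num_tapes M"
    "\<And>k. k < num_tapes M ==> fits (num_symbols M) (- int t) (reach w k t) (snd (f t) ! k)" by auto
  have sp: "reach w k (Suc t) = reach w k t + 1" for k by (simp add: reach_def)
  have mono: "fits (num_symbols M) (- int (Suc t)) (reach w k (Suc t)) (snd (f t) ! k)" if "k < num_tapes M" for k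
    by (rule fits_mono[OF IH(3)[OF that]]) (simp_all add: sp)
  have "step M B (f t) (f (Suc t))" using Suc.prems by simp
  then show ?case unfolding step_gstep gstep_def
  proof (elim disjE conjE)
    assume "\<exists>(q', acts)\<in>trans M (fst (f t)) (map scan (snd (f t))). f (Suc t) = (q', map2 act (snd (f t)) acts)"
    then obtain q' acts where tr: "(q', acts) \<in> trans M (fst (f t)) (map scan (snd (f t)))"
      and f: "f (Suc t) = (q', map2 act (snd (f t)) acts)" by blast
    have "scan (snd (f t) ! k) < num_symbols M" if "k < num_tapes M" for k
      using IH(3)[OF that] by (simp add: fits_def scan_def)
    then have "\<forall>x\<in>set (map scan (snd (f t))). x < num_symbols M"
      unfolding all_set_conv_all_nth using IH(2) by simp
    then have "set (map scan (snd (f t))) \<subseteq> {..<num_symbols M}" by blast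
    then have wf: "q' < num_states M" "length acts = num_tapes M" "fst ` set acts \<subseteq> {..<num_symbols M}"
      using wf_trans[OF assms(1) IH(1) _ _ tr] IH(2) by auto
    have "fits (num_symbols M) (- int (Suc t)) (reach w k (Suc t)) (snd (f (Suc t)) ! k)" if k: "k < num_tapes M" for k
    proof -
      have "fst (acts ! k) < num_symbols M" using wf(2,3) k by (auto simp: image_subset_iff)
      have "- int (Suc t) = - int t - 1" by simp
      then show ?thesis
        using fits_act[OF IH(3)[OF k] \<open>fst (acts ! k) < num_symbols M\<close>] k wf(2) IH(2) by (simp only: sp) (simp add: f)
    qed
    then show ?thesis using wf IH(2) f by simp
  next
    assume "snd (f (Suc t)) = snd (f t)" "fst (f (Suc t)) = yes_state M"
    then show ?thesis using IH(2) mono assms(1) by (simp add: wf_otm_def)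
  next
    assume "snd (f (Suc t)) = snd (f t)" "fst (f (Suc t)) = no_state M"
    then show ?thesis using IH(2) mono assms(1) by (simp add: wf_otm_def)
  qed
qed

lemma range_bit_symbol: "range bit_symbol = {1, 2}" by (auto simp: bit_symbol_def image_def)

text \<open>The tape is blank beyond \<open>h\<close>, so from cell 0 on there is a first cell that
  holds no bit. Queries are therefore always well defined.\<close>

lemma holds_word_exists:
  assumes "fits S l h t" "0 \<le> h"
  obtains u where "holds_word t u" "int (length u) \<le> h + 1"
proof -
  let ?P = "\<lambda>j. fst t (int j) \<notin> {1, 2}"
  have P: "?P (nat (h + 1))" using assms by (auto simp: fits_def)
  define j where "j = (LEAST j. ?P j)"
  have j: "?P j" "j \<le> nat (h + 1)" unfolding j_def by (rule LeastI[of ?P, OF P], rule Least_le[of ?P, OF P])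
  have lt: "fst t (int i) \<in> {1, 2}" if "i < j" for i using not_less_Least[of i ?P] that unfolding j_def by blast
  define u where "u = map (\<lambda>i. fst t (int i) = 2) [0..<j]"
  have "holds_word t u" unfolding holds_word_def range_bit_symbol
  proof (intro conjI allI impI)
    show "fst t (int i) = bit_symbol (u ! i)" if "i < length u" for i
      using lt[of i] that by (auto simp: u_def bit_symbol_def)
  qed (use j in \<open>simp add: u_def\<close>)
  then show ?thesis using that j(2) assms(2) by (simp add: u_def)
qed

text \<open>Describes the input tape for the query \<open>u\<close> by the query tape
  \<open>t\<close> alone: a cell belongs to the word iff all cells from 0 up to it hold bits. This
  is how a formula hands a query over to another run.\<close>

lemma input_tape_symbol:
  assumes "holds_word t u" "s \<in> {1, 2}"
  shows "fst (input_tape u) z = s \<longleftrightarrow> 0 \<le> z & fst t z = s & (\<forall>y. 0 \<le> y & y \<le> z --> fst t y \<in> {1, 2})"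
proof (cases "0 \<le> z & z < int (length u)")
  case True
  have "fst t y \<in> {1, 2}" if "0 \<le> y" "y \<le> z" for y
    using assms(1) that True unfolding holds_word_def by (elim conjE allE[of _ "nat y"]) (auto simp: bit_symbol_def)
  moreover have "fst t z = bit_symbol (u ! nat z)"
    using assms(1) True unfolding holds_word_def by (elim conjE allE[of _ "nat z"]) auto
  ultimately show ?thesis using True by (auto simp: input_tape_def)
next
  case False
  then have "fst (input_tape u) z = 0" by (auto simp: input_tape_def)
  have "fst t (int (length u)) \<notin> {1, 2}"
    using assms(1) by (simp add: holds_word_def range_bit_symbol)
  then have "~ (0 \<le> z & (\<forall>y. 0 \<le> y & y \<le> z --> fst t y \<in> {1, 2}))"
    using False by (metis linorder_not_less of_nat_0_le_iff)
  moreover have "fst (input_tape u) z ~= s" using \<open>fst (input_tape u) z = 0\<close> assms(2) by auto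
  ultimately show ?thesis by blast
qed

section \<open>Finite conjunctions, disjunctions and successors\<close>

definition listof :: "'b set => 'b list" where "listof X = (SOME xs. set xs = X)"

lemma set_listof: "finite X ==> set (listof X) = X"
  unfolding listof_def by (rule someI_ex) (rule finite_list)

definition FAndS :: "'b set => ('b => 'r fm) => 'r fm" where "FAndS X f = FAnds (map f (listof X))"
definition FOrS :: "'b set => ('b => 'r fm) => 'r fm" where "FOrS X f = FNot (FAndS X (\<lambda>x. FNot (f x)))"
definition FOne :: "'b set => ('b => 'r fm) => 'r fm" where
  "FOne X f = FOrS X (\<lambda>x. FAnd (f x) (FAndS (X - {x}) (\<lambda>y. FNot (f y))))"
definition FSucc :: "nat => nat => nat => 'r fm" where
  "FSucc x y z = FAnd (FLess x y) (FNot (FEx z (FAnd (FLess x z) (FLess z y))))"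

lemma ev_FAndS: "finite X ==> ev N xs rho (FAndS X f) e = (\<forall>x\<in>X. ev N xs rho (f x) e)"
  by (simp add: FAndS_def set_listof)

lemma ev_FOrS: "finite X ==> ev N xs rho (FOrS X f) e = (\<exists>x\<in>X. ev N xs rho (f x) e)"
  by (simp add: FOrS_def ev_FAndS)

lemma ev_FOne: "finite X ==> ev N xs rho (FOne X f) e = (\<exists>x\<in>X. \<forall>y\<in>X. ev N xs rho (f y) e \<longleftrightarrow> x = y)"
proof -
  assume X: "finite X"
  have "ev N xs rho (FOne X f) e = (\<exists>x\<in>X. ev N xs rho (f x) e & (\<forall>y\<in>X - {x}. ~ ev N xs rho (f y) e))"
    unfolding FOne_def ev_FOrS[OF X] using X by (simp add: ev_FAndS)
  also have "\<dots> = (\<exists>x\<in>X. \<forall>y\<in>X. ev N xs rho (f y) e \<longleftrightarrow> x = y)" by (rule bex_cong[OF refl]) auto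
  finally show ?thesis .
qed

lemma ev_FSucc: "e y < N ==> z ~= x ==> z ~= y ==> ev N xs rho (FSucc x y z) e = (e y = Suc (e x))"
proof -
  assume a: "e y < N" "z ~= x" "z ~= y"
  have "ev N xs rho (FSucc x y z) e = (e x < e y & ~ (\<exists>i<N. e x < i & i < e y))" using a by (simp add: FSucc_def)
  also have "\<dots> = (e y = Suc (e x))"
  proof
    assume s: "e x < e y & ~ (\<exists>i<N. e x < i & i < e y)"
    then have "~ Suc (e x) < e y" using a(1) less_trans by blast
    then show "e y = Suc (e x)" using s by linarith
  qed auto
  finally show ?thesis .
qed

lemma plain_derived [simp]:
  "plain V (FNot phi) = plain V phi" "plain V (FOr phi psi) = (plain V phi & plain V psi)" "plain V (FAnd phi psi) = (plain V phi & plain V psi)"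
  "plain V (FImp phi psi) = (plain V phi & plain V psi)" "plain V (FIff phi psi) = (plain V phi & plain V psi)"
  "plain V (FEx v phi) = (v < V & plain V phi)" "plain V (FAll v phi) = (v < V & plain V phi)"
  "plain V (FSucc x y z) = (x < V & y < V & z < V)"
  by (auto simp: FNot_def FOr_def FAnd_def FImp_def FIff_def FEx_def FAll_def FSucc_def)

lemma plain_FAnds: "0 < V ==> (\<And>phi. phi \<in> set phis ==> plain V phi) ==> plain V (FAnds phis)"
  unfolding FAnds_def by (induction phis) auto

lemma plain_FAndS: "0 < V ==> finite X ==> (\<And>x. x \<in> X ==> plain V (f x)) ==> plain V (FAndS X f)"
  unfolding FAndS_def by (rule plain_FAnds) (auto simp: set_listof)

lemma plain_FOrS: "0 < V ==> finite X ==> (\<And>x. x \<in> X ==> plain V (f x)) ==> plain V (FOrS X f)"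
  unfolding FOrS_def by (simp add: plain_FAndS)

lemma plain_FOne: "0 < V ==> finite X ==> (\<And>x. x \<in> X ==> plain V (f x)) ==> plain V (FOne X f)"
  unfolding FOne_def by (rule plain_FOrS) (auto intro!: plain_FAndS)

lemma plain_Bool: "0 < V ==> plain V (Bool c)" by (simp add: Bool_def)

text \<open>
  Runs of machines are described by relations for states, cells and head positions. The first
  argument is a tag that distinguishes several families of runs. A tuple consists of the member of
  the family, the time and the position on the tape, padded with zeros (variable 0 is never bound).
\<close>

datatype rsym = QS nat nat | QC nat nat nat | QH nat nat

text \<open>The circuit requires tuples as long as the number of variables, which is 16 here; hence
  the 13 padding zeros.\<close>

definition atom :: "rsym => nat => nat => nat => rsym fm" where
  "atom r x y z = FRel r ([x, y, z] @ replicate 13 0)"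

definition rl :: "(rsym => nat list => bool) => rsym => nat => nat => nat => bool" where
  "rl rho r i t p = rho r ([i, t, p] @ replicate 13 0)"

lemma ev_atom: "e 0 = 0 ==> ev N xs rho (atom r x y z) e = rl rho r (e x) (e y) (e z)"
  by (simp add: atom_def rl_def)

lemma plain_atom: "x < 16 ==> y < 16 ==> z < 16 ==> plain 16 (atom r x y z)"
  by (auto simp: atom_def)

text \<open>\<open>g\<close> is the tag of the relations, \<open>iv\<close> the variable that
  selects a member of the family, and \<open>b\<close> the first of the six variables bound by the
  formulas of the tableau. \<open>ini s\<close> states that the cell at the position variable
  initially holds \<open>s\<close> on tape 0; \<open>yes\<close> and \<open>no\<close> are the
  conditions for the two answers to a query. Positions are natural numbers, with cell 0 at
  \<open>off\<close>.\<close>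

locale tableau =
  fixes M :: otm and g b iv :: nat and ini :: "nat => rsym fm" and yes no :: "rsym fm"
    and N :: nat and xs :: "nat list" and rho :: "rsym => nat list => bool" and off :: nat
  assumes wf: "wf_otm M" and vars: "2 \<le> b" "iv < b" and off: "off < N"
begin

abbreviation "tv \<equiv> b"
abbreviation "tv' \<equiv> Suc b"
abbreviation "pv \<equiv> b + 2"
abbreviation "pv' \<equiv> b + 3"
abbreviation "rv \<equiv> b + 4"
abbreviation "nv \<equiv> b + 5"

abbreviation "nt \<equiv> num_tapes M"
abbreviation "ns \<equiv> num_states M"
abbreviation "ny \<equiv> num_symbols M"

definition Sta :: "nat => nat => rsym fm" where "Sta q t = atom (QS g q) iv t 0"
definition Cel :: "nat => nat => nat => nat => rsym fm" where "Cel k s t p = atom (QC g k s) iv t p"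
definition Hea :: "nat => nat => nat => rsym fm" where "Hea k t p = atom (QH g k) iv t p"

definition Func :: "rsym fm" where
  "Func = FAll tv (FAnd (FOne {..<ns} (\<lambda>q. Sta q tv)) (FAndS {..<nt} (\<lambda>k. FAnd
     (FEx pv (FAll pv' (FIff (Hea k tv pv') (FEq pv' pv))))
     (FAll pv (FOne {..<ny} (\<lambda>s. Cel k s tv pv))))))"

text \<open>Variables serve as constants: variable 0 stands for time 0 and variable 1 for the
  position of cell 0.\<close>

definition Init :: "rsym fm" where
  "Init = FAnd (Sta (start_state M) 0) (FAndS {..<nt} (\<lambda>k. FAnd (Hea k 0 1)
     (FAll pv (FAndS {..<ny} (\<lambda>s. FIff (Cel k s 0 pv) (if k = 0 then ini s else Bool (s = 0)))))))"

definition Move :: "nat => dir => rsym fm" where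
  "Move k d = (case d of Stay => Hea k tv' pv
     | Right => FEx pv' (FAnd (FSucc pv pv' rv) (Hea k tv' pv'))
     | Left => FEx pv' (FAnd (FSucc pv' pv rv) (Hea k tv' pv')))"

definition Tape :: "nat => nat => nat \<times> dir => rsym fm" where
  "Tape k s a = FEx pv (FAnd (Hea k tv pv) (FAnd (Cel k s tv pv) (FAnd (Cel k (fst a) tv' pv) (FAnd (Move k (snd a))
     (FAll pv' (FImp (FNot (FEq pv' pv)) (FAndS {..<ny} (\<lambda>r. FIff (Cel k r tv pv') (Cel k r tv' pv')))))))))"

definition Keep :: "nat => rsym fm" where
  "Keep k = FAll pv (FAnd (FIff (Hea k tv pv) (Hea k tv' pv)) (FAndS {..<ny} (\<lambda>r. FIff (Cel k r tv pv) (Cel k r tv' pv))))"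

definition TR :: "(nat \<times> nat list \<times> nat \<times> (nat \<times> dir) list) set" where
  "TR = {(q, rs, q', acts). q < ns & q ~= query_state M & length rs = nt & set rs \<subseteq> {..<ny} & (q', acts) \<in> trans M q rs}"

definition Trans :: "nat \<times> nat list \<times> nat \<times> (nat \<times> dir) list => rsym fm" where
  "Trans = (\<lambda>(q, rs, q', acts). FAnd (Sta q tv) (FAnd (Sta q' tv') (FAndS {..<nt} (\<lambda>k. Tape k (rs ! k) (acts ! k)))))"

definition Step :: "rsym fm" where
  "Step = FOr (FOrS TR Trans) (FAnd (Sta (query_state M) tv) (FAnd (FAndS {..<nt} Keep)
     (FOr (FAnd (Sta (yes_state M) tv') yes) (FAnd (Sta (no_state M) tv') no))))"

definition Accepting :: "rsym fm" where
  "Accepting = FAnd Func (FAnd Init (FEx nv (FAnd (Sta (accept_state M) nv)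
     (FAll tv (FImp (FLess tv nv) (FEx tv' (FAnd (FSucc tv tv' rv) Step)))))))"

lemma finite_TR: "finite TR"
proof -
  let ?W = "{rs. set rs \<subseteq> {..<ny} & length rs = nt}"
  let ?D = "{Left, Stay, Right}"
  let ?Z = "{acts. set acts \<subseteq> {..<ny} \<times> ?D & length acts = nt}"
  have "(UNIV :: dir set) = ?D" using dir.exhaust by blast
  have "TR \<subseteq> {..<ns} \<times> ?W \<times> {..<ns} \<times> ?Z"
  proof
    fix x assume "x \<in> TR"
    then obtain q rs q' acts where x: "x = (q, rs, q', acts)" "q < ns" "length rs = nt" "set rs \<subseteq> {..<ny}" "(q', acts) \<in> trans M q rs"
      unfolding TR_def by blast
    note t = wf_trans[OF wf x(2-5)]
    have "set acts \<subseteq> {..<ny} \<times> ?D"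
    proof
      fix a assume "a \<in> set acts"
      then have "fst a < ny" using t by auto
      moreover have "snd a \<in> ?D" using \<open>UNIV = ?D\<close> by blast
      ultimately show "a \<in> {..<ny} \<times> ?D" by (simp add: mem_Times_iff)
    qed
    then show "x \<in> {..<ns} \<times> ?W \<times> {..<ns} \<times> ?Z" using x t by simp
  qed
  moreover have "finite ?W" "finite ?Z" by (rule finite_lists_length_eq; simp)+
  ultimately show ?thesis by (auto intro: finite_subset)
qed

lemma plain_Accepting:
  assumes "b \<le> 10" "\<And>s. plain 16 (ini s)" "plain 16 yes" "plain 16 no"
  shows "plain 16 Accepting"
proof -
  have at: "plain 16 (Sta q t)" "plain 16 (Cel k s t p)" "plain 16 (Hea k t p)" if "t < 16" "p < 16" for q k s t p
    unfolding Sta_def Cel_def Hea_def using that vars assms(1) by (simp_all add: plain_atom)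
  have mv: "plain 16 (Move k d)" for k d using assms(1) by (cases d) (simp_all add: Move_def at)
  have tp: "plain 16 (Tape k s a)" for k s a
    unfolding Tape_def using assms(1) by (auto simp: at mv intro!: plain_FAndS)
  have kp: "plain 16 (Keep k)" for k
    unfolding Keep_def using assms(1) by (auto simp: at intro!: plain_FAndS)
  have tr: "plain 16 (Trans x)" for x
    unfolding Trans_def using assms(1) by (cases x) (auto simp: at[of _ 0] tp intro!: plain_FAndS)
  have "plain 16 Step"
    unfolding Step_def using assms by (auto simp: at[of _ 0] tr kp finite_TR intro!: plain_FAndS plain_FOrS)
  moreover have "plain 16 Func"
    unfolding Func_def using assms(1) by (auto simp: at[of _ 0] at intro!: plain_FAndS plain_FOne)
  moreover have "plain 16 Init"
    unfolding Init_def using assms by (auto simp: at[of _ 0] at plain_Bool intro!: plain_FAndS)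
  ultimately show ?thesis unfolding Accepting_def using assms(1) by (simp add: at[of _ 0])
qed

definition env :: "nat => (nat => nat) => bool" where
  "env iota e = (e 0 = 0 & e 1 = off & e iv = iota)"

lemma env_upd: "env iota e ==> b \<le> x ==> env iota (e(x := i))" using vars by (simp add: env_def)

abbreviation "R \<equiv> rl rho"
abbreviation "evl \<equiv> ev N xs rho"

lemma ev_atoms:
  assumes "env iota e"
  shows "evl (Sta q t) e = R (QS g q) iota (e t) 0" "evl (Cel k s t p) e = R (QC g k s) iota (e t) (e p)"
    "evl (Hea k t p) e = R (QH g k) iota (e t) (e p)"
  using assms by (simp_all add: Sta_def Cel_def Hea_def ev_atom env_def)

definition place :: "nat => int" where "place p = int p - int off"

lemma place_eq [simp]: "place p = place q \<longleftrightarrow> p = q" by (simp add: place_def)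

text \<open>The tapes that the relations can describe: head and non-blank cells lie at positions
  below \<open>N\<close>.\<close>

definition win :: "tape => bool" where "win = fits ny (- int off) (int N - 1 - int off)"

lemma win_head: "win T ==> \<exists>p<N. snd T = place p"
  unfolding win_def fits_def place_def by (intro exI[of _ "nat (snd T + int off)"]) auto

lemma win_eqI:
  assumes "win T" "win T'" "\<And>p. p < N ==> fst T (place p) = fst T' (place p)"
  shows "fst T = fst T'"
proof
  fix z
  show "fst T z = fst T' z"
  proof (cases "- int off \<le> z & z \<le> int N - 1 - int off")
    case True
    then have "place (nat (z + int off)) = z" "nat (z + int off) < N" by (auto simp: place_def)
    then show ?thesis using assms(3) by metis
  next
    case False
    then have "z < - int off | int N - 1 - int off < z" by linarith
    then show ?thesis using assms(1,2) unfolding win_def fits_def by metis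
  qed
qed

lemma win_symbol: "win T ==> fst T z < ny" by (simp add: win_def fits_def)

text \<open>A configuration inside the window is demanded at every time below \<open>N\<close>, also
  after the run has ended.\<close>

definition rep :: "nat => (nat => config) => bool" where
  "rep iota cfg = (\<forall>t<N. fst (cfg t) < ns & (\<forall>q<ns. R (QS g q) iota t 0 \<longleftrightarrow> fst (cfg t) = q) &
     length (snd (cfg t)) = nt & (\<forall>k<nt. win (snd (cfg t) ! k) &
       (\<forall>p<N. (R (QH g k) iota t p \<longleftrightarrow> snd (snd (cfg t) ! k) = place p) &
         (\<forall>s<ny. R (QC g k s) iota t p \<longleftrightarrow> fst (snd (cfg t) ! k) (place p) = s))))"

lemma ev_Func:
  assumes "env iota e"
  shows "evl Func e = (\<forall>t<N. (\<exists>q<ns. \<forall>q'<ns. R (QS g q') iota t 0 \<longleftrightarrow> q = q') &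
    (\<forall>k<nt. (\<exists>p<N. \<forall>p'<N. R (QH g k) iota t p' \<longleftrightarrow> p' = p) & (\<forall>p<N. \<exists>s<ny. \<forall>s'<ny. R (QC g k s') iota t p \<longleftrightarrow> s = s')))"
proof -
  have e: "env iota (e(tv := t))" "env iota (e(tv := t, pv := p))" "env iota (e(tv := t, pv := p, pv' := p'))" for t p p'
    using assms by (auto intro!: env_upd)
  show ?thesis unfolding Func_def using ev_atoms[OF e(1)] ev_atoms[OF e(2)] ev_atoms[OF e(3)]
    by (simp add: ev_FAndS ev_FOne lessThan_def[symmetric] Ball_def Bex_def)
qed

lemma rep_Func: "env iota e ==> rep iota cfg ==> evl Func e"
proof -
  assume e: "env iota e" and r: "rep iota cfg"
  show "evl Func e" unfolding ev_Func[OF e]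
  proof (intro allI impI conjI)
    fix t assume t: "t < N"
    show "\<exists>q<ns. \<forall>q'<ns. R (QS g q') iota t 0 \<longleftrightarrow> q = q'"
      using r t unfolding rep_def by (intro exI[of _ "fst (cfg t)"]) auto
    fix k assume k: "k < nt"
    have w: "win (snd (cfg t) ! k)" using r t k unfolding rep_def by blast
    obtain p where p: "p < N" "snd (snd (cfg t) ! k) = place p" using win_head[OF w] by blast
    have "R (QH g k) iota t p' = (p' = p)" if "p' < N" for p'
      using r t k that p(2) unfolding rep_def by auto
    then show "\<exists>p<N. \<forall>p'<N. R (QH g k) iota t p' \<longleftrightarrow> p' = p" using p(1) by blast
    fix p assume "p < N"
    then show "\<exists>s<ny. \<forall>s'<ny. R (QC g k s') iota t p \<longleftrightarrow> s = s'"
      using r t k win_symbol[OF w, of "place p"] unfolding rep_def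
      by (intro exI[of _ "fst (snd (cfg t) ! k) (place p)"]) auto
  qed
qed

lemma some_unique: "\<exists>q<n. \<forall>q'<n. P q' \<longleftrightarrow> q = q' ==>
    (SOME q. q < n & P q) < n & (\<forall>q'<n. P q' \<longleftrightarrow> (SOME q. q < n & P q) = q')" for n :: nat
proof -
  assume "\<exists>q<n. \<forall>q'<n. P q' \<longleftrightarrow> q = q'"
  then obtain q where q: "q < n" "\<forall>q'<n. P q' \<longleftrightarrow> q = q'" by blast
  then have "(SOME q. q < n & P q) = q" by (intro some_equality) auto
  then show ?thesis using q by simp
qed

text \<open>Functionality alone makes arbitrary relations describe a sequence of configurations, if
  cells outside the window are taken to be blank. So interpretations chosen by an adversary can be
  treated like honest ones.\<close>

lemma Func_rep:
  assumes e: "env iota e" and f: "evl Func e"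
  obtains cfg where "rep iota cfg"
proof -
  define Q where "Q t = (SOME q. q < ns & R (QS g q) iota t 0)" for t
  define H where "H t k = (SOME p. p < N & R (QH g k) iota t p)" for t k
  define C where "C t k p = (SOME s. s < ny & R (QC g k s) iota t p)" for t k p
  define T where "T t k = ((\<lambda>z. if - int off \<le> z & z \<le> int N - 1 - int off then C t k (nat (z + int off)) else 0), place (H t k))" for t k
  define cfg where "cfg t = (Q t, map (T t) [0..<nt])" for t
  have "rep iota cfg" unfolding rep_def
  proof (intro allI impI)
    fix t assume t: "t < N"
    note F = f[unfolded ev_Func[OF e], rule_format, OF t]
    have Q: "Q t < ns" "\<forall>q<ns. R (QS g q) iota t 0 \<longleftrightarrow> Q t = q"
      using some_unique[of ns "\<lambda>q. R (QS g q) iota t 0"] F unfolding Q_def by blast+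
    have tape: "win (T t k) & (\<forall>p<N. (R (QH g k) iota t p \<longleftrightarrow> snd (T t k) = place p) &
         (\<forall>s<ny. R (QC g k s) iota t p \<longleftrightarrow> fst (T t k) (place p) = s))" if k: "k < nt" for k
    proof -
      have "\<exists>p<N. \<forall>p'<N. R (QH g k) iota t p' \<longleftrightarrow> p' = p" using F k by blast
      then have "\<exists>p<N. \<forall>p'<N. R (QH g k) iota t p' \<longleftrightarrow> p = p'" by metis
      from some_unique[OF this] have H: "H t k < N" "\<forall>p<N. R (QH g k) iota t p \<longleftrightarrow> H t k = p"
        unfolding H_def by blast+
      have "\<exists>s<ny. \<forall>s'<ny. R (QC g k s') iota t p \<longleftrightarrow> s = s'" if "p < N" for p using F k that by blast
      from some_unique[OF this] have C: "C t k p < ny" "\<forall>s<ny. R (QC g k s) iota t p \<longleftrightarrow> C t k p = s" if "p < N" for p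
        using that unfolding C_def by blast+
      have ny: "0 < ny" using wf by (simp add: wf_otm_def)
      have "C t k (nat (z + int off)) < ny" if "- int off \<le> z" "z \<le> int N - 1 - int off" for z
        by (rule C(1)) (use that in linarith)
      then have "win (T t k)" using H(1) ny unfolding win_def fits_def T_def place_def by auto
      moreover have "fst (T t k) (place p) = C t k p" if "p < N" for p
        using that by (simp add: T_def place_def)
      ultimately show ?thesis using H(2) C(2) by (simp add: T_def)
    qed
    show "fst (cfg t) < ns & (\<forall>q<ns. R (QS g q) iota t 0 \<longleftrightarrow> fst (cfg t) = q) &
     length (snd (cfg t)) = nt & (\<forall>k<nt. win (snd (cfg t) ! k) &
       (\<forall>p<N. (R (QH g k) iota t p \<longleftrightarrow> snd (snd (cfg t) ! k) = place p) &
         (\<forall>s<ny. R (QC g k s) iota t p \<longleftrightarrow> fst (snd (cfg t) ! k) (place p) = s)))"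
      using Q tape by (simp add: cfg_def)
  qed
  then show ?thesis by (rule that)
qed

context
  fixes iota :: nat and cfg :: "nat => config"
  assumes r: "rep iota cfg"
begin

lemma rep_state: "t < N ==> fst (cfg t) < ns" "t < N ==> length (snd (cfg t)) = nt"
  using r unfolding rep_def by blast+

lemma rep_win: "t < N ==> k < nt ==> win (snd (cfg t) ! k)" using r unfolding rep_def by blast

lemma rep_atoms:
  assumes "env iota e" "e t < N"
  shows "q < ns ==> evl (Sta q t) e = (fst (cfg (e t)) = q)"
    "k < nt ==> e p < N ==> evl (Hea k t p) e = (snd (snd (cfg (e t)) ! k) = place (e p))"
    "k < nt ==> e p < N ==> s < ny ==> evl (Cel k s t p) e = (fst (snd (cfg (e t)) ! k) (place (e p)) = s)"
  using r assms(2) unfolding ev_atoms[OF assms(1)] rep_def by blast+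

lemma ev_Init:
  assumes e: "env iota e" and u: "int (length u) \<le> int N - int off"
    and ini: "\<And>e s. env iota e ==> e pv < N ==> s < ny ==> evl (ini s) e = (fst (input_tape u) (place (e pv)) = s)"
  shows "evl Init e = (cfg 0 = init_config M u)"
proof -
  let ?I = "snd (init_config M u)"
  have N0: "0 < N" using off by simp
  have e0: "e 0 = 0" "e 1 = off" using e by (simp_all add: env_def)
  have ns: "start_state M < ns" and ny: "3 \<le> ny" using wf by (simp_all add: wf_otm_def)
  have lI: "length ?I = nt" using wf by (simp add: init_config_def wf_otm_def)
  have wI: "win (?I ! k)" if "k < nt" for k
  proof -
    have "win (input_tape u)"
      using u ny off by (auto simp: win_def fits_def input_tape_def bit_symbol_def)
    moreover have "win blank_tape" using ny off by (auto simp: win_def fits_def blank_tape_def)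
    ultimately show ?thesis using that by (auto simp: init_config_def nth_Cons')
  qed
  have hI: "snd (?I ! k) = place off" if "k < nt" for k
    using that by (auto simp: init_config_def nth_Cons' input_tape_def blank_tape_def place_def)
  have cI: "fst (?I ! k) z = (if k = 0 then fst (input_tape u) z else 0)" if "k < nt" for k z
    using that by (auto simp: init_config_def nth_Cons' blank_tape_def)
  have "evl Init e = (fst (cfg 0) = start_state M & (\<forall>k<nt. snd (snd (cfg 0) ! k) = place off &
      (\<forall>p<N. \<forall>s<ny. fst (snd (cfg 0) ! k) (place p) = s \<longleftrightarrow> fst (?I ! k) (place p) = s)))"
  proof -
    have 1: "evl (FAndS {..<ny} (\<lambda>s. FIff (Cel k s 0 pv) (if k = 0 then ini s else Bool (s = 0)))) (e(pv := p)) =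
        (\<forall>s<ny. fst (snd (cfg 0) ! k) (place p) = s \<longleftrightarrow> fst (?I ! k) (place p) = s)" if "k < nt" "p < N" for k p
    proof -
      have ep: "env iota (e(pv := p))" by (rule env_upd[OF e]) simp
      have "(e(pv := p)) 0 = 0" using ep by (simp add: env_def)
      then show ?thesis
        using rep_atoms(3)[OF ep, of 0 k pv] ini[OF ep] that N0 cI[OF that(1)] by (auto simp: ev_FAndS)
    qed
    have 2: "evl (Hea k 0 1) e = (snd (snd (cfg 0) ! k) = place off)" if "k < nt" for k
      using rep_atoms(2)[OF e, of 0 k 1] that e0 N0 off by simp
    have 3: "evl (Sta (start_state M) 0) e = (fst (cfg 0) = start_state M)"
      using rep_atoms(1)[OF e, of 0] ns e0 N0 by simp
    show ?thesis unfolding Init_def ev_derived(3) 3 using 1 2 by (simp add: ev_FAndS Ball_def)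
  qed
  also have "\<dots> = (fst (cfg 0) = start_state M & (\<forall>k<nt. snd (cfg 0) ! k = ?I ! k))"
  proof -
    have "(snd (snd (cfg 0) ! k) = place off & (\<forall>p<N. \<forall>s<ny. fst (snd (cfg 0) ! k) (place p) = s \<longleftrightarrow> fst (?I ! k) (place p) = s)) \<longleftrightarrow>
        snd (cfg 0) ! k = ?I ! k" if k: "k < nt" for k
    proof
      assume a: "snd (snd (cfg 0) ! k) = place off & (\<forall>p<N. \<forall>s<ny. fst (snd (cfg 0) ! k) (place p) = s \<longleftrightarrow> fst (?I ! k) (place p) = s)"
      have "fst (snd (cfg 0) ! k) = fst (?I ! k)"
        by (rule win_eqI[OF rep_win[OF N0 k] wI[OF k]]) (use a win_symbol[OF wI[OF k]] in blast)
      then show "snd (cfg 0) ! k = ?I ! k" using a hI[OF k] by (simp add: prod_eq_iff)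
    qed (use hI[OF k] in simp)
    then show ?thesis by blast
  qed
  also have "\<dots> = (cfg 0 = init_config M u)"
  proof -
    have "(\<forall>k<nt. snd (cfg 0) ! k = ?I ! k) = (snd (cfg 0) = ?I)"
      using rep_state(2)[OF N0] lI nth_equalityI[of "snd (cfg 0)" ?I] by auto
    moreover have "fst (init_config M u) = start_state M" by (simp add: init_config_def)
    ultimately show ?thesis by (simp add: prod_eq_iff)
  qed
  finally show ?thesis .
qed

end

end

lemma symbols_eq: "x < S ==> y < S ==> (\<forall>r<S. x = r \<longleftrightarrow> y = r) \<longleftrightarrow> x = (y :: nat)" by auto

context tableau
begin

context
  fixes iota t :: nat and cfg :: "nat => config" and e :: "nat => nat"
  assumes r: "rep iota cfg" and e: "env iota e" "e tv = t" "e tv' = Suc t" and t: "Suc t < N"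
begin

lemma step_env: "env iota (e(pv := p))" "env iota (e(pv := p, pv' := p'))"
  using e(1) by (auto intro!: env_upd)

lemma sym_same:
  assumes k: "k < nt" and p: "e' pp < N" and e': "env iota e'" "e' tv = t" "e' tv' = Suc t"
  shows "evl (FAndS {..<ny} (\<lambda>r. FIff (Cel k r tv pp) (Cel k r tv' pp))) e' =
    (fst (snd (cfg t) ! k) (place (e' pp)) = fst (snd (cfg (Suc t)) ! k) (place (e' pp)))"
proof -
  have tN: "e' tv < N" "e' tv' < N" using e' t by simp_all
  have w: "win (snd (cfg t) ! k)" "win (snd (cfg (Suc t)) ! k)" using rep_win[OF r _ k] t by simp_all
  show ?thesis using rep_atoms(3)[OF r e'(1) tN(1) k p] rep_atoms(3)[OF r e'(1) tN(2) k p] e'(2,3)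
      symbols_eq[OF win_symbol[OF w(1)] win_symbol[OF w(2)], of "place (e' pp)" "place (e' pp)"]
    by (simp add: ev_FAndS Ball_def)
qed

text \<open>At the border of the window the formula finds no position to move to and is false. The
  right-hand side is false as well, because the next configuration lies inside the window.\<close>

lemma ev_Move:
  assumes k: "k < nt" and p: "p < N"
  shows "evl (Move k d) (e(pv := p)) = (snd (snd (cfg (Suc t)) ! k) = place p + offset d)"
proof -
  let ?T' = "snd (cfg (Suc t)) ! k"
  have w: "win ?T'" using rep_win[OF r t k] .
  obtain h where h: "h < N" "snd ?T' = place h" using win_head[OF w] by blast
  have H: "evl (Hea k tv' pv') (e(pv := p, pv' := p')) = (snd ?T' = place p')" if "p' < N" for p'
    using rep_atoms(2)[OF r step_env(2)[of p p'], of tv' k pv'] k that e t by simp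
  show ?thesis
  proof (cases d)
    case Stay
    have "evl (Hea k tv' pv) (e(pv := p)) = (snd ?T' = place p)"
      using rep_atoms(2)[OF r step_env(1)[of p], of tv' k pv] k p e t by simp
    then show ?thesis using Stay by (simp add: Move_def)
  next
    case Right
    have "evl (Move k d) (e(pv := p)) = (\<exists>p'<N. p' = Suc p & snd ?T' = place p')"
      using H Right by (simp add: Move_def ev_FSucc cong: conj_cong)
    also have "\<dots> = (snd ?T' = place p + offset d)" using h Right by (auto simp: place_def)
    finally show ?thesis .
  next
    case Left
    have "evl (Move k d) (e(pv := p)) = (\<exists>p'<N. p = Suc p' & evl (Hea k tv' pv') (e(pv := p, pv' := p')))"
      using Left p by (simp add: Move_def ev_FSucc)
    also have "\<dots> = (\<exists>p'<N. p = Suc p' & snd ?T' = place p')" using H by metis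
    also have "\<dots> = (snd ?T' = place p + offset d)" using h Left by (auto simp: place_def)
    finally show ?thesis .
  qed
qed

lemma ev_Tape:
  assumes k: "k < nt" and s: "s < ny" "fst a < ny"
  shows "evl (Tape k s a) e = (scan (snd (cfg t) ! k) = s & snd (cfg (Suc t)) ! k = act (snd (cfg t) ! k) a)"
proof -
  let ?T = "snd (cfg t) ! k" and ?T' = "snd (cfg (Suc t)) ! k"
  have tN: "t < N" using t by simp
  have w: "win ?T" "win ?T'" using rep_win[OF r _ k] t by simp_all
  obtain h where h: "h < N" "snd ?T = place h" using win_head[OF w(1)] by blast
  let ?P = "\<lambda>p. snd ?T = place p & fst ?T (place p) = s & fst ?T' (place p) = fst a & snd ?T' = place p + offset (snd a) &
      (\<forall>p'<N. p' ~= p --> fst ?T (place p') = fst ?T' (place p'))"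
  have "evl (Tape k s a) e = (\<exists>p<N. ?P p)" unfolding Tape_def ev_derived(6)
  proof (intro ex_cong1 conj_cong refl)
    fix p assume p: "p < N"
    note e1 = step_env(1)[of p]
    have "evl (Hea k tv pv) (e(pv := p)) = (snd ?T = place p)"
      "evl (Cel k s tv pv) (e(pv := p)) = (fst ?T (place p) = s)"
      "evl (Cel k (fst a) tv' pv) (e(pv := p)) = (fst ?T' (place p) = fst a)"
      using rep_atoms(2,3)[OF r e1, of tv k pv] rep_atoms(3)[OF r e1, of tv' k pv] k p s e t by simp_all
    moreover have "evl (FAll pv' (FImp (FNot (FEq pv' pv)) (FAndS {..<ny} (\<lambda>r. FIff (Cel k r tv pv') (Cel k r tv' pv'))))) (e(pv := p)) =
        (\<forall>p'<N. p' ~= p --> fst ?T (place p') = fst ?T' (place p'))"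
    proof -
      have "evl (FAndS {..<ny} (\<lambda>r. FIff (Cel k r tv pv') (Cel k r tv' pv'))) (e(pv := p, pv' := p')) =
          (fst ?T (place p') = fst ?T' (place p'))" if "p' < N" for p'
        using sym_same[OF k, of "e(pv := p, pv' := p')" pv'] step_env(2) that e by simp
      then show ?thesis by simp
    qed
    ultimately show "evl (FAnd (Hea k tv pv) (FAnd (Cel k s tv pv) (FAnd (Cel k (fst a) tv' pv) (FAnd (Move k (snd a))
     (FAll pv' (FImp (FNot (FEq pv' pv)) (FAndS {..<ny} (\<lambda>r. FIff (Cel k r tv pv') (Cel k r tv' pv'))))))))) (e(pv := p)) = ?P p"
      unfolding ev_derived(3) ev_Move[OF k p] by simp
  qed
  also have "\<dots> = ?P h" using h by (metis place_eq)
  also have "\<dots> = (scan ?T = s & ?T' = act ?T a)"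
  proof
    assume P: "?P h"
    have wa: "win (act ?T a)" using w P s(2) h unfolding win_def fits_def act_def by auto
    have "fst ?T' = fst (act ?T a)" by (rule win_eqI[OF w(2) wa]) (use P h in \<open>auto simp: act_def\<close>)
    then show "scan ?T = s & ?T' = act ?T a"
      using P by (simp add: scan_def prod_eq_iff) (simp add: act_def)
  next
    assume a: "scan ?T = s & ?T' = act ?T a"
    then have "fst ?T' = (fst ?T)(place h := fst a)" "snd ?T' = place h + offset (snd a)"
      using h by (simp_all add: act_def)
    then show "?P h" using a h by (simp add: scan_def)
  qed
  finally show ?thesis .
qed

lemma ev_Keep:
  assumes k: "k < nt"
  shows "evl (Keep k) e = (snd (cfg (Suc t)) ! k = snd (cfg t) ! k)"
proof -
  let ?T = "snd (cfg t) ! k" and ?T' = "snd (cfg (Suc t)) ! k"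
  have w: "win ?T" "win ?T'" using rep_win[OF r _ k] t by simp_all
  have "evl (Keep k) e = (\<forall>p<N. (snd ?T = place p \<longleftrightarrow> snd ?T' = place p) & fst ?T (place p) = fst ?T' (place p))"
    unfolding Keep_def ev_derived(7)
  proof (intro all_cong1 imp_cong refl)
    fix p assume p: "p < N"
    note e1 = step_env(1)[of p]
    have "evl (FAndS {..<ny} (\<lambda>r. FIff (Cel k r tv pv) (Cel k r tv' pv))) (e(pv := p)) = (fst ?T (place p) = fst ?T' (place p))"
      using sym_same[OF k, of "e(pv := p)" pv] e1 p e by simp
    moreover have "evl (Hea k tv pv) (e(pv := p)) = (snd ?T = place p)" "evl (Hea k tv' pv) (e(pv := p)) = (snd ?T' = place p)"
      using rep_atoms(2)[OF r e1, of tv k pv] rep_atoms(2)[OF r e1, of tv' k pv] k p e t by simp_all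
    ultimately show "evl (FAnd (FIff (Hea k tv pv) (Hea k tv' pv)) (FAndS {..<ny} (\<lambda>r. FIff (Cel k r tv pv) (Cel k r tv' pv)))) (e(pv := p)) =
        ((snd ?T = place p \<longleftrightarrow> snd ?T' = place p) & fst ?T (place p) = fst ?T' (place p))"
      unfolding ev_derived(3,5) by simp
  qed
  also have "\<dots> = (?T' = ?T)"
  proof
    assume a: "\<forall>p<N. (snd ?T = place p \<longleftrightarrow> snd ?T' = place p) & fst ?T (place p) = fst ?T' (place p)"
    have "snd ?T' = snd ?T" using a win_head[OF w(1)] by metis
    moreover have "fst ?T' = fst ?T" by (rule win_eqI[OF w(2,1)]) (use a in simp)
    ultimately show "?T' = ?T" by (simp add: prod_eq_iff)
  qed simp
  finally show ?thesis .
qed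

lemma ev_Step: "evl Step e = gstep M (evl yes e) (evl no e) (cfg t) (cfg (Suc t))"
proof -
  let ?c = "cfg t" and ?c' = "cfg (Suc t)"
  have tN: "t < N" "e tv < N" "e tv' < N" using t e by simp_all
  have st: "evl (Sta q tv) e = (fst ?c = q)" "evl (Sta q tv') e = (fst ?c' = q)" if "q < ns" for q
    using rep_atoms(1)[OF r e(1) tN(2) that] rep_atoms(1)[OF r e(1) tN(3) that] e by simp_all
  have q: "query_state M < ns" "yes_state M < ns" "no_state M < ns" using wf by (simp_all add: wf_otm_def)
  have len: "length (snd ?c) = nt" "length (snd ?c') = nt" using rep_state(2)[OF r] t by simp_all
  have scan: "scan (snd ?c ! k) < ny" if "k < nt" for k
    using win_symbol[OF rep_win[OF r tN(1) that]] by (simp add: scan_def)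
  have fin: "fst ?c < ns" using rep_state(1)[OF r tN(1)] .
  have tr: "evl (Trans (q, rs, q', acts)) e = (fst ?c = q & fst ?c' = q' & rs = map scan (snd ?c) & snd ?c' = map2 act (snd ?c) acts)"
    if "(q, rs, q', acts) \<in> TR" for q rs q' acts
  proof -
    have x: "q < ns" "length rs = nt" "set rs \<subseteq> {..<ny}" "(q', acts) \<in> trans M q rs" using that by (auto simp: TR_def)
    have y: "q' < ns" "length acts = nt" "fst ` set acts \<subseteq> {..<ny}" using wf_trans[OF wf x] by auto
    have "rs ! k < ny" "fst (acts ! k) < ny" if "k < nt" for k
    proof -
      have "rs ! k \<in> set rs" "acts ! k \<in> set acts" using that x(2) y(2) by simp_all
      then show "rs ! k < ny" "fst (acts ! k) < ny" using x(3) y(3) by auto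
    qed
    then have "evl (Trans (q, rs, q', acts)) e = (fst ?c = q & fst ?c' = q' &
        (\<forall>k<nt. scan (snd ?c ! k) = rs ! k & snd ?c' ! k = act (snd ?c ! k) (acts ! k)))"
      using st[OF x(1)] st[OF y(1)] ev_Tape by (simp add: Trans_def ev_FAndS Ball_def)
    moreover have "(\<forall>k<nt. scan (snd ?c ! k) = rs ! k) = (rs = map scan (snd ?c))"
      unfolding list_eq_iff_nth_eq using len x(2) by auto
    moreover have "(\<forall>k<nt. snd ?c' ! k = act (snd ?c ! k) (acts ! k)) = (snd ?c' = map2 act (snd ?c) acts)"
      unfolding list_eq_iff_nth_eq using len y(2) by auto
    ultimately show ?thesis by blast
  qed
  have kp: "evl (FAndS {..<nt} Keep) e = (snd ?c' = snd ?c)"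
  proof -
    have "evl (FAndS {..<nt} Keep) e = (\<forall>k<nt. snd ?c' ! k = snd ?c ! k)"
      using ev_Keep by (simp add: ev_FAndS Ball_def)
    also have "\<dots> = (snd ?c' = snd ?c)" unfolding list_eq_iff_nth_eq using len by auto
    finally show ?thesis .
  qed
  have "evl (FOrS TR Trans) e = (fst ?c ~= query_state M &
      (\<exists>(q', acts)\<in>trans M (fst ?c) (map scan (snd ?c)). ?c' = (q', map2 act (snd ?c) acts)))"
  proof
    assume "evl (FOrS TR Trans) e"
    then obtain q rs q' acts where x: "(q, rs, q', acts) \<in> TR" "evl (Trans (q, rs, q', acts)) e"
      unfolding ev_FOrS[OF finite_TR] by (metis prod_cases4)
    note x2 = x(2)[unfolded tr[OF x(1)]]
    have "?c' = (q', map2 act (snd ?c) acts)" using x2 by (simp add: prod_eq_iff)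
    moreover have "(q', acts) \<in> trans M (fst ?c) (map scan (snd ?c))" "fst ?c ~= query_state M"
      using x(1) x2 by (auto simp: TR_def)
    ultimately show "fst ?c ~= query_state M &
      (\<exists>(q', acts)\<in>trans M (fst ?c) (map scan (snd ?c)). ?c' = (q', map2 act (snd ?c) acts))" by blast
  next
    assume a: "fst ?c ~= query_state M &
      (\<exists>(q', acts)\<in>trans M (fst ?c) (map scan (snd ?c)). ?c' = (q', map2 act (snd ?c) acts))"
    then obtain q' acts where x: "(q', acts) \<in> trans M (fst ?c) (map scan (snd ?c))" "?c' = (q', map2 act (snd ?c) acts)" by blast
    have "\<forall>s\<in>set (map scan (snd ?c)). s < ny" unfolding all_set_conv_all_nth using scan len by simp
    then have TR: "(fst ?c, map scan (snd ?c), q', acts) \<in> TR" using a x(1) fin len by (auto simp: TR_def)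
    then have "evl (Trans (fst ?c, map scan (snd ?c), q', acts)) e" unfolding tr[OF TR] using x(2) by simp
    then show "evl (FOrS TR Trans) e" unfolding ev_FOrS[OF finite_TR] using TR by blast
  qed
  then show ?thesis
    unfolding Step_def ev_derived(2,3) gstep_def kp using st(1)[OF q(1)] st(2)[OF q(2)] st(2)[OF q(3)] by blast
qed

end

lemma ev_Accepting:
  assumes r: "rep iota cfg" and e: "env iota e" and u: "int (length u) \<le> int N - int off"
    and ini: "\<And>e s. env iota e ==> e pv < N ==> s < ny ==> evl (ini s) e = (fst (input_tape u) (place (e pv)) = s)"
  defines "E \<equiv> \<lambda>n t. e(nv := n, tv := t, tv' := Suc t)"
  shows "evl Accepting e = (cfg 0 = init_config M u & (\<exists>n<N. fst (cfg n) = accept_state M &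
    (\<forall>t<n. gstep M (evl yes (E n t)) (evl no (E n t)) (cfg t) (cfg (Suc t)))))"
proof -
  have acc: "evl (Sta (accept_state M) nv) (e(nv := n)) = (fst (cfg n) = accept_state M)" if "n < N" for n
    using rep_atoms(1)[OF r env_upd[OF e], of nv n nv] that wf by (simp add: wf_otm_def)
  have steps: "evl (FAll tv (FImp (FLess tv nv) (FEx tv' (FAnd (FSucc tv tv' rv) Step)))) (e(nv := n)) =
      (\<forall>t<n. gstep M (evl yes (E n t)) (evl no (E n t)) (cfg t) (cfg (Suc t)))" if n: "n < N" for n
  proof -
    have "evl (FEx tv' (FAnd (FSucc tv tv' rv) Step)) (e(nv := n, tv := t)) =
        gstep M (evl yes (E n t)) (evl no (E n t)) (cfg t) (cfg (Suc t))" if "t < n" for t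
    proof -
      have t: "Suc t < N" using that n by simp
      have "evl (FEx tv' (FAnd (FSucc tv tv' rv) Step)) (e(nv := n, tv := t)) = evl Step (E n t)"
        using t by (simp add: ev_FSucc E_def cong: conj_cong)
      also have "\<dots> = gstep M (evl yes (E n t)) (evl no (E n t)) (cfg t) (cfg (Suc t))"
      proof (rule ev_Step[OF r _ _ _ t])
        show "env iota (E n t)" unfolding E_def by (intro env_upd e) simp_all
      qed (simp_all add: E_def)
      finally show ?thesis .
    qed
    moreover have "t < N" if "t < n" for t using that n by simp
    ultimately show ?thesis by (simp add: Ball_def del: ev_derived(6)) (metis)
  qed
  have "evl Accepting e = (evl Init e & (\<exists>n<N. evl (Sta (accept_state M) nv) (e(nv := n)) &
      evl (FAll tv (FImp (FLess tv nv) (FEx tv' (FAnd (FSucc tv tv' rv) Step)))) (e(nv := n))))"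
    unfolding Accepting_def ev_derived(3) ev_derived(6)[of _ _ _ nv] using rep_Func[OF e r] by blast
  moreover have "evl Init e = (cfg 0 = init_config M u)" by (rule ev_Init[OF r e u]) (rule ini)
  ultimately show ?thesis using acc steps by (simp cong: conj_cong del: ev_derived)
qed

end

section \<open>Initial tapes, the position of cell 0 and coded runs\<close>

lemma gstep_mono: "gstep M y n c c' ==> (y ==> y') ==> (n ==> n') ==> gstep M y' n' c c'"
  unfolding gstep_def by blast

text \<open>Variable 4 is the position variable of the tableau whose variables start at 2. Variable
  14 is the number of the cell, which is its position minus the offset; cells to the left of the
  offset are blank.\<close>

definition main_ini :: "nat => rsym fm" where
  "main_ini s = (if s = 0 then FOr (FLess 4 1) (FEx 14 (FAnd (FSum 1 14 4) (FIn 0 14)))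
     else FEx 14 (FAnd (FSum 1 14 4) (FIn s 14)))"

text \<open>The query on tape 1 of the main run at the time given by variable 2, copied to position 10.\<close>

definition query_bit :: "nat => nat => rsym fm" where "query_bit s x = atom (QC 0 1 s) 0 2 x"
definition query_pre :: "rsym fm" where
  "query_pre = FAnd (FNot (FLess 10 1)) (FAll 14 (FImp (FAnd (FNot (FLess 14 1)) (FNot (FLess 10 14)))
     (FOr (query_bit 1 14) (query_bit 2 14))))"
definition query_ini :: "nat => rsym fm" where
  "query_ini s = (if s = 1 | s = 2 then FAnd (query_bit s 10) query_pre
     else if s = 0 then FNot (FAnd (FOr (query_bit 1 10) (query_bit 2 10)) query_pre) else Bool False)"

text \<open>Tapes are infinite in both directions, so cell 0 is put into the middle. It is the
  largest \<open>x\<close> with \<open>x + x < N\<close>, a property that \<open>Off\<close> can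
  express.\<close>

definition middle :: "nat => nat" where "middle N = (N - 1) div 2"

definition Off :: "rsym fm" where
  "Off = FAnd (FEx 2 (FSum 1 1 2)) (FAll 2 (FImp (FLess 1 2) (FNot (FEx 3 (FSum 2 2 3)))))"

lemma ev_Off:
  assumes "0 < N" "x < N"
  shows "ev N xs rho Off (origin(1 := x)) = (x = middle N)"
proof -
  have "ev N xs rho Off (origin(1 := x)) = (x + x < N & (\<forall>y<N. x < y --> ~ y + y < N))"
    by (auto simp: Off_def)
  also have "\<dots> = (x = middle N)"
  proof
    assume a: "x + x < N & (\<forall>y<N. x < y --> ~ y + y < N)"
    have "~ Suc x + Suc x < N" using a by (meson add_lessD1 lessI)
    then show "x = middle N" using a unfolding middle_def by linarith
  qed (use assms in \<open>auto simp: middle_def\<close>)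
  finally show ?thesis .
qed

lemma input_tape_bits: "fst (input_tape w) (int d) = nth0 (bits w) d"
  by (simp add: input_tape_def nth0_bits)

lemma bit_symbol_01: "bit_symbol x ~= 0" "bit_symbol x < 3" by (simp_all add: bit_symbol_def)

lemma tableau_length:
  assumes "tableau M b iv N off" "tableau.win M N off t" "holds_word t u"
  shows "int (length u) \<le> int N - int off"
proof (rule ccontr)
  assume "~ int (length u) \<le> int N - int off"
  then have l: "int N - 1 - int off < int (length u) - 1" by simp
  then have "fst t (int (length u - 1)) = 0"
    using assms(2) unfolding tableau.win_def[OF assms(1)] fits_def by auto
  moreover have "off < N" using assms(1) by (simp add: tableau_def)
  then have "0 < length u" using l by linarith
  then have "fst t (int (length u - 1)) = bit_symbol (u ! (length u - 1))"
    using assms(3) by (simp add: holds_word_def)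
  ultimately show False using bit_symbol_01 by simp
qed

fun tag :: "rsym => nat" where
  "tag (QS g q) = g"
| "tag (QC g k s) = g"
| "tag (QH g k) = g"

fun coded :: "nat => (nat => nat => nat => config) => rsym => nat list => bool" where
  "coded off K (QS g q) ts = (fst (K g (ts ! 0) (ts ! 1)) = q)"
| "coded off K (QC g k s) ts = (fst (snd (K g (ts ! 0) (ts ! 1)) ! k) (int (ts ! 2) - int off) = s)"
| "coded off K (QH g k) ts = (snd (snd (K g (ts ! 0) (ts ! 1)) ! k) = int (ts ! 2) - int off)"

lemma coded_rep:
  assumes tab: "tableau M b iv N off" and "\<And>r i t q. tag r = g ==> rl rho r i t q = rl (coded off K) r i t q"
    and "\<And>t. fst (K g iota t) < num_states M & length (snd (K g iota t)) = num_tapes M &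
      (\<forall>k<num_tapes M. tableau.win M N off (snd (K g iota t) ! k))"
  shows "tableau.rep M g N rho off iota (K g iota)"
  unfolding tableau.rep_def[OF tab] tableau.place_def[OF tab] using assms(2,3) by (simp add: rl_def)

text \<open>\<open>Func\<close> speaks about all times below \<open>N\<close>, so a run of
  \<open>n\<close> steps is prolonged by repeating its last configuration. The assumptions on
  \<open>n\<close> keep every tape inside the window.\<close>

lemma seq_good:
  assumes tab: "tableau M b iv N off" and f: "f 0 = init_config M u" "\<forall>i<n. step M B (f i) (f (Suc i))"
    and n: "n \<le> off" "int n + int (length u) \<le> int N - 1 - int off"
  shows "fst (f (min t n)) < num_states M & length (snd (f (min t n))) = num_tapes M &
    (\<forall>k<num_tapes M. tableau.win M N off (snd (f (min t n)) ! k))"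
proof -
  have wf: "wf_otm M" using tab by (simp add: tableau_def)
  let ?m = "min t n"
  have "\<forall>i<?m. step M B (f i) (f (Suc i))" using f(2) by simp
  note s = seq_fits[OF wf f(1) this]
  have "tableau.win M N off (snd (f ?m) ! k)" if "k < num_tapes M" for k
    unfolding tableau.win_def[OF tab]
  proof (rule fits_mono)
    show "fits (num_symbols M) (- int ?m) (reach u k ?m) (snd (f ?m) ! k)" using s that by blast
    show "- int off \<le> - int ?m" using n(1) by simp
    show "reach u k ?m \<le> int N - 1 - int off" 
    proof -
      have "?m \<le> n" by simp
      then have "reach u k ?m \<le> int n + int (length u)" unfolding reach_def by (simp del: of_nat_min min.cobounded2)
      then show ?thesis using n(2) by linarith
    qed
  qed
  then show ?thesis using s by blast
qed

section \<open>A machine with an oracle in NP as a formula\<close>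

locale oracle_run = fixes M M2 :: otm and B :: "word set" and p p2 :: "nat poly"
  assumes wf: "wf_otm M" "wf_otm M2" and B: "B = {u. accepts M2 {} u}"
    and time: "\<And>w n k c. run M B (init_config M w) n k c ==> n \<le> poly p (length w)"
    and time2: "\<And>w n k c. run M2 {} (init_config M2 w) n k c ==> n \<le> poly p2 (length w)"
begin

text \<open>The run on a query is the member of a family indexed by the time of the main run,
  variable 2, so that one group of relations holds the runs for all queries. Its own variables start
  at 8, behind those of the main tableau. \<open>M2\<close> has the empty oracle, and so the answer
  to its queries is always no.\<close>

definition Asks :: "nat => rsym fm" where
  "Asks g = tableau.Accepting M2 g 8 2 query_ini (Bool False) (Bool True)"

text \<open>A positive answer needs a run with tag 1, a negative one the failure of the candidate
  with tag 2. Only tag 2 is quantified universally.\<close>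

definition Accepts :: "rsym fm" where
  "Accepts = tableau.Accepting M 0 2 0 main_ini (Asks 1) (FNot (Asks 2))"

definition Psi :: "rsym fm" where
  "Psi = FEx 1 (FAnd Off Accepts)"

lemma plain_Psi: "plain 16 Psi"
proof -
  have t: "tableau M 2 0 1 0" "tableau M2 8 2 1 0" using wf by (simp_all add: tableau_def)
  have bit: "plain 16 (query_bit s x)" if "x < 16" for s x
    using that by (simp add: query_bit_def plain_atom)
  have "plain 16 (query_ini s)" for s by (auto simp: query_ini_def query_pre_def bit plain_Bool)
  then have asks: "plain 16 (Asks g)" for g
    unfolding Asks_def by (intro tableau.plain_Accepting[OF t(2)]) (simp_all add: plain_Bool)
  have "plain 16 Accepts"
    unfolding Accepts_def by (rule tableau.plain_Accepting[OF t(1)]) (simp_all add: asks main_ini_def)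
  then show ?thesis by (simp add: Psi_def Off_def)
qed

text \<open>The main run takes \<open>poly p l\<close> steps on an input of length \<open>l\<close>.
  A query has length at most \<open>poly p l + 1\<close> by \<open>query_bound\<close>, and
  \<open>poly p2\<close> of that bounds the run on it. Twice this number leaves enough room on both
  sides of the middle.\<close>

definition slack :: "nat => nat" where
  "slack l = poly p l + l + poly p2 (poly p l + 1) + 3"

context
  fixes N :: nat and w :: word
  assumes N: "2 * slack (length w) \<le> N"
begin

abbreviation "off \<equiv> middle N"

lemma off: "off < N" "slack (length w) \<le> off + 1" "slack (length w) \<le> N - off"
proof -
  have *: "(n - 1) div 2 < n & k \<le> (n - 1) div 2 + 1 & k \<le> n - (n - 1) div 2" if "2 * k \<le> n" "3 \<le> k" for n k :: nat
    using that by presburger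
  show "off < N" "slack (length w) \<le> off + 1" "slack (length w) \<le> N - off"
    using *[OF N] unfolding middle_def by (simp_all add: slack_def)
qed

lemma tabs: "tableau M 2 0 N off" "tableau M2 8 2 N off"
  using wf off(1) by (simp_all add: tableau_def)

abbreviation "start_env \<equiv> origin(1 := off)"

lemma ev_Psi: "ev N (bits w) rho Psi origin = ev N (bits w) rho Accepts start_env"
proof -
  have "0 < N" using off(1) by simp
  then have "ev N (bits w) rho Psi origin = (\<exists>x<N. x = off & ev N (bits w) rho Accepts (origin(1 := x)))"
    using ev_Off by (auto simp: Psi_def)
  then show ?thesis using off(1) by auto
qed

abbreviation "mrep rho \<equiv> tableau.rep M 0 N rho off 0"
abbreviation "qrep g rho \<equiv> tableau.rep M2 g N rho off"
abbreviation "place \<equiv> tableau.place off"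

lemma place: "place q = int q - int off" using tableau.place_def[OF tabs(1)] .

lemma main_ini:
  assumes "e 1 = off" "e 4 < N"
  shows "ev N (bits w) rho (main_ini s) e = (fst (input_tape w) (place (e 4)) = s)"
proof (cases "e 4 < off")
  case True
  then have "fst (input_tape w) (place (e 4)) = 0" by (simp add: place input_tape_def)
  moreover have "~ (\<exists>d. off + d = e 4)" using True by auto
  ultimately show ?thesis using True assms by (auto simp: main_ini_def)
next
  case False
  define d where "d = e 4 - off"
  have d: "d < N" "e 4 = off + d" using False assms by (simp_all add: d_def)
  have "ev N (bits w) rho (FEx 14 (FAnd (FSum 1 14 4) (FIn s 14))) e = (nth0 (bits w) d = s)"
    using assms d by auto
  then show ?thesis using False assms(1) d(2) by (auto simp: main_ini_def place input_tape_bits)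
qed

context
  fixes rho :: "rsym => nat list => bool" and cfg :: "nat => config" and t :: nat and u :: word
  assumes r: "mrep rho cfg" and t: "t < N" and u: "holds_word (snd (cfg t) ! 1) u"
begin

lemma query_win: "tableau.win M N off (snd (cfg t) ! 1)"
  using tableau.rep_win[OF tabs(1) r t, of 1] wf(1) by (simp add: wf_otm_def)

lemma query_length: "int (length u) \<le> int N - int off"
  by (rule tableau_length[OF tabs(1) query_win u])

lemma query_bit:
  assumes "e 0 = 0" "e 2 = t" "e x < N" "s < 3"
  shows "ev N xs rho (query_bit s x) e = (fst (snd (cfg t) ! 1) (place (e x)) = s)"
proof -
  have "1 < num_tapes M" "s < num_symbols M" using wf(1) assms(4) by (auto simp: wf_otm_def)
  then have "rl rho (QC 0 1 s) 0 t (e x) = (fst (snd (cfg t) ! 1) (place (e x)) = s)"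
    using r t assms(3) unfolding tableau.rep_def[OF tabs(1)] by blast
  then show ?thesis using assms by (simp add: query_bit_def ev_atom)
qed

lemma query_pre:
  assumes "e 0 = 0" "e 1 = off" "e 2 = t" "e 10 < N"
  shows "ev N xs rho query_pre e = (0 \<le> place (e 10) &
    (\<forall>y. 0 \<le> y & y \<le> place (e 10) --> fst (snd (cfg t) ! 1) y \<in> {1, 2}))"
proof -
  have "ev N xs rho query_pre e = (off \<le> e 10 &
      (\<forall>q<N. off \<le> q & q \<le> e 10 --> fst (snd (cfg t) ! 1) (place q) \<in> {1, 2}))"
    using query_bit[of "e(14 := _)" 14 1 xs] query_bit[of "e(14 := _)" 14 2 xs] assms
    by (simp add: query_pre_def not_less)
  also have "\<dots> = (0 \<le> place (e 10) & (\<forall>y. 0 \<le> y & y \<le> place (e 10) --> fst (snd (cfg t) ! 1) y \<in> {1, 2}))"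
  proof -
    have "fst (snd (cfg t) ! 1) y \<in> {1, 2}" if
      a: "\<forall>q<N. off \<le> q & q \<le> e 10 --> fst (snd (cfg t) ! 1) (place q) \<in> {1, 2}" "0 \<le> y" "y \<le> place (e 10)" for y
    proof -
      define q where "q = nat (y + int off)"
      have "place q = y" "off \<le> q" "q \<le> e 10" using a(2,3) by (auto simp: q_def place)
      then show ?thesis using a(1) assms(4) le_less_trans by metis
    qed
    moreover have "0 \<le> place q \<longleftrightarrow> off \<le> q" "place q \<le> place q' \<longleftrightarrow> q \<le> q'" for q q' by (auto simp: place)
    ultimately show ?thesis by blast
  qed
  finally show ?thesis .
qed

lemma query_ini:
  assumes "e 0 = 0" "e 1 = off" "e 2 = t" "e 10 < N"
  shows "ev N xs rho (query_ini s) e = (fst (input_tape u) (place (e 10)) = s)"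
proof -
  let ?f = "fst (input_tape u) (place (e 10))"
  note pre = query_pre[OF assms] and b = query_bit[OF assms(1,3,4)]
  have 12: "ev N xs rho (FAnd (query_bit s 10) query_pre) e = (?f = s)" if "s \<in> {1, 2}" for s
  proof -
    have "s < 3" using that by auto
    then show ?thesis unfolding ev_derived(3) b[OF \<open>s < 3\<close>] pre input_tape_symbol[OF u that] by blast
  qed
  have ex: "?f = 0 | ?f = 1 | ?f = 2" by (simp add: input_tape_def bit_symbol_def)
  show ?thesis
  proof (cases "s = 1 | s = 2")
    case True
    then show ?thesis using 12[of s] by (auto simp: query_ini_def)
  next
    case False
    have "ev N xs rho (FAnd (FOr (query_bit 1 10) (query_bit 2 10)) query_pre) e = (?f = 1 | ?f = 2)"
      using 12[of 1] 12[of 2] by auto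
    then show ?thesis using False ex by (auto simp: query_ini_def)
  qed
qed

lemma Asks_iff:
  assumes e: "e 0 = 0" "e 1 = off" "e 2 = t" and q: "qrep g rho t cfg2"
  shows "ev N xs rho (Asks g) e = (cfg2 0 = init_config M2 u & (\<exists>n<N. fst (cfg2 n) = accept_state M2 &
    (\<forall>i<n. gstep M2 False True (cfg2 i) (cfg2 (Suc i)))))"
proof -
  have "tableau.env 2 off t e" using e by (simp add: tableau.env_def[OF tabs(2)])
  moreover have "ev N xs rho (query_ini s) e' = (fst (input_tape u) (place (e' (8 + 2))) = s)"
    if "tableau.env 2 off t e'" "e' (8 + 2) < N" for e' s
    using query_ini[of e' xs s] that by (simp add: tableau.env_def[OF tabs(2)])
  ultimately show ?thesis unfolding Asks_def
    using tableau.ev_Accepting[OF tabs(2) q _ query_length, where e = e and ini = query_ini and xs = xs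
        and yes = "Bool False" and no = "Bool True"] by simp
qed

text \<open>Holds for every interpretation of the relations: whatever satisfies the tableau is a
  genuine accepting run of \<open>M2\<close>, so no choice of the universal relations can fake a
  positive answer.\<close>

lemma Asks_sound:
  assumes e: "e 0 = 0" "e 1 = off" "e 2 = t" and a: "ev N xs rho (Asks g) e"
  shows "u \<in> B"
proof -
  have env: "tableau.env 2 off t e" using e by (simp add: tableau.env_def[OF tabs(2)])
  have "ev N xs rho (tableau.Func M2 g 8 2) e"
    using a unfolding Asks_def tableau.Accepting_def[OF tabs(2)] by simp
  then obtain cfg2 where q: "qrep g rho t cfg2" using tableau.Func_rep[OF tabs(2) env] by blast
  obtain n where n: "cfg2 0 = init_config M2 u" "n < N" "fst (cfg2 n) = accept_state M2"
    "\<forall>i<n. gstep M2 False True (cfg2 i) (cfg2 (Suc i))" using a unfolding Asks_iff[OF e q] by blast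
  have "step M2 {} (cfg2 i) (cfg2 (Suc i))" if "i < n" for i
  proof -
    have "i < N" "1 < num_tapes M2" using that n(2) wf(2) by (auto simp: wf_otm_def)
    then have "tableau.win M2 N off (snd (cfg2 i) ! 1)" using tableau.rep_win[OF tabs(2) q] by simp
    then have "fits (num_symbols M2) (- int off) (int N - 1 - int off) (snd (cfg2 i) ! 1)"
      unfolding tableau.win_def[OF tabs(2)] .
    moreover have "0 \<le> int N - 1 - int off" using off(1) by linarith
    ultimately obtain v where v: "holds_word (snd (cfg2 i) ! 1) v" by (rule holds_word_exists)
    have "gstep M2 False True (cfg2 i) (cfg2 (Suc i))" using n(4) that by blast
    then show ?thesis unfolding step_gstep by (rule gstep_mono) (use v in auto)
  qed
  then have "accepts M2 {} u" unfolding accepts_seq using n(1,3) by blast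
  then show ?thesis by (simp add: B)
qed

end

lemma Accepts_iff:
  assumes r: "mrep rho cfg"
  defines "E \<equiv> \<lambda>n t. start_env(2 + 5 := n, 2 := t, Suc 2 := Suc t)"
  shows "ev N (bits w) rho Accepts start_env = (cfg 0 = init_config M w & (\<exists>n<N. fst (cfg n) = accept_state M &
    (\<forall>t<n. gstep M (ev N (bits w) rho (Asks 1) (E n t)) (~ ev N (bits w) rho (Asks 2) (E n t)) (cfg t) (cfg (Suc t)))))"
proof -
  have env: "tableau.env 0 off 0 start_env" by (simp add: tableau.env_def[OF tabs(1)])
  have len: "int (length w) \<le> int N - int off" using off unfolding slack_def by linarith
  have ini: "ev N (bits w) rho (main_ini s) e = (fst (input_tape w) (place (e (2 + 2))) = s)"
    if "tableau.env 0 off 0 e" "e (2 + 2) < N" for e s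
    using main_ini[of e rho s] that by (simp add: tableau.env_def[OF tabs(1)])
  show ?thesis unfolding Accepts_def E_def
    using tableau.ev_Accepting[OF tabs(1) r env len, where ini = main_ini and xs = "bits w"
        and yes = "Asks 1" and no = "FNot (Asks 2)"] ini by simp
qed

definition accepting_run :: "word => (nat => config) => nat => bool" where
  "accepting_run u h n = (h 0 = init_config M2 u & (\<forall>i<n. step M2 {} (h i) (h (Suc i))) &
     fst (h n) = accept_state M2 & (\<forall>i. h i = h (min i n)))"

text \<open>One accepting run is fixed per word, so that runs for all queries can be coded together.
  For words outside \<open>B\<close> the choice is arbitrary.\<close>

definition query_run :: "word => nat => config" where
  "query_run u = (SOME h. \<exists>n. accepting_run u h n)"

lemma query_run: "u \<in> B ==> \<exists>n. accepting_run u (query_run u) n"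
proof -
  assume "u \<in> B"
  then obtain f n where "f 0 = init_config M2 u" "\<forall>i<n. step M2 {} (f i) (f (Suc i))" "fst (f n) = accept_state M2"
    unfolding B mem_Collect_eq accepts_seq by blast
  then have "accepting_run u (\<lambda>i. f (min i n)) n" by (simp add: accepting_run_def)
  then have "\<exists>h n. accepting_run u h n" by blast
  then show ?thesis unfolding query_run_def by (rule someI_ex)
qed

text \<open>The run fits into the window because \<open>slack\<close> accounts for the length of a
  query and for the time \<open>M2\<close> spends on it.\<close>

lemma Asks_complete:
  assumes r: "mrep rho cfg" and t: "t < N" and u: "holds_word (snd (cfg t) ! 1) u"
    and e: "e 0 = 0" "e 1 = off" "e 2 = t" and "u \<in> B" "length u \<le> poly p (length w) + 1"
    and coded: "\<And>r i t q. tag r = g ==> rl rho r i t q = rl (coded off K) r i t q" and K: "K g t = query_run u"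
  shows "ev N xs rho (Asks g) e"
proof -
  obtain n where a: "accepting_run u (K g t) n" using query_run[OF assms(7)] K by auto
  then have h: "K g t 0 = init_config M2 u" "\<forall>i<n. step M2 {} (K g t i) (K g t (Suc i))"
    "fst (K g t n) = accept_state M2" "\<And>i. K g t i = K g t (min i n)"
    unfolding accepting_run_def by blast+
  obtain k where "run M2 {} (K g t 0) n k (K g t n)" using seq_run[OF h(2)] by blast
  then have "n \<le> poly p2 (length u)" unfolding h(1) by (rule time2)
  also have "\<dots> \<le> poly p2 (poly p (length w) + 1)" using assms(8) by (rule poly_nat_mono)
  finally have n: "n + length u + 2 \<le> slack (length w)" using assms(8) by (simp add: slack_def)
  have b: "n \<le> off" "int n + int (length u) \<le> int N - 1 - int off" using n off by linarith+
  have "qrep g rho t (K g t)"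
  proof (rule coded_rep[OF tabs(2) coded])
    fix i
    show "fst (K g t i) < num_states M2 & length (snd (K g t i)) = num_tapes M2 &
      (\<forall>k<num_tapes M2. tableau.win M2 N off (snd (K g t i) ! k))"
      using seq_good[OF tabs(2) h(1,2) b, of i] h(4)[of i] by simp
  qed
  note iff = Asks_iff[OF r t u e this, of xs]
  have "gstep M2 False True (K g t i) (K g t (Suc i))" if "i < n" for i
  proof -
    have "step M2 {} (K g t i) (K g t (Suc i))" using h(2) that by blast
    then show ?thesis unfolding step_gstep by (rule gstep_mono) auto
  qed
  moreover have "n < N" using b(1) off(1) by simp
  ultimately show ?thesis unfolding iff using h(1,3) by blast
qed

text \<open>The query tape starts blank, so after \<open>t\<close> steps it is blank beyond cell
  \<open>t\<close> and its word has length at most \<open>t + 1\<close>; and \<open>t\<close> is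
  bounded by the running time.\<close>

lemma query_bound:
  assumes "f 0 = init_config M w" "\<forall>i<t. step M B (f i) (f (Suc i))" "holds_word (snd (f t) ! 1) u"
  shows "length u \<le> poly p (length w) + 1"
proof -
  have "1 < num_tapes M" using wf(1) by (simp add: wf_otm_def)
  then have "fits (num_symbols M) (- int t) (int t) (snd (f t) ! 1)"
    using seq_fits[OF wf(1) assms(1,2)] by (auto simp: reach_def)
  then obtain v where "holds_word (snd (f t) ! 1) v" "int (length v) \<le> int t + 1" by (rule holds_word_exists) simp
  then have "length u \<le> t + 1" using holds_word_unique[OF assms(3)] by auto
  moreover obtain k where "run M B (f 0) t k (f t)" using seq_run[OF assms(2)] by blast
  then have "t \<le> poly p (length w)" unfolding assms(1) by (rule time)
  ultimately show ?thesis by simp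
qed

text \<open>True positive answers are witnessed by the runs coded in \<open>Y\<close>. True negative
  answers withstand every \<open>Z\<close> because \<open>Asks_sound\<close> does not depend on the
  interpretation.\<close>

lemma Psi_complete:
  assumes "accepts M B w"
  shows "\<exists>Y. \<forall>Z. ev N (bits w) (merge (\<lambda>r. tag r = 2) Y Z) Psi origin"
proof -
  obtain f n where f: "f 0 = init_config M w" "\<forall>i<n. step M B (f i) (f (Suc i))" "fst (f n) = accept_state M"
    using assms unfolding accepts_seq by blast
  obtain k where "run M B (f 0) n k (f n)" using seq_run[OF f(2)] by blast
  then have n: "n \<le> poly p (length w)" unfolding f(1) by (rule time)
  define cfg where "cfg t = f (min t n)" for t
  \<comment> \<open>Tag 0 codes the main run, every other tag the runs on the queries. For a query
    outside \<open>B\<close> the coded run is arbitrary and its answer no is justified by soundness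
    instead.\<close>
  define K where "K g i = (if g = 0 then cfg else query_run (THE u. holds_word (snd (cfg i) ! 1) u))" for g i :: nat
  have b: "n \<le> off" "int n + int (length w) \<le> int N - 1 - int off" using n off unfolding slack_def by linarith+
  have "ev N (bits w) (merge (\<lambda>r. tag r = 2) (coded off K) Z) Psi origin" for Z
  proof -
    let ?rho = "merge (\<lambda>r. tag r = 2) (coded off K) Z"
    have agree: "rl ?rho r i t q = rl (coded off K) r i t q" if "tag r ~= 2" for r i t q
      using that by (simp add: rl_def merge_def)
    have "tableau.rep M 0 N ?rho off 0 (K 0 0)"
    proof (rule coded_rep[OF tabs(1) agree])
      fix t
      show "fst (K 0 0 t) < num_states M & length (snd (K 0 0 t)) = num_tapes M &
        (\<forall>k<num_tapes M. tableau.win M N off (snd (K 0 0 t) ! k))"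
        using seq_good[OF tabs(1) f(1,2) b, of t] by (simp add: K_def cfg_def)
    qed simp
    then have r: "mrep ?rho cfg" by (simp add: K_def)
    show ?thesis unfolding ev_Psi Accepts_iff[OF r]
    proof (intro conjI exI[of _ n] allI impI)
      show "cfg 0 = init_config M w" "fst (cfg n) = accept_state M" using f by (simp_all add: cfg_def)
      show "n < N" using b(1) off(1) by simp
      fix t assume t: "t < n"
      let ?e = "start_env(2 + 5 := n, 2 := t, Suc 2 := Suc t)"
      have e: "?e 0 = 0" "?e 1 = off" "?e 2 = t" by simp_all
      have tN: "t < N" using t \<open>n < N\<close> by simp
      have ct: "cfg t = f t" using t by (simp add: cfg_def)
      have "step M B (cfg t) (cfg (Suc t))" using f(2) t by (simp add: cfg_def)
      then show "gstep M (ev N (bits w) ?rho (Asks 1) ?e) (~ ev N (bits w) ?rho (Asks 2) ?e) (cfg t) (cfg (Suc t))"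
        unfolding step_gstep
      proof (rule gstep_mono)
        assume "\<exists>u. holds_word (snd (cfg t) ! 1) u & u \<in> B"
        then obtain u where u: "holds_word (snd (cfg t) ! 1) u" "u \<in> B" by blast
        have len: "length u \<le> poly p (length w) + 1" using query_bound[of f t u] f t u(1) ct by simp
        have "(THE u. holds_word (snd (cfg t) ! 1) u) = u" using u(1) holds_word_unique by blast
        then have "K 1 t = query_run u" by (simp add: K_def)
        then show "ev N (bits w) ?rho (Asks 1) ?e"
          by (intro Asks_complete[OF r tN u(1) e u(2) len agree]) simp_all
      next
        assume "\<exists>u. holds_word (snd (cfg t) ! 1) u & u \<notin> B"
        then obtain u where u: "holds_word (snd (cfg t) ! 1) u" "u \<notin> B" by blast
        then show "~ ev N (bits w) ?rho (Asks 2) ?e" using Asks_sound[OF r tN u(1) e] by blast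
      qed
    qed
  qed
  then show ?thesis by blast
qed

text \<open>The steps are validated in the order of time: the condition \<open>neg\<close> on a
  query may rely on all earlier steps being genuine, which is what bounds the length of the
  query.\<close>

lemma Accepts_sound:
  assumes r: "mrep rho cfg" and a: "ev N (bits w) rho Accepts start_env"
    and neg: "\<And>t u e. cfg 0 = init_config M w ==> \<forall>i<t. step M B (cfg i) (cfg (Suc i)) ==> t < N ==>
      holds_word (snd (cfg t) ! 1) u ==> u \<in> B ==> e 0 = 0 ==> e 1 = off ==> e 2 = t ==> ev N (bits w) rho (Asks 2) e"
  shows "accepts M B w"
proof -
  let ?E = "\<lambda>n t. start_env(2 + 5 := n, 2 := t, Suc 2 := Suc t)"
  obtain n where n: "cfg 0 = init_config M w" "n < N" "fst (cfg n) = accept_state M"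
    "\<forall>t<n. gstep M (ev N (bits w) rho (Asks 1) (?E n t)) (~ ev N (bits w) rho (Asks 2) (?E n t)) (cfg t) (cfg (Suc t))"
    using a unfolding Accepts_iff[OF r] by blast
  have "t < n --> step M B (cfg t) (cfg (Suc t))" for t
  proof (induction t rule: less_induct)
    case (less t)
    show ?case
    proof
      assume t: "t < n"
      then have tN: "t < N" and prev: "\<forall>i<t. step M B (cfg i) (cfg (Suc i))" using less n(2) by auto
      have e: "?E n t 0 = 0" "?E n t 1 = off" "?E n t 2 = t" by simp_all
      have "1 < num_tapes M" using wf(1) by (simp add: wf_otm_def)
      then have "fits (num_symbols M) (- int off) (int N - 1 - int off) (snd (cfg t) ! 1)"
        using tableau.rep_win[OF tabs(1) r tN] unfolding tableau.win_def[OF tabs(1)] by blast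
      moreover have "0 \<le> int N - 1 - int off" using off(1) by linarith
      ultimately obtain u where u: "holds_word (snd (cfg t) ! 1) u" by (rule holds_word_exists)
      have "gstep M (ev N (bits w) rho (Asks 1) (?E n t)) (~ ev N (bits w) rho (Asks 2) (?E n t)) (cfg t) (cfg (Suc t))"
        using n(4) t by blast
      then show "step M B (cfg t) (cfg (Suc t))" unfolding step_gstep
      proof (rule gstep_mono)
        assume "ev N (bits w) rho (Asks 1) (?E n t)"
        then have "u \<in> B" by (rule Asks_sound[OF r tN u e])
        then show "\<exists>u. holds_word (snd (cfg t) ! 1) u & u \<in> B" using u by blast
      next
        assume "~ ev N (bits w) rho (Asks 2) (?E n t)"
        then have "u \<notin> B" using neg[OF n(1) prev tN u _ e] by blast
        then show "\<exists>u. holds_word (snd (cfg t) ! 1) u & u \<notin> B" using u by blast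
      qed
    qed
  qed
  then show ?thesis unfolding accepts_seq using n(1,3) by blast
qed

lemma main_rep:
  assumes "ev N (bits w) rho Accepts start_env"
  obtains cfg where "mrep rho cfg"
proof -
  have env: "tableau.env 0 off 0 start_env" by (simp add: tableau.env_def[OF tabs(1)])
  have "ev N (bits w) rho (tableau.Func M 0 2 0) start_env"
    using assms unfolding Accepts_def tableau.Accepting_def[OF tabs(1)] by simp
  then show ?thesis using tableau.Func_rep[OF tabs(1) env] that by blast
qed

text \<open>The universal relations are instantiated with the worst case, genuine accepting runs for
  all queries in \<open>B\<close>. A wrong answer no in the run described by \<open>Y\<close> is
  exposed by them.\<close>

lemma Psi_sound:
  assumes "\<forall>Z. ev N (bits w) (merge (\<lambda>r. tag r = 2) Y Z) Psi origin"
  shows "accepts M B w"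
proof -
  have a: "ev N (bits w) (merge (\<lambda>r. tag r = 2) Y Z) Accepts start_env" for Z
    using assms unfolding ev_Psi by blast
  \<comment> \<open>The main run is described by tag 0, on which the universal relations have no
    influence, so any instance serves to extract it.\<close>
  obtain cfg where r0: "mrep (merge (\<lambda>r. tag r = 2) Y Y) cfg" using main_rep[OF a] .
  define K where "K g i = query_run (THE u. holds_word (snd (cfg i) ! 1) u)" for g i :: nat
  let ?rho = "merge (\<lambda>r. tag r = 2) Y (coded off K)"
  have r: "mrep ?rho cfg"
    using r0 unfolding tableau.rep_def[OF tabs(1)] by (simp add: rl_def merge_def)
  show ?thesis
  proof (rule Accepts_sound[OF r a])
    fix t u and e :: "nat => nat"
    assume A: "cfg 0 = init_config M w" "\<forall>i<t. step M B (cfg i) (cfg (Suc i))" "t < N"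
      "holds_word (snd (cfg t) ! 1) u" "u \<in> B" "e 0 = 0" "e 1 = off" "e 2 = t"
    have len: "length u \<le> poly p (length w) + 1" by (rule query_bound[OF A(1,2,4)])
    have "(THE u. holds_word (snd (cfg t) ! 1) u) = u" using A(4) holds_word_unique by blast
    then have K: "K 2 t = query_run u" by (simp add: K_def)
    show "ev N (bits w) ?rho (Asks 2) e"
      by (rule Asks_complete[where K = K and g = 2 and t = t and e = e, OF r A(3,4,6-8,5) len _ K]) (simp add: rl_def merge_def)
  qed
qed

text \<open>With the empty oracle there are no wrong negative answers to be exposed, so one
  interpretation suffices in place of a universal quantifier.\<close>

lemma Psi_sound_no_oracle:
  assumes "B = {}" "ev N (bits w) rho Psi origin"
  shows "accepts M B w"
proof -
  have a: "ev N (bits w) rho Accepts start_env" using assms(2) unfolding ev_Psi .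
  obtain cfg where r: "mrep rho cfg" using main_rep[OF a] .
  show ?thesis by (rule Accepts_sound[OF r a]) (use assms(1) in simp)
qed

end

end

text \<open>Fagin's argument relative to an oracle. The last conclusion is for the first level: with
  it, satisfiability in all relations at once defines the language, which is what the gadget
  expresses for \<open>Co\<close> and \<open>St\<close>.\<close>

theorem second_order_definable:
  assumes X: "X \<in> NP_oracle B" and B: "B \<in> NP"
  obtains psi a where "plain 16 psi" "0 < a"
    "\<And>w. w \<in> X \<longleftrightarrow> (\<exists>Y. \<forall>Z. ev (bound a w) (bits w) (merge (\<lambda>r. tag r = 2) Y Z) psi origin)"
    "\<And>w rho. B = {} ==> ev (bound a w) (bits w) rho psi origin ==> w \<in> X"
proof -
  obtain M where M: "wf_otm M" "poly_time M B" "X = {w. accepts M B w}"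
    using X unfolding NP_oracle_def by blast
  obtain M2 where M2: "wf_otm M2" "poly_time M2 {}" "B = {w. accepts M2 {} w}"
    using B unfolding NP_def NP_oracle_def by blast
  obtain p p2 where p: "\<And>w n k c. run M B (init_config M w) n k c ==> n \<le> poly p (length w)"
    "\<And>w n k c. run M2 {} (init_config M2 w) n k c ==> n \<le> poly p2 (length w)"
    using M(2) M2(2) unfolding poly_time_def by metis
  interpret oracle_run M M2 B p p2 by unfold_locales (use M M2 p in auto)
  have "polyb (\<lambda>l. 2 * slack l)"
    unfolding slack_def by (intro polyb_mult polyb_add polyb_const polyb_id polyb_poly)
  then obtain a where a: "0 < a" "\<And>w. 2 * slack (length w) \<le> bound a w"
    by (rule polyb_le_bound) blast
  show ?thesis
  proof (rule that[OF plain_Psi a(1)])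
    show "w \<in> X \<longleftrightarrow> (\<exists>Y. \<forall>Z. ev (bound a w) (bits w) (merge (\<lambda>r. tag r = 2) Y Z) Psi origin)" for w
      using Psi_complete[OF a(2)] Psi_sound[OF a(2)] M(3) by blast
    show "w \<in> X" if "B = {}" "ev (bound a w) (bits w) rho Psi origin" for w rho
      using Psi_sound_no_oracle[OF a(2) that] M(3) by blast
  qed
qed

section \<open>The reductions\<close>

lemma gadget_reduction:
  fixes phi :: "'r fm"
  assumes "plain V phi" "0 < a"
  obtains f where "poly_time_computable f" "\<And>w. f w \<in> CF_SA_inputs s"
    "\<And>w. s \<in> {Co, St} ==> f w \<in> CF_SA s \<longleftrightarrow> ~ (\<exists>rho. ev (bound a w) (bits w) rho phi origin)"
    "\<And>w. s \<in> {Pr, Sst} ==> f w \<in> CF_SA s \<longleftrightarrow>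
      ~ (\<exists>Y. \<forall>Z. ~ ev (bound a w) (bits w) (merge U Y Z) phi origin)"
proof -
  define f where "f w = emw (bound a w) (bits w) (guess_rel []) (gadget.builder s V U phi) origin" for w
  have g: "gadget (bound a w) V phi" for w using assms bound_pos[of a w] by (simp add: gadget_def)
  show ?thesis
  proof (rule that)
    show "poly_time_computable f"
      unfolding f_def by (rule poly_time_computable_em[OF gadget.unary_builder[OF g[of "[]"]] assms(2)])
    show "f w \<in> CF_SA_inputs s" for w unfolding f_def by (rule gadget.builder_input[OF g])
    show "f w \<in> CF_SA s \<longleftrightarrow> ~ (\<exists>rho. ev (bound a w) (bits w) rho phi origin)" if "s \<in> {Co, St}" for w
      unfolding f_def gadget.builder_answer[OF g]
      by (subst gadget.other_labelling_Co_St[OF g]) (use that in \<open>auto simp: gadget.co_def[OF g] gadget.st_def[OF g]\<close>)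
    show "f w \<in> CF_SA s \<longleftrightarrow> ~ (\<exists>Y. \<forall>Z. ~ ev (bound a w) (bits w) (merge U Y Z) phi origin)" if "s \<in> {Pr, Sst}" for w
      unfolding f_def gadget.builder_answer[OF g]
      by (subst gadget.other_labelling_Pr_Sst[OF g]) (use that in \<open>auto simp: gadget.co_def[OF g] gadget.st_def[OF g]\<close>)
  qed
qed

text \<open>Lets machines without oracle be treated as machines with an oracle in NP.\<close>

lemma empty_NP: "{} \<in> NP" using NP_fm[of "FNot (FEq 0 0)" 1] by simp

theorem coNP_hard:
  assumes "s \<in> {Co, St}"
  shows "hard_for coNP (CF_SA_inputs s) (CF_SA s)" unfolding hard_for_def
proof
  fix X assume "X \<in> coNP"
  then have "- X \<in> NP_oracle {}" by (simp add: coNP_def NP_def)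
  from second_order_definable[OF this empty_NP] obtain psi a where psi: "plain 16 psi" "0 < a"
    "\<And>w. w \<in> - X \<longleftrightarrow> (\<exists>Y. \<forall>Z. ev (bound a w) (bits w) (merge (\<lambda>r. tag r = 2) Y Z) psi origin)"
    "\<And>w rho. ev (bound a w) (bits w) rho psi origin ==> w \<in> - X" by metis
  obtain f where f: "poly_time_computable f" "\<And>w. f w \<in> CF_SA_inputs s"
    "\<And>w. f w \<in> CF_SA s \<longleftrightarrow> ~ (\<exists>rho. ev (bound a w) (bits w) rho psi origin)"
    using gadget_reduction[OF psi(1,2), of s] assms by metis
  have "w \<in> X \<longleftrightarrow> f w \<in> CF_SA s" for w using psi(3,4)[of w] f(3)[of w] by blast
  then show "\<exists>f. poly_time_computable f & (\<forall>w. f w \<in> CF_SA_inputs s & (w \<in> X \<longleftrightarrow> f w \<in> CF_SA s))"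
    using f(1,2) by blast
qed

theorem Pi2p_hard:
  assumes "s \<in> {Pr, Sst}"
  shows "hard_for Pi2p (CF_SA_inputs s) (CF_SA s)" unfolding hard_for_def
proof
  fix X assume "X \<in> Pi2p"
  then obtain B where "B \<in> NP" "- X \<in> NP_oracle B" by (auto simp: Pi2p_def Sigma2p_def)
  from second_order_definable[OF this(2,1)] obtain psi a where psi: "plain 16 psi" "0 < a"
    "\<And>w. w \<in> - X \<longleftrightarrow> (\<exists>Y. \<forall>Z. ev (bound a w) (bits w) (merge (\<lambda>r. tag r = 2) Y Z) psi origin)" by metis
  \<comment> \<open>For \<open>Pr\<close> and \<open>Sst\<close> the gadget expresses that some
    \<open>Y\<close> has no completion satisfying its formula; applied to the negation this becomes
    truth of \<open>psi\<close> for all completions.\<close>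
  have "plain 16 (FNot psi)" using psi(1) by simp
  from gadget_reduction[OF this psi(2), of s "\<lambda>r. tag r = 2"] assms
  obtain f where f: "poly_time_computable f" "\<And>w. f w \<in> CF_SA_inputs s"
    "\<And>w. f w \<in> CF_SA s \<longleftrightarrow>
      ~ (\<exists>Y. \<forall>Z. ~ ev (bound a w) (bits w) (merge (\<lambda>r. tag r = 2) Y Z) (FNot psi) origin)" by metis
  have "w \<in> X \<longleftrightarrow> f w \<in> CF_SA s" for w using psi(3)[of w] f(3)[of w] by (simp, blast)
  then show "\<exists>f. poly_time_computable f & (\<forall>w. f w \<in> CF_SA_inputs s & (w \<in> X \<longleftrightarrow> f w \<in> CF_SA s))"
    using f(1,2) by blast
qed

theorem theorem4:
  "(\<forall>s\<in>{Co, St}. hard_for coNP (CF_SA_inputs s) (CF_SA s) \<and> CF_SA s \<in> Theta2p) \<and>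
   (\<forall>s\<in>{Pr, Sst}. hard_for Pi2p (CF_SA_inputs s) (CF_SA s) \<and> CF_SA s \<in> Theta3p)"
  using coNP_hard Pi2p_hard CF_SA_Theta2p CF_SA_Theta3p by blast

end
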